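(* The constrained NE existence problem is $\mathsf{PSPACE}$-complete for RP games where the number of payoffs of each player is fixed. That is: for every constant $\ell$, the problem restricted to RP games with $|P_i|\le \ell$ for every player $i$ is in $\mathsf{PSPACE}$; and there is a constant $\ell$ for which this restricted problem is $\mathsf{PSPACE}$-hard. (The number of players is not bounded.)
   Context: **Arenas.** An arena is $A=(V,E,\mathcal P,(V_i)_{i\in\mathcal P})$ with $V$ a finite set of vertices, $E\subseteq V\times V$ such that every vertex has at least one successor, $\mathcal P$ a finite set of players, and $(V_i)_{i\in\mathcal P}$ a partition of $V$ ($V_i$ is the set of vertices owned by player $i$; some $V_i$ may be empty). A play (resp. history) is an infinite (resp. finite) sequence of vertices following edges. **Games.** A game $\mathcal G=(A,(\mathsf{pay}_i)_{i\in\mathcal P})$ consists of an arena and, for each player $i$, a payoff function $\mathsf{pay}_i:V^\omega\to P_i$, where $P_i$ is a set equipped with a binary relation $\ltimes_i\subseteq P_i\times P_i$ (the preference relation; $p\ltimes_i p'$ means $p'$ is preferred to $p$). It is a *regular-payoff game* (RP game) if, for each $i$, $P_i$ is finite and $\mathsf{pay}_i^{-1}(p)$ is $\omega$-regular for each $p\in P_i$. No condition is imposed on $\ltimes_i$. As an input to a decision problem, an RP game is given by its arena, the finite sets $P_i$ and relations $\ltimes_i$ listed explicitly, and, for each $i$ and each $p\in P_i$, a deterministic parity automaton over the alphabet $V$ accepting $\mathsf{pay}_i^{-1}(p)$. **Strategies and equilibria.** A strategy $\sigma_i$ of player $i$ maps each history $hv$ with $v\in V_i$ to a successor of $v$. A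 strategy profile is $\bar\sigma=(\sigma_i)_{i\in\mathcal P}$; its outcome $\langle\bar\sigma\rangle_v$ is the unique play from $v$ consistent with all $\sigma_i$; $\bar\sigma_{-i}=(\sigma_j)_{j\neq i}$. A profile $\bar\sigma$ is a Nash equilibrium (NE) from $v$ if for every player $i$ and every strategy $\tau_i$ of player $i$, it is not the case that $\mathsf{pay}_i(\langle\bar\sigma\rangle_v)\ltimes_i\mathsf{pay}_i(\langle(\tau_i,\bar\sigma_{-i})\rangle_v)$. **Problem.** The constrained NE existence problem: given an RP game, a vertex $v$ and a payoff $p_i\in P_i$ for each player $i$, decide whether there exists an NE $\bar\sigma$ from $v$ such that for all $i\in\mathcal P$, $p_i=\mathsf{pay}_i(\langle\bar\sigma\rangle_v)$ or $p_i\ltimes_i\mathsf{pay}_i(\langle\bar\sigma\rangle_v)$. *)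

theory Defs
  imports
    "HOL-Library.Omega_Words_Fun"
    "HOL-Library.Disjoint_Sets"
    "HOL-Computational_Algebra.Polynomial"
begin

section \<open>Arenas and games\<close>

record ('v, 'i) arena =
  verts :: "'v set"
  edges :: "('v \<times> 'v) set"
  players :: "'i set"
  owned :: "'i \<Rightarrow> 'v set"

definition wf_arena :: "('v, 'i, 'z) arena_scheme \<Rightarrow> bool" where
  "wf_arena A \<longleftrightarrow>
     finite (verts A) \<and> edges A \<subseteq> verts A \<times> verts A \<and>
     (\<forall>v\<in>verts A. \<exists>u. (v, u) \<in> edges A) \<and>
     finite (players A) \<and>
     disjoint_family_on (owned A) (players A) \<and> (\<Union>i\<in>players A. owned A i) = verts A"

definition play :: "('v, 'i, 'z) arena_scheme \<Rightarrow> 'v word \<Rightarrow> bool" where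
  "play A w \<longleftrightarrow> range w \<subseteq> verts A \<and> (\<forall>k. (w k, w (Suc k)) \<in> edges A)"

definition history :: "('v, 'i, 'z) arena_scheme \<Rightarrow> 'v list \<Rightarrow> bool" where
  "history A h \<longleftrightarrow>
     h \<noteq> [] \<and> set h \<subseteq> verts A \<and> (\<forall>k. Suc k < length h \<longrightarrow> (h ! k, h ! Suc k) \<in> edges A)"

record ('v, 'i, 'p) game = "('v, 'i) arena" +
  payoffs :: "'i \<Rightarrow> 'p set"
  pref :: "'i \<Rightarrow> ('p \<times> 'p) set"  \<comment> \<open>\<open>(p, q) \<in> pref G i\<close> means that \<open>i\<close> prefers \<open>q\<close> to \<open>p\<close>\<close>
  pay :: "'i \<Rightarrow> 'v word \<Rightarrow> 'p"

text \<open>The set \<open>V\<^sup>\<omega>\<close>. Payoff functions are only relevant on it.\<close>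

definition omega_words :: "'a set \<Rightarrow> 'a word set" where
  "omega_words V = {w. range w \<subseteq> V}"

definition wf_game :: "('v, 'i, 'p) game \<Rightarrow> bool" where
  "wf_game G \<longleftrightarrow>
     wf_arena G \<and>
     (\<forall>i\<in>players G. pref G i \<subseteq> payoffs G i \<times> payoffs G i \<and>
        (\<forall>w\<in>omega_words (verts G). pay G i w \<in> payoffs G i))"


section \<open>Strategies and Nash equilibria\<close>

definition strategy :: "('v, 'i, 'z) arena_scheme \<Rightarrow> 'i \<Rightarrow> ('v list \<Rightarrow> 'v) \<Rightarrow> bool" where
  "strategy A i s \<longleftrightarrow> (\<forall>h. history A h \<and> last h \<in> owned A i \<longrightarrow> (last h, s h) \<in> edges A)"

definition profile :: "('v, 'i, 'z) arena_scheme \<Rightarrow> ('i \<Rightarrow> 'v list \<Rightarrow> 'v) \<Rightarrow> bool" where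
  "profile A \<sigma> \<longleftrightarrow> (\<forall>i\<in>players A. strategy A i (\<sigma> i))"

definition consistent ::
    "('v, 'i, 'z) arena_scheme \<Rightarrow> 'i \<Rightarrow> ('v list \<Rightarrow> 'v) \<Rightarrow> 'v word \<Rightarrow> bool" where
  "consistent A i s w \<longleftrightarrow> (\<forall>k. w k \<in> owned A i \<longrightarrow> w (Suc k) = s (prefix (Suc k) w))"

definition outcome ::
    "('v, 'i, 'z) arena_scheme \<Rightarrow> ('i \<Rightarrow> 'v list \<Rightarrow> 'v) \<Rightarrow> 'v \<Rightarrow> 'v word" where
  "outcome A \<sigma> v = (THE w. play A w \<and> w 0 = v \<and> (\<forall>i\<in>players A. consistent A i (\<sigma> i) w))"

definition nash_equilibrium ::
    "('v, 'i, 'p) game \<Rightarrow> 'v \<Rightarrow> ('i \<Rightarrow> 'v list \<Rightarrow> 'v) \<Rightarrow> bool" where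
  "nash_equilibrium G v \<sigma> \<longleftrightarrow>
     profile G \<sigma> \<and>
     (\<forall>i\<in>players G. \<forall>\<tau>. strategy G i \<tau> \<longrightarrow>
        (pay G i (outcome G \<sigma> v), pay G i (outcome G (\<sigma>(i := \<tau>)) v)) \<notin> pref G i)"

definition constrained_ne_exists :: "('v, 'i, 'p) game \<Rightarrow> 'v \<Rightarrow> ('i \<Rightarrow> 'p) \<Rightarrow> bool" where
  "constrained_ne_exists G v p \<longleftrightarrow>
     (\<exists>\<sigma>. nash_equilibrium G v \<sigma> \<and>
        (\<forall>i\<in>players G. p i = pay G i (outcome G \<sigma> v) \<or> (p i, pay G i (outcome G \<sigma> v)) \<in> pref G i))"

text \<open>The definite description in the definition of outcomes is proper.\<close>

lemma outcome_ex1: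
  assumes A: "wf_arena A" and \<sigma>: "profile A \<sigma>" and v: "v \<in> verts A"
  shows "\<exists>!w. play A w \<and> w 0 = v \<and> (\<forall>i\<in>players A. consistent A i (\<sigma> i) w)"
proof -
  define own where "own u = (SOME i. i \<in> players A \<and> u \<in> owned A i)" for u
  have own: "own u \<in> players A \<and> u \<in> owned A (own u)" if "u \<in> verts A" for u
    unfolding own_def by (rule someI_ex) (use A that in \<open>auto simp: wf_arena_def\<close>)
  have own_eq: "own u = i" if "i \<in> players A" "u \<in> owned A i" for u i
  proof (rule ccontr)
    assume ne: "own u \<noteq> i"
    have "u \<in> verts A" using A that by (auto simp: wf_arena_def)
    then have "own u \<in> players A \<and> u \<in> owned A (own u)" by (rule own)
    moreover have "owned A (own u) \<inter> owned A i = {}" if "own u \<in> players A"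
      using A ne that \<open>i \<in> players A\<close> by (auto simp: wf_arena_def disjoint_family_on_def)
    ultimately show False using that by blast
  qed
  define H where "H = rec_nat [v] (\<lambda>_ h. h @ [\<sigma> (own (last h)) h])"
  have H0: "H 0 = [v]" and HS: "H (Suc k) = H k @ [\<sigma> (own (last (H k))) (H k)]" for k
    by (simp_all add: H_def)
  define w where "w k = last (H k)" for k
  have pre: "prefix (Suc k) w = H k" for k
    by (induction k) (simp_all add: subsequence_def H0 HS w_def)
  have w0: "w 0 = v" by (simp add: w_def H0)
  have wS: "w (Suc k) = \<sigma> (own (w k)) (prefix (Suc k) w)" for k
    unfolding pre by (simp add: w_def HS)
  have step: "(w k, w (Suc k)) \<in> edges A" if h: "history A (prefix (Suc k) w)" for k
  proof -
    have l: "last (prefix (Suc k) w) = w k" by (simp add: subsequence_def)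
    have "w k \<in> verts A" using h by (simp add: history_def subsequence_def)
    then have "own (w k) \<in> players A" "w k \<in> owned A (own (w k))" using own by auto
    then show ?thesis using \<sigma> h l wS[of k] unfolding profile_def strategy_def by metis
  qed
  have hist_iff: "history A (prefix (Suc n) w) \<longleftrightarrow>
      (\<forall>j<Suc n. w j \<in> verts A) \<and> (\<forall>j<n. (w j, w (Suc j)) \<in> edges A)" for n
    by (auto simp: history_def subsequence_def image_subset_iff nth_append simp del: upt_Suc)
  have hist: "history A (prefix (Suc k) w)" for k
  proof (induction k)
    case 0
    then show ?case using v w0 unfolding hist_iff by simp
  next
    case (Suc k)
    have e: "(w k, w (Suc k)) \<in> edges A" using step[OF Suc] .
    then have "w (Suc k) \<in> verts A" using A by (auto simp: wf_arena_def)
    then show ?case using e Suc unfolding hist_iff by (auto simp: less_Suc_eq)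
  qed
  have "w k \<in> verts A" for k
    using hist[of k] by (simp add: history_def subsequence_def)
  then have ex: "play A w \<and> w 0 = v \<and> (\<forall>i\<in>players A. consistent A i (\<sigma> i) w)"
    using step[OF hist] w0 wS own_eq by (auto simp: play_def consistent_def)
  have uniq: "w' = w"
    if w': "play A w' \<and> w' 0 = v \<and> (\<forall>i\<in>players A. consistent A i (\<sigma> i) w')" for w'
  proof
    fix n
    have "\<forall>j\<le>n. w' j = w j"
    proof (induction n)
      case 0
      then show ?case using w' w0 by simp
    next
      case (Suc n)
      then have p: "prefix (Suc n) w' = prefix (Suc n) w"
        by (simp add: subsequence_def less_Suc_eq_le)
      have "w' n \<in> verts A" using w' by (auto simp: play_def)
      then have "own (w' n) \<in> players A" "w' n \<in> owned A (own (w' n))" using own by auto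
      then have "w' (Suc n) = \<sigma> (own (w' n)) (prefix (Suc n) w')"
        using w' unfolding consistent_def by blast
      then show ?case using Suc p wS[of n] by (auto simp: le_Suc_eq)
    qed
    then show "w' n = w n" by simp
  qed
  show ?thesis using ex uniq by (rule ex1I)
qed


section \<open>Deterministic parity automata and regular-payoff games\<close>

record ('q, 'a) dpa =
  states :: "'q set"
  initial :: 'q
  succ :: "'q \<Rightarrow> 'a \<Rightarrow> 'q"
  priority :: "'q \<Rightarrow> nat"

definition wf_dpa :: "'a set \<Rightarrow> ('q, 'a) dpa \<Rightarrow> bool" where
  "wf_dpa V B \<longleftrightarrow>
     finite (states B) \<and> initial B \<in> states B \<and>
     (\<forall>q\<in>states B. \<forall>a\<in>V. succ B q a \<in> states B)"

primrec run :: "('q, 'a) dpa \<Rightarrow> 'a word \<Rightarrow> 'q word" where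
  "run B w 0 = initial B"
| "run B w (Suc k) = succ B (run B w k) (w k)"

definition dpa_language :: "'a set \<Rightarrow> ('q, 'a) dpa \<Rightarrow> 'a word set" where
  "dpa_language V B = {w \<in> omega_words V. even (Max (limit (priority B \<circ> run B w)))}"

text \<open>The \<open>\<omega>\<close>-regular languages are those recognised by deterministic parity automata; up to
  renaming, the states are natural numbers.\<close>

definition omega_regular :: "'a set \<Rightarrow> 'a word set \<Rightarrow> bool" where
  "omega_regular V L \<longleftrightarrow> (\<exists>B :: (nat, 'a) dpa. wf_dpa V B \<and> L = dpa_language V B)"

definition pay_preimage :: "('v, 'i, 'p) game \<Rightarrow> 'i \<Rightarrow> 'p \<Rightarrow> 'v word set" where
  "pay_preimage G i p = {w \<in> omega_words (verts G). pay G i w = p}"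

definition rp_game :: "('v, 'i, 'p) game \<Rightarrow> bool" where
  "rp_game G \<longleftrightarrow>
     wf_game G \<and>
     (\<forall>i\<in>players G. finite (payoffs G i) \<and>
        (\<forall>p\<in>payoffs G i. omega_regular (verts G) (pay_preimage G i p)))"


section \<open>Explicit representations of regular-payoff games\<close>

text \<open>Vertices, players, payoffs and automaton states are numbered from \<open>0\<close>. Row \<open>q\<close> of a
  transition table lists the successors of state \<open>q\<close> under the letters \<open>0, 1, \<dots>\<close>.\<close>

record dpa_rep =
  rep_initial :: nat
  rep_succ :: "nat list list"
  rep_priority :: "nat list"

record player_rep =
  rep_automata :: "dpa_rep list"  \<comment> \<open>one automaton for each payoff\<close>
  rep_pref :: "(nat \<times> nat) list"

record game_rep =
  rep_owner :: "nat list"  \<comment> \<open>one entry for each vertex\<close>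
  rep_edges :: "(nat \<times> nat) list"
  rep_players :: "player_rep list"

definition dpa_of :: "dpa_rep \<Rightarrow> (nat, nat) dpa" where
  "dpa_of B =
     \<lparr>states = {..<length (rep_succ B)}, initial = rep_initial B,
      succ = (\<lambda>q a. rep_succ B ! q ! a), priority = (\<lambda>q. rep_priority B ! q)\<rparr>"

text \<open>The argument \<open>n\<close> is the size of the alphabet.\<close>

definition wf_dpa_rep :: "nat \<Rightarrow> dpa_rep \<Rightarrow> bool" where
  "wf_dpa_rep n B \<longleftrightarrow>
     length (rep_priority B) = length (rep_succ B) \<and>
     (\<forall>row\<in>set (rep_succ B). length row = n) \<and>
     wf_dpa {..<n} (dpa_of B)"

definition represents :: "game_rep \<Rightarrow> (nat, nat, nat) game \<Rightarrow> bool" where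
  "represents R G \<longleftrightarrow>
     rp_game G \<and>
     verts G = {..<length (rep_owner R)} \<and>
     edges G = set (rep_edges R) \<and>
     players G = {..<length (rep_players R)} \<and>
     (\<forall>i\<in>players G. owned G i = {v \<in> verts G. rep_owner R ! v = i}) \<and>
     (\<forall>i\<in>players G.
        payoffs G i = {..<length (rep_automata (rep_players R ! i))} \<and>
        pref G i = set (rep_pref (rep_players R ! i)) \<and>
        (\<forall>p\<in>payoffs G i.
           let B = rep_automata (rep_players R ! i) ! p
           in wf_dpa_rep (length (rep_owner R)) B \<and>
              dpa_language (verts G) (dpa_of B) = pay_preimage G i p))"


section \<open>Binary encoding of problem instances\<close>

fun binary :: "nat \<Rightarrow> bool list" where
  "binary n = (if n = 0 then [] else odd n # binary (n div 2))"

declare binary.simps [simp del]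

definition encode_list :: "('a \<Rightarrow> bool list) \<Rightarrow> 'a list \<Rightarrow> bool list" where
  "encode_list e xs = concat (map (\<lambda>x. True # e x) xs) @ [False]"

definition encode_nat :: "nat \<Rightarrow> bool list" where
  "encode_nat n = encode_list (\<lambda>b. [b]) (binary n)"

definition encode_pair :: "nat \<times> nat \<Rightarrow> bool list" where
  "encode_pair p = encode_nat (fst p) @ encode_nat (snd p)"

definition encode_dpa :: "dpa_rep \<Rightarrow> bool list" where
  "encode_dpa B =
     encode_nat (rep_initial B) @ encode_list (encode_list encode_nat) (rep_succ B) @
     encode_list encode_nat (rep_priority B)"

definition encode_player :: "player_rep \<Rightarrow> bool list" where
  "encode_player P = encode_list encode_dpa (rep_automata P) @ encode_list encode_pair (rep_pref P)"

definition encode_game :: "game_rep \<Rightarrow> bool list" where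
  "encode_game R =
     encode_list encode_nat (rep_owner R) @ encode_list encode_pair (rep_edges R) @
     encode_list encode_player (rep_players R)"

definition encode_instance :: "game_rep \<times> nat \<times> nat list \<Rightarrow> bool list" where
  "encode_instance = (\<lambda>(R, v, ps). encode_game R @ encode_nat v @ encode_list encode_nat ps)"

definition prefix_code :: "('a \<Rightarrow> bool list) \<Rightarrow> bool" where
  "prefix_code e \<longleftrightarrow> (\<forall>x y r s. e x @ r = e y @ s \<longrightarrow> x = y \<and> r = s)"

lemma prefix_codeD: "prefix_code e \<Longrightarrow> e x @ r = e y @ s \<Longrightarrow> x = y \<and> r = s"
  unfolding prefix_code_def by blast

lemma prefix_code_list:
  assumes "prefix_code e"
  shows "prefix_code (encode_list e)"
proof -
  have "xs = ys \<and> r = s" if "encode_list e xs @ r = encode_list e ys @ s" for xs ys r s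
    using that
  proof (induction xs arbitrary: ys)
    case Nil
    then show ?case by (cases ys) (auto simp: encode_list_def)
  next
    case (Cons x xs)
    show ?case
    proof (cases ys)
      case Nil
      then show ?thesis using Cons.prems by (auto simp: encode_list_def)
    next
      case (Cons y ys')
      have "e x @ (encode_list e xs @ r) = e y @ (encode_list e ys' @ s)"
        using Cons.prems Cons by (simp add: encode_list_def)
      from prefix_codeD[OF assms this] show ?thesis using Cons.IH[of ys'] Cons by simp
    qed
  qed
  then show ?thesis unfolding prefix_code_def by blast
qed

lemma binary_inj: "binary m = binary n \<Longrightarrow> m = n"
proof (induction m arbitrary: n rule: binary.induct)
  case (1 m)
  show ?case
  proof (cases "m = 0")
    case True
    then show ?thesis using "1.prems" binary.simps[of 0] binary.simps[of n] by (cases "n = 0") auto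
  next
    case False
    then have n: "n \<noteq> 0"
      using "1.prems" binary.simps[of m] binary.simps[of n] by (cases "n = 0") auto
    then have "odd m = odd n" "binary (m div 2) = binary (n div 2)"
      using "1.prems" False binary.simps[of m] binary.simps[of n] by auto
    then show ?thesis using "1.IH"[OF False, of "n div 2"] by presburger
  qed
qed

lemma prefix_code_nat: "prefix_code encode_nat"
proof -
  have "prefix_code (\<lambda>b :: bool. [b])" by (simp add: prefix_code_def)
  from prefix_codeD[OF prefix_code_list[OF this]] show ?thesis
    unfolding prefix_code_def encode_nat_def by (blast dest: binary_inj)
qed

lemmas prefix_code_natD = prefix_codeD[OF prefix_code_nat]

lemma prefix_code_pair: "prefix_code encode_pair"
  unfolding prefix_code_def encode_pair_def
  by (auto simp: prod_eq_iff dest!: prefix_code_natD)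

lemma prefix_code_dpa: "prefix_code encode_dpa"
  unfolding prefix_code_def encode_dpa_def
  by (auto dest!: prefix_code_natD prefix_codeD[OF prefix_code_list[OF prefix_code_nat]]
      prefix_codeD[OF prefix_code_list[OF prefix_code_list[OF prefix_code_nat]]])

lemma prefix_code_player: "prefix_code encode_player"
  unfolding prefix_code_def encode_player_def
  by (auto dest!: prefix_codeD[OF prefix_code_list[OF prefix_code_dpa]]
      prefix_codeD[OF prefix_code_list[OF prefix_code_pair]])

lemma prefix_code_game: "prefix_code encode_game"
  unfolding prefix_code_def encode_game_def
  by (auto dest!: prefix_codeD[OF prefix_code_list[OF prefix_code_nat]]
      prefix_codeD[OF prefix_code_list[OF prefix_code_pair]]
      prefix_codeD[OF prefix_code_list[OF prefix_code_player]])

lemma inj_encode_instance: "inj encode_instance"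
proof (rule injI)
  fix I J :: "game_rep \<times> nat \<times> nat list"
  assume "encode_instance I = encode_instance J"
  then have "encode_instance I @ [] = encode_instance J @ []" by simp
  then show "I = J"
    unfolding encode_instance_def
    by (auto split: prod.splits dest!: prefix_codeD[OF prefix_code_game] prefix_code_natD
        prefix_codeD[OF prefix_code_list[OF prefix_code_nat], where r = "[]" and s = "[]", simplified])
qed

text \<open>The language of the yes-instances with at most \<open>l\<close> payoffs for each player. The represented
  game is unique up to the components that are irrelevant: the values of its functions outside the
  set of players, and the payoffs of words that leave the set of vertices.\<close>

definition constrained_ne_problem :: "nat \<Rightarrow> bool list set" where
  "constrained_ne_problem l =
     {encode_instance (R, v, ps) | R v ps. \<exists>G.
        represents R G \<and> (\<forall>i\<in>players G. card (payoffs G i) \<le> l) \<and>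
        v \<in> verts G \<and> length ps = length (rep_players R) \<and>
        (\<forall>i\<in>players G. ps ! i \<in> payoffs G i) \<and>
        constrained_ne_exists G v (\<lambda>i. ps ! i)}"


section \<open>Deterministic multi-tape Turing machines\<close>

text \<open>States and tape symbols are initial segments of the natural numbers. Symbol \<open>0\<close> is the blank,
  and \<open>1\<close> and \<open>2\<close> are the input letters. Tapes are infinite in both directions.\<close>

datatype direction = Go_Left | Stay | Go_Right

record tm =
  tape_count :: nat
  state_count :: nat
  symbol_count :: nat
  start_state :: nat
  accept_state :: nat
  reject_state :: nat
  trans_fun :: "nat \<Rightarrow> nat list \<Rightarrow> nat \<times> (nat \<times> direction) list"

definition wf_tm :: "tm \<Rightarrow> bool" where
  "wf_tm M \<longleftrightarrow>
     tape_count M \<ge> 1 \<and> symbol_count M \<ge> 3 \<and>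
     start_state M < state_count M \<and> accept_state M < state_count M \<and>
     reject_state M < state_count M \<and> accept_state M \<noteq> reject_state M \<and>
     (\<forall>q < state_count M. \<forall>as. length as = tape_count M \<and> set as \<subseteq> {..<symbol_count M} \<longrightarrow>
        (case trans_fun M q as of (q', acts) \<Rightarrow>
           q' < state_count M \<and> length acts = tape_count M \<and>
           (\<forall>(b, d)\<in>set acts. b < symbol_count M)))"

type_synonym tape = "(int \<Rightarrow> nat) \<times> int"  \<comment> \<open>contents and head position\<close>
type_synonym config = "nat \<times> tape list"

fun tape_read :: "tape \<Rightarrow> nat" where
  "tape_read (t, z) = t z"

fun tape_act :: "nat \<times> direction \<Rightarrow> tape \<Rightarrow> tape" where
  "tape_act (b, d) (t, z) =
     (t(z := b), case d of Go_Left \<Rightarrow> z - 1 | Stay \<Rightarrow> z | Go_Right \<Rightarrow> z + 1)"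

definition halted :: "tm \<Rightarrow> config \<Rightarrow> bool" where
  "halted M c \<longleftrightarrow> fst c = accept_state M \<or> fst c = reject_state M"

definition tm_step :: "tm \<Rightarrow> config \<Rightarrow> config" where
  "tm_step M c =
     (if halted M c then c
      else case trans_fun M (fst c) (map tape_read (snd c)) of (q, acts) \<Rightarrow>
        (q, map2 tape_act acts (snd c)))"

definition letter :: "bool \<Rightarrow> nat" where
  "letter b = (if b then 2 else 1)"

definition word_tape :: "bool list \<Rightarrow> tape" where
  "word_tape x = (\<lambda>z. if 0 \<le> z \<and> nat z < length x then letter (x ! nat z) else 0, 0)"

text \<open>The first tape initially holds the input; the last tape finally holds the output.\<close>

definition start_config :: "tm \<Rightarrow> bool list \<Rightarrow> config" where
  "start_config M x = (start_state M, word_tape x # replicate (tape_count M - 1) (word_tape []))"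

definition config_at :: "tm \<Rightarrow> bool list \<Rightarrow> nat \<Rightarrow> config" where
  "config_at M x t = (tm_step M ^^ t) (start_config M x)"

definition holds_word :: "tape \<Rightarrow> bool list \<Rightarrow> bool" where
  "holds_word t y \<longleftrightarrow>
     (\<forall>j < length y. fst t (int j) = letter (y ! j)) \<and> fst t (int (length y)) = 0"

definition visited_cells :: "tm \<Rightarrow> bool list \<Rightarrow> (nat \<times> int) set" where
  "visited_cells M x = {(j, snd (snd (config_at M x t) ! j)) | j t. j < tape_count M}"


section \<open>Polynomial space\<close>

definition decides :: "tm \<Rightarrow> bool list set \<Rightarrow> bool" where
  "decides M L \<longleftrightarrow>
     (\<forall>x. \<exists>t. halted M (config_at M x t) \<and> (fst (config_at M x t) = accept_state M \<longleftrightarrow> x \<in> L))"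

definition PSPACE :: "bool list set set" where
  "PSPACE =
     {L. \<exists>M. \<exists>p :: nat poly. wf_tm M \<and> decides M L \<and>
        (\<forall>x. finite (visited_cells M x) \<and> card (visited_cells M x) \<le> poly p (length x))}"

definition polytime_computable :: "(bool list \<Rightarrow> bool list) \<Rightarrow> bool" where
  "polytime_computable f \<longleftrightarrow>
     (\<exists>M. \<exists>p :: nat poly. wf_tm M \<and>
        (\<forall>x. \<exists>t \<le> poly p (length x). halted M (config_at M x t) \<and>
           holds_word (last (snd (config_at M x t))) (f x)))"

definition polytime_reducible :: "bool list set \<Rightarrow> bool list set \<Rightarrow> bool" where
  "polytime_reducible K L \<longleftrightarrow> (\<exists>f. polytime_computable f \<and> (\<forall>x. x \<in> K \<longleftrightarrow> f x \<in> L))"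

definition PSPACE_hard :: "bool list set \<Rightarrow> bool" where
  "PSPACE_hard L \<longleftrightarrow> (\<forall>K\<in>PSPACE. polytime_reducible K L)"

end

theory Submission
  imports Defs
begin

text \<open>Membership. A play \<open>w\<close> is the outcome of an equilibrium iff no player prefers the payoff of
  \<open>w\<close> to itself and, after every prefix of \<open>w\<close>, the coalition of the other players can prevent the
  payoffs that the player prefers. The product of the automata of one player has polynomially many
  states, as their number is fixed, and the coalition wins iff it wins the game that ends when the play
  closes its first cycle: since the automata partition all words, exactly one of them accepts a cycle
  repeated forever. First-cycle games have polynomial length, so they are evaluated by a depth-first
  search. A suitable \<open>w\<close> can be chosen ultimately periodic and is found by Savitch's algorithm in the
  product of all automata, which is exponential; the same search checks that the automata of each player
  partition the words, so that the representation is valid.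

  Hardness. With empty preference relations all profiles are equilibria, and the problem contains
  nonemptiness of intersections of automata. The runs of a space-bounded machine are checked by one automaton
  for its control and one for each cell and symbol.

  Turing machines are obtained by compiling programs that operate on finitely many stacks.\<close>


subsection \<open>Stack programs and Turing machines\<close>

text \<open>The goal of the coalition is a conjunction of parity conditions, which first cycles do
  not decide in general: two cycles, each even for another condition, can combine to a play that is
  odd for both. The partition of the words repairs this. If the coalition wins, every closed cycle
  is odd for every preferred payoff, and an automaton for which all closed cycles are odd rejects.
  If it loses, the player makes each closed cycle even for some preferred payoff, which may change
  from cycle to cycle; but only one automaton accepts a cycle, so every other payoff is odd on all
  cycles and is rejected as well. Both directions use the same fact about odd cycles. A node of the
  product of one player has a letter and at most \<open>l\<close> states, so simple paths are
  polynomial for fixed \<open>l\<close>; the product of all players is only searched for a lasso.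
  Membership needs loops with exponentially many rounds in polynomial space, the reduction needs
  polynomial time. One calculus of feasible functions serves both: sizes are always polynomial, and
  a flag decides whether numbers of rounds must be.\<close>

datatype com = Skip | Push nat bool | Pop nat | Seq com com
  | Cond nat "bool option \<Rightarrow> bool" com com | Loop nat "bool option \<Rightarrow> bool" com

type_synonym store = "nat \<Rightarrow> bool list"

fun peek :: "bool list \<Rightarrow> bool option" where
  "peek [] = None"
| "peek (b # _) = Some b"

text \<open>A machine step writes before it moves. A push has to move left first and then write, so
  it takes two steps, and \<open>Write\<close> is the control in between.\<close>

datatype item = Do com | Write nat bool

fun mstep :: "item list \<times> store \<Rightarrow> item list \<times> store" where
  "mstep ([], s) = ([], s)"
| "mstep (Write r b # k, s) = (k, s(r := b # s r))"
| "mstep (Do Skip # k, s) = (k, s)"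
| "mstep (Do (Push r b) # k, s) = (Write r b # k, s)"
| "mstep (Do (Pop r) # k, s) = (k, s(r := tl (s r)))"
| "mstep (Do (Seq c d) # k, s) = (Do c # Do d # k, s)"
| "mstep (Do (Cond r P c d) # k, s) = (Do (if P (peek (s r)) then c else d) # k, s)"
| "mstep (Do (Loop r P c) # k, s) = (if P (peek (s r)) then Do c # Do (Loop r P c) # k else k, s)"

fun regs :: "com \<Rightarrow> nat set" where
  "regs Skip = {}"
| "regs (Push r b) = {r}"
| "regs (Pop r) = {r}"
| "regs (Seq c d) = regs c \<union> regs d"
| "regs (Cond r P c d) = insert r (regs c \<union> regs d)"
| "regs (Loop r P c) = insert r (regs c)"

lemma finite_regs: "finite (regs c)"
  by (induction c) auto

fun item_regs :: "item \<Rightarrow> nat set" where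
  "item_regs (Do c) = regs c"
| "item_regs (Write r b) = {r}"

text \<open>The continuations that a run of \<open>Do c # k\<close> goes through before it reaches \<open>k\<close>.\<close>

fun conts :: "com \<Rightarrow> item list \<Rightarrow> item list set" where
  "conts Skip k = {Do Skip # k}"
| "conts (Push r b) k = {Do (Push r b) # k, Write r b # k}"
| "conts (Pop r) k = {Do (Pop r) # k}"
| "conts (Seq c d) k = insert (Do (Seq c d) # k) (conts c (Do d # k) \<union> conts d k)"
| "conts (Cond r P c d) k = insert (Do (Cond r P c d) # k) (conts c k \<union> conts d k)"
| "conts (Loop r P c) k = insert (Do (Loop r P c) # k) (conts c (Do (Loop r P c) # k))"

lemma finite_conts: "finite (conts c k)"
  by (induction c arbitrary: k) auto

lemma conts_start: "Do c # k \<in> conts c k"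
  by (cases c) auto

lemma conts_step: "cs \<in> conts c k \<Longrightarrow> fst (mstep (cs, s)) \<in> insert k (conts c k)"
proof (induction c arbitrary: k)
  case (Seq c d)
  then show ?case using conts_start[of c "Do d # k"] conts_start[of d k] by fastforce
next
  case (Cond r P c d)
  then show ?case using conts_start[of c k] conts_start[of d k] by (cases "P (peek (s r))") auto
next
  case (Loop r P c)
  then show ?case using conts_start[of c "Do (Loop r P c) # k"] by fastforce
qed auto

lemma conts_regs: "cs \<in> conts c k \<Longrightarrow> x \<in> set cs \<Longrightarrow> item_regs x \<subseteq> regs c \<or> x \<in> set k"
  by (induction c arbitrary: k) fastforce+

text \<open>Keeps \<open>Write\<close> at the front of the control, so that at most one tape at a
  time is in the intermediate position of a push.\<close>

lemma conts_tl: "cs \<in> conts c k \<Longrightarrow> Write r b \<in> set (tl cs) \<Longrightarrow> Write r b \<in> set k"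
  by (induction c arbitrary: k) fastforce+

text \<open>A machine sees only the scanned symbols, that is, the tops of the stacks; they have to
  determine the next control.\<close>

lemma mstep_control:
  assumes "\<And>r. cs \<noteq> [] \<Longrightarrow> r \<in> item_regs (hd cs) \<Longrightarrow> peek (s r) = peek (s' r)"
  shows "fst (mstep (cs, s)) = fst (mstep (cs, s'))"
  using assms by (cases "(cs, s)" rule: mstep.cases) auto

text \<open>The number counts steps of \<open>mstep\<close>, hence 2 for a push. Pushes are allowed
  only below height \<open>m\<close>, so a derivation is also evidence of a space bound.\<close>

inductive exec :: "nat \<Rightarrow> com \<Rightarrow> store \<Rightarrow> nat \<Rightarrow> store \<Rightarrow> bool" for m where
  exec_Skip: "exec m Skip s 1 s"
| exec_Push: "length (s r) < m \<Longrightarrow> exec m (Push r b) s 2 (s(r := b # s r))"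
| exec_Pop: "exec m (Pop r) s 1 (s(r := tl (s r)))"
| exec_Seq: "exec m c s t s' \<Longrightarrow> exec m d s' u s'' \<Longrightarrow> exec m (Seq c d) s (Suc (t + u)) s''"
| exec_Cond: "exec m (if P (peek (s r)) then c else d) s t s' \<Longrightarrow> exec m (Cond r P c d) s (Suc t) s'"
| exec_Loop_end: "\<not> P (peek (s r)) \<Longrightarrow> exec m (Loop r P c) s 1 s"
| exec_Loop: "P (peek (s r)) \<Longrightarrow> exec m c s t s' \<Longrightarrow> exec m (Loop r P c) s' u s'' \<Longrightarrow>
    exec m (Loop r P c) s (Suc (t + u)) s''"

definition fits :: "nat \<Rightarrow> store \<Rightarrow> bool" where
  "fits m s \<longleftrightarrow> (\<forall>r. length (s r) \<le> m)"

lemma mstep_chain: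
  assumes "(mstep ^^ t) x = y" "(mstep ^^ u) y = z"
    and "\<forall>j\<le>t. Q ((mstep ^^ j) x)" "\<forall>j\<le>u. Q ((mstep ^^ j) y)"
  shows "(mstep ^^ (t + u)) x = z \<and> (\<forall>j\<le>t + u. Q ((mstep ^^ j) x))"
proof -
  have s: "(mstep ^^ (t + i)) x = (mstep ^^ i) y" for i
    using assms(1) by (simp add: add.commute[of t i] funpow_add)
  have "Q ((mstep ^^ j) x)" if "j \<le> t + u" for j
  proof (cases "j \<le> t")
    case False
    then have "j = t + (j - t)" "j - t \<le> u" using that by auto
    then show ?thesis using s[of "j - t"] assms(4) by metis
  qed (use assms in auto)
  then show ?thesis using s assms by auto
qed

text \<open>Space is a matter of all intermediate stores, therefore the bound is carried along for
  every \<open>j\<close>. The continuation \<open>k\<close> is arbitrary so that the rule for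
  \<open>Seq\<close> and the one for \<open>Loop\<close> can be chained.\<close>

lemma exec_mstep:
  assumes "exec m c s t s'" "fits m s"
  shows "(mstep ^^ t) (Do c # k, s) = (k, s') \<and> (\<forall>j\<le>t. fits m (snd ((mstep ^^ j) (Do c # k, s)))) \<and> fits m s'"
  using assms
proof (induction arbitrary: k)
  case (exec_Skip s)
  then show ?case by (auto simp: le_Suc_eq)
next
  case (exec_Push s r b)
  then have "fits m (s(r := b # s r))" by (auto simp: fits_def)
  with exec_Push show ?case by (auto simp: le_Suc_eq numeral_2_eq_2 fits_def)
next
  case (exec_Pop r s)
  then have "fits m (s(r := tl (s r)))" by (auto simp: fits_def le_diff_conv intro: le_trans)
  with exec_Pop show ?case by (auto simp: le_Suc_eq fits_def)
next
  case (exec_Seq c s t s' d u s'')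
  note 1 = exec_Seq.IH(1)[OF exec_Seq.prems, of "Do d # k"]
  note 2 = exec_Seq.IH(2)[of k]
  have 3: "(mstep ^^ (t + u)) (Do c # Do d # k, s) = (k, s'') \<and>
      (\<forall>j\<le>t + u. fits m (snd ((mstep ^^ j) (Do c # Do d # k, s))))"
    by (rule mstep_chain) (use 1 2 in auto)
  have "(mstep ^^ (1 + (t + u))) (Do (Seq c d) # k, s) = (k, s'') \<and>
      (\<forall>j\<le>1 + (t + u). fits m (snd ((mstep ^^ j) (Do (Seq c d) # k, s))))"
    by (rule mstep_chain[where y = "(Do c # Do d # k, s)"]) (use 3 exec_Seq.prems in \<open>auto simp: le_Suc_eq\<close>)
  then show ?case using 1 2 by simp
next
  case (exec_Cond P s r c d t s')
  note 1 = exec_Cond.IH[OF exec_Cond.prems, of k]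
  have "(mstep ^^ (1 + t)) (Do (Cond r P c d) # k, s) = (k, s') \<and>
      (\<forall>j\<le>1 + t. fits m (snd ((mstep ^^ j) (Do (Cond r P c d) # k, s))))"
    by (rule mstep_chain[where y = "(Do (if P (peek (s r)) then c else d) # k, s)"])
      (use 1 exec_Cond.prems in \<open>auto simp: le_Suc_eq\<close>)
  then show ?case using 1 by simp
next
  case (exec_Loop_end P s r c)
  then show ?case by (auto simp: le_Suc_eq)
next
  case (exec_Loop P s r c t s' u s'')
  note 1 = exec_Loop.IH(1)[OF exec_Loop.prems, of "Do (Loop r P c) # k"]
  note 2 = exec_Loop.IH(2)[of k]
  have 3: "(mstep ^^ (t + u)) (Do c # Do (Loop r P c) # k, s) = (k, s'') \<and>
      (\<forall>j\<le>t + u. fits m (snd ((mstep ^^ j) (Do c # Do (Loop r P c) # k, s))))"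
    by (rule mstep_chain) (use 1 2 in auto)
  have "(mstep ^^ (1 + (t + u))) (Do (Loop r P c) # k, s) = (k, s'') \<and>
      (\<forall>j\<le>1 + (t + u). fits m (snd ((mstep ^^ j) (Do (Loop r P c) # k, s))))"
    by (rule mstep_chain[where y = "(Do c # Do (Loop r P c) # k, s)"])
      (use 3 exec_Loop.prems exec_Loop.hyps in \<open>auto simp: le_Suc_eq\<close>)
  then show ?case using 1 2 by simp
qed

text \<open>A stack is stored to the right of the head, its bottom at a fixed position. Between the two
  steps of a push the head stands one cell further left.\<close>

fun tape_rep :: "bool \<Rightarrow> int \<Rightarrow> bool list \<Rightarrow> tape \<Rightarrow> bool" where
  "tape_rep w base xs (t, z) \<longleftrightarrow> z = base - int (length xs) - (if w then 1 else 0) \<and> t base = 0 \<and>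
     (\<forall>j<length xs. t (base - int (length xs) + int j) = letter (xs ! j))"

lemma letter_eq [simp]: "letter b = 0 \<longleftrightarrow> False" "letter b = 2 \<longleftrightarrow> b" "letter b < 3"
  by (auto simp: letter_def)

lemma tape_rep_read:
  assumes "tape_rep False base xs T"
  shows "tape_read T = (case peek xs of None \<Rightarrow> 0 | Some b \<Rightarrow> letter b)"
  using assms by (cases T; cases xs) (auto dest: spec[of _ 0])

lemma tape_rep_stay: "tape_rep w base xs T \<Longrightarrow> tape_rep w base xs (tape_act (tape_read T, Stay) T)"
  by (cases T) auto

lemma tape_rep_left: "tape_rep False base xs T \<Longrightarrow> tape_rep True base xs (tape_act (tape_read T, Go_Left) T)"
  by (cases T) auto

lemma tape_rep_write:
  "tape_rep True base xs T \<Longrightarrow> tape_rep False base (b # xs) (tape_act (letter b, Stay) T)"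
  by (cases T) (auto simp: nth_Cons algebra_simps split: nat.splits)

lemma tape_rep_right:
  assumes "tape_rep False base xs T"
  shows "tape_rep False base (tl xs)
    (tape_act (tape_read T, if tape_read T = 0 then Stay else Go_Right) T)"
proof (cases xs)
  case Nil
  with assms show ?thesis by (cases T) auto
next
  case (Cons b ys)
  obtain t z where T: "T = (t, z)" by fastforce
  have "t (base - int (length ys) + int j) = letter (ys ! j)" if "j < length ys" for j
    using assms that unfolding T Cons by (auto dest!: spec[of _ "Suc j"] simp: algebra_simps)
  moreover have "t z \<noteq> 0"
    using assms tape_rep_read[OF assms] unfolding T Cons by simp
  ultimately show ?thesis using assms unfolding T Cons by simp
qed

fun control_act :: "item list \<Rightarrow> nat list \<Rightarrow> nat \<times> nat \<times> direction" where
  "control_act (Do (Push r b) # k) as = (r, as ! r, Go_Left)"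
| "control_act (Write r b # k) as = (r, letter b, Stay)"
| "control_act (Do (Pop r) # k) as = (r, as ! r, if as ! r = 0 then Stay else Go_Right)"
| "control_act cs as = (0, as ! 0, Stay)"

text \<open>A store with stacks of height at most one that has the tops which the symbols
  \<open>as\<close> stand for. By \<open>mstep_control\<close> the next control can be computed from
  it.\<close>

definition sym_store :: "nat list \<Rightarrow> store" where
  "sym_store as r = (if r < length as \<and> as ! r \<noteq> 0 then [as ! r = 2] else [])"

definition upd_acts :: "nat list \<Rightarrow> nat \<times> nat \<times> direction \<Rightarrow> (nat \<times> direction) list" where
  "upd_acts as = (\<lambda>(r, act). map (\<lambda>j. if j = r then act else (as ! j, Stay)) [0..<length as])"

definition index_of :: "'a list \<Rightarrow> 'a \<Rightarrow> nat" where
  "index_of L x = (SOME i. i < length L \<and> L ! i = x)"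

lemma index_of: "x \<in> set L \<Longrightarrow> index_of L x < length L \<and> L ! index_of L x = x"
  unfolding index_of_def by (rule someI_ex) (auto simp: in_set_conv_nth)

text \<open>When the control is empty, register \<open>0\<close> is copied to the last tape.\<close>

definition machine_trans :: "item list list \<Rightarrow> nat \<Rightarrow> nat \<Rightarrow> nat list \<Rightarrow> nat \<times> (nat \<times> direction) list" where
  "machine_trans L K q as =
     (if q < length L then
        if L ! q = [] then (if as ! 0 = 0 then length L + 1 else length L + 2, upd_acts as (0, as ! 0, Stay))
        else (index_of L (fst (mstep (L ! q, sym_store as))), upd_acts as (control_act (L ! q) as))
      else if as ! 0 = 0 then (length L, upd_acts as (0, as ! 0, Stay))
      else (length L + 2, (upd_acts as (0, as ! 0, Go_Right))[K := (as ! 0, Go_Right)]))"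

text \<open>Acceptance means that register \<open>0\<close> ends nonempty, in accordance with the
  code of \<open>False\<close>, which is empty. Tape \<open>K\<close> lies beyond all registers of
  \<open>c\<close> and receives the output.\<close>

definition machine :: "com \<Rightarrow> nat \<Rightarrow> tm" where
  "machine c K = (let L = (SOME L. set L = insert [] (conts c [])) in
     \<lparr>tape_count = Suc K, state_count = length L + 3, symbol_count = 3, start_state = index_of L [Do c],
      accept_state = length L, reject_state = length L + 1, trans_fun = machine_trans L K\<rparr>)"

definition input_store :: "bool list \<Rightarrow> store" where
  "input_store x r = (if r = 0 then x else [])"

section \<open>Simulation of a program by a machine\<close>

locale com_machine =
  fixes c :: com and K :: nat
  assumes regs: "regs c \<subseteq> {..<K}" and K: "K > 0"
begin

definition L where "L = (SOME L. set L = insert [] (conts c []))"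

lemma set_L: "set L = insert [] (conts c [])"
  unfolding L_def by (rule someI_ex, rule finite_list) (simp add: finite_conts)

abbreviation "M \<equiv> machine c K"

lemma M_simps:
  "tape_count M = Suc K" "state_count M = length L + 3" "symbol_count M = 3"
  "start_state M = index_of L [Do c]" "accept_state M = length L" "reject_state M = length L + 1"
  "trans_fun M = machine_trans L K"
  unfolding machine_def L_def[symmetric] Let_def by simp_all

lemma L_regs: "cs \<in> set L \<Longrightarrow> x \<in> set cs \<Longrightarrow> item_regs x \<subseteq> {..<K}"
  using conts_regs[of cs c "[]" x] regs unfolding set_L by auto

lemma L_tl: "cs \<in> set L \<Longrightarrow> Write r b \<notin> set (tl cs)"
  using conts_tl[of cs c "[]" r b] unfolding set_L by auto

lemma L_step: "cs \<in> set L \<Longrightarrow> fst (mstep (cs, s)) \<in> set L"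
  using conts_step[of cs c "[]" s] unfolding set_L by auto

lemma length_upd_acts [simp]: "length (upd_acts as x) = length as"
  by (simp add: upd_acts_def split_beta)

lemma set_upd_acts: "set (upd_acts as (r, a, d)) \<subseteq> insert (a, d) ((\<lambda>b. (b, Stay)) ` set as)"
  by (auto simp: upd_acts_def)

lemma control_act_bound:
  assumes "control_act cs as = (r, b, d)" "length as = Suc K" "set as \<subseteq> {..<3}" "cs \<in> set L"
  shows "b < 3"
proof -
  have "as ! j < 3" if "j \<le> K" for j using assms(2,3) that subsetD[OF assms(3) nth_mem, of j] by auto
  moreover have "cs \<noteq> [] \<Longrightarrow> item_regs (hd cs) \<subseteq> {..<K}"
    using L_regs[OF assms(4), of "hd cs"] by auto
  ultimately show ?thesis using assms(1)
    by (cases "(cs, as)" rule: control_act.cases) (auto split: if_splits)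
qed

lemma wf_M: "wf_tm M"
proof -
  have *: "case machine_trans L K q as of (q', acts) \<Rightarrow> q' < length L + 3 \<and> length acts = Suc K \<and>
      (\<forall>(b, d)\<in>set acts. b < 3)"
    if q: "q < length L + 3" and as: "length as = Suc K" "set as \<subseteq> {..<3}" for q as
  proof -
    have a0: "as ! 0 < 3" using as subsetD[OF as(2) nth_mem, of 0] by auto
    have u: "b < 3" if "(b, d) \<in> set (upd_acts as (r, a, e))" "a < 3" for b d r a e
      using set_upd_acts[of as r a e] as that by fastforce
    have v: "b < 3" if "(b, d) \<in> set ((upd_acts as (r, a, e))[K := (a', e')])" "a < 3" "a' < 3" for b d r a e a' e'
      using set_update_subset_insert[of "upd_acts as (r, a, e)" K "(a', e')"] u[of b d r a e] that
      by fastforce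
    have "index_of L (fst (mstep (L ! q, s))) < length L" if "q < length L" for s
      using index_of[OF L_step, of "L ! q" s] that by auto
    then show ?thesis
      using as a0 control_act_bound[OF _ as, of "L ! q"]
      by (cases "control_act (L ! q) as") (auto simp: machine_trans_def trans_less_add1 dest: u v)
  qed
  have "index_of L [Do c] < length L"
    using index_of[of "[Do c]" L] conts_start[of c "[]"] unfolding set_L by auto
  then show ?thesis using * unfolding wf_tm_def M_simps by auto
qed

definition sim :: "(nat \<Rightarrow> int) \<Rightarrow> item list \<Rightarrow> store \<Rightarrow> config \<Rightarrow> bool" where
  "sim base cs s C \<longleftrightarrow> cs \<in> set L \<and> fst C = index_of L cs \<and> length (snd C) = Suc K \<and>
     (\<forall>r<K. tape_rep (\<exists>b k. cs = Write r b # k) (base r) (s r) (snd C ! r)) \<and>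
     snd C ! K = (\<lambda>_. 0, 0)"

text \<open>One step of \<open>mstep\<close> is one step of the machine: the next control depends on
  the scanned symbols only, and the single tape named by \<open>control_act\<close> is the only one
  that changes.\<close>

lemma sim_step:
  assumes S: "sim base cs s C" and ne: "cs \<noteq> []"
  shows "sim base (fst (mstep (cs, s))) (snd (mstep (cs, s))) (tm_step M C)"
proof -
  obtain q Ts where C: "C = (q, Ts)" by fastforce
  define as where "as = map tape_read Ts"
  have cs: "cs \<in> set L" and q: "q < length L" "L ! q = cs" and len: "length Ts = Suc K" "length as = Suc K"
    using S index_of[of cs L] by (auto simp: sim_def C as_def)
  have rep: "tape_rep (\<exists>b k. cs = Write r b # k) (base r) (s r) (Ts ! r)" if "r < K" for r
    using S that by (simp add: sim_def C)
  have out: "Ts ! K = (\<lambda>_. 0, 0)" using S by (simp add: sim_def C)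
  have as_nth: "as ! j = tape_read (Ts ! j)" if "j \<le> K" for j using that len by (simp add: as_def)
  have nh: "\<not> halted M C" using q by (auto simp: halted_def M_simps C)
  have pk: "peek (s r) = peek (sym_store as r)" if "r < K" "\<nexists>b k. cs = Write r b # k" for r
    using tape_rep_read[of "base r" "s r" "Ts ! r"] rep[OF that(1)] that len
    by (cases "s r") (auto simp: sym_store_def as_nth)
  have hd_regs: "item_regs (hd cs) \<subseteq> {..<K}" using L_regs[OF cs, of "hd cs"] ne by auto
  have ctl: "fst (mstep (cs, s)) = fst (mstep (cs, sym_store as))"
  proof (cases "\<exists>r b k. cs = Write r b # k")
    case False
    then show ?thesis by (intro mstep_control pk) (use hd_regs in auto)
  qed auto
  obtain r b d where act: "control_act cs as = (r, b, d)" by (cases "control_act cs as")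
  define Ts' where "Ts' = map2 tape_act (upd_acts as (r, b, d)) Ts"
  have step: "tm_step M C = (index_of L (fst (mstep (cs, s))), Ts')"
    using nh q ne ctl act by (simp add: tm_step_def M_simps C machine_trans_def as_def[symmetric] Ts'_def)
  have Ts': "Ts' ! j = tape_act (if j = r then (b, d) else (tape_read (Ts ! j), Stay)) (Ts ! j)" if "j \<le> K" for j
    using that len by (simp add: Ts'_def upd_acts_def as_nth nth_append del: upt_Suc)
  have len': "length Ts' = Suc K" using len by (simp add: Ts'_def)
  have rK: "r < K" using act hd_regs K by (cases "(cs, as)" rule: control_act.cases) auto
  \<comment> \<open>The tail of a control contains no \<open>Write\<close>, so a
    \<open>Write\<close> in front can only stem from a push that has just begun.\<close>
  have shift: "(\<exists>b k. fst (mstep (cs, s)) = Write r' b # k) \<longleftrightarrow> (\<exists>b k. cs = Do (Push r' b) # k)" for r'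
  proof -
    have "\<forall>b. Write r' b \<notin> set (tl cs)" using L_tl[OF cs] by blast
    then show ?thesis by (cases "(cs, s)" rule: mstep.cases) (auto split: if_splits)
  qed
  have "tape_rep (\<exists>b k. fst (mstep (cs, s)) = Write r' b # k) (base r') (snd (mstep (cs, s)) r') (Ts' ! r')"
    if "r' < K" for r'
  proof -
    have st: "tape_rep (\<exists>b k. cs = Write r' b # k) (base r') (s r') (tape_act (tape_read (Ts ! r'), Stay) (Ts ! r'))"
      by (rule tape_rep_stay[OF rep[OF that]])
    show ?thesis
      using rep[OF that] st act rK that tape_rep_left[of "base r'" "s r'" "Ts ! r'"]
        tape_rep_write[of "base r'" "s r'" "Ts ! r'"] tape_rep_right[of "base r'" "s r'" "Ts ! r'"]
      unfolding shift
      by (cases "(cs, as)" rule: control_act.cases) (auto simp: Ts' as_nth ne)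
  qed
  moreover have "Ts' ! K = (\<lambda>_. 0, 0)" using rK out by (simp add: Ts' fun_eq_iff)
  ultimately show ?thesis using step len' L_step[OF cs] by (simp add: sim_def)
qed

text \<open>The input with the head on its first symbol already is a stack; its bottom is the blank
  cell behind the last symbol, hence the base \<open>length x\<close>.\<close>

lemma sim_start: "sim (\<lambda>r. if r = 0 then int (length x) else 0) [Do c] (input_store x) (start_config M x)"
proof -
  have L: "[Do c] \<in> set L" using conts_start[of c "[]"] by (simp add: set_L)
  have nth: "(word_tape x # replicate K (word_tape [])) ! r = (if r = 0 then word_tape x else word_tape [])"
    if "r \<le> K" for r
    using that by (simp add: nth_Cons')
  have "tape_rep False (if r = 0 then int (length x) else 0) (input_store x r)
      ((word_tape x # replicate K (word_tape [])) ! r)" if "r < K" for r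
    unfolding nth[OF less_imp_le[OF that]] by (simp add: word_tape_def input_store_def)
  moreover have "(word_tape x # replicate K (word_tape [])) ! K = (\<lambda>_. 0, 0)"
    unfolding nth[OF order_refl] using K by (simp add: word_tape_def)
  ultimately show ?thesis using L by (simp add: sim_def start_config_def M_simps)
qed

text \<open>Bottoms lie at \<open>0\<close> or at the length of the input, stacks extend at most
  \<open>m\<close> cells to the left, and an unfinished push needs one cell more.\<close>

definition pos_ok :: "nat \<Rightarrow> config \<Rightarrow> bool" where
  "pos_ok m C \<longleftrightarrow> (\<forall>j\<le>K. - int m - 1 \<le> snd (snd C ! j) \<and> snd (snd C ! j) \<le> int m)"

lemma sim_pos:
  assumes "sim (\<lambda>r. if r = 0 then int n else 0) cs s C" "fits m s" "n \<le> m"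
  shows "pos_ok m C"
  unfolding pos_ok_def
proof (intro allI impI)
  fix j assume "j \<le> K"
  show "- int m - 1 \<le> snd (snd C ! j) \<and> snd (snd C ! j) \<le> int m"
  proof (cases "j = K")
    case True
    then show ?thesis using assms(1) by (simp add: sim_def)
  next
    case False
    obtain t z where T: "snd C ! j = (t, z)" by fastforce
    have "length (s j) \<le> m" using assms(2) by (simp add: fits_def)
    moreover have "tape_rep (\<exists>b k. cs = Write j b # k) (if j = 0 then int n else 0) (s j) (t, z)"
      using assms(1) False \<open>j \<le> K\<close> unfolding T[symmetric] by (simp add: sim_def)
    ultimately show ?thesis using T assms(3) by (auto split: if_splits)
  qed
qed

definition flushing :: "int \<Rightarrow> bool list \<Rightarrow> nat \<Rightarrow> config \<Rightarrow> bool" where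
  "flushing base ys j C \<longleftrightarrow> fst C = length L + 2 \<and> length (snd C) = Suc K \<and> j \<le> length ys \<and>
     tape_rep False base (drop j ys) (snd C ! 0) \<and>
     snd C ! K = ((\<lambda>z. if 0 \<le> z \<and> z < int j then letter (ys ! nat z) else 0), int j)"

lemma upd_noop:
  assumes len: "length Ts = Suc K"
  shows "map2 tape_act (upd_acts (map tape_read Ts) (0, tape_read (Ts ! 0), Stay)) Ts = Ts"
proof (rule nth_equalityI)
  fix i assume "i < length (map2 tape_act (upd_acts (map tape_read Ts) (0, tape_read (Ts ! 0), Stay)) Ts)"
  then show "map2 tape_act (upd_acts (map tape_read Ts) (0, tape_read (Ts ! 0), Stay)) Ts ! i = Ts ! i"
    using len by (cases "Ts ! i") (auto simp: upd_acts_def simp del: upt_Suc)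
qed simp

lemma flush_step:
  assumes F: "flushing base ys j C" and j: "j < length ys"
  shows "flushing base ys (Suc j) (tm_step M C)"
    and "\<lbrakk>0 < r; r < K\<rbrakk> \<Longrightarrow> snd (snd (tm_step M C) ! r) = snd (snd C ! r)"
proof -
  obtain q Ts where C: "C = (q, Ts)" by fastforce
  have q: "q = length L + 2" and len: "length Ts = Suc K"
    and T0: "tape_rep False base (drop j ys) (Ts ! 0)"
    and TK: "Ts ! K = ((\<lambda>z. if 0 \<le> z \<and> z < int j then letter (ys ! nat z) else 0), int j)"
    using F by (auto simp: flushing_def C)
  have d: "drop j ys = ys ! j # drop (Suc j) ys" using j by (simp add: Cons_nth_drop_Suc)
  have rd: "tape_read (Ts ! 0) = letter (ys ! j)" using tape_rep_read[OF T0] by (simp add: d)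
  have T0': "tape_rep False base (drop (Suc j) ys) (tape_act (tape_read (Ts ! 0), Go_Right) (Ts ! 0))"
    using tape_rep_right[OF T0] rd by (simp add: d)
  have step: "tm_step M C = (length L + 2,
      map2 tape_act ((upd_acts (map tape_read Ts) (0, letter (ys ! j), Go_Right))[K := (letter (ys ! j), Go_Right)]) Ts)"
    using rd len by (simp add: tm_step_def halted_def M_simps C q machine_trans_def)
  show "flushing base ys (Suc j) (tm_step M C)"
    using K T0' rd TK len j unfolding flushing_def step
    by (auto simp: upd_acts_def nth_list_update nat_less_iff intro!: ext simp del: upt_Suc)
  show "snd (snd (tm_step M C) ! r) = snd (snd C ! r)" if "0 < r" "r < K"
    using that len unfolding step
    by (cases "Ts ! r") (simp add: C upd_acts_def nth_list_update del: upt_Suc)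
qed

lemma halted_config: "halted M (config_at M x u) \<Longrightarrow> config_at M x (u + i) = config_at M x u"
  by (induction i) (auto simp: config_at_def tm_step_def)

text \<open>Beyond the simulated steps, one step leaves the empty control, one per symbol copies
  register \<open>0\<close> to the last tape, and one accepts.\<close>

theorem machine_run:
  assumes run: "exec m c (input_store x) t s'" and m: "length x \<le> m"
  obtains u where "u \<le> t + length (s' 0) + 2" "halted M (config_at M x u)"
    "fst (config_at M x u) = accept_state M \<longleftrightarrow> s' 0 \<noteq> []"
    "holds_word (last (snd (config_at M x u))) (s' 0)"
    "\<And>u. pos_ok m (config_at M x u)"
proof -
  define base where "base = (\<lambda>r::nat. if r = 0 then int (length x) else (0::int))"
  define X where "X j = (mstep ^^ j) ([Do c], input_store x)" for j
  have f0: "fits m (input_store x)" using m by (auto simp: fits_def input_store_def)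
  have X: "X t = ([], s')" and fit: "fits m s'" "\<And>j. j \<le> t \<Longrightarrow> fits m (snd (X j))"
    using exec_mstep[OF run f0, of "[]"] by (auto simp: X_def)
  have XS: "X (Suc j) = mstep (X j)" for j by (simp add: X_def)
  \<comment> \<open>The machine stops simulating when the control is empty for the first time. Since
    \<open>mstep\<close> idles on the empty control, the store is \<open>s'\<close> already
    then.\<close>
  define v where "v = (LEAST j. fst (X j) = [])"
  have v: "fst (X v) = []" unfolding v_def by (rule LeastI[of _ t]) (simp add: X)
  have vt: "v \<le> t" unfolding v_def by (rule Least_le) (simp add: X)
  have before: "fst (X j) \<noteq> []" if "j < v" for j using not_less_Least[of j] that by (auto simp: v_def)
  have "X (v + i) = X v" for i using v by (induction i) (auto simp: XS, cases "X v", auto)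
  from this[of "t - v"] have Xv: "X v = ([], s')" using X vt by simp
  have conf: "config_at M x (Suc j) = tm_step M (config_at M x j)" for j by (simp add: config_at_def)
  have sim: "sim base (fst (X j)) (snd (X j)) (config_at M x j)" if "j \<le> v" for j
    using that
  proof (induction j)
    case 0
    then show ?case using sim_start[of x] by (simp add: X_def config_at_def base_def)
  next
    case (Suc j)
    then show ?case using sim_step[of base "fst (X j)" "snd (X j)"] before[of j] by (simp add: XS conf)
  qed
  have pos1: "pos_ok m (config_at M x j)" if "j \<le> v" for j
    using sim_pos[of "length x"] sim[OF that] fit(2)[of j] that vt m unfolding base_def by simp
  obtain q Ts where C: "config_at M x v = (q, Ts)" by fastforce
  have nil: "[] \<in> set L" by (simp add: set_L)
  have S: "sim base [] s' (q, Ts)" using sim[of v] by (simp add: Xv C)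
  then have q: "q < length L" "L ! q = []" and len: "length Ts = Suc K"
    and T: "\<And>r. r < K \<Longrightarrow> tape_rep False (base r) (s' r) (Ts ! r)" and TK: "Ts ! K = (\<lambda>_. 0, 0)"
    using index_of[OF nil] by (auto simp: sim_def)
  have rd: "tape_read (Ts ! 0) = (case peek (s' 0) of None \<Rightarrow> 0 | Some b \<Rightarrow> letter b)"
    using tape_rep_read[OF T[of 0]] K by simp
  note acts = upd_noop[OF len]
  have step: "config_at M x (Suc v) = (if s' 0 = [] then length L + 1 else length L + 2, Ts)"
    using q len acts rd
    by (cases "s' 0") (auto simp: conf C tm_step_def halted_def M_simps machine_trans_def)
  have halt_pos: "pos_ok m (config_at M x u)"
    if "halted M (config_at M x w)" "\<And>u. u \<le> w \<Longrightarrow> pos_ok m (config_at M x u)" for u w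
    using halted_config[OF that(1), of "u - w"] that(2)[of u] that(2)[of w] by (cases "u \<le> w") auto
  have lastK: "last Us = Us ! K" if "length Us = Suc K" for Us :: "tape list"
    using that by (cases Us rule: rev_cases) auto
  show thesis
  proof (cases "s' 0 = []")
    case True
    have h: "halted M (config_at M x (Suc v))" using step True by (simp add: halted_def M_simps)
    have "pos_ok m (config_at M x (Suc v))"
      using pos1[of v] unfolding step C by (simp add: pos_ok_def)
    then have "pos_ok m (config_at M x u)" if "u \<le> Suc v" for u
      using that pos1[of u] by (cases "u = Suc v") auto
    from halt_pos[OF h this] show thesis
      using that[of "Suc v"] h vt step True TK lastK[OF len] by (simp add: M_simps holds_word_def)
  next
    case False
    define n where "n = length (s' 0)"
    have fl: "flushing (base 0) (s' 0) j (config_at M x (Suc v + j)) \<and>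
        (\<forall>r. 0 < r \<and> r < K \<longrightarrow> snd (snd (config_at M x (Suc v + j)) ! r) = snd (Ts ! r))" if "j \<le> n" for j
      using that
    proof (induction j)
      case 0
      then show ?case using False step len T[of 0] K TK by (auto simp: flushing_def)
    next
      case (Suc j)
      have e: "config_at M x (Suc v + Suc j) = tm_step M (config_at M x (Suc v + j))"
        unfolding add_Suc_right by (rule conf)
      show ?case
        using flush_step[of "base 0" "s' 0" j "config_at M x (Suc v + j)"] Suc unfolding e n_def by auto
    qed
    have n: "n \<le> m" using fit(1) by (simp add: fits_def n_def)
    have pos2: "pos_ok m (config_at M x (Suc v + j))" if "j \<le> n" for j
    proof -
      have "- int m - 1 \<le> snd (snd (config_at M x (Suc v + j)) ! i) \<and>
          snd (snd (config_at M x (Suc v + j)) ! i) \<le> int m" if i: "i \<le> K" for i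
      proof -
        consider "i = 0" | "i = K" | "0 < i \<and> i < K" using i by fastforce
        then show ?thesis
        proof cases
          case 1
          obtain a z where "snd (config_at M x (Suc v + j)) ! 0 = (a, z)" by fastforce
          then show ?thesis using fl[OF \<open>j \<le> n\<close>] n m 1 by (auto simp: flushing_def base_def n_def)
        next
          case 2
          then show ?thesis using fl[OF \<open>j \<le> n\<close>] n \<open>j \<le> n\<close> by (auto simp: flushing_def)
        next
          case 3
          then show ?thesis using fl[OF \<open>j \<le> n\<close>] pos1[of v] i by (auto simp: pos_ok_def C)
        qed
      qed
      then show ?thesis by (simp add: pos_ok_def)
    qed
    obtain q' Us where D: "config_at M x (Suc v + n) = (q', Us)" by fastforce
    have F: "q' = length L + 2" "length Us = Suc K" "tape_rep False (base 0) [] (Us ! 0)"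
      "Us ! K = ((\<lambda>z. if 0 \<le> z \<and> z < int n then letter (s' 0 ! nat z) else 0), int n)"
      using fl[of n] unfolding D flushing_def by (simp_all add: n_def)
    note acts' = upd_noop[OF F(2)]
    have fin: "config_at M x (Suc (Suc v + n)) = (length L, Us)"
      using F(1,2) acts' tape_rep_read[OF F(3)] unfolding conf[of "Suc v + n"] D
      by (simp add: tm_step_def halted_def M_simps machine_trans_def)
    have h: "halted M (config_at M x (Suc (Suc v + n)))" unfolding fin by (simp add: halted_def M_simps)
    have "pos_ok m (config_at M x (Suc (Suc v + n)))"
      using pos2[of n] unfolding fin D by (simp add: pos_ok_def)
    then have "pos_ok m (config_at M x u)" if "u \<le> Suc (Suc v + n)" for u
    proof -
      consider "u \<le> v" | "u - Suc v \<le> n" "Suc v + (u - Suc v) = u" | "u = Suc (Suc v + n)"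
        using \<open>u \<le> Suc (Suc v + n)\<close> by linarith
      then show ?thesis
      proof cases
        case 2
        then show ?thesis using pos2[of "u - Suc v"] by simp
      qed (use pos1 \<open>pos_ok m (config_at M x (Suc (Suc v + n)))\<close> in simp_all)
    qed
    from halt_pos[OF h this] show thesis
      using that[of "Suc (Suc v + n)"] h vt False F(4) lastK[OF F(2)] unfolding fin
      by (simp add: M_simps holds_word_def n_def)
  qed
qed

lemma visited_bound:
  assumes "\<And>u. pos_ok m (config_at M x u)"
  shows "finite (visited_cells M x)" "card (visited_cells M x) \<le> Suc K * (2 * m + 2)"
proof -
  have sub: "visited_cells M x \<subseteq> {..K} \<times> {- int m - 1..int m}"
    using assms by (auto simp: visited_cells_def M_simps pos_ok_def less_Suc_eq_le)
  then show "finite (visited_cells M x)" by (rule finite_subset) simp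
  show "card (visited_cells M x) \<le> Suc K * (2 * m + 2)"
    using card_mono[OF _ sub] by (simp add: card_cartesian_product nat_add_distrib nat_mult_distrib)
qed

end


subsection \<open>Codes of data\<close>

text \<open>The base is at least 2, so constants, sums and factors are absorbed into the exponent.
  Monotonicity allows a size to be replaced by an upper bound of it.\<close>

definition poly_bounded :: "(nat \<Rightarrow> nat) \<Rightarrow> bool" where
  "poly_bounded p \<longleftrightarrow> mono p \<and> (\<exists>k. \<forall>n. p n \<le> (n + 2) ^ k)"

lemma poly_bounded_mono: "poly_bounded p \<Longrightarrow> m \<le> n \<Longrightarrow> p m \<le> p n"
  by (auto simp: poly_bounded_def mono_def)

lemma poly_boundedI: "mono p \<Longrightarrow> (\<And>n. p n \<le> (n + 2) ^ k) \<Longrightarrow> poly_bounded p"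
  by (auto simp: poly_bounded_def)

lemma poly_bounded_id [intro!, simp]: "poly_bounded (\<lambda>n. n)"
  unfolding poly_bounded_def by (intro conjI exI[of _ 1]) (auto simp: mono_def)

lemma poly_bounded_const [intro!, simp]: "poly_bounded (\<lambda>n. c)"
proof -
  have "c \<le> (n + 2) ^ c" for n
    using less_exp[of c] power_mono[of 2 "n + 2" c] by linarith
  then show ?thesis by (intro poly_boundedI[where k = c]) (auto simp: mono_def)
qed

lemma poly_bounded_add [intro!]:
  assumes "poly_bounded p" "poly_bounded q" shows "poly_bounded (\<lambda>n. p n + q n)"
proof -
  obtain i j where i: "\<And>n. p n \<le> (n + 2) ^ i" and j: "\<And>n. q n \<le> (n + 2) ^ j"
    using assms by (auto simp: poly_bounded_def)
  have "p n + q n \<le> (n + 2) ^ Suc (i + j)" for n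
  proof -
    have "(n + 2) ^ i \<le> (n + 2) ^ (i + j)" "(n + 2) ^ j \<le> (n + 2) ^ (i + j)"
      by (auto intro!: power_increasing)
    then have "p n + q n \<le> 2 * (n + 2) ^ (i + j)" using i[of n] j[of n] by linarith
    also have "\<dots> \<le> (n + 2) ^ Suc (i + j)" by simp
    finally show ?thesis .
  qed
  then show ?thesis using assms by (intro poly_boundedI[where k = "Suc (i + j)"]) (auto simp: mono_def poly_bounded_def intro!: add_mono)
qed

lemma poly_bounded_mult [intro!]:
  assumes "poly_bounded p" "poly_bounded q" shows "poly_bounded (\<lambda>n. p n * q n)"
proof -
  obtain i j where "\<And>n. p n \<le> (n + 2) ^ i" "\<And>n. q n \<le> (n + 2) ^ j"
    using assms by (auto simp: poly_bounded_def)
  then have "p n * q n \<le> (n + 2) ^ (i + j)" for n unfolding power_add by (intro mult_mono) auto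
  then show ?thesis using assms by (intro poly_boundedI[where k = "i + j"]) (auto simp: mono_def poly_bounded_def intro!: mult_mono)
qed

lemma poly_bounded_Suc [intro!]: "poly_bounded p \<Longrightarrow> poly_bounded (\<lambda>n. Suc (p n))"
  using poly_bounded_add[of p "\<lambda>_. 1"] by simp

lemma poly_bounded_comp:
  assumes "poly_bounded p" "poly_bounded q" shows "poly_bounded (\<lambda>n. p (q n))"
proof -
  obtain i j where i: "\<And>n. p n \<le> (n + 2) ^ i" and j: "\<And>n. q n \<le> (n + 2) ^ j"
    using assms by (auto simp: poly_bounded_def)
  have "p (q n) \<le> (n + 2) ^ ((j + 2) * i)" for n
  proof -
    have "q n + 2 \<le> 3 * (n + 2) ^ j" using j[of n] one_le_power[of "n + 2" j] by linarith
    also have "\<dots> \<le> (n + 2) ^ 2 * (n + 2) ^ j" by (intro mult_right_mono) (auto simp: power2_eq_square)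
    finally have "q n + 2 \<le> (n + 2) ^ (j + 2)" by (simp only: power_add mult.commute)
    then have "(q n + 2) ^ i \<le> ((n + 2) ^ (j + 2)) ^ i" by (intro power_mono) auto
    then show ?thesis using i[of "q n"] unfolding power_mult by linarith
  qed
  then show ?thesis using assms by (intro poly_boundedI[where k = "(j + 2) * i"]) (auto simp: mono_def poly_bounded_def)
qed

lemma poly_bounded_poly: "poly_bounded p \<Longrightarrow> \<exists>q :: nat poly. \<forall>n. p n \<le> poly q n"
proof -
  assume "poly_bounded p"
  then obtain k where "\<And>n. p n \<le> (n + 2) ^ k" by (auto simp: poly_bounded_def)
  then have "\<forall>n. p n \<le> poly ([:2, 1:] ^ k) n" by (simp add: add.commute)
  then show ?thesis by blast
qed

section \<open>Codes of data types\<close>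

primrec delim :: "bool list \<Rightarrow> bool list" where
  "delim [] = [False]"
| "delim (b # bs) = True # b # delim bs"

lemma length_delim [simp]: "length (delim a) = 2 * length a + 1"
  by (induction a) auto

lemma delim_inj: "delim a @ r = delim b @ s \<longleftrightarrow> a = b \<and> r = s"
proof (induction a arbitrary: b)
  case Nil
  then show ?case by (cases b) auto
next
  case (Cons x a)
  then show ?case by (cases b) auto
qed

text \<open>A value fills a whole stack, so its code need not be prefix-free; only first components
  of pairs and entries of lists are delimited.\<close>

class enc =
  fixes enc :: "'a \<Rightarrow> bool list"
  assumes enc_inj: "enc x = enc y \<Longrightarrow> x = y"

lemma enc_eq_iff: "enc x = enc y \<longleftrightarrow> x = y"
  using enc_inj by blast

text \<open>With \<open>False\<close> as the empty stack, a program that computes a predicate leaves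
  register \<open>0\<close> nonempty exactly if the predicate holds.\<close>

instantiation bool :: enc begin
definition enc_bool :: "bool \<Rightarrow> bool list" where "enc b = (if b then [True] else [])"
instance by standard (auto simp: enc_bool_def split: if_splits)
end

instantiation nat :: enc begin
definition enc_nat :: "nat \<Rightarrow> bool list" where "enc n = binary n"
instance by standard (auto simp: enc_nat_def dest: binary_inj)
end

instantiation prod :: (enc, enc) enc begin
definition enc_prod :: "'a \<times> 'b \<Rightarrow> bool list" where "enc p = delim (enc (fst p)) @ enc (snd p)"
instance by standard (auto simp: enc_prod_def delim_inj prod_eq_iff dest: enc_inj)
end

instantiation option :: (enc) enc begin
definition enc_option :: "'a option \<Rightarrow> bool list" where
  "enc x = (case x of None \<Rightarrow> [] | Some y \<Rightarrow> True # enc y)"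
instance by standard (auto simp: enc_option_def enc_eq_iff split: option.splits)
end

text \<open>The code of \<open>x # xs\<close> is that of \<open>Some (x, xs)\<close>, so lists
  inherit construction and case distinction from options and pairs.\<close>

instantiation list :: (enc) enc begin
definition enc_list :: "'a list \<Rightarrow> bool list" where "enc xs = concat (map (\<lambda>x. True # delim (enc x)) xs)"
instance
proof
  fix x y :: "'a list"
  assume "enc x = enc y"
  then show "x = y"
  proof (induction x arbitrary: y)
    case Nil
    then show ?case by (cases y) (auto simp: enc_list_def)
  next
    case (Cons a x)
    then show ?case by (cases y) (auto simp: enc_list_def delim_inj enc_eq_iff)
  qed
qed
end

text \<open>Strings that are their own codes, as a machine receives and returns them. A
  \<open>bool list\<close>, by contrast, has delimited entries.\<close>

datatype raw = Raw (unraw: "bool list")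

instantiation raw :: enc begin
definition enc_raw :: "raw \<Rightarrow> bool list" where "enc = unraw"
instance by standard (auto simp: enc_raw_def raw.expand)
end

lemma enc_simps [simp]:
  "enc (a, b) = delim (enc a) @ enc b"
  "enc (Some x) = True # enc x" "enc None = []"
  "enc ([] :: 'a::enc list) = []" "enc (x # xs) = True # delim (enc x) @ enc xs"
  "enc True = [True]" "enc False = []" "enc (Raw bs) = bs"
  by (auto simp: enc_prod_def enc_option_def enc_list_def enc_bool_def enc_raw_def)

lemma enc_append [simp]: "enc (xs @ ys) = enc xs @ enc ys"
  by (simp add: enc_list_def)

abbreviation sz :: "'a::enc \<Rightarrow> nat" where "sz x \<equiv> length (enc x)"

lemma enc_nat_0 [simp]: "enc (0::nat) = []" "enc n = [] \<longleftrightarrow> n = 0" for n :: nat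
  using binary.simps[of n] by (auto simp: enc_nat_def binary.simps[of 0])

lemma enc_nat_double [simp]: "n > 0 \<Longrightarrow> enc (2 * n) = False # enc n" "enc (Suc (2 * n)) = True # enc n" for n :: nat
  by (subst (1) enc_nat_def, subst binary.simps, simp add: enc_nat_def)+

lemma enc_nat_tl: "tl (enc n) = enc (n div 2)" "n > 0 \<Longrightarrow> enc n = odd n # enc (n div 2)" for n :: nat
  using binary.simps[of n] by (auto simp: enc_nat_def binary.simps[of 0])

text \<open>The stack height is bounded by \<open>m\<close>, and if \<open>b\<close> holds, the time by \<open>T\<close>.\<close>

definition ex :: "bool \<Rightarrow> nat \<Rightarrow> com \<Rightarrow> store \<Rightarrow> nat \<Rightarrow> store \<Rightarrow> bool" where
  "ex b m c s T s' \<longleftrightarrow> (\<exists>t. exec m c s t s' \<and> (b \<longrightarrow> t \<le> T))"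

section \<open>Costs of composed programs\<close>

lemma ex_weaken: "ex b m c s T s' \<Longrightarrow> (b \<Longrightarrow> T \<le> U) \<Longrightarrow> ex b m c s U s'"
  by (auto simp: ex_def intro: le_trans)

lemma ex_Skip: "ex b m Skip s 1 s"
  unfolding ex_def by (auto intro: exec_Skip)

lemma ex_Push: "length (s r) < m \<Longrightarrow> ex b m (Push r a) s 2 (s(r := a # s r))"
  unfolding ex_def by (auto intro: exec_Push)

lemma ex_Pop: "ex b m (Pop r) s 1 (s(r := tl (s r)))"
  unfolding ex_def by (auto intro: exec_Pop)

lemma ex_Seq: "ex b m c s T s' \<Longrightarrow> ex b m d s' U s'' \<Longrightarrow> ex b m (Seq c d) s (T + U + 1) s''"
  unfolding ex_def by (fastforce intro: exec_Seq)

lemma ex_Cond: "ex b m (if P (peek (s r)) then c else d) s T s' \<Longrightarrow> ex b m (Cond r P c d) s (T + 1) s'"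
  unfolding ex_def by (fastforce intro: exec_Cond)

lemma ex_Loop_end: "\<not> P (peek (s r)) \<Longrightarrow> ex b m (Loop r P c) s 1 s"
  unfolding ex_def by (auto intro: exec_Loop_end)

lemma ex_Loop: "P (peek (s r)) \<Longrightarrow> ex b m c s T s' \<Longrightarrow> ex b m (Loop r P c) s' U s'' \<Longrightarrow>
    ex b m (Loop r P c) s (T + U + 1) s''"
  unfolding ex_def by (fastforce intro: exec_Loop)

primrec pushes :: "(nat \<times> bool) list \<Rightarrow> com" where
  "pushes [] = Skip"
| "pushes (p # ps) = Seq (Push (fst p) (snd p)) (pushes ps)"

definition pushed :: "(nat \<times> bool) list \<Rightarrow> store \<Rightarrow> store" where
  "pushed ps s = fold (\<lambda>(q, b) s. s(q := b # s q)) ps s"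

lemma pushed_simps [simp]: "pushed [] s = s" "pushed ((q, b) # ps) s = pushed ps (s(q := b # s q))"
  by (simp_all add: pushed_def)

lemma ex_pushes:
  "(\<And>q. q \<in> fst ` set ps \<Longrightarrow> length (s q) + length ps \<le> m) \<Longrightarrow> ex b m (pushes ps) s (3 * length ps + 1) (pushed ps s)"
proof (induction ps arbitrary: s)
  case Nil
  then show ?case using ex_Skip by simp
next
  case (Cons p ps)
  obtain q a where p: "p = (q, a)" by fastforce
  have "ex b m (pushes (p # ps)) s (2 + (3 * length ps + 1) + 1) (pushed (p # ps) s)"
    unfolding pushes.simps p fst_conv snd_conv pushed_simps
  proof (rule ex_Seq)
    show "ex b m (Push q a) s 2 (s(q := a # s q))"
      using Cons.prems[of q] by (intro ex_Push) (auto simp: p)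
    show "ex b m (pushes ps) (s(q := a # s q)) (3 * length ps + 1) (pushed ps (s(q := a # s q)))"
    proof (rule Cons.IH)
      fix q' assume "q' \<in> fst ` set ps"
      then show "length ((s(q := a # s q)) q') + length ps \<le> m"
        using Cons.prems[of q'] Cons.prems[of q] by (auto simp: p)
    qed
  qed
  then show ?case by (rule ex_weaken) simp
qed

text \<open>The one loop behind clearing, moving, copying and delimiting. What it pushes arrives in
  reversed order, so that a faithful copy takes two passes.\<close>

definition drain :: "nat \<Rightarrow> (bool \<Rightarrow> (nat \<times> bool) list) \<Rightarrow> com" where
  "drain r f = Loop r (\<lambda>a. a \<noteq> None)
     (Cond r (\<lambda>a. a = Some True) (Seq (Pop r) (pushes (f True))) (Seq (Pop r) (pushes (f False))))"

lemma length_pushed: "length (pushed ps s q) \<le> length (s q) + length ps"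
proof (induction ps arbitrary: s)
  case (Cons p ps)
  obtain r a where "p = (r, a)" by fastforce
  then show ?case by (auto intro!: order_trans[OF Cons.IH])
qed simp

lemma pushed_other: "q \<notin> fst ` set ps \<Longrightarrow> pushed ps s q = s q"
  by (induction ps arbitrary: s) auto

lemma pushed_upd: "r \<notin> fst ` set ps \<Longrightarrow> pushed ps (s(r := v)) = (pushed ps s)(r := v)"
proof (induction ps arbitrary: s)
  case (Cons p ps)
  obtain q a where p: "p = (q, a)" by fastforce
  have e: "(s(r := v))(q := a # (s(r := v)) q) = (s(q := a # s q))(r := v)"
    using Cons.prems p by (auto simp: fun_eq_iff)
  show ?case unfolding p pushed_simps e by (rule Cons.IH) (use Cons.prems p in auto)
qed simp

lemma ex_drain:
  assumes "\<And>a. r \<notin> fst ` set (f a)" "\<And>a. length (f a) \<le> k"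
    and "\<And>q a. q \<in> fst ` set (f a) \<Longrightarrow> length (s q) + k * length (s r) \<le> m"
  shows "ex b m (drain r f) s ((3 * k + 6) * length (s r) + 1) (fold (\<lambda>a. pushed (f a)) (s r) (s(r := [])))"
  using assms(3)
proof (induction "s r" arbitrary: s)
  case Nil
  then show ?case
    using ex_Loop_end[of "\<lambda>a. a \<noteq> None" s r] by (simp add: drain_def fun_upd_idem flip: Nil(1))
next
  case (Cons a as)
  define s' where "s' = pushed (f a) (s(r := as))"
  have sr: "s r = a # as" using Cons by simp
  have s'r: "s' r = as" using assms(1) by (simp add: s'_def pushed_other)
  have "ex b m (if a then Seq (Pop r) (pushes (f True)) else Seq (Pop r) (pushes (f False))) s
      (1 + (3 * k + 1) + 1) s'"
  proof -
    have "ex b m (Seq (Pop r) (pushes (f a))) s (1 + (3 * k + 1) + 1) s'"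
    proof (rule ex_Seq)
      show "ex b m (Pop r) s 1 (s(r := as))" using ex_Pop[of b m r s] by (simp add: sr)
      have "ex b m (pushes (f a)) (s(r := as)) (3 * length (f a) + 1) s'"
        unfolding s'_def
      proof (rule ex_pushes)
        fix q assume q: "q \<in> fst ` set (f a)"
        then have "q \<noteq> r" using assms(1)[of a] by auto
        moreover have "length (f a) \<le> k + k * length as" using assms(2)[of a] by simp
        ultimately show "length ((s(r := as)) q) + length (f a) \<le> m"
          using Cons.prems[OF q] by (simp add: sr)
      qed
      then show "ex b m (pushes (f a)) (s(r := as)) (3 * k + 1) s'"
        by (rule ex_weaken) (use assms(2)[of a] in simp)
    qed
    then show ?thesis by (cases a) simp_all
  qed
  then have 1: "ex b m (Cond r (\<lambda>a. a = Some True) (Seq (Pop r) (pushes (f True))) (Seq (Pop r) (pushes (f False)))) s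
      (1 + (3 * k + 1) + 1 + 1) s'"
    by (intro ex_Cond) (simp add: sr)
  have 2: "ex b m (drain r f) s' ((3 * k + 6) * length (s' r) + 1) (fold (\<lambda>a. pushed (f a)) (s' r) (s'(r := [])))"
  proof (rule Cons.hyps)
    show "as = s' r" by (simp add: s'r)
    fix q a' assume q: "q \<in> fst ` set (f a')"
    then have "q \<noteq> r" using assms(1)[of a'] by auto
    then have "length (s' q) \<le> length (s q) + k"
      using length_pushed[of "f a" "s(r := as)" q] assms(2)[of a] by (simp add: s'_def)
    then show "length (s' q) + k * length (s' r) \<le> m"
      using Cons.prems[OF q] by (simp add: s'r sr)
  qed
  have 3: "s'(r := []) = pushed (f a) (s(r := []))"
    using pushed_upd[OF assms(1), of a "s(r := as)" "[]"] by (simp add: s'_def)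
  have "ex b m (drain r f) s (1 + (3 * k + 1) + 1 + 1 + ((3 * k + 6) * length (s' r) + 1) + 1)
      (fold (\<lambda>a. pushed (f a)) (s' r) (s'(r := [])))"
    unfolding drain_def
    by (rule ex_Loop[OF _ 1 2[unfolded drain_def]]) (simp add: sr)
  then show ?case unfolding 3 s'r sr unfolding fold_simps comp_def by (rule ex_weaken) simp
qed

lemma fold_push: "r \<noteq> q \<Longrightarrow> fold (\<lambda>a. pushed [(q, a)]) xs s = s(q := rev xs @ s q)"
  by (induction xs arbitrary: s) (auto simp: fun_upd_idem)

lemma fold_push2: "q \<noteq> q' \<Longrightarrow>
    fold (\<lambda>a. pushed [(q, a), (q', a)]) xs s = s(q := rev xs @ s q, q' := rev xs @ s q')"
  by (induction xs arbitrary: s) (auto simp: fun_upd_idem fun_upd_twist)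

lemma fold_push_code:
  assumes "\<And>s b. pushed (f b) s = s(q := g b @ s q)"
  shows "fold (\<lambda>a. pushed (f a)) xs s = s(q := concat (map g (rev xs)) @ s q)"
  using assms by (induction xs arbitrary: s) auto

lemma delim_concat: "delim a @ r = concat (map (\<lambda>b. [True, b]) a) @ False # r"
  by (induction a) auto

lemma fold_nothing: "fold (\<lambda>a. pushed []) xs s = s"
  by (induction xs arbitrary: s) auto

text \<open>Registers above the argument of a program serve as scratch space; four of them are enough.\<close>

definition st :: "store \<Rightarrow> nat \<Rightarrow> bool list \<Rightarrow> bool list \<Rightarrow> bool list \<Rightarrow> bool list \<Rightarrow> store" where
  "st s r a b c d = s(r := a, r + 1 := b, r + 2 := c, r + 3 := d)"

lemma st_nth [simp]:
  "st s r a b c d r = a" "st s r a b c d (Suc r) = b" "st s r a b c d (r + 2) = c" "st s r a b c d (r + 3) = d"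
  "st s r a b c d (Suc (Suc r)) = c"
  by (auto simp: st_def)

lemma st_upd [simp]:
  "(st s r a b c d)(r := x) = st s r x b c d"
  "(st s r a b c d)(Suc r := x) = st s r a x c d"
  "(st s r a b c d)(r + 2 := x) = st s r a b x d"
  "(st s r a b c d)(r + 3 := x) = st s r a b c x"
  "(st s r a b c d)(Suc (Suc r) := x) = st s r a b x d"
  by (auto simp: st_def fun_eq_iff)

lemma st_start: "\<forall>q>r. s q = [] \<Longrightarrow> s = st s r (s r) [] [] []"
  by (auto simp: st_def fun_eq_iff)

lemma st_finish: "\<forall>q>r. s q = [] \<Longrightarrow> s(r := x) = st s r x [] [] []"
  by (auto simp: st_def fun_eq_iff)


subsection \<open>Feasible functions\<close>

definition move :: "nat \<Rightarrow> nat \<Rightarrow> com" where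
  "move r q = drain r (\<lambda>a. [(q, a)])"

lemma ex_move:
  assumes "r \<noteq> q" "length (s q) + length (s r) \<le> m"
  shows "ex b m (move r q) s (9 * length (s r) + 1) (s(r := [], q := rev (s r) @ s q))"
  using ex_drain[of r "\<lambda>a. [(q, a)]" 1 s m b] assms by (simp add: move_def fold_push)

lemma ex_move2:
  assumes "r \<noteq> q" "r \<noteq> q'" "q \<noteq> q'" "length (s q) + 2 * length (s r) \<le> m" "length (s q') + 2 * length (s r) \<le> m"
  shows "ex b m (drain r (\<lambda>a. [(q, a), (q', a)])) s (12 * length (s r) + 1)
    (s(r := [], q := rev (s r) @ s q, q' := rev (s r) @ s q'))"
  using ex_drain[of r "\<lambda>a. [(q, a), (q', a)]" 2 s m b] assms by (auto simp: fold_push2)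

lemma ex_clear: "ex b m (drain r (\<lambda>a. [])) s (6 * length (s r) + 1) (s(r := []))"
  using ex_drain[of r "\<lambda>a. []" 0 s m b] by (simp add: fold_nothing)

lemma ex_delim:
  assumes "r \<noteq> q" "length (s q) + 2 * length (s r) \<le> m"
  shows "ex b m (drain r (\<lambda>a. [(q, a), (q, True)])) s (12 * length (s r) + 1)
    (s(r := [], q := concat (map (\<lambda>b. [True, b]) (rev (s r))) @ s q))"
proof -
  have "fold (\<lambda>a. pushed [(q, a), (q, True)]) (s r) (s(r := [])) =
      (s(r := []))(q := concat (map (\<lambda>b. [True, b]) (rev (s r))) @ (s(r := [])) q)"
    by (rule fold_push_code) simp
  then show ?thesis using ex_drain[of r "\<lambda>a. [(q, a), (q, True)]" 2 s m b] assms by auto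
qed

definition split_pair :: "nat \<Rightarrow> nat \<Rightarrow> com" where
  "split_pair r q = Seq (Loop r (\<lambda>a. a = Some True)
     (Seq (Pop r) (Seq (Cond r (\<lambda>a. a = Some True) (Push q True) (Push q False)) (Pop r)))) (Pop r)"

lemma ex_split_pair:
  assumes "r \<noteq> q" "s r = delim x @ y" "length (s q) + length x \<le> m"
  shows "ex b m (split_pair r q) s (9 * length x + 3) (s(r := y, q := rev x @ s q))"
proof -
  have "ex b m (Loop r (\<lambda>a. a = Some True)
      (Seq (Pop r) (Seq (Cond r (\<lambda>a. a = Some True) (Push q True) (Push q False)) (Pop r)))) s
      (9 * length x + 1) (s(r := False # y, q := rev x @ s q))"
    using assms
  proof (induction x arbitrary: s)
    case Nil
    then show ?case using ex_Loop_end[of "\<lambda>a. a = Some True" s r] by (simp add: fun_upd_idem)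
  next
    case (Cons a x)
    let ?s = "s(r := delim x @ y, q := a # s q)"
    have "ex b m (Pop r) s 1 (s(r := a # delim x @ y))"
      using ex_Pop[of b m r s] Cons.prems by simp
    moreover have "ex b m (Cond r (\<lambda>a. a = Some True) (Push q True) (Push q False)) (s(r := a # delim x @ y)) (2 + 1)
        (s(r := a # delim x @ y, q := a # s q))"
      using ex_Push[of "s(r := a # delim x @ y)" q m b a] Cons.prems by (intro ex_Cond) (cases a; simp)
    moreover have "ex b m (Pop r) (s(r := a # delim x @ y, q := a # s q)) 1 ?s"
      using ex_Pop[of b m r "s(r := a # delim x @ y, q := a # s q)"] Cons.prems by (simp add: fun_upd_twist)
    ultimately have 1: "ex b m (Seq (Pop r) (Seq (Cond r (\<lambda>a. a = Some True) (Push q True) (Push q False)) (Pop r))) s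
        (1 + (2 + 1 + 1 + 1) + 1) ?s"
      by (intro ex_Seq)
    have 2: "?s(r := False # y, q := rev x @ ?s q) = s(r := False # y, q := rev (a # x) @ s q)"
      by (auto simp: fun_eq_iff)
    have 3: "ex b m (Loop r (\<lambda>a. a = Some True)
      (Seq (Pop r) (Seq (Cond r (\<lambda>a. a = Some True) (Push q True) (Push q False)) (Pop r)))) ?s
      (9 * length x + 1) (s(r := False # y, q := rev (a # x) @ s q))"
      unfolding 2[symmetric] by (rule Cons.IH) (use Cons.prems in auto)
    show ?case
      by (rule ex_weaken[OF ex_Loop[OF _ 1 3]]) (use Cons.prems in simp_all)
  qed
  moreover have "ex b m (Pop r) (s(r := False # y, q := rev x @ s q)) 1 (s(r := y, q := rev x @ s q))"
    using ex_Pop[of b m r "s(r := False # y, q := rev x @ s q)"] assms by (simp add: fun_upd_twist)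
  ultimately show ?thesis unfolding split_pair_def by (rule ex_weaken[OF ex_Seq]) simp
qed

text \<open>Registers below \<open>r\<close> are untouched, and those above are empty before and
  after the call; therefore programs can be nested by shifting \<open>r\<close>. The single
  polynomial bounds the result, the heights during pushes and, if \<open>b\<close> holds, the
  time.\<close>

definition implements ::
    "bool \<Rightarrow> 'a::enc set \<Rightarrow> ('a \<Rightarrow> 'b::enc) \<Rightarrow> (nat \<Rightarrow> com) \<Rightarrow> (nat \<Rightarrow> nat) \<Rightarrow> bool" where
  "implements b D f c p \<longleftrightarrow> poly_bounded p \<and> (\<forall>x\<in>D. sz (f x) \<le> p (sz x) \<and>
     (\<forall>r s m. s r = enc x \<longrightarrow> (\<forall>q>r. s q = []) \<longrightarrow> p (sz x) \<le> m \<longrightarrow>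
       ex b m (c r) s (p (sz x)) (s(r := enc (f x)))))"

text \<open>\<open>feas True D f\<close>: on \<open>D\<close>, the function \<open>f\<close> is computable in polynomial time;
  \<open>feas False D f\<close>: it is computable in polynomial space.\<close>

definition feas :: "bool \<Rightarrow> 'a::enc set \<Rightarrow> ('a \<Rightarrow> 'b::enc) \<Rightarrow> bool" where
  "feas b D f \<longleftrightarrow> (\<exists>c p. implements b D f c p)"

section \<open>Closure properties of feasible functions\<close>

lemma feasE:
  assumes "feas b D f"
  obtains c p where "implements b D f c p"
  using assms by (auto simp: feas_def)

lemma feasI:
  assumes "poly_bounded p"
    and "\<And>x. x \<in> D \<Longrightarrow> sz (f x) \<le> p (sz x)"
    and "\<And>x r s m. x \<in> D \<Longrightarrow> \<forall>q>r. s q = [] \<Longrightarrow> p (sz x) \<le> m \<Longrightarrow>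
      ex b m (c r) (st s r (enc x) [] [] []) (p (sz x)) (st s r (enc (f x)) [] [] [])"
  shows "feas b D f"
proof -
  have "implements b D f c p"
    unfolding implements_def
  proof (intro conjI ballI allI impI assms(1,2))
    fix x r m and s :: store
    assume s: "x \<in> D" "s r = enc x" "\<forall>q>r. s q = []" "p (sz x) \<le> m"
    show "ex b m (c r) s (p (sz x)) (s(r := enc (f x)))"
      using assms(3)[OF s(1,3,4)] st_start[OF s(3)] st_finish[OF s(3)] s(2) by metis
  qed
  then show ?thesis by (auto simp: feas_def)
qed

lemma implements_size:
  assumes "implements b D f c p" "x \<in> D" "sz x \<le> n"
  shows "sz (f x) \<le> p n"
proof -
  have "sz (f x) \<le> p (sz x)" "p (sz x) \<le> p n" using assms by (auto simp: implements_def intro: poly_bounded_mono)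
  then show ?thesis by simp
qed

lemma implements_call:
  assumes f: "implements b D f c p" and x: "x \<in> D" and free: "\<forall>q>r. s q = []"
    and m: "p (sz x) \<le> m" and n: "sz x \<le> n"
  shows "ex b m (c r) (st s r (enc x) [] [] []) (p n) (st s r (enc (f x)) [] [] [])"
    and "ex b m (c (Suc r)) (st s r a (enc x) [] []) (p n) (st s r a (enc (f x)) [] [])"
    and "ex b m (c (r + 2)) (st s r a a' (enc x) []) (p n) (st s r a a' (enc (f x)) [])"
proof -
  have spec: "ex b m (c q) s (p (sz x)) (s(q := enc (f x)))" if "s q = enc x" "\<forall>q'>q. s q' = []" for q s
    using f x m that by (auto simp: implements_def)
  have le: "p (sz x) \<le> p n" using f n by (auto simp: implements_def intro: poly_bounded_mono)
  have 0: "\<forall>q>r. st s r (enc x) [] [] [] q = []" "\<forall>q>Suc r. st s r a (enc x) [] [] q = []"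
    "\<forall>q>r + 2. st s r a a' (enc x) [] q = []"
    using free by (auto simp: st_def)
  show "ex b m (c r) (st s r (enc x) [] [] []) (p n) (st s r (enc (f x)) [] [] [])"
    using ex_weaken[OF spec[OF _ 0(1)] le] by simp
  show "ex b m (c (Suc r)) (st s r a (enc x) [] []) (p n) (st s r a (enc (f x)) [] [])"
    using ex_weaken[OF spec[OF _ 0(2)] le] by simp
  show "ex b m (c (r + 2)) (st s r a a' (enc x) []) (p n) (st s r a a' (enc (f x)) [])"
    using ex_weaken[OF spec[OF _ 0(3)] le] by simp
qed

lemma implements_pbd: "implements b D f c p \<Longrightarrow> poly_bounded p"
  by (simp add: implements_def)

named_theorems feas_intros

text \<open>A program sees nothing but codes, so one program serves all functions that act alike on
  codes, even between different types.\<close>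

lemma feas_cast:
  assumes "feas b D f" "\<And>x. x \<in> E \<Longrightarrow> \<exists>y\<in>D. enc y = enc x \<and> enc (f y) = enc (g x)"
  shows "feas b E g"
proof -
  obtain c p where c: "implements b D f c p" by (rule feasE[OF assms(1)])
  have "implements b E g c p"
    unfolding implements_def
  proof (intro conjI ballI)
    show "poly_bounded p" using c by (simp add: implements_def)
    fix x assume "x \<in> E"
    from assms(2)[OF this] obtain y where y: "y \<in> D" "enc y = enc x" "enc (f y) = enc (g x)" by blast
    note spec = c[unfolded implements_def, THEN conjunct2, THEN bspec, OF y(1), unfolded y(2,3)]
    show "sz (g x) \<le> p (sz x)" by (rule conjunct1[OF spec])
    show "\<forall>r s m. s r = enc x \<longrightarrow> (\<forall>q>r. s q = []) \<longrightarrow> p (sz x) \<le> m \<longrightarrow> ex b m (c r) s (p (sz x)) (s(r := enc (g x)))"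
      by (rule conjunct2[OF spec])
  qed
  then show ?thesis by (auto simp: feas_def)
qed

lemma feas_cong: "feas b D f \<Longrightarrow> (\<And>x. x \<in> D \<Longrightarrow> f x = g x) \<Longrightarrow> feas b D g"
  by (erule feas_cast) auto

lemma feas_subset: "feas b D f \<Longrightarrow> E \<subseteq> D \<Longrightarrow> feas b E f"
  by (erule feas_cast) auto

lemma feas_size:
  assumes "feas b D f"
  obtains p where "poly_bounded p" "\<And>x. x \<in> D \<Longrightarrow> sz (f x) \<le> p (sz x)"
proof -
  obtain c p where c: "implements b D f c p" by (rule feasE[OF assms])
  show thesis by (rule that[OF implements_pbd[OF c] implements_size[OF c]]) simp_all
qed

lemma feas_id [feas_intros]: "feas b D (\<lambda>x. x)"
proof (rule feasI)
  show "poly_bounded (\<lambda>n. n + 1)" by auto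
  show "ex b m Skip (st s r (enc x) [] [] []) (sz x + 1) (st s r (enc x) [] [] [])" for x :: 'a and r s m
    by (rule ex_weaken[OF ex_Skip]) simp
qed auto

lemma feas_comp_on:
  assumes "feas b E f" "feas b D g" "g ` D \<subseteq> E"
  shows "feas b D (\<lambda>x. f (g x))"
proof -
  obtain cf pf where f: "implements b E f cf pf" by (rule feasE[OF assms(1)])
  obtain cg pg where g: "implements b D g cg pg" by (rule feasE[OF assms(2)])
  show ?thesis
  proof (rule feasI)
    show "poly_bounded (\<lambda>n. pg n + pf (pg n) + 1)"
      using implements_pbd[OF g] poly_bounded_comp[OF implements_pbd[OF f] implements_pbd[OF g]] by auto
    fix x assume x: "x \<in> D"
    then have gx: "g x \<in> E" "sz (g x) \<le> pg (sz x)" using assms(3) implements_size[OF g] by auto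
    show "sz (f (g x)) \<le> pg (sz x) + pf (pg (sz x)) + 1"
      using implements_size[OF f gx] by simp
    fix r and s :: store and m assume s: "\<forall>q>r. s q = []" and m: "pg (sz x) + pf (pg (sz x)) + 1 \<le> m"
    have "pf (sz (g x)) \<le> pf (pg (sz x))" using implements_pbd[OF f] gx by (auto intro: poly_bounded_mono)
    then show "ex b m (Seq (cg r) (cf r)) (st s r (enc x) [] [] []) (pg (sz x) + pf (pg (sz x)) + 1)
        (st s r (enc (f (g x))) [] [] [])"
      using m by (intro ex_Seq[OF implements_call(1)[OF g x s _ order_refl] implements_call(1)[OF f gx(1) s _ gx(2)]]) auto
  qed
qed

lemma feas_comp: "feas b UNIV f \<Longrightarrow> feas b D g \<Longrightarrow> feas b D (\<lambda>x. f (g x))"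
  by (rule feas_comp_on) auto

text \<open>The argument is kept in \<open>r\<close> while \<open>f\<close> runs on a copy above it.
  It is then moved above the result of \<open>f\<close>, where \<open>g\<close> runs. The delimited
  pair is finally assembled in \<open>r\<close>.\<close>

lemma feas_pair [feas_intros]:
  assumes "feas b D f" "feas b D g"
  shows "feas b D (\<lambda>x. (f x, g x))"
proof -
  obtain cf pf where f: "implements b D f cf pf" by (rule feasE[OF assms(1)])
  obtain cg pg where g: "implements b D g cg pg" by (rule feasE[OF assms(2)])
  \<comment> \<open>A generous bound that dominates the total cost of the eleven phases of
    \<open>?c\<close>.\<close>
  let ?p = "\<lambda>n. 100 * n + 100 * pf n + 100 * pg n + 100"
  let ?c = "\<lambda>r. Seq (move r (r + 2)) (Seq (drain (r + 2) (\<lambda>a. [(r, a), (Suc r, a)])) (Seq (cf (Suc r))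
    (Seq (move r (r + 3)) (Seq (move (r + 3) (r + 2)) (Seq (cg (r + 2)) (Seq (move (r + 2) (r + 3)) (Seq (move (r + 3) r)
    (Seq (Push r False) (Seq (move (Suc r) (r + 2)) (drain (r + 2) (\<lambda>a. [(r, a), (r, True)])))))))))))"
  show ?thesis
  proof (rule feasI)
    show "poly_bounded ?p" using implements_pbd[OF f] implements_pbd[OF g] by auto
    fix x assume x: "x \<in> D"
    have fx: "sz (f x) \<le> pf (sz x)" and gx: "sz (g x) \<le> pg (sz x)"
      using implements_size[OF f x] implements_size[OF g x] by auto
    then show "sz (f x, g x) \<le> ?p (sz x)" by simp
    fix r and s :: store and m assume s: "\<forall>q>r. s q = []" and m: "?p (sz x) \<le> m"
    note F = ex_weaken[where U = "100 * sz x + 100 * pf (sz x) + 100 * pg (sz x) + 100" for U]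
    have 1: "ex b m (move r (r + 2)) (st s r (enc x) [] [] []) (9 * sz x + 1) (st s r [] [] (rev (enc x)) [])"
      using ex_move[of r "r + 2" "st s r (enc x) [] [] []" m b] m by simp
    have 2: "ex b m (drain (r + 2) (\<lambda>a. [(r, a), (Suc r, a)])) (st s r [] [] (rev (enc x)) []) (12 * sz x + 1)
        (st s r (enc x) (enc x) [] [])"
      using ex_move2[of "r + 2" r "Suc r" "st s r [] [] (rev (enc x)) []" m b] m by simp
    have 3: "ex b m (cf (Suc r)) (st s r (enc x) (enc x) [] []) (pf (sz x)) (st s r (enc x) (enc (f x)) [] [])"
      using implements_call(2)[OF f x s] m by simp
    have 4: "ex b m (move r (r + 3)) (st s r (enc x) (enc (f x)) [] []) (9 * sz x + 1)
        (st s r [] (enc (f x)) [] (rev (enc x)))"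
      using ex_move[of r "r + 3" "st s r (enc x) (enc (f x)) [] []" m b] m by simp
    have 5: "ex b m (move (r + 3) (r + 2)) (st s r [] (enc (f x)) [] (rev (enc x))) (9 * sz x + 1)
        (st s r [] (enc (f x)) (enc x) [])"
      using ex_move[of "r + 3" "r + 2" "st s r [] (enc (f x)) [] (rev (enc x))" m b] m by simp
    have 6: "ex b m (cg (r + 2)) (st s r [] (enc (f x)) (enc x) []) (pg (sz x)) (st s r [] (enc (f x)) (enc (g x)) [])"
      using implements_call(3)[OF g x s] m by simp
    have 7: "ex b m (move (r + 2) (r + 3)) (st s r [] (enc (f x)) (enc (g x)) []) (9 * sz (g x) + 1)
        (st s r [] (enc (f x)) [] (rev (enc (g x))))"
      using ex_move[of "r + 2" "r + 3" "st s r [] (enc (f x)) (enc (g x)) []" m b] m gx by simp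
    have 8: "ex b m (move (r + 3) r) (st s r [] (enc (f x)) [] (rev (enc (g x)))) (9 * sz (g x) + 1)
        (st s r (enc (g x)) (enc (f x)) [] [])"
      using ex_move[of "r + 3" r "st s r [] (enc (f x)) [] (rev (enc (g x)))" m b] m gx by simp
    have 9: "ex b m (Push r False) (st s r (enc (g x)) (enc (f x)) [] []) 2
        (st s r (False # enc (g x)) (enc (f x)) [] [])"
      using ex_Push[of "st s r (enc (g x)) (enc (f x)) [] []" r m b False] m gx by simp
    have 10: "ex b m (move (Suc r) (r + 2)) (st s r (False # enc (g x)) (enc (f x)) [] []) (9 * sz (f x) + 1)
        (st s r (False # enc (g x)) [] (rev (enc (f x))) [])"
      using ex_move[of "Suc r" "r + 2" "st s r (False # enc (g x)) (enc (f x)) [] []" m b] m fx by simp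
    have 11: "ex b m (drain (r + 2) (\<lambda>a. [(r, a), (r, True)])) (st s r (False # enc (g x)) [] (rev (enc (f x))) [])
        (12 * sz (f x) + 1) (st s r (enc (f x, g x)) [] [] [])"
      using ex_delim[of "r + 2" r "st s r (False # enc (g x)) [] (rev (enc (f x))) []" m b] m fx gx
      by (simp add: delim_concat)
    show "ex b m (?c r) (st s r (enc x) [] [] []) (?p (sz x)) (st s r (enc (f x, g x)) [] [] [])"
      by (rule ex_weaken, (rule ex_Seq 1 2 3 4 5 6 7 8 9 10 11)+) (use fx gx in simp)
  qed
qed

lemma feas_fst_raw: "feas b D (fst :: 'a::enc \<times> 'b::enc \<Rightarrow> 'a)"
proof (rule feasI)
  show "poly_bounded (\<lambda>n. 100 * n + 100)" by auto
  fix x :: "'a \<times> 'b"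
  show "sz (fst x) \<le> 100 * sz x + 100" by (cases x) auto
  fix r and s :: store and m assume s: "\<forall>q>r. s q = []" and m: "100 * sz x + 100 \<le> m"
  obtain y z where x: "x = (y, z)" by fastforce
  have 1: "ex b m (split_pair r (Suc r)) (st s r (enc x) [] [] []) (9 * sz y + 3) (st s r (enc z) (rev (enc y)) [] [])"
    using ex_split_pair[of r "Suc r" "st s r (enc x) [] [] []" "enc y" "enc z" m b] m x by simp
  have 2: "ex b m (drain r (\<lambda>a. [])) (st s r (enc z) (rev (enc y)) [] []) (6 * sz z + 1) (st s r [] (rev (enc y)) [] [])"
    using ex_clear[of b m r "st s r (enc z) (rev (enc y)) [] []"] by simp
  have 3: "ex b m (move (Suc r) r) (st s r [] (rev (enc y)) [] []) (9 * sz y + 1) (st s r (enc (fst x)) [] [] [])"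
    using ex_move[of "Suc r" r "st s r [] (rev (enc y)) [] []" m b] m x by simp
  show "ex b m (Seq (split_pair r (Suc r)) (Seq (drain r (\<lambda>a. [])) (move (Suc r) r))) (st s r (enc x) [] [] [])
      (100 * sz x + 100) (st s r (enc (fst x)) [] [] [])"
    by (rule ex_weaken, (rule ex_Seq 1 2 3)+) (simp add: x)
qed

lemma feas_snd_raw: "feas b D (snd :: 'a::enc \<times> 'b::enc \<Rightarrow> 'b)"
proof (rule feasI)
  show "poly_bounded (\<lambda>n. 100 * n + 100)" by auto
  fix x :: "'a \<times> 'b"
  show "sz (snd x) \<le> 100 * sz x + 100" by (cases x) auto
  fix r and s :: store and m assume s: "\<forall>q>r. s q = []" and m: "100 * sz x + 100 \<le> m"
  obtain y z where x: "x = (y, z)" by fastforce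
  have 1: "ex b m (split_pair r (Suc r)) (st s r (enc x) [] [] []) (9 * sz y + 3) (st s r (enc z) (rev (enc y)) [] [])"
    using ex_split_pair[of r "Suc r" "st s r (enc x) [] [] []" "enc y" "enc z" m b] m x by simp
  have 2: "ex b m (drain (Suc r) (\<lambda>a. [])) (st s r (enc z) (rev (enc y)) [] []) (6 * sz y + 1) (st s r (enc (snd x)) [] [] [])"
    using ex_clear[of b m "Suc r" "st s r (enc z) (rev (enc y)) [] []"] x by simp
  show "ex b m (Seq (split_pair r (Suc r)) (drain (Suc r) (\<lambda>a. []))) (st s r (enc x) [] [] [])
      (100 * sz x + 100) (st s r (enc (snd x)) [] [] [])"
    by (rule ex_weaken, (rule ex_Seq 1 2)+) (simp add: x)
qed

lemmas feas_fst [feas_intros] = feas_comp[OF feas_fst_raw]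
lemmas feas_snd [feas_intros] = feas_comp[OF feas_snd_raw]

lemma feas_const [feas_intros]: "feas b D (\<lambda>x. v)"
proof (rule feasI)
  let ?ps = "\<lambda>r. map (\<lambda>a. (r, a)) (rev (enc v))"
  show "poly_bounded (\<lambda>n. 6 * n + 1 + (3 * sz v + 1) + 1)" by auto
  fix x :: 'a and r and s :: store and m
  assume s: "\<forall>q>r. s q = []" and m: "6 * sz x + 1 + (3 * sz v + 1) + 1 \<le> m"
  have p: "pushed (map (\<lambda>a. (r, a)) as) (st s r as' [] [] []) = st s r (rev as @ as') [] [] []" for as as'
    by (induction as arbitrary: as') auto
  have "ex b m (pushes (?ps r)) (st s r [] [] [] []) (3 * length (?ps r) + 1) (pushed (?ps r) (st s r [] [] [] []))"
    by (rule ex_pushes) (use m in auto)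
  then have "ex b m (pushes (?ps r)) (st s r [] [] [] []) (3 * sz v + 1) (st s r (enc v) [] [] [])"
    by (simp add: p)
  moreover have "ex b m (drain r (\<lambda>a. [])) (st s r (enc x) [] [] []) (6 * sz x + 1) (st s r [] [] [] [])"
    using ex_clear[of b m r "st s r (enc x) [] [] []"] by simp
  ultimately show "ex b m (Seq (drain r (\<lambda>a. [])) (pushes (?ps r))) (st s r (enc x) [] [] [])
      (6 * sz x + 1 + (3 * sz v + 1) + 1) (st s r (enc v) [] [] [])"
    by (intro ex_Seq)
qed auto

lemma ex_copy:
  assumes "4 * length x \<le> m"
  shows "ex b m (Seq (move r (r + 2)) (drain (r + 2) (\<lambda>a. [(r, a), (Suc r, a)]))) (st s r x [] [] [])
    (21 * length x + 3) (st s r x x [] [])"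
proof -
  have 1: "ex b m (move r (r + 2)) (st s r x [] [] []) (9 * length x + 1) (st s r [] [] (rev x) [])"
    using ex_move[of r "r + 2" "st s r x [] [] []" m b] assms by simp
  have 2: "ex b m (drain (r + 2) (\<lambda>a. [(r, a), (Suc r, a)])) (st s r [] [] (rev x) []) (12 * length x + 1)
      (st s r x x [] [])"
    using ex_move2[of "r + 2" r "Suc r" "st s r [] [] (rev x) []" m b] assms by simp
  show ?thesis by (rule ex_weaken[OF ex_Seq[OF 1 2]]) simp
qed

text \<open>Each branch has to be feasible only where it is taken, which admits partial functions
  such as \<open>the\<close>.\<close>

lemma feas_if_on:
  assumes "feas b D p" "feas b {x\<in>D. p x} f" "feas b {x\<in>D. \<not> p x} g"
  shows "feas b D (\<lambda>x. if p x then f x else g x)"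
proof -
  obtain cp pp where p: "implements b D p cp pp" by (rule feasE[OF assms(1)])
  obtain cf pf where f: "implements b {x\<in>D. p x} f cf pf" by (rule feasE[OF assms(2)])
  obtain cg pg where g: "implements b {x\<in>D. \<not> p x} g cg pg" by (rule feasE[OF assms(3)])
  let ?p = "\<lambda>n. 100 * n + pp n + pf n + pg n + 100"
  let ?c = "\<lambda>r. Seq (Seq (move r (r + 2)) (drain (r + 2) (\<lambda>a. [(r, a), (Suc r, a)])))
    (Seq (cp (Suc r)) (Cond (Suc r) (\<lambda>a. a = Some True) (Seq (Pop (Suc r)) (cf r)) (cg r)))"
  show ?thesis
  proof (rule feasI)
    show "poly_bounded ?p" using implements_pbd[OF p] implements_pbd[OF f] implements_pbd[OF g] by auto
    fix x assume x: "x \<in> D"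
    show "sz (if p x then f x else g x) \<le> ?p (sz x)"
      using implements_size[OF f _ order_refl, of x] implements_size[OF g _ order_refl, of x] x by auto
    fix r and s :: store and m assume s: "\<forall>q>r. s q = []" and m: "?p (sz x) \<le> m"
    have 1: "ex b m (cp (Suc r)) (st s r (enc x) (enc x) [] []) (pp (sz x)) (st s r (enc x) (enc (p x)) [] [])"
      using implements_call(2)[OF p x s] m by simp
    have 2: "ex b m (Cond (Suc r) (\<lambda>a. a = Some True) (Seq (Pop (Suc r)) (cf r)) (cg r))
        (st s r (enc x) (enc (p x)) [] []) (pf (sz x) + pg (sz x) + 2 + 1) (st s r (enc (if p x then f x else g x)) [] [] [])"
    proof (rule ex_Cond, cases "p x")
      case True
      have "ex b m (Pop (Suc r)) (st s r (enc x) [True] [] []) 1 (st s r (enc x) [] [] [])"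
        using ex_Pop[of b m "Suc r" "st s r (enc x) [True] [] []"] by simp
      moreover have "ex b m (cf r) (st s r (enc x) [] [] []) (pf (sz x)) (st s r (enc (f x)) [] [] [])"
        using implements_call(1)[OF f _ s] x True m by simp
      ultimately have "ex b m (Seq (Pop (Suc r)) (cf r)) (st s r (enc x) [True] [] []) (1 + pf (sz x) + 1) (st s r (enc (f x)) [] [] [])"
        by (rule ex_Seq)
      then show "ex b m (if peek (st s r (enc x) (enc (p x)) [] [] (Suc r)) = Some True then Seq (Pop (Suc r)) (cf r) else cg r)
          (st s r (enc x) (enc (p x)) [] []) (pf (sz x) + pg (sz x) + 2) (st s r (enc (if p x then f x else g x)) [] [] [])"
        using True by (auto elim!: ex_weaken)
    next
      case False
      have "ex b m (cg r) (st s r (enc x) [] [] []) (pg (sz x)) (st s r (enc (g x)) [] [] [])"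
        using implements_call(1)[OF g _ s] x False m by simp
      then show "ex b m (if peek (st s r (enc x) (enc (p x)) [] [] (Suc r)) = Some True then Seq (Pop (Suc r)) (cf r) else cg r)
          (st s r (enc x) (enc (p x)) [] []) (pf (sz x) + pg (sz x) + 2) (st s r (enc (if p x then f x else g x)) [] [] [])"
        using False by (auto elim!: ex_weaken)
    qed
    show "ex b m (?c r) (st s r (enc x) [] [] []) (?p (sz x)) (st s r (enc (if p x then f x else g x)) [] [] [])"
      by (rule ex_weaken, rule ex_Seq[OF ex_copy ex_Seq[OF 1 2]]) (use m in simp_all)
  qed
qed

lemma feas_if [feas_intros]:
  "feas b D p \<Longrightarrow> feas b D f \<Longrightarrow> feas b D g \<Longrightarrow> feas b D (\<lambda>x. if p x then f x else g x)"
  by (rule feas_if_on) (auto intro: feas_subset)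

text \<open>The only rule in which time and space part: the sizes of all iterates must be
  polynomial, whereas the number \<open>n x\<close> of rounds is restricted only if \<open>b\<close>
  holds. The program finds the end by the test \<open>T\<close> and never computes
  \<open>n x\<close>.\<close>

lemma feas_loop:
  assumes F: "feas b D F" and T: "feas b D T" and p: "poly_bounded p"
    and D: "\<And>x j. x \<in> X \<Longrightarrow> j \<le> n x \<Longrightarrow> (F ^^ j) x \<in> D \<and> sz ((F ^^ j) x) \<le> p (sz x)"
    and test: "\<And>x j. x \<in> X \<Longrightarrow> j < n x \<Longrightarrow> T ((F ^^ j) x)" "\<And>x. x \<in> X \<Longrightarrow> \<not> T ((F ^^ n x) x)"
    and time: "\<And>x. b \<Longrightarrow> x \<in> X \<Longrightarrow> n x \<le> p (sz x)"
  shows "feas b X (\<lambda>x. (F ^^ n x) x)"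
proof -
  obtain cF pF where f: "implements b D F cF pF" by (rule feasE[OF F])
  obtain cT pT where t: "implements b D T cT pT" by (rule feasE[OF T])
  let ?test = "\<lambda>r. Seq (Seq (move r (r + 2)) (drain (r + 2) (\<lambda>a. [(r, a), (Suc r, a)]))) (cT (Suc r))"
  let ?body = "\<lambda>r. Seq (Pop (Suc r)) (Seq (cF r) (?test r))"
  let ?k = "\<lambda>n. 30 * p n + pT (p n) + pF (p n) + 10"
  let ?p = "\<lambda>n. (p n + 1) * (?k n + 1) + ?k n + 100 * p n + pT (p n) + pF (p n) + 10"
  show ?thesis
  proof (rule feasI)
    have "poly_bounded (\<lambda>n. pT (p n))" "poly_bounded (\<lambda>n. pF (p n))"
      by (rule poly_bounded_comp[OF _ p], rule implements_pbd[OF t] implements_pbd[OF f])+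
    then show "poly_bounded ?p" using p by auto
    fix x assume x: "x \<in> X"
    show "sz ((F ^^ n x) x) \<le> ?p (sz x)" using D[OF x, of "n x"] by simp
    fix r and s :: store and m assume s: "\<forall>q>r. s q = []" and m: "?p (sz x) \<le> m"
    let ?N = "sz x"
    define y where "y j = (F ^^ j) x" for j
    have y: "y j \<in> D" "sz (y j) \<le> p ?N" if "j \<le> n x" for j using D[OF x that] by (auto simp: y_def)
    have le: "pF (sz (y j)) \<le> m" "pT (sz (y j)) \<le> m" if "j \<le> n x" for j
      using m poly_bounded_mono[OF implements_pbd[OF f] y(2)[OF that]] poly_bounded_mono[OF implements_pbd[OF t] y(2)[OF that]] by auto
    have tst: "ex b m (?test r) (st s r (enc (y j)) [] [] []) (21 * p ?N + pT (p ?N) + 4)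
        (st s r (enc (y j)) (enc (T (y j))) [] [])" if "j \<le> n x" for j
    proof -
      have "ex b m (?test r) (st s r (enc (y j)) [] [] []) (21 * sz (y j) + 3 + pT (p ?N) + 1)
        (st s r (enc (y j)) (enc (T (y j))) [] [])"
        by (rule ex_Seq[OF ex_copy implements_call(2)[OF t y(1)[OF that] s le(2)[OF that] y(2)[OF that]]])
          (use m y(2)[OF that] in simp)
      then show ?thesis by (rule ex_weaken) (use y(2)[OF that] in simp)
    qed
    have loop: "ex b m (Loop (Suc r) (\<lambda>a. a = Some True) (?body r)) (st s r (enc (y j)) (enc (T (y j))) [] [])
        ((n x - j) * (?k ?N + 1) + 1) (st s r (enc (y (n x))) [] [] [])" if "j \<le> n x" for j
      using that
    proof (induction "n x - j" arbitrary: j)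
      case 0
      then have "j = n x" by simp
      then show ?case
        using ex_Loop_end[of "\<lambda>a. a = Some True" "st s r (enc (y j)) [] [] []" "Suc r" b m] test(2)[OF x]
        by (auto simp: y_def elim!: ex_weaken)
    next
      case (Suc i)
      then have j: "j < n x" "Suc j \<le> n x" "n x - Suc j = i" "n x - j = Suc i" by auto
      have T: "T (y j)" using test(1)[OF x j(1)] by (simp add: y_def)
      have yS: "y (Suc j) = F (y j)" by (simp add: y_def)
      have 1: "ex b m (Pop (Suc r)) (st s r (enc (y j)) (enc (T (y j))) [] []) 1 (st s r (enc (y j)) [] [] [])"
        using ex_Pop[of b m "Suc r" "st s r (enc (y j)) [True] [] []"] T by simp
      have 2: "ex b m (cF r) (st s r (enc (y j)) [] [] []) (pF (p ?N)) (st s r (enc (y (Suc j))) [] [] [])"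
        unfolding yS using implements_call(1)[OF f y(1) s le(1) y(2)] j by simp
      have 3: "ex b m (?body r) (st s r (enc (y j)) (enc (T (y j))) [] []) (?k ?N)
          (st s r (enc (y (Suc j))) (enc (T (y (Suc j)))) [] [])"
        by (rule ex_weaken[OF ex_Seq[OF 1 ex_Seq[OF 2 tst[OF j(2)]]]]) simp
      have 4: "ex b m (Loop (Suc r) (\<lambda>a. a = Some True) (?body r)) (st s r (enc (y (Suc j))) (enc (T (y (Suc j)))) [] [])
        (i * (?k ?N + 1) + 1) (st s r (enc (y (n x))) [] [] [])"
        using Suc.hyps(1)[of "Suc j"] j by simp
      show ?case
        by (rule ex_weaken[OF ex_Loop[OF _ 3 4]]) (use T in \<open>simp_all add: j(4)\<close>)
    qed
    have "ex b m (Seq (?test r) (Loop (Suc r) (\<lambda>a. a = Some True) (?body r))) (st s r (enc x) [] [] [])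
        (21 * p ?N + pT (p ?N) + 4 + (n x * (?k ?N + 1) + 1) + 1) (st s r (enc ((F ^^ n x) x)) [] [] [])"
      using ex_Seq[OF tst[of 0] loop[of 0]] by (simp add: y_def)
    then show "ex b m (Seq (?test r) (Loop (Suc r) (\<lambda>a. a = Some True) (?body r))) (st s r (enc x) [] [] [])
        (?p ?N) (st s r (enc ((F ^^ n x) x)) [] [] [])"
    proof (rule ex_weaken)
      assume b
      then have "n x * (?k ?N + 1) \<le> p ?N * (?k ?N + 1)" using time[OF _ x] by (intro mult_right_mono) auto
      then show "21 * p ?N + pT (p ?N) + 4 + (n x * (?k ?N + 1) + 1) + 1 \<le> ?p ?N"
        unfolding add_mult_distrib by linarith
    qed
  qed
qed

lemma feas_push:
  fixes f :: "'a::enc \<Rightarrow> 'b::enc"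
  assumes "\<And>x. x \<in> D \<Longrightarrow> enc (f x) = a # enc x"
  shows "feas b D f"
proof (rule feasI)
  show "poly_bounded (\<lambda>n. n + 2)" by auto
  fix x :: 'a and r :: nat and s :: store and m :: nat
  assume "x \<in> D" "\<forall>q>r. s q = []" "sz x + 2 \<le> m"
  then show "ex b m (Push r a) (st s r (enc x) [] [] []) (sz x + 2) (st s r (enc (f x)) [] [] [])"
    using ex_Push[of "st s r (enc x) [] [] []" r m b a] assms by (auto elim!: ex_weaken)
qed (use assms in auto)

lemma feas_pop:
  fixes f :: "'a::enc \<Rightarrow> 'b::enc"
  assumes "\<And>x. x \<in> D \<Longrightarrow> enc (f x) = tl (enc x)"
  shows "feas b D f"
proof (rule feasI)
  show "poly_bounded (\<lambda>n. n + 2)" by auto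
  fix x :: 'a and r :: nat and s :: store and m :: nat
  assume "x \<in> D" "\<forall>q>r. s q = []" "sz x + 2 \<le> m"
  then show "ex b m (Pop r) (st s r (enc x) [] [] []) (sz x + 2) (st s r (enc (f x)) [] [] [])"
    using ex_Pop[of b m r "st s r (enc x) [] [] []"] assms by (auto elim!: ex_weaken)
qed (use assms in auto)

lemma feas_peek:
  fixes f :: "'a::enc \<Rightarrow> bool"
  assumes "\<And>x. x \<in> D \<Longrightarrow> f x \<longleftrightarrow> P (peek (enc x))"
  shows "feas b D f"
proof (rule feasI)
  show "poly_bounded (\<lambda>n. 6 * n + 10)" by auto
  fix x :: 'a and r :: nat and s :: store and m :: nat
  assume x: "x \<in> D" "\<forall>q>r. s q = []" "6 * sz x + 10 \<le> m"
  have 1: "ex b m (drain r (\<lambda>a. [])) (st s r (enc x) [] [] []) (6 * sz x + 1) (st s r [] [] [] [])"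
    using ex_clear[of b m r "st s r (enc x) [] [] []"] by simp
  have 2: "ex b m (Push r True) (st s r [] [] [] []) 2 (st s r [True] [] [] [])"
    using ex_Push[of "st s r [] [] [] []" r m b True] x by simp
  have "ex b m (if P (peek (enc x)) then Seq (drain r (\<lambda>a. [])) (Push r True) else drain r (\<lambda>a. []))
      (st s r (enc x) [] [] []) (6 * sz x + 9) (st s r (enc (f x)) [] [] [])"
    using ex_weaken[OF ex_Seq[OF 1 2]] ex_weaken[OF 1] assms[OF x(1)] by auto
  then show "ex b m (Cond r P (Seq (drain r (\<lambda>a. [])) (Push r True)) (drain r (\<lambda>a. [])))
      (st s r (enc x) [] [] []) (6 * sz x + 10) (st s r (enc (f x)) [] [] [])"
    by (intro ex_weaken[OF ex_Cond]) auto
qed (auto simp: enc_bool_def)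

text \<open>Makes the code of a value available as data. Equality at any type thereby reduces to
  equality of bit lists.\<close>

lemma feas_enc: "feas b D (enc :: 'a::enc \<Rightarrow> bool list)"
proof (rule feasI)
  show "poly_bounded (\<lambda>n. 100 * n + 100)" by auto
  have len: "sz bs \<le> 4 * length bs" for bs :: "bool list"
    by (induction bs) (auto simp: enc_bool_def)
  fix x :: 'a
  show "sz (enc x) \<le> 100 * sz x + 100" using len[of "enc x"] by simp
  fix r and s :: store and m assume s: "\<forall>q>r. s q = []" and m: "100 * sz x + 100 \<le> m"
  \<comment> \<open>Within a list, the entry \<open>True\<close> has the code
    \<open>True, True, True, False\<close> and the entry \<open>False\<close> has the code
    \<open>True, False\<close>; they are pushed from the end.\<close>
  let ?f = "\<lambda>a. if a then [(r, False), (r, True), (r, True), (r, True)] else [(r, False), (r, True)]"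
  have 1: "ex b m (move r (Suc r)) (st s r (enc x) [] [] []) (9 * sz x + 1) (st s r [] (rev (enc x)) [] [])"
    using ex_move[of r "Suc r" "st s r (enc x) [] [] []" m b] m by simp
  have "fold (\<lambda>a. pushed (?f a)) (rev (enc x)) (st s r [] [] [] []) =
      (st s r [] [] [] [])(r := concat (map (\<lambda>b. True # delim (enc b)) (rev (rev (enc x)))) @ st s r [] [] [] [] r)"
    by (rule fold_push_code) auto
  then have "fold (\<lambda>a. pushed (?f a)) (rev (enc x)) (st s r [] [] [] []) = st s r (enc (enc x)) [] [] []"
    by (simp add: enc_list_def)
  moreover have "ex b m (drain (Suc r) ?f) (st s r [] (rev (enc x)) [] [])
      ((3 * 4 + 6) * length (st s r [] (rev (enc x)) [] [] (Suc r)) + 1)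
      (fold (\<lambda>a. pushed (?f a)) (st s r [] (rev (enc x)) [] [] (Suc r)) ((st s r [] (rev (enc x)) [] [])(Suc r := [])))"
    by (rule ex_drain) (use m in \<open>auto split: if_splits\<close>)
  ultimately have 2: "ex b m (drain (Suc r) ?f) (st s r [] (rev (enc x)) [] []) (18 * sz x + 1) (st s r (enc (enc x)) [] [] [])"
    by simp
  show "ex b m (Seq (move r (Suc r)) (drain (Suc r) ?f)) (st s r (enc x) [] [] []) (100 * sz x + 100)
      (st s r (enc (enc x)) [] [] [])"
    by (rule ex_weaken[OF ex_Seq[OF 1 2]]) simp
qed

lemma feas_Raw: "feas b D Raw"
proof (rule feasI)
  show "poly_bounded (\<lambda>n. 100 * n + 100)" by auto
  have len: "length bs \<le> sz bs" for bs :: "bool list"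
    by (induction bs) (auto simp: enc_bool_def)
  fix x :: "bool list"
  show "sz (Raw x) \<le> 100 * sz x + 100" using len[of x] by simp
  fix r and s :: store and m assume s: "\<forall>q>r. s q = []" and m: "100 * sz x + 100 \<le> m"
  \<comment> \<open>After the leading \<open>True\<close> of an entry has been popped, the next
    symbol tells the two codes apart; three symbols or one remain to be removed.\<close>
  let ?if = "Cond r (\<lambda>a. a = Some True) (Seq (Push (Suc r) True) (Seq (Pop r) (Seq (Pop r) (Pop r))))
    (Seq (Push (Suc r) False) (Pop r))"
  have body: "ex b m (Seq (Pop r) ?if) (st s r (True # delim (enc a) @ ys) xs [] []) 14 (st s r ys (a # xs) [] [])"
    if "length xs < m" for a xs ys
  proof -
    have "ex b m (if a then Seq (Push (Suc r) True) (Seq (Pop r) (Seq (Pop r) (Pop r))) else Seq (Push (Suc r) False) (Pop r))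
        (st s r (delim (enc a) @ ys) xs [] []) 9 (st s r ys (a # xs) [] [])"
    proof (cases a)
      case True
      have "ex b m (Seq (Push (Suc r) True) (Seq (Pop r) (Seq (Pop r) (Pop r)))) (st s r (True # True # False # ys) xs [] [])
          (2 + (1 + (1 + 1 + 1) + 1) + 1) (st s r ys (True # xs) [] [])"
        by (intro ex_Seq)
          (use ex_Push[of "st s r (True # True # False # ys) xs [] []" "Suc r" m b True] that
            ex_Pop[of b m r "st s r (True # True # False # ys) (True # xs) [] []"]
            ex_Pop[of b m r "st s r (True # False # ys) (True # xs) [] []"]
            ex_Pop[of b m r "st s r (False # ys) (True # xs) [] []"] in simp_all)
      then show ?thesis using True by (auto elim!: ex_weaken)
    next
      case False
      have "ex b m (Seq (Push (Suc r) False) (Pop r)) (st s r (False # ys) xs [] []) (2 + 1 + 1) (st s r ys (False # xs) [] [])"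
        by (intro ex_Seq)
          (use ex_Push[of "st s r (False # ys) xs [] []" "Suc r" m b False] that
            ex_Pop[of b m r "st s r (False # ys) (False # xs) [] []"] in simp_all)
      then show ?thesis using False by (auto elim!: ex_weaken)
    qed
    then have "ex b m ?if (st s r (delim (enc a) @ ys) xs [] []) (9 + 1) (st s r ys (a # xs) [] [])"
      by (intro ex_Cond) (cases a; simp)
    moreover have "ex b m (Pop r) (st s r (True # delim (enc a) @ ys) xs [] []) 1 (st s r (delim (enc a) @ ys) xs [] [])"
      using ex_Pop[of b m r "st s r (True # delim (enc a) @ ys) xs [] []"] by simp
    ultimately show ?thesis by (rule ex_weaken[OF ex_Seq[rotated]]) simp
  qed
  have loop: "ex b m (Loop r (\<lambda>a. a \<noteq> None) (Seq (Pop r) ?if)) (st s r (enc bs) xs [] []) (15 * length bs + 1)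
      (st s r [] (rev bs @ xs) [] [])" if "length bs + length xs \<le> m" for bs xs
    using that
  proof (induction bs arbitrary: xs)
    case Nil
    then show ?case using ex_Loop_end[of "\<lambda>a. a \<noteq> None" "st s r [] xs [] []" r] by simp
  next
    case (Cons a bs)
    then have "ex b m (Loop r (\<lambda>a. a \<noteq> None) (Seq (Pop r) ?if)) (st s r (enc bs) (a # xs) [] []) (15 * length bs + 1)
      (st s r [] (rev bs @ a # xs) [] [])" by simp
    from ex_Loop[OF _ body this] Cons.prems show ?case by (auto elim!: ex_weaken)
  qed
  have 1: "ex b m (Loop r (\<lambda>a. a \<noteq> None) (Seq (Pop r) ?if)) (st s r (enc x) [] [] []) (15 * length x + 1)
      (st s r [] (rev x) [] [])"
    using loop[of x "[]"] len[of x] m by simp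
  have 2: "ex b m (move (Suc r) r) (st s r [] (rev x) [] []) (9 * length x + 1) (st s r (enc (Raw x)) [] [] [])"
    using ex_move[of "Suc r" r "st s r [] (rev x) [] []" m b] len[of x] m by simp
  show "ex b m (Seq (Loop r (\<lambda>a. a \<noteq> None) (Seq (Pop r) ?if)) (move (Suc r) r)) (st s r (enc x) [] [] [])
      (100 * sz x + 100) (st s r (enc (Raw x)) [] [] [])"
    by (rule ex_weaken[OF ex_Seq[OF 1 2]]) (use len[of x] in simp)
qed

section \<open>Propositional connectives, numbers, options and lists\<close>

lemma feas_comp2:
  assumes "feas b UNIV (\<lambda>z. f (fst z) (snd z))" "feas b D g" "feas b D h"
  shows "feas b D (\<lambda>x. f (g x) (h x))"
  using feas_comp[OF assms(1) feas_pair[OF assms(2,3)]] by simp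

lemma feas_comp3:
  assumes "feas b UNIV (\<lambda>z. f (fst z) (fst (snd z)) (snd (snd z)))" "feas b D g" "feas b D h" "feas b D i"
  shows "feas b D (\<lambda>x. f (g x) (h x) (i x))"
  using feas_comp[OF assms(1) feas_pair[OF assms(2) feas_pair[OF assms(3,4)]]] by simp

lemma feas_not [feas_intros]: "feas b D p \<Longrightarrow> feas b D (\<lambda>x. \<not> p x)"
  by (rule feas_cong[OF feas_if[of b D p "\<lambda>_. False" "\<lambda>_. True"]]) (auto intro: feas_const)

lemma feas_conj [feas_intros]: "feas b D p \<Longrightarrow> feas b D q \<Longrightarrow> feas b D (\<lambda>x. p x \<and> q x)"
  by (rule feas_cong[OF feas_if[of b D p q "\<lambda>_. False"]]) (auto intro: feas_const)

lemma feas_disj [feas_intros]: "feas b D p \<Longrightarrow> feas b D q \<Longrightarrow> feas b D (\<lambda>x. p x \<or> q x)"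
  by (rule feas_cong[OF feas_if[of b D p "\<lambda>_. True" q]]) (auto intro: feas_const)

lemma feas_imp [feas_intros]: "feas b D p \<Longrightarrow> feas b D q \<Longrightarrow> feas b D (\<lambda>x. p x \<longrightarrow> q x)"
  by (rule feas_cong[OF feas_disj[OF feas_not]]) auto

lemma feas_iff: "feas b D p \<Longrightarrow> feas b D q \<Longrightarrow> feas b D (\<lambda>x. p x = (q x :: bool))"
  by (rule feas_cong[OF feas_if[of b D p q "\<lambda>x. \<not> q x"]]) (auto intro: feas_not)

lemma feas_nat_null: "feas b D f \<Longrightarrow> feas b D (\<lambda>x. f x = (0::nat))"
  by (rule feas_comp) (rule feas_peek[where P = "\<lambda>a. a = None"], case_tac x, auto simp: enc_nat_tl)

lemma feas_double [feas_intros]: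
  assumes "feas b D f" shows "feas b D (\<lambda>x. 2 * f x :: nat)"
proof (rule feas_comp[OF _ assms])
  \<comment> \<open>Doubling pushes a low bit \<open>False\<close>, except for \<open>0\<close>: its
    code is empty and \<open>[False]\<close> is not the code of a number.\<close>
  have "feas b UNIV (\<lambda>n::nat. if n = 0 then n else 2 * n)"
    by (rule feas_if_on[OF feas_nat_null[OF feas_id] feas_id feas_push[where a = False]]) simp
  then show "feas b UNIV (\<lambda>n::nat. 2 * n)" by (rule feas_cong) simp
qed

lemma feas_Suc_double [feas_intros]: "feas b D f \<Longrightarrow> feas b D (\<lambda>x. Suc (2 * f x))"
  by (rule feas_comp, rule feas_push) simp_all

lemma feas_half [feas_intros]: "feas b D f \<Longrightarrow> feas b D (\<lambda>x. f x div 2 :: nat)"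
  by (rule feas_comp, rule feas_pop) (simp_all add: enc_nat_tl)

lemma peek_enc_nat: "peek (enc n) = (if n = 0 then None else Some (odd n))" for n :: nat
  by (cases "n = 0") (simp_all add: enc_nat_tl(2))

lemma feas_odd [feas_intros]: "feas b D f \<Longrightarrow> feas b D (\<lambda>x. odd (f x :: nat))"
  by (rule feas_comp, rule feas_peek[where P = "\<lambda>a. a = Some True"]) (auto simp: peek_enc_nat)

lemma feas_even [feas_intros]: "feas b D f \<Longrightarrow> feas b D (\<lambda>x. even (f x :: nat))"
  using feas_not[OF feas_odd] by fastforce

lemma feas_Some [feas_intros]: "feas b D f \<Longrightarrow> feas b D (\<lambda>x. Some (f x))"
  by (rule feas_comp, rule feas_push) simp_all

lemma feas_is_None: "feas b D f \<Longrightarrow> feas b D (\<lambda>x. f x = None)"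
  by (rule feas_comp) (rule feas_peek[where P = "\<lambda>a. a = None"], case_tac x, auto)

lemma feas_case_option [feas_intros]:
  fixes g :: "'a::enc \<Rightarrow> 'b::enc option"
  assumes g: "feas b D g" and f: "feas b D f" and h: "feas b UNIV (\<lambda>z. h (fst z) (snd z))"
  shows "feas b D (\<lambda>x. case g x of None \<Rightarrow> f x | Some y \<Rightarrow> h x y)"
proof -
  have "feas b {x\<in>D. g x \<noteq> None} (\<lambda>x. the (g x))"
  proof (rule feas_comp_on[where E = "{x. x \<noteq> None}"])
    show "feas b {x. x \<noteq> None} (the :: 'b option \<Rightarrow> 'b)" by (rule feas_pop) auto
    show "feas b {x\<in>D. g x \<noteq> None} g" by (rule feas_subset[OF g]) auto
  qed auto
  then have "feas b {x\<in>D. g x \<noteq> None} (\<lambda>x. (x, the (g x)))" by (intro feas_pair feas_id)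
  from feas_comp[OF h this] have h': "feas b {x\<in>D. g x \<noteq> None} (\<lambda>x. h x (the (g x)))" by simp
  have "feas b D (\<lambda>x. if g x = None then f x else h x (the (g x)))"
    by (rule feas_if_on[OF feas_is_None[OF g] feas_subset[OF f] h']) auto
  then show ?thesis by (rule feas_cong) (auto split: option.splits)
qed

lemma feas_Cons [feas_intros]:
  assumes "feas b D f" "feas b D g" shows "feas b D (\<lambda>x. f x # g x)"
  by (rule feas_cast[OF feas_Some[OF feas_pair[OF assms]]]) auto

lemma feas_case_list [feas_intros]:
  assumes g: "feas b D g" and f: "feas b D f" and h: "feas b UNIV (\<lambda>z. h (fst z) (fst (snd z)) (snd (snd z)))"
  shows "feas b D (\<lambda>x. case g x of [] \<Rightarrow> f x | y # ys \<Rightarrow> h x y ys)"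
proof -
  have "feas b D (\<lambda>x. case g x of [] \<Rightarrow> None | y # ys \<Rightarrow> Some (y, ys))"
    by (rule feas_cast[OF g]) (auto split: list.splits)
  from feas_case_option[OF this f, of "\<lambda>x z. h x (fst z) (snd z)"] h show ?thesis
    by (auto elim!: feas_cong split: list.splits)
qed

lemma feas_null: "feas b D g \<Longrightarrow> feas b D (\<lambda>x. g x = [])"
  by (rule feas_cong[OF feas_case_list[of b D g "\<lambda>_. True" "\<lambda>_ _ _. False"]]) (auto intro: feas_const split: list.splits)

lemma feas_tl [feas_intros]: "feas b D g \<Longrightarrow> feas b D (\<lambda>x. tl (g x))"
  by (rule feas_cong[OF feas_case_list[of b D g "\<lambda>_. []" "\<lambda>_ _ ys. ys"]])
    (auto intro!: feas_intros split: list.splits)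

lemma sz_prod [simp]: "sz (a, b) = Suc (2 * sz a + sz b)"
  by simp

lemma length_le_sz: "length xs \<le> sz xs"
  by (induction xs) auto

lemma sz_mem: "x \<in> set xs \<Longrightarrow> sz x \<le> sz xs"
  by (induction xs) auto

lemma sz_bound: "(\<And>x. x \<in> set xs \<Longrightarrow> sz x \<le> k) \<Longrightarrow> sz xs \<le> length xs * (2 * k + 2)"
proof (induction xs)
  case (Cons x xs)
  then have "sz x \<le> k" "sz xs \<le> length xs * (2 * k + 2)" by auto
  then show ?case by simp
qed simp

lemma sz_take: "sz (take i xs) \<le> sz xs"
  using enc_append[of "take i xs" "drop i xs"] by simp

lemma sz_drop: "sz (drop i xs) \<le> sz xs"
  using enc_append[of "take i xs" "drop i xs"] by simp

lemma sz_rev [simp]: "sz (rev xs) = sz xs"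
  by (induction xs) auto

lemma sz_nat: "sz n \<le> n" for n :: nat
proof (induction n rule: less_induct)
  case (less n)
  show ?case
  proof (cases "n = 0")
    case False
    then have "sz (n div 2) \<le> n div 2" using less by simp
    then show ?thesis using False by (simp add: enc_nat_tl(2))
  qed simp
qed

lemma sz_nat_mono: "m \<le> n \<Longrightarrow> sz m \<le> sz n" for m n :: nat
proof (induction n arbitrary: m rule: less_induct)
  case (less n)
  show ?case
  proof (cases "m = 0")
    case False
    then have "sz (m div 2) \<le> sz (n div 2)" using less by (intro less.IH) auto
    then show ?thesis using False less.prems by (simp add: enc_nat_tl(2))
  qed simp
qed

lemma sz_Suc: "sz (Suc n) \<le> Suc (sz n)"
proof -
  have "sz (Suc n) \<le> sz (Suc (2 * n))" by (rule sz_nat_mono) simp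
  then show ?thesis by simp
qed

lemma sz_bool: "sz (b::bool) \<le> 1"
  by (simp add: enc_bool_def)

text \<open>The parameter \<open>x\<close> of the loop is carried along unchanged in the state of
  \<open>feas_loop\<close>.\<close>

lemma feas_iterate:
  assumes f: "feas b E (\<lambda>z. f (fst z) (snd z))" and c: "feas b E (\<lambda>z. c (fst z) (snd z))"
    and a: "feas b D a" and p: "poly_bounded p"
    and I: "\<And>x j. x \<in> D \<Longrightarrow> j \<le> n x \<Longrightarrow> (x, (f x ^^ j) (a x)) \<in> E \<and> sz ((f x ^^ j) (a x)) \<le> p (sz x)"
    and test: "\<And>x j. x \<in> D \<Longrightarrow> j < n x \<Longrightarrow> c x ((f x ^^ j) (a x))" "\<And>x. x \<in> D \<Longrightarrow> \<not> c x ((f x ^^ n x) (a x))"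
    and time: "\<And>x. b \<Longrightarrow> x \<in> D \<Longrightarrow> n x \<le> p (sz x)"
  shows "feas b D (\<lambda>x. (f x ^^ n x) (a x))"
proof -
  let ?F = "\<lambda>z. (fst z, f (fst z) (snd z))"
  have F: "(?F ^^ j) (x, y) = (x, (f x ^^ j) y)" for j x y by (induction j) auto
  have "feas b ((\<lambda>x. (x, a x)) ` D) (\<lambda>z. (?F ^^ n (fst z)) z)"
  proof (rule feas_loop)
    show "feas b E ?F" by (intro feas_pair f feas_fst feas_id)
    show "feas b E (\<lambda>z. c (fst z) (snd z))" by (rule c)
    show "poly_bounded (\<lambda>m. 2 * m + 1 + p m)" using p by auto
    fix z assume "z \<in> (\<lambda>x. (x, a x)) ` D"
    then obtain x where z: "z = (x, a x)" and x: "x \<in> D" by auto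
    have le: "p (sz x) \<le> p (sz z)" by (rule poly_bounded_mono[OF p]) (simp add: z)
    show "(?F ^^ j) z \<in> E \<and> sz ((?F ^^ j) z) \<le> 2 * sz z + 1 + p (sz z)" if "j \<le> n (fst z)" for j
      using I[OF x, of j] that le unfolding z F by simp
    show "c (fst ((?F ^^ j) z)) (snd ((?F ^^ j) z))" if "j < n (fst z)" for j
      using test(1)[OF x] that unfolding z F by simp
    show "\<not> c (fst ((?F ^^ n (fst z)) z)) (snd ((?F ^^ n (fst z)) z))"
      using test(2)[OF x] unfolding z F by simp
    show "n (fst z) \<le> 2 * sz z + 1 + p (sz z)" if b
      using time[OF that x] le unfolding z by simp
  qed
  from feas_comp_on[OF this feas_pair[OF feas_id a] order_refl]
  have "feas b D (\<lambda>x. (?F ^^ n (fst (x, a x))) (x, a x))" by simp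
  from feas_snd[OF this] show ?thesis unfolding F by simp
qed

lemma foldl_take_Suc: "i < length xs \<Longrightarrow> foldl f a (take (Suc i) xs) = f (foldl f a (take i xs)) (xs ! i)"
  by (simp add: take_Suc_conv_app_nth)

text \<open>The length of a list is bounded by its size, so the number of rounds is polynomial in
  any case. What has to be supplied is a bound for the intermediate accumulators.\<close>

lemma feas_foldl:
  assumes f: "feas b UNIV (\<lambda>z. f (fst z) (fst (snd z)) (snd (snd z)))"
    and g: "feas b D g" and a: "feas b D a" and p: "poly_bounded p"
    and size: "\<And>x i. x \<in> D \<Longrightarrow> i \<le> length (g x) \<Longrightarrow> sz (foldl (f x) (a x) (take i (g x))) \<le> p (sz x)"
  shows "feas b D (\<lambda>x. foldl (f x) (a x) (g x))"
proof -
  let ?f = "\<lambda>x s. case snd s of [] \<Rightarrow> s | y # ys \<Rightarrow> (f x (fst s) y, ys)"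
  have it: "(?f x ^^ i) (a x, g x) = (foldl (f x) (a x) (take i (g x)), drop i (g x))" if "i \<le> length (g x)" for x i
    using that
  proof (induction i)
    case (Suc i)
    then show ?case by (simp add: foldl_take_Suc Cons_nth_drop_Suc[symmetric])
  qed simp
  obtain pg where pg: "poly_bounded pg" "\<And>x. x \<in> D \<Longrightarrow> sz (g x) \<le> pg (sz x)" by (rule feas_size[OF g]) auto
  have "feas b D (\<lambda>x. (?f x ^^ length (g x)) (a x, g x))"
  proof (rule feas_iterate)
    show "feas b UNIV (\<lambda>z. ?f (fst z) (snd z))"
      by (intro feas_intros feas_comp3[OF f])
    show "feas b UNIV (\<lambda>z. snd (snd z) \<noteq> [])" by (intro feas_intros feas_null)
    show "feas b D (\<lambda>x. (a x, g x))" by (intro feas_intros a g)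
    show "poly_bounded (\<lambda>n. 2 * p n + 1 + pg n)" using p pg by auto
    fix x assume x: "x \<in> D"
    show "(x, (?f x ^^ j) (a x, g x)) \<in> UNIV \<and> sz ((?f x ^^ j) (a x, g x)) \<le> 2 * p (sz x) + 1 + pg (sz x)"
      if "j \<le> length (g x)" for j
      using size[OF x that] pg(2)[OF x] sz_drop[of j "g x"] unfolding it[OF that] by simp
    show "snd ((?f x ^^ j) (a x, g x)) \<noteq> []" if "j < length (g x)" for j
      using that by (simp add: it)
    show "\<not> snd ((?f x ^^ length (g x)) (a x, g x)) \<noteq> []" by (simp add: it)
    show "length (g x) \<le> 2 * p (sz x) + 1 + pg (sz x)"
      using length_le_sz[of "g x"] pg(2)[OF x] by simp
  qed
  from feas_fst[OF this] show ?thesis by (simp add: it)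
qed

lemma foldl_snoc_rev: "foldl (\<lambda>a y. h y # a) as xs = rev (map h xs) @ as"
  by (induction xs arbitrary: as) auto

lemma feas_rev [feas_intros]:
  assumes "feas b D g" shows "feas b D (\<lambda>x. rev (g x))"
proof -
  obtain pg where pg: "poly_bounded pg" "\<And>x. x \<in> D \<Longrightarrow> sz (g x) \<le> pg (sz x)" by (rule feas_size[OF assms]) auto
  have "feas b D (\<lambda>x. foldl (\<lambda>a y. y # a) [] (g x))"
    by (rule feas_foldl[OF _ assms feas_const pg(1)])
      (auto intro!: feas_intros simp: foldl_snoc_rev[of "\<lambda>y. y", simplified] le_trans[OF sz_take] pg)
  then show ?thesis by (simp add: foldl_snoc_rev[of "\<lambda>y. y", simplified])
qed

lemma feas_append [feas_intros]:
  assumes "feas b D f" "feas b D g" shows "feas b D (\<lambda>x. f x @ g x)"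
proof -
  obtain pf where pf: "poly_bounded pf" "\<And>x. x \<in> D \<Longrightarrow> sz (f x) \<le> pf (sz x)" by (rule feas_size[OF assms(1)]) auto
  obtain pg where pg: "poly_bounded pg" "\<And>x. x \<in> D \<Longrightarrow> sz (g x) \<le> pg (sz x)" by (rule feas_size[OF assms(2)]) auto
  have "feas b D (\<lambda>x. foldl (\<lambda>a y. y # a) (g x) (rev (f x)))"
  proof (rule feas_foldl)
    show "poly_bounded (\<lambda>n. pf n + pg n)" using pf pg by auto
    fix x i assume "x \<in> D"
    then show "sz (foldl (\<lambda>a y. y # a) (g x) (take i (rev (f x)))) \<le> pf (sz x) + pg (sz x)"
      using pf(2)[of x] pg(2)[of x] sz_take[of i "rev (f x)"] by (simp add: foldl_snoc_rev[of "\<lambda>y. y", simplified])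
  qed (auto intro!: feas_intros assms)
  then show ?thesis by (simp add: foldl_snoc_rev[of "\<lambda>y. y", simplified])
qed

lemma feas_map [feas_intros]:
  assumes f: "feas b UNIV (\<lambda>z. f (fst z) (snd z))" and g: "feas b D g"
  shows "feas b D (\<lambda>x. map (\<lambda>y. f x y) (g x))"
proof -
  obtain pf where pf: "poly_bounded pf" "\<And>z. sz (f (fst z) (snd z)) \<le> pf (sz z)" by (rule feas_size[OF f]) auto
  obtain pg where pg: "poly_bounded pg" "\<And>x. x \<in> D \<Longrightarrow> sz (g x) \<le> pg (sz x)" by (rule feas_size[OF g]) auto
  have "feas b D (\<lambda>x. foldl (\<lambda>a y. f x y # a) [] (g x))"
  proof (rule feas_foldl[OF _ g feas_const])
    show "feas b UNIV (\<lambda>z. f (fst z) (snd (snd z)) # fst (snd z))"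
      by (intro feas_intros feas_comp2[OF f])
    show "poly_bounded (\<lambda>n. pg n * (2 * pf (2 * n + 1 + pg n) + 2))"
    proof -
      have "poly_bounded (\<lambda>n. 2 * n + 1 + pg n)" using pg by auto
      from poly_bounded_comp[OF pf(1) this] show ?thesis by (intro poly_bounded_mult poly_bounded_add poly_bounded_const pg(1))
    qed
    fix x i assume x: "x \<in> D"
    have "sz (map (f x) (take i (g x))) \<le> length (map (f x) (take i (g x))) * (2 * pf (2 * sz x + 1 + pg (sz x)) + 2)"
    proof (rule sz_bound)
      fix y assume "y \<in> set (map (f x) (take i (g x)))"
      then obtain u where u: "u \<in> set (g x)" "y = f x u" by (auto dest: in_set_takeD)
      then have "sz (x, u) \<le> 2 * sz x + 1 + pg (sz x)" using sz_mem[of u "g x"] pg(2)[OF x] by simp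
      from poly_bounded_mono[OF pf(1) this] pf(2)[of "(x, u)"] show "sz y \<le> pf (2 * sz x + 1 + pg (sz x))"
        by (simp add: u)
    qed
    also have "\<dots> \<le> pg (sz x) * (2 * pf (2 * sz x + 1 + pg (sz x)) + 2)"
      using length_le_sz[of "g x"] pg(2)[OF x] by (intro mult_right_mono) auto
    finally show "sz (foldl (\<lambda>a y. f x y # a) [] (take i (g x))) \<le> pg (sz x) * (2 * pf (2 * sz x + 1 + pg (sz x)) + 2)"
      by (simp add: foldl_snoc_rev)
  qed
  from feas_rev[OF this] show ?thesis by (simp add: foldl_snoc_rev)
qed

lemma sz_concat: "sz (concat xss) \<le> sz xss"
  by (induction xss) auto

lemma feas_concat [feas_intros]:
  assumes g: "feas b D g" shows "feas b D (\<lambda>x. concat (g x))"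
proof -
  obtain pg where pg: "poly_bounded pg" "\<And>x. x \<in> D \<Longrightarrow> sz (g x) \<le> pg (sz x)" by (rule feas_size[OF g]) auto
  have e: "foldl (\<lambda>a y. a @ y) [] xss = concat xss" for xss :: "'c list list"
    by (induction xss rule: rev_induct) auto
  have "feas b D (\<lambda>x. foldl (\<lambda>a y. a @ y) [] (g x))"
  proof (rule feas_foldl[OF _ g feas_const pg(1)])
    fix x i assume "x \<in> D"
    then show "sz (foldl (\<lambda>a y. a @ y) [] (take i (g x))) \<le> pg (sz x)"
      using sz_concat[of "take i (g x)"] sz_take[of i "g x"] pg(2)[of x] unfolding e by linarith
  qed (intro feas_intros)
  then show ?thesis by (simp add: e)
qed

lemma feas_Ball [feas_intros]:
  assumes P: "feas b UNIV (\<lambda>z. P (fst z) (snd z))" and g: "feas b D g"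
  shows "feas b D (\<lambda>x. \<forall>y\<in>set (g x). P x y)"
proof -
  have e: "foldl (\<lambda>a y. a \<and> P x y) a ys \<longleftrightarrow> a \<and> (\<forall>y\<in>set ys. P x y)" for x a ys
    by (induction ys arbitrary: a) auto
  have "feas b D (\<lambda>x. foldl (\<lambda>a y. a \<and> P x y) True (g x))"
  proof (rule feas_foldl[OF _ g feas_const])
    show "feas b UNIV (\<lambda>z. fst (snd z) \<and> P (fst z) (snd (snd z)))"
      by (intro feas_intros feas_comp2[OF P])
  qed (auto intro!: sz_bool)
  then show ?thesis by (simp add: e)
qed

lemma feas_Bex [feas_intros]:
  assumes P: "feas b UNIV (\<lambda>z. P (fst z) (snd z))" and g: "feas b D g"
  shows "feas b D (\<lambda>x. \<exists>y\<in>set (g x). P x y)"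
  using feas_not[OF feas_Ball[OF feas_not[OF P] g]] by simp

section \<open>Equality, arithmetic and access to lists\<close>

lemma feas_eq_bools:
  fixes f g :: "'a::enc \<Rightarrow> bool list"
  assumes f: "feas b D f" and g: "feas b D g"
  shows "feas b D (\<lambda>x. f x = g x)"
proof -
  let ?h = "\<lambda>s a. case snd s of [] \<Rightarrow> (False, []) | y # ys \<Rightarrow> if y = a then (fst s, ys) else (False, [])"
  have e: "(fst (foldl ?h s as) \<and> snd (foldl ?h s as) = []) \<longleftrightarrow> fst s \<and> snd s = as" for s and as :: "bool list"
  proof (induction as arbitrary: s)
    case (Cons a as)
    have n: "\<not> fst (foldl ?h (False, ys) zs)" for ys zs
      by (induction zs arbitrary: ys) (auto split: list.splits)
    show ?case using n[of "[]" as] Cons.IH[of "?h s a"] by (cases "snd s") auto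
  qed (cases s; simp)
  obtain pg where pg: "poly_bounded pg" "\<And>x. x \<in> D \<Longrightarrow> sz (g x) \<le> pg (sz x)" by (rule feas_size[OF g]) auto
  have len: "sz (snd (foldl ?h s as)) \<le> sz (snd s)" for s and as :: "bool list"
  proof (induction as arbitrary: s)
    case (Cons a as)
    show ?case using Cons.IH[of "?h s a"] by (cases "snd s") auto
  qed simp
  have "feas b D (\<lambda>x. foldl ?h (True, g x) (f x))"
  proof (rule feas_foldl[OF _ f])
    show "poly_bounded (\<lambda>n. 3 + pg n)" using pg by auto
    fix x i assume "x \<in> D"
    then show "sz (foldl ?h (True, g x) (take i (f x))) \<le> 3 + pg (sz x)"
      using len[of "(True, g x)" "take i (f x)"] pg(2)[of x] sz_bool[of "fst (foldl ?h (True, g x) (take i (f x)))"]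
      by (cases "foldl ?h (True, g x) (take i (f x))") auto
  qed (intro feas_intros g feas_iff)+
  from feas_conj[OF feas_fst[OF this] feas_null[OF feas_snd[OF this]]] show ?thesis
    by (auto elim!: feas_cong simp: e)
qed

lemma feas_eq [feas_intros]:
  assumes "feas b D f" "feas b D g" shows "feas b D (\<lambda>x. f x = g x)"
proof -
  have "feas b D (\<lambda>x. enc (f x) = enc (g x))"
    by (intro feas_eq_bools feas_comp[OF feas_enc] assms)
  then show ?thesis by (simp add: enc_eq_iff)
qed

lemma feas_mem [feas_intros]:
  assumes "feas b D f" "feas b D g" shows "feas b D (\<lambda>x. f x \<in> set (g x))"
proof -
  have "feas b UNIV (\<lambda>z::'b \<times> 'b list. \<exists>y\<in>set (snd z). fst z = y)" by (intro feas_intros)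
  from feas_comp[OF this feas_pair[OF assms]] show ?thesis by simp
qed

text \<open>Binary increment. If \<open>k n\<close> is the number of trailing ones,
  \<open>n div 2 ^ k n\<close> is even, so its successor merely sets the lowest bit, and
  \<open>k n\<close> doublings turn the removed ones into zeros. A list records \<open>k n\<close>
  in unary.\<close>

lemma feas_Suc [feas_intros]:
  assumes "feas b D f" shows "feas b D (\<lambda>x. Suc (f x))"
proof (rule feas_comp[OF _ assms])
  let ?f = "\<lambda>s :: nat \<times> bool list. (fst s div 2, True # snd s)"
  define k where "k n = (LEAST j. even (n div 2 ^ j))" for n :: nat
  have it: "(?f ^^ j) (n, []) = (n div 2 ^ j, replicate j True)" for n j
    by (induction j) (auto simp: div_mult2_eq[symmetric] mult.commute)
  have even: "even (n div 2 ^ k n)" for n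
    unfolding k_def by (rule LeastI[of _ n]) simp
  have odd: "odd (n div 2 ^ j)" if "j < k n" for n j
    using not_less_Least[of j "\<lambda>j. even (n div 2 ^ j)"] that by (simp add: k_def)
  have len: "sz (n div 2 ^ j) + j = sz n" if "j \<le> k n" for n j
    using that
  proof (induction j)
    case (Suc j)
    then have "odd (n div 2 ^ j)" using odd by simp
    then have "n div 2 ^ j > 0" by (rule odd_pos)
    then have "sz (n div 2 ^ j) = Suc (sz (n div 2 ^ j div 2))" by (simp add: enc_nat_tl(2))
    then show ?case using Suc by (simp add: div_mult2_eq[symmetric] mult.commute)
  qed simp
  have val: "Suc n = 2 ^ j * Suc (n div 2 ^ j)" if "j \<le> k n" for n j
    using that
  proof (induction j)
    case (Suc j)
    have "n div 2 ^ Suc j = n div 2 ^ j div 2" by (simp add: div_mult2_eq[symmetric] mult.commute)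
    moreover have "odd (n div 2 ^ j)" using odd Suc by simp
    then have "Suc (n div 2 ^ j) = 2 * Suc (n div 2 ^ j div 2)" by (auto elim!: oddE)
    moreover have "Suc n = 2 ^ j * Suc (n div 2 ^ j)" using Suc by simp
    ultimately show ?case by (metis mult.assoc mult.commute power_Suc)
  qed simp
  have 1: "feas b UNIV (\<lambda>n. (?f ^^ k n) (n, []))"
  proof (rule feas_iterate[where c = "\<lambda>n s. odd (fst s)"])
    show "poly_bounded (\<lambda>n. 10 * n + 10)" by auto
    show "(n, (?f ^^ j) (n, [])) \<in> UNIV \<and> sz ((?f ^^ j) (n, [])) \<le> 10 * sz n + 10" if "j \<le> k n" for n j
    proof -
      have "sz (replicate j True) = 4 * j" by (induction j) auto
      then show ?thesis using len[OF that] unfolding it by simp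
    qed
    show "k n \<le> 10 * sz n + 10" for n using len[of "k n" n] by simp
  qed (auto intro!: feas_intros simp: it even odd)
  have dbl: "foldl (\<lambda>a y. 2 * a) m (replicate j True) = 2 ^ j * m" for m j :: nat
    by (induction j arbitrary: m) auto
  have 2: "feas b UNIV (\<lambda>s :: nat \<times> bool list. foldl (\<lambda>a y. 2 * a) (Suc (2 * (fst s div 2))) (snd s))"
  proof (rule feas_foldl)
    show "poly_bounded (\<lambda>n. 2 * n + 2)" by auto
    fix s :: "nat \<times> bool list" and i assume i: "i \<le> length (snd s)"
    obtain n as where s: "s = (n, as)" by fastforce
    have h: "sz (n div 2) \<le> sz n" by (rule sz_nat_mono) simp
    have l: "sz (foldl (\<lambda>a y. 2 * a) m cs) \<le> sz m + length cs" for m :: nat and cs :: "bool list"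
    proof (induction cs arbitrary: m)
      case (Cons y cs)
      have "sz (2 * m) \<le> Suc (sz m)" by (cases "m = 0") auto
      then show ?case using Cons.IH[of "2 * m"] by simp
    qed simp
    show "sz (foldl (\<lambda>a y. 2 * a) (Suc (2 * (fst s div 2))) (take i (snd s))) \<le> 2 * sz s + 2"
      using l[of "Suc (2 * (n div 2))" "take i as"] h i length_le_sz[of as] by (simp add: s)
  qed (intro feas_intros)+
  have e: "Suc (2 * (n div 2 ^ k n div 2)) = Suc (n div 2 ^ k n)" for n using even[of n] by simp
  show "feas b UNIV Suc"
    by (rule feas_cong[OF feas_comp[OF 2 1]]) (simp only: it fst_conv snd_conv dbl e val[OF order_refl, symmetric])
qed

lemma feas_length [feas_intros]:
  assumes g: "feas b D g" shows "feas b D (\<lambda>x. length (g x))"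
proof -
  obtain pg where pg: "poly_bounded pg" "\<And>x. x \<in> D \<Longrightarrow> sz (g x) \<le> pg (sz x)" by (rule feas_size[OF g]) auto
  have e: "foldl (\<lambda>a y. Suc a) a ys = a + length ys" for a and ys :: "'c list"
    by (induction ys arbitrary: a) auto
  have "feas b D (\<lambda>x. foldl (\<lambda>a y. Suc a) 0 (g x))"
  proof (rule feas_foldl[OF _ g feas_const pg(1)])
    fix x i assume "x \<in> D" "i \<le> length (g x)"
    then show "sz (foldl (\<lambda>a y. Suc a) 0 (take i (g x))) \<le> pg (sz x)"
      using sz_nat[of i] length_le_sz[of "g x"] pg(2)[of x] unfolding e by simp
  qed (intro feas_intros)
  then show ?thesis by (simp add: e)
qed

lemma feas_upt [feas_intros]:
  assumes g: "feas b D g" shows "feas b D (\<lambda>x. [0..<length (g x)])"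
proof -
  obtain pg where pg: "poly_bounded pg" "\<And>x. x \<in> D \<Longrightarrow> sz (g x) \<le> pg (sz x)" by (rule feas_size[OF g]) auto
  let ?h = "\<lambda>s y. (Suc (fst s), fst s # snd s)"
  have e: "foldl ?h (0, []) ys = (length ys, rev [0..<length ys])" for ys :: "'c list"
    by (induction ys rule: rev_induct) auto
  have "feas b D (\<lambda>x. foldl ?h (0, []) (g x))"
  proof (rule feas_foldl[OF _ g feas_const])
    show "poly_bounded (\<lambda>n. 2 * pg n + 1 + pg n * (2 * pg n + 2))" using pg by auto
    fix x i assume x: "x \<in> D" and i: "i \<le> length (g x)"
    have i': "i \<le> pg (sz x)" using i length_le_sz[of "g x"] pg(2)[OF x] by simp
    have "sz [0..<i] \<le> length [0..<i] * (2 * pg (sz x) + 2)"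
      by (rule sz_bound) (use i' in \<open>auto intro!: order_trans[OF sz_nat]\<close>)
    also have "\<dots> \<le> pg (sz x) * (2 * pg (sz x) + 2)" using i' by (intro mult_right_mono) auto
    finally show "sz (foldl ?h (0, []) (take i (g x))) \<le> 2 * pg (sz x) + 1 + pg (sz x) * (2 * pg (sz x) + 2)"
      using i i' sz_nat[of i] unfolding e by (simp del: enc_append)
  qed (intro feas_intros)
  from feas_rev[OF feas_snd[OF this]] show ?thesis by (simp add: e)
qed

text \<open>Comparison starts at the lowest bits, which are on top of the stacks. The third
  component is the verdict on the bits seen so far and is overridden by any difference further up;
  \<open>lt\<close> is invariant under a step.\<close>

lemma feas_less [feas_intros]:
  assumes "feas b D f" "feas b D g" shows "feas b D (\<lambda>x. f x < (g x :: nat))"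
proof -
  let ?h = "\<lambda>s :: nat \<times> nat \<times> bool. (fst s div 2, fst (snd s) div 2,
    if odd (fst s) = odd (fst (snd s)) then snd (snd s) else odd (fst (snd s)))"
  define lt where "lt = (\<lambda>(m, n :: nat, r). m < n \<or> m = n \<and> r)"
  have step: "lt (?h s) = lt s" for s
  proof -
    obtain m n r where s: "s = (m, n, r)" by (cases s)
    have "m = 2 * (m div 2) + (if odd m then 1 else 0)" "n = 2 * (n div 2) + (if odd n then 1 else 0)" by presburger+
    then show ?thesis unfolding s lt_def by (auto split: if_splits) presburger+
  qed
  have it: "lt ((?h ^^ j) s) = lt s" for j s
    by (induction j) (simp_all only: funpow.simps id_apply comp_apply step)
  have it2: "fst ((?h ^^ j) s) = fst s div 2 ^ j \<and> fst (snd ((?h ^^ j) s)) = fst (snd s) div 2 ^ j" for j s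
    by (induction j) (auto simp: div_mult2_eq[symmetric] mult.commute)
  have zero: "n div 2 ^ sz n = 0" for n :: nat
  proof (induction n rule: less_induct)
    case (less n)
    show ?case
    proof (cases "n = 0")
      case False
      have "n div 2 ^ sz n = n div 2 div 2 ^ sz (n div 2)"
        using False by (simp add: enc_nat_tl(2) div_mult2_eq)
      then show ?thesis using less[of "n div 2"] False by simp
    qed simp
  qed
  have z2: "n div 2 ^ (sz n + i) = 0" for n i :: nat using zero[of n] by (simp add: power_add div_mult2_eq)
  define P where "P z j \<longleftrightarrow> fst z div 2 ^ j = 0 \<and> snd z div 2 ^ j = 0" for z :: "nat \<times> nat" and j
  define k where "k z = (LEAST j. P z j)" for z
  have P: "P z (sz (fst z) + sz (snd z))" for z
    using z2[of "fst z" "sz (snd z)"] z2[of "snd z" "sz (fst z)"] by (simp add: P_def add.commute)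
  have k1: "P z (k z)" for z unfolding k_def by (rule LeastI[of "P z", OF P])
  have k2: "k z \<le> sz (fst z) + sz (snd z)" for z unfolding k_def by (rule Least_le[of "P z", OF P])
  have k3: "\<not> P z j" if "j < k z" for z j using not_less_Least[of j "P z"] that unfolding k_def by blast
  have "feas b UNIV (\<lambda>z. (?h ^^ k z) (fst z, snd z, False))"
  proof (rule feas_iterate[where c = "\<lambda>z s. fst s \<noteq> 0 \<or> fst (snd s) \<noteq> 0"])
    show "poly_bounded (\<lambda>n. 10 * n + 10)" by auto
    show "(z, (?h ^^ j) (fst z, snd z, False)) \<in> UNIV \<and> sz ((?h ^^ j) (fst z, snd z, False)) \<le> 10 * sz z + 10" for z j
    proof -
      obtain m n r where s: "(?h ^^ j) (fst z, snd z, False) = (m, n, r)" by (cases "(?h ^^ j) (fst z, snd z, False)")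
      then have "m \<le> fst z" "n \<le> snd z" using it2[of j "(fst z, snd z, False)"] by auto
      then have "sz m \<le> sz (fst z)" "sz n \<le> sz (snd z)" by (auto intro: sz_nat_mono)
      then show ?thesis using sz_bool[of r] unfolding s by (cases z) simp
    qed
    show "fst ((?h ^^ j) (fst z, snd z, False)) \<noteq> 0 \<or> fst (snd ((?h ^^ j) (fst z, snd z, False))) \<noteq> 0"
      if "j < k z" for z j using k3[OF that] unfolding it2[THEN conjunct1] it2[THEN conjunct2] P_def by simp
    show "\<not> (fst ((?h ^^ k z) (fst z, snd z, False)) \<noteq> 0 \<or> fst (snd ((?h ^^ k z) (fst z, snd z, False))) \<noteq> 0)" for z
      using k1[of z] unfolding it2[THEN conjunct1] it2[THEN conjunct2] P_def by simp
    show "k z \<le> 10 * sz z + 10" for z using k2[of z] by (cases z) simp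
  qed (intro feas_intros feas_iff feas_nat_null)+
  from feas_snd[OF feas_snd[OF feas_comp[OF this feas_pair[OF assms]]]]
  have "feas b D (\<lambda>x. snd (snd ((?h ^^ k (f x, g x)) (f x, g x, False))))" by simp
  moreover have "snd (snd ((?h ^^ k (m, n)) (m, n, False))) \<longleftrightarrow> m < n" for m n
  proof -
    obtain a c r where s: "(?h ^^ k (m, n)) (m, n, False) = (a, c, r)" by (cases "(?h ^^ k (m, n)) (m, n, False)")
    have "a = 0" "c = 0" using it2[of "k (m, n)" "(m, n, False)"] k1[of "(m, n)"] unfolding s P_def by auto
    then show ?thesis using it[of "k (m, n)" "(m, n, False)"] unfolding s by (simp add: lt_def)
  qed
  ultimately show ?thesis by simp
qed

lemma feas_le [feas_intros]: "feas b D f \<Longrightarrow> feas b D g \<Longrightarrow> feas b D (\<lambda>x. f x \<le> (g x :: nat))"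
  using feas_not[OF feas_less[of b D g f]] by (simp add: not_less)

text \<open>Out of range, \<open>!\<close> has unspecified values that no program can be shown to
  produce. Here the value is the fixed \<open>undefined\<close>, so that access is feasible for all
  arguments.\<close>

definition lookup :: "'a list \<Rightarrow> nat \<Rightarrow> 'a" where
  "lookup xs i = (if i < length xs then xs ! i else undefined)"

lemma lookup_nth [simp]: "i < length xs \<Longrightarrow> lookup xs i = xs ! i"
  by (simp add: lookup_def)

lemma feas_take [feas_intros]:
  fixes g :: "'a::enc \<Rightarrow> 'b::enc list"
  assumes "feas b D i" "feas b D g" shows "feas b D (\<lambda>x. take (i x) (g x))"
proof -
  let ?h = "\<lambda>i s y. if fst s < i then (Suc (fst s), y # snd s) else s"
  have e: "foldl (?h i) (0, []) ys = (min (length ys) i, rev (take i ys))" for i and ys :: "'b list"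
    by (induction ys rule: rev_induct) auto
  have "feas b UNIV (\<lambda>x :: nat \<times> 'b list. foldl (?h (fst x)) (0, []) (snd x))"
  proof (rule feas_foldl)
    show "poly_bounded (\<lambda>n. 10 * n + 10)" by auto
    fix x :: "nat \<times> 'b list" and j assume "j \<le> length (snd x)"
    then show "sz (foldl (?h (fst x)) (0, []) (take j (snd x))) \<le> 10 * sz x + 10"
      using sz_nat[of "min j (fst x)"] length_le_sz[of "snd x"] sz_take[of "min j (fst x)" "snd x"] unfolding e
      by (cases x) (simp add: min.commute)
  qed (intro feas_intros)+
  from feas_comp[OF feas_rev[OF feas_snd[OF this]] feas_pair[OF assms]] show ?thesis by (simp add: e)
qed

lemma feas_drop [feas_intros]:
  fixes g :: "'a::enc \<Rightarrow> 'b::enc list"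
  assumes "feas b D i" "feas b D g" shows "feas b D (\<lambda>x. drop (i x) (g x))"
proof -
  let ?h = "\<lambda>i s y. if fst s < i then (Suc (fst s), snd s) else (fst s, y # snd s)"
  have e: "foldl (?h i) (0, []) ys = (min (length ys) i, rev (drop i ys))" for i and ys :: "'b list"
    by (induction ys rule: rev_induct) auto
  have "feas b UNIV (\<lambda>x :: nat \<times> 'b list. foldl (?h (fst x)) (0, []) (snd x))"
  proof (rule feas_foldl)
    show "poly_bounded (\<lambda>n. 10 * n + 10)" by auto
    fix x :: "nat \<times> 'b list" and j assume "j \<le> length (snd x)"
    then show "sz (foldl (?h (fst x)) (0, []) (take j (snd x))) \<le> 10 * sz x + 10"
      using sz_nat[of "min j (fst x)"] length_le_sz[of "snd x"] sz_drop[of "fst x" "take j (snd x)"] sz_take[of j "snd x"]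
      unfolding e by (cases x) simp
  qed (intro feas_intros)+
  from feas_comp[OF feas_rev[OF feas_snd[OF this]] feas_pair[OF assms]] show ?thesis by (simp add: e)
qed

lemma feas_lookup [feas_intros]:
  fixes g :: "'a::enc \<Rightarrow> 'b::enc list"
  assumes "feas b D g" "feas b D i" shows "feas b D (\<lambda>x. lookup (g x) (i x))"
proof -
  have "feas b UNIV (\<lambda>z :: 'b list \<times> nat. case drop (snd z) (fst z) of [] \<Rightarrow> undefined | y # ys \<Rightarrow> y)"
    by (intro feas_intros)
  moreover have "(case drop j xs of [] \<Rightarrow> undefined | y # ys \<Rightarrow> y) = lookup xs j" for j and xs :: "'b list"
    by (cases "j < length xs") (auto simp: lookup_def Cons_nth_drop_Suc[symmetric])
  ultimately show ?thesis using feas_comp[of b _ D, OF _ feas_pair[OF assms]] by fastforce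
qed

section \<open>From feasible functions to Turing machines\<close>

lemma ex_machine:
  obtains K where "com_machine c K"
proof
  have "r < Suc (Max (regs c))" if "r \<in> regs c" for r
    using Max_ge[OF finite_regs that] by simp
  then show "com_machine c (Suc (Max (regs c)))" by unfold_locales auto
qed

lemma implements_run:
  assumes "implements b UNIV f c p"
  shows "ex b (p (length x) + length x) (c 0) (input_store x) (p (length x)) ((input_store x)(0 := enc (f (Raw x))))"
  using assms[unfolded implements_def, THEN conjunct2, THEN bspec, of "Raw x", THEN conjunct2, rule_format,
      of "input_store x" 0 "p (length x) + length x"]
  by (simp add: input_store_def)

lemma feas_PSPACE:
  assumes "feas False UNIV P"
  shows "{x. P (Raw x)} \<in> PSPACE"
proof -
  obtain c p where c: "implements False UNIV P c p" by (rule feasE[OF assms])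
  obtain K where K: "com_machine (c 0) K" by (rule ex_machine)
  interpret com_machine "c 0" K by (rule K)
  let ?m = "\<lambda>n. p n + n"
  have run: "\<exists>u. halted M (config_at M x u) \<and> (fst (config_at M x u) = accept_state M \<longleftrightarrow> P (Raw x))"
    and pos: "pos_ok (?m (length x)) (config_at M x u)" for x u
  proof -
    have "ex False (?m (length x)) (c 0) (input_store x) (p (length x)) ((input_store x)(0 := enc (P (Raw x))))"
      by (rule implements_run[OF c])
    then obtain t where t: "exec (?m (length x)) (c 0) (input_store x) t ((input_store x)(0 := enc (P (Raw x))))"
      by (auto simp: ex_def)
    show "\<exists>u. halted M (config_at M x u) \<and> (fst (config_at M x u) = accept_state M \<longleftrightarrow> P (Raw x))"
      by (rule machine_run[OF t]) (auto simp: enc_bool_def split: if_splits)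
    show "pos_ok (?m (length x)) (config_at M x u)" by (rule machine_run[OF t]) auto
  qed
  have "poly_bounded (\<lambda>n. Suc K * (2 * ?m n + 2))" using implements_pbd[OF c] by auto
  then obtain q :: "nat poly" where q: "Suc K * (2 * ?m n + 2) \<le> poly q n" for n using poly_bounded_poly by blast
  have "finite (visited_cells M x) \<and> card (visited_cells M x) \<le> poly q (length x)" for x
    using visited_bound[OF pos, of x] q[of "length x"] by linarith
  then show ?thesis using wf_M run unfolding PSPACE_def decides_def by blast
qed

lemma feas_polytime:
  assumes "feas True UNIV f"
  shows "polytime_computable (\<lambda>x. unraw (f (Raw x)))"
proof -
  obtain c p where c: "implements True UNIV f c p" by (rule feasE[OF assms])
  obtain K where K: "com_machine (c 0) K" by (rule ex_machine)
  interpret com_machine "c 0" K by (rule K)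
  have "poly_bounded (\<lambda>n. 2 * p n + 2)" using implements_pbd[OF c] by auto
  then obtain q :: "nat poly" where q: "2 * p n + 2 \<le> poly q n" for n using poly_bounded_poly by blast
  have "\<exists>u\<le>poly q (length x). halted M (config_at M x u) \<and>
      holds_word (last (snd (config_at M x u))) (unraw (f (Raw x)))" for x
  proof -
    let ?m = "p (length x) + length x"
    have "ex True ?m (c 0) (input_store x) (p (length x)) ((input_store x)(0 := enc (f (Raw x))))"
      by (rule implements_run[OF c])
    then obtain t where t: "exec ?m (c 0) (input_store x) t ((input_store x)(0 := enc (f (Raw x))))" "t \<le> p (length x)"
      by (auto simp: ex_def)
    have "sz (f (Raw x)) \<le> p (length x)" using implements_size[OF c, of "Raw x" "length x"] by simp
    then have "t + length (((input_store x)(0 := enc (f (Raw x)))) 0) + 2 \<le> poly q (length x)"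
      using q[of "length x"] t(2) by simp
    moreover obtain u where "u \<le> t + length (((input_store x)(0 := enc (f (Raw x)))) 0) + 2" "halted M (config_at M x u)"
      "holds_word (last (snd (config_at M x u))) (((input_store x)(0 := enc (f (Raw x)))) 0)"
      by (rule machine_run[OF t(1)]) auto
    ultimately show ?thesis by (auto simp: enc_raw_def intro: le_trans)
  qed
  then show ?thesis using wf_M unfolding polytime_computable_def by blast
qed

lemma feas_unraw: "feas b D f \<Longrightarrow> feas b D (\<lambda>x. unraw (f x))"
  by (rule feas_comp[OF feas_enc[where 'a = raw, unfolded enc_raw_def]])

text \<open>Counterparts of the records built from pairs and lists, which have codes and feasible
  projections.\<close>

type_synonym dpa_tuple = "nat \<times> nat list list \<times> nat list"
type_synonym player_tuple = "dpa_tuple list \<times> (nat \<times> nat) list"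
type_synonym game_tuple = "nat list \<times> (nat \<times> nat) list \<times> player_tuple list"

definition mk_dpa :: "dpa_tuple \<Rightarrow> dpa_rep" where
  "mk_dpa A = \<lparr>rep_initial = fst A, rep_succ = fst (snd A), rep_priority = snd (snd A)\<rparr>"

definition mk_player :: "player_tuple \<Rightarrow> player_rep" where
  "mk_player P = \<lparr>rep_automata = map mk_dpa (fst P), rep_pref = snd P\<rparr>"

definition mk_game :: "game_tuple \<Rightarrow> game_rep" where
  "mk_game R = \<lparr>rep_owner = fst R, rep_edges = fst (snd R), rep_players = map mk_player (snd (snd R))\<rparr>"

lemma encode_list_map: "encode_list e (map f xs) = encode_list (\<lambda>x. e (f x)) xs"
  by (simp add: encode_list_def comp_def)

lemma encode_mk:
  "encode_dpa (mk_dpa A) = encode_nat (fst A) @ encode_list (encode_list encode_nat) (fst (snd A)) @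
    encode_list encode_nat (snd (snd A))"
  "encode_player (mk_player P) = encode_list (\<lambda>A. encode_dpa (mk_dpa A)) (fst P) @ encode_list encode_pair (snd P)"
  "encode_game (mk_game R) = encode_list encode_nat (fst R) @ encode_list encode_pair (fst (snd R)) @
    encode_list (\<lambda>P. encode_player (mk_player P)) (snd (snd R))"
  by (simp_all add: mk_dpa_def mk_player_def mk_game_def encode_dpa_def encode_player_def encode_game_def encode_list_map)

lemma feas_encode_list [feas_intros]:
  assumes "feas b UNIV (\<lambda>z. e (fst z) (snd z))" "feas b D g"
  shows "feas b D (\<lambda>x. encode_list (\<lambda>y. e x y) (g x))"
  unfolding encode_list_def by (intro feas_intros assms)

lemma feas_encode_nat [feas_intros]: "feas b D f \<Longrightarrow> feas b D (\<lambda>x. encode_nat (f x))"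
  unfolding encode_nat_def enc_nat_def[symmetric] by (intro feas_intros feas_comp[OF feas_enc])

lemma feas_encode_pair [feas_intros]: "feas b D f \<Longrightarrow> feas b D (\<lambda>x. encode_pair (f x))"
  unfolding encode_pair_def by (intro feas_intros)

lemma feas_encode_instance:
  assumes "feas b D R" "feas b D v" "feas b D ps"
  shows "feas b D (\<lambda>x. encode_instance (mk_game (R x), v x, ps x))"
  unfolding encode_instance_def case_prod_conv encode_mk by (intro feas_intros assms)


subsection \<open>Hardness\<close>

lemma limit_eventually_const: "(\<And>k. k \<ge> n \<Longrightarrow> f k = c) \<Longrightarrow> limit f = {c}"
proof -
  assume c: "\<And>k. k \<ge> n \<Longrightarrow> f k = c"
  have "\<exists>k>m. f k = c" for m by (rule exI[of _ "m + n + 1"]) (simp add: c)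
  moreover have "a = c" if "\<forall>m. \<exists>k>m. f k = a" for a using that c by (metis less_imp_le)
  ultimately show ?thesis by (auto simp: limit_def INFM_nat)
qed

lemma limit_comp_inj:
  assumes "inj g" shows "limit (g \<circ> f) = g ` limit f"
proof -
  have "a \<in> g ` limit f" if a: "\<forall>m. \<exists>k>m. g (f k) = a" for a
  proof -
    obtain k where "g (f k) = a" using a by blast
    then have "f k \<in> limit f" "a = g (f k)" using a assms by (auto simp: limit_def INFM_nat inj_eq)
    then show ?thesis by blast
  qed
  then show ?thesis by (auto simp: limit_def INFM_nat)
qed

lemma limit_finite_range:
  assumes "finite (range f)"
  shows "finite (limit f)" "limit f \<noteq> {}"
  using assms limit_nonempty[OF assms] finite_subset[OF limit_in_range assms] by auto

lemma run_states:
  assumes "wf_dpa V B" "w \<in> omega_words V"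
  shows "run B w k \<in> states B"
  using assms by (induction k) (auto simp: wf_dpa_def omega_words_def)

lemma run_less: "wf_dpa_rep n B \<Longrightarrow> w \<in> omega_words {..<n} \<Longrightarrow> run (dpa_of B) w t < length (rep_succ B)"
  using run_states[of "{..<n}" "dpa_of B" w t] by (simp add: wf_dpa_rep_def dpa_of_def)

lemma omega_words_less: "w \<in> omega_words {..<n} \<Longrightarrow> w t < n"
  by (auto simp: omega_words_def)

text \<open>Raising every priority by one flips the parity of the limit maximum.\<close>

definition complement_rep :: "dpa_rep \<Rightarrow> dpa_rep" where
  "complement_rep B = B\<lparr>rep_priority := map Suc (rep_priority B)\<rparr>"

lemma complement_rep:
  assumes B: "wf_dpa_rep n B"
  shows "wf_dpa_rep n (complement_rep B)"
    and "dpa_language {..<n} (dpa_of (complement_rep B)) = omega_words {..<n} - dpa_language {..<n} (dpa_of B)"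
proof -
  show "wf_dpa_rep n (complement_rep B)"
    using B by (simp add: wf_dpa_rep_def complement_rep_def wf_dpa_def dpa_of_def)
  have "even (Max (limit (priority (dpa_of (complement_rep B)) \<circ> run (dpa_of (complement_rep B)) w))) \<longleftrightarrow>
      odd (Max (limit (priority (dpa_of B) \<circ> run (dpa_of B) w)))" if w: "w \<in> omega_words {..<n}" for w
  proof -
    have wf: "wf_dpa {..<n} (dpa_of B)" using B by (simp add: wf_dpa_rep_def)
    have same: "run (dpa_of (complement_rep B)) w k = run (dpa_of B) w k" for k
      by (induction k) (simp_all add: dpa_of_def complement_rep_def)
    have "run (dpa_of B) w k < length (rep_priority B)" for k
      using run_states[OF wf w, of k] B by (simp add: dpa_of_def wf_dpa_rep_def)
    then have e: "priority (dpa_of (complement_rep B)) \<circ> run (dpa_of (complement_rep B)) w =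
        Suc \<circ> (priority (dpa_of B) \<circ> run (dpa_of B) w)"
      unfolding same[abs_def] fun_eq_iff comp_def by (simp add: dpa_of_def complement_rep_def)
    have "finite (range (run (dpa_of B) w))"
      using wf by (rule_tac finite_subset[of _ "states (dpa_of B)"]) (auto simp: run_states[OF wf w] wf_dpa_def)
    then have fin: "finite (range (priority (dpa_of B) \<circ> run (dpa_of B) w))"
      by (metis finite_imageI image_comp)
    have "limit (Suc \<circ> (priority (dpa_of B) \<circ> run (dpa_of B) w)) = Suc ` limit (priority (dpa_of B) \<circ> run (dpa_of B) w)"
      by (rule limit_comp_inj) simp
    then show ?thesis
      using limit_finite_range[OF fin] unfolding e by (simp add: mono_Max_commute[symmetric] mono_Suc)
  qed
  then show "dpa_language {..<n} (dpa_of (complement_rep B)) = omega_words {..<n} - dpa_language {..<n} (dpa_of B)"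
    by (auto simp: dpa_language_def)
qed

section \<open>Games without preferences\<close>

lemma problem_iff:
  "encode_instance (R, v, ps) \<in> constrained_ne_problem l \<longleftrightarrow> (\<exists>G.
     represents R G \<and> (\<forall>i\<in>players G. card (payoffs G i) \<le> l) \<and> v \<in> verts G \<and> length ps = length (rep_players R) \<and>
     (\<forall>i\<in>players G. ps ! i \<in> payoffs G i) \<and> constrained_ne_exists G v (\<lambda>i. ps ! i))"
  unfolding constrained_ne_problem_def by (auto simp: inj_eq[OF inj_encode_instance])

lemma outcome_props:
  assumes "wf_arena A" "profile A \<sigma>" "v \<in> verts A"
  shows "play A (outcome A \<sigma> v)" "outcome A \<sigma> v 0 = v" "\<And>i. i \<in> players A \<Longrightarrow> consistent A i (\<sigma> i) (outcome A \<sigma> v)"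
  using theI'[OF outcome_ex1[OF assms]] unfolding outcome_def by blast+

lemma outcome_eqI:
  assumes "wf_arena A" "profile A \<sigma>" "play A w" "\<And>i. i \<in> players A \<Longrightarrow> consistent A i (\<sigma> i) w"
  shows "outcome A \<sigma> (w 0) = w"
proof -
  have "w 0 \<in> verts A" using assms(3) by (auto simp: play_def)
  from outcome_ex1[OF assms(1,2) this] show ?thesis unfolding outcome_def by (rule the1_equality) (use assms in auto)
qed

text \<open>With empty preference relations every profile is an equilibrium, so the problem contains
  nonemptiness of intersections of automata.\<close>

lemma problem_intersection:
  assumes n: "v < n" and Bs: "Bs \<noteq> []" "\<And>B. B \<in> set Bs \<Longrightarrow> wf_dpa_rep n B"
    and R: "rep_owner R = replicate n 0" "set (rep_edges R) = {..<n} \<times> {..<n}"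
      "rep_players R = map (\<lambda>B. \<lparr>rep_automata = [B, complement_rep B], rep_pref = []\<rparr>) Bs"
  shows "encode_instance (R, v, replicate (length Bs) 0) \<in> constrained_ne_problem 2 \<longleftrightarrow>
    (\<exists>w\<in>omega_words {..<n}. w 0 = v \<and> (\<forall>B\<in>set Bs. w \<in> dpa_language {..<n} (dpa_of B)))"
  unfolding problem_iff
proof
  assume "\<exists>G. represents R G \<and> (\<forall>i\<in>players G. card (payoffs G i) \<le> 2) \<and> v \<in> verts G \<and>
    length (replicate (length Bs) (0::nat)) = length (rep_players R) \<and>
    (\<forall>i\<in>players G. replicate (length Bs) 0 ! i \<in> payoffs G i) \<and> constrained_ne_exists G v (\<lambda>i. replicate (length Bs) 0 ! i)"
  then obtain G \<sigma> where G: "represents R G" "v \<in> verts G" "nash_equilibrium G v \<sigma>"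
    and c: "\<And>i. i \<in> players G \<Longrightarrow> replicate (length Bs) 0 ! i = pay G i (outcome G \<sigma> v) \<or>
      (replicate (length Bs) 0 ! i, pay G i (outcome G \<sigma> v)) \<in> pref G i"
    unfolding constrained_ne_exists_def by blast
  have V: "verts G = {..<n}" and P: "players G = {..<length Bs}" using G by (auto simp: represents_def R)
  have wf: "wf_arena G" "profile G \<sigma>" using G by (auto simp: represents_def rp_game_def wf_game_def nash_equilibrium_def)
  let ?w = "outcome G \<sigma> v"
  have w: "?w \<in> omega_words {..<n}" "?w 0 = v"
    using outcome_props[OF wf G(2)] V by (auto simp: play_def omega_words_def)
  have "?w \<in> dpa_language {..<n} (dpa_of (Bs ! i))" if i: "i < length Bs" for i
  proof -
    have "pref G i = {}" and po: "payoffs G i = {..<2}"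
      and "\<forall>p\<in>payoffs G i. dpa_language (verts G) (dpa_of ([Bs ! i, complement_rep (Bs ! i)] ! p)) = pay_preimage G i p"
      using G(1) i P by (auto simp: represents_def R Let_def numeral_2_eq_2)
    from this(3) have "dpa_language (verts G) (dpa_of (Bs ! i)) = pay_preimage G i 0"
      using po by (force dest: bspec[of _ _ 0])
    moreover have "pay G i ?w = 0" using c[of i] i P \<open>pref G i = {}\<close> by auto
    ultimately show ?thesis using w V by (auto simp: pay_preimage_def)
  qed
  then show "\<exists>w\<in>omega_words {..<n}. w 0 = v \<and> (\<forall>B\<in>set Bs. w \<in> dpa_language {..<n} (dpa_of B))"
    using w by (intro bexI[of _ ?w]) (auto simp: in_set_conv_nth)
next
  assume "\<exists>w\<in>omega_words {..<n}. w 0 = v \<and> (\<forall>B\<in>set Bs. w \<in> dpa_language {..<n} (dpa_of B))"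
  then obtain w where w: "w \<in> omega_words {..<n}" "w 0 = v" "\<And>B. B \<in> set Bs \<Longrightarrow> w \<in> dpa_language {..<n} (dpa_of B)"
    by blast
  \<comment> \<open>Player \<open>0\<close>, who exists because \<open>Bs\<close> is nonempty, owns
    all vertices; the other players contribute only their automata.\<close>
  define G :: "(nat, nat, nat) game" where
    "G = \<lparr>verts = {..<n}, edges = {..<n} \<times> {..<n}, players = {..<length Bs},
      owned = (\<lambda>i. if i = 0 then {..<n} else {}), payoffs = (\<lambda>i. {..<2}), pref = (\<lambda>i. {}),
      pay = (\<lambda>i w. if w \<in> dpa_language {..<n} (dpa_of (Bs ! i)) then 0 else 1)\<rparr>"
  have Gs: "verts G = {..<n}" "edges G = {..<n} \<times> {..<n}" "players G = {..<length Bs}" "payoffs G i = {..<2}" "pref G i = {}"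
    "owned G i = (if i = 0 then {..<n} else {})" "pay G i u = (if u \<in> dpa_language {..<n} (dpa_of (Bs ! i)) then 0 else 1)" for i u
    by (simp_all add: G_def)
  have wfa: "wf_arena G"
    using n Bs by (auto simp: wf_arena_def G_def disjoint_family_on_def)
  have wfB: "wf_dpa_rep n (Bs ! i)" if "i < length Bs" for i using Bs that by auto
  have pre: "pay_preimage G i 0 = dpa_language {..<n} (dpa_of (Bs ! i))"
    "pay_preimage G i 1 = dpa_language {..<n} (dpa_of (complement_rep (Bs ! i)))" if "i < length Bs" for i
    using complement_rep(2)[OF wfB[OF that]] by (auto simp: pay_preimage_def G_def dpa_language_def)
  have reg: "omega_regular {..<n} (dpa_language {..<n} (dpa_of B))" if "wf_dpa_rep n B" for B
    using that by (auto simp: omega_regular_def wf_dpa_rep_def)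
  have two: "p < 2 \<longleftrightarrow> p = 0 \<or> p = 1" for p :: nat by auto
  have "rp_game G"
    using wfa n pre reg[OF wfB] reg[OF complement_rep(1)[OF wfB]] unfolding rp_game_def wf_game_def
    by (auto simp: Gs two)
  then have rep: "represents R G"
    using pre wfB complement_rep(1)[OF wfB] unfolding represents_def R Let_def
    by (auto simp: Gs two)
  \<comment> \<open>Every pair of vertices is an edge, so the profile can follow \<open>w\<close> by
    position alone, whatever the history is.\<close>
  define \<sigma> where "\<sigma> i h = (w (length h) :: nat)" for i :: nat and h :: "nat list"
  have prof: "profile G \<sigma>"
  proof -
    have "last h < n" if "history G h" for h
      using that subsetD[OF _ last_in_set, of h "{..<n}"] by (simp add: history_def G_def)
    moreover have "w k < n" for k using w(1) by (auto simp: omega_words_def)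
    ultimately show ?thesis by (auto simp: profile_def strategy_def \<sigma>_def G_def)
  qed
  have out: "outcome G \<sigma> v = w"
    unfolding w(2)[symmetric]
    by (rule outcome_eqI[OF wfa prof]) (use w(1) in \<open>auto simp: play_def omega_words_def consistent_def \<sigma>_def G_def\<close>)
  have "nash_equilibrium G v \<sigma>" using prof by (auto simp: nash_equilibrium_def G_def)
  moreover have "pay G i (outcome G \<sigma> v) = 0" if "i < length Bs" for i using w(3) that by (simp add: out) (simp add: G_def)
  ultimately have "constrained_ne_exists G v (\<lambda>i. replicate (length Bs) 0 ! i)"
    unfolding constrained_ne_exists_def by (intro exI[of _ \<sigma>]) (auto simp: G_def)
  then show "\<exists>G. represents R G \<and> (\<forall>i\<in>players G. card (payoffs G i) \<le> 2) \<and> v \<in> verts G \<and>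
    length (replicate (length Bs) (0::nat)) = length (rep_players R) \<and>
    (\<forall>i\<in>players G. replicate (length Bs) 0 ! i \<in> payoffs G i) \<and> constrained_ne_exists G v (\<lambda>i. replicate (length Bs) 0 ! i)"
    using rep n by (intro exI[of _ G]) (auto simp: R G_def)
qed

section \<open>Checking the run of a space-bounded machine by automata\<close>

locale space_bounded =
  fixes M :: tm
  assumes wf: "wf_tm M"
begin

abbreviation "Q \<equiv> state_count M"
abbreviation "G \<equiv> symbol_count M"
abbreviation "k \<equiv> tape_count M"

text \<open>A letter is a state with the scanned symbols, which is all that a transition depends on.
  A run becomes a word over an alphabet that is fixed with the machine, although its configurations
  are unbounded.\<close>

definition letters :: "(nat \<times> nat list) list" where
  "letters = List.product [0..<Q] (List.n_lists k [0..<G])"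

text \<open>Halting states idle, so that a halted run is still an infinite word.\<close>

definition next_action :: "nat \<times> nat list \<Rightarrow> nat \<times> (nat \<times> direction) list" where
  "next_action a = (if fst a = accept_state M \<or> fst a = reject_state M then (fst a, map (\<lambda>b. (b, Stay)) (snd a))
     else trans_fun M (fst a) (snd a))"

lemma set_letters: "(q, as) \<in> set letters \<longleftrightarrow> q < Q \<and> length as = k \<and> set as \<subseteq> {..<G}"
  by (auto simp: letters_def set_n_lists)

lemma next_action_wf:
  assumes "a \<in> set letters" "next_action a = (q', acts)"
  shows "q' < Q" "length acts = k" "\<And>j. j < k \<Longrightarrow> fst (acts ! j) < G"
proof -
  obtain q as where a: "a = (q, as)" "q < Q" "length as = k" "set as \<subseteq> {..<G}"
    using assms(1) set_letters[of "fst a" "snd a"] that[of "fst a" "snd a"] by simp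
  have "q' < Q \<and> length acts = k \<and> (\<forall>x\<in>set acts. fst x < G)"
  proof (cases "q = accept_state M \<or> q = reject_state M")
    case True
    then show ?thesis using assms(2) a by (auto simp: next_action_def)
  next
    case False
    have "case trans_fun M q as of (q', acts) \<Rightarrow> q' < Q \<and> length acts = k \<and> (\<forall>(b, d)\<in>set acts. b < G)"
      using wf a by (simp add: wf_tm_def)
    then show ?thesis using assms(2) a False by (auto simp: next_action_def)
  qed
  then show "q' < Q" "length acts = k" "\<And>j. j < k \<Longrightarrow> fst (acts ! j) < G" by auto
qed

definition config_letter :: "config \<Rightarrow> nat \<times> nat list" where
  "config_letter C = (fst C, map tape_read (snd C))"

definition config_ok :: "config \<Rightarrow> bool" where
  "config_ok C \<longleftrightarrow> fst C < Q \<and> length (snd C) = k \<and> (\<forall>T\<in>set (snd C). \<forall>z. fst T z < G)"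

lemma config_letter: "config_ok C \<Longrightarrow> config_letter C \<in> set letters"
  by (cases C) (auto simp: config_letter_def config_ok_def set_letters)

lemma tape_act_Stay: "tape_act (tape_read T, Stay) T = T"
  by (cases T) (auto simp: fun_eq_iff)

lemma step_next_action:
  assumes "config_ok C"
  shows "tm_step M C = (case next_action (config_letter C) of (q, acts) \<Rightarrow> (q, map2 tape_act acts (snd C)))"
proof (cases "halted M C")
  case True
  have "map2 tape_act (map (\<lambda>b. (b, Stay)) (map tape_read Ts)) Ts = Ts" for Ts
    by (induction Ts) (auto simp: tape_act_Stay simp del: tape_act.simps)
  then show ?thesis using True by (cases C) (auto simp: tm_step_def halted_def next_action_def config_letter_def)
next
  case False
  then show ?thesis by (simp add: tm_step_def halted_def next_action_def config_letter_def)
qed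

lemma tape_act_range: "\<forall>z. fst T z < n \<Longrightarrow> fst a < n \<Longrightarrow> fst (tape_act a T) z < n"
  by (cases T; cases a) auto

lemma config_ok_step:
  assumes "config_ok C" shows "config_ok (tm_step M C)"
proof -
  obtain q acts where n: "next_action (config_letter C) = (q, acts)" by fastforce
  note a = next_action_wf[OF config_letter[OF assms] n]
  have "fst T z < G" if T: "T \<in> set (map2 tape_act acts (snd C))" for T z
  proof -
    obtain i where i: "i < k" "T = tape_act (acts ! i) (snd C ! i)"
      using T assms a(2) by (fastforce simp: set_zip config_ok_def)
    then show ?thesis using a(3)[of i] assms unfolding i(2) by (intro tape_act_range) (auto simp: config_ok_def)
  qed
  then show ?thesis using assms a(1,2) step_next_action[OF assms] n by (auto simp: config_ok_def)
qed

lemma config_ok_at: "config_ok (config_at M x t)"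
proof (induction t)
  case 0
  have "letter b < G" for b using wf by (auto simp: wf_tm_def letter_def)
  then show ?case using wf
    by (auto simp: config_at_def start_config_def config_ok_def wf_tm_def word_tape_def)
next
  case (Suc t)
  then show ?case using config_ok_step by (simp add: config_at_def)
qed

definition head :: "bool list \<Rightarrow> nat \<Rightarrow> nat \<Rightarrow> int" where
  "head x j t = snd (snd (config_at M x t) ! j)"

definition cell :: "bool list \<Rightarrow> nat \<Rightarrow> nat \<Rightarrow> int \<Rightarrow> nat" where
  "cell x j t = fst (snd (config_at M x t) ! j)"

text \<open>A head starts at \<open>0\<close> and moves by at most one cell, so by the discrete
  intermediate value theorem it visits cells of every smaller absolute value. Reaching distance
  \<open>a\<close> thus takes more than \<open>a\<close> visited cells.\<close>

lemma head_bound: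
  assumes fin: "finite (visited_cells M x)" and card: "card (visited_cells M x) \<le> S" and j: "j < k"
  shows "\<bar>head x j t\<bar> \<le> int S"
proof -
  have step: "\<bar>head x j (Suc t) - head x j t\<bar> \<le> 1" for t
  proof -
    obtain q acts where n: "next_action (config_letter (config_at M x t)) = (q, acts)" by fastforce
    obtain T z where T: "snd (config_at M x t) ! j = (T, z)" by fastforce
    obtain b d where a: "acts ! j = (b, d)" by fastforce
    have "length acts = k" "length (snd (config_at M x t)) = k"
      using next_action_wf[OF config_letter[OF config_ok_at] n] config_ok_at[of x t] by (auto simp: config_ok_def)
    then have "snd (config_at M x (Suc t)) ! j = tape_act (b, d) (T, z)"
      using step_next_action[OF config_ok_at[of x t]] n j T a by (simp add: config_at_def)
    then show ?thesis using T by (cases d) (auto simp: head_def)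
  qed
  have 0: "head x j 0 = 0"
    using j by (cases j) (auto simp: head_def config_at_def start_config_def word_tape_def)
  have "int ` {..nat \<bar>head x j t\<bar>} \<subseteq> abs ` snd ` (visited_cells M x \<inter> {j} \<times> UNIV)" for t
  proof
    fix y assume "y \<in> int ` {..nat \<bar>head x j t\<bar>}"
    then obtain i where i: "y = int i" "int i \<le> \<bar>head x j t\<bar>" by auto
    have "\<bar>\<bar>head x j (i + 1)\<bar> - \<bar>head x j i\<bar>\<bar> \<le> 1" for i using step[of i] by simp
    then have "\<exists>i\<le>t. \<bar>head x j i\<bar> = y"
      using nat0_intermed_int_val[of t "\<lambda>i. \<bar>head x j i\<bar>" y] i 0 by auto
    then obtain i where "y = \<bar>head x j i\<bar>" by blast
    then show "y \<in> abs ` snd ` (visited_cells M x \<inter> {j} \<times> UNIV)"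
      using j by (force simp: visited_cells_def head_def)
  qed
  from card_mono[OF _ this, of t] have "Suc (nat \<bar>head x j t\<bar>) \<le> card (abs ` snd ` (visited_cells M x \<inter> {j} \<times> UNIV))"
    using fin by (simp add: card_image)
  also have "\<dots> \<le> card (visited_cells M x)"
    using fin card_image_le[of "visited_cells M x \<inter> {j} \<times> UNIV" "\<lambda>p. \<bar>snd p\<bar>"] card_mono[of "visited_cells M x"]
    by (auto simp: image_image intro: le_trans)
  finally show ?thesis using card by simp
qed

text \<open>State \<open>Suc q\<close> expects a letter with state \<open>q\<close>, and
  \<open>0\<close> is a rejecting sink. Only \<open>Suc (accept_state M)\<close> has an even
  priority, and it is the lower one, so acceptance means staying there eventually.\<close>

definition control_rep :: dpa_rep where
  "control_rep = mk_dpa (Suc (start_state M),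
     map (\<lambda>s. map (\<lambda>a. if s = Suc (fst a) then Suc (fst (next_action a)) else 0) letters) [0..<Suc Q],
     map (\<lambda>s. if s = Suc (accept_state M) then 0 else 1) [0..<Suc Q])"

text \<open>For each letter, what an automaton for tape \<open>j\<close> and symbol \<open>s\<close>
  has to know about the transition. The table depends on the machine alone and enters the reduction
  as a constant.\<close>

definition actions :: "nat \<Rightarrow> nat \<Rightarrow> (bool \<times> bool \<times> nat) list" where
  "actions j s = map (\<lambda>a. (snd a ! j = s, fst (snd (next_action a) ! j) = s,
     case snd (snd (next_action a) ! j) of Go_Left \<Rightarrow> 0 | Stay \<Rightarrow> 1 | Go_Right \<Rightarrow> 2)) letters"

text \<open>The automaton of a cell and a symbol stores, in state \<open>2 * d + b\<close>, the position \<open>d\<close> of the cell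
  relative to the head (which is at \<open>c\<close>) and whether the cell contains the symbol. States
  \<open>0\<close> and \<open>1\<close> are rejecting.\<close>

definition cell_target :: "nat \<Rightarrow> nat \<Rightarrow> nat \<Rightarrow> bool \<Rightarrow> bool \<times> bool \<times> nat \<Rightarrow> nat" where
  "cell_target c m e b act =
     (if Suc e = c \<and> fst act \<noteq> b then 0
      else let b' = (if Suc e = c then fst (snd act) else b);
               d = (if snd (snd act) = 0 then Suc (Suc e) else if snd (snd act) = 1 then Suc e else e)
           in if d < m then (if b' then Suc (2 * d) else 2 * d) else 0)"

text \<open>Position \<open>0\<close> belongs to the two rejecting states. The pair of rows with
  index \<open>e\<close> is therefore the one for position \<open>Suc e\<close>.\<close>

definition cell_rows :: "nat \<Rightarrow> nat \<Rightarrow> (bool \<times> bool \<times> nat) list \<Rightarrow> nat list list" where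
  "cell_rows c m L = [map (\<lambda>_. 0) L, map (\<lambda>_. 0) L] @
     concat (map (\<lambda>e. [map (cell_target c m e False) L, map (cell_target c m e True) L]) [0..<m - 1])"

definition cell_priorities :: "nat \<Rightarrow> nat list" where
  "cell_priorities m = [1, 1] @ concat (map (\<lambda>e. [0, 0]) [0..<m - 1])"

definition cell_rep :: "nat \<Rightarrow> nat \<Rightarrow> nat \<Rightarrow> bool \<Rightarrow> (bool \<times> bool \<times> nat) list \<Rightarrow> dpa_rep" where
  "cell_rep c m d b L = mk_dpa ((if b then Suc (2 * d) else 2 * d), cell_rows c m L, cell_priorities m)"

lemma nth_pairs: "d < n \<Longrightarrow> concat (map (\<lambda>e. [f e, g e]) [0..<n]) ! (2 * d) = f d"
  "d < n \<Longrightarrow> concat (map (\<lambda>e. [f e, g e]) [0..<n]) ! Suc (2 * d) = g d"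
  "length (concat (map (\<lambda>e. [f e, g e]) [0..<n])) = 2 * n"
proof -
  show len: "length (concat (map (\<lambda>e. [f e, g e]) [0..<n])) = 2 * n" for n by (induction n) auto
  show "d < n \<Longrightarrow> concat (map (\<lambda>e. [f e, g e]) [0..<n]) ! (2 * d) = f d"
    and "d < n \<Longrightarrow> concat (map (\<lambda>e. [f e, g e]) [0..<n]) ! Suc (2 * d) = g d"
    by (induction n) (auto simp: nth_append len less_Suc_eq)
qed

end

context space_bounded
begin

abbreviation "N \<equiv> length letters"

lemma wf_states: "start_state M < Q" "accept_state M < Q" "0 < k"
  using wf unfolding wf_tm_def by (elim conjE; simp)+

text \<open>If the cell and the head are both within distance \<open>S\<close> of the origin, the
  shifted difference lies between \<open>1\<close> and \<open>4 * S + 1\<close>. The shift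
  \<open>2 * S + 1\<close> thus avoids the rejecting states, and \<open>4 * S + 2\<close> positions
  suffice.\<close>

definition cell_state :: "bool list \<Rightarrow> nat \<Rightarrow> nat \<Rightarrow> nat \<Rightarrow> int \<Rightarrow> nat \<Rightarrow> nat" where
  "cell_state x S j s z t = (let d = nat (2 * int S + 1 + z - head x j t) in
     if cell x j t z = s then Suc (2 * d) else 2 * d)"

definition the_cell_rep :: "bool list \<Rightarrow> nat \<Rightarrow> nat \<Rightarrow> nat \<Rightarrow> int \<Rightarrow> dpa_rep" where
  "the_cell_rep x S j s z =
     cell_rep (2 * S + 1) (4 * S + 2) (nat (2 * int S + 1 + z)) (cell x j 0 z = s) (actions j s)"

lemma control_succ:
  assumes "s \<le> Q" "i < N"
  shows "succ (dpa_of control_rep) s i =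
    (if s = Suc (fst (letters ! i)) then Suc (fst (next_action (letters ! i))) else 0)"
  using assms by (simp add: control_rep_def mk_dpa_def dpa_of_def del: upt_Suc)

lemma control_priority:
  "s \<le> Q \<Longrightarrow> priority (dpa_of control_rep) s = (if s = Suc (accept_state M) then 0 else 1)"
  by (simp add: control_rep_def mk_dpa_def dpa_of_def del: upt_Suc)

lemma next_state: "i < N \<Longrightarrow> fst (next_action (letters ! i)) < Q"
  using next_action_wf(1)[of "letters ! i"] by (cases "next_action (letters ! i)") auto

lemma wf_control: "wf_dpa_rep N control_rep"
proof -
  have start: "start_state M < Q" by (rule wf_states)
  have ok: "succ (dpa_of control_rep) s i < Suc Q" if "s < Suc Q" "i < N" for s i
    using control_succ[of s i] that next_state[of i] by simp
  have "states (dpa_of control_rep) = {..<Suc Q}" "initial (dpa_of control_rep) < Suc Q"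
    using start by (simp_all add: control_rep_def mk_dpa_def dpa_of_def del: upt_Suc)
  then have "wf_dpa {..<N} (dpa_of control_rep)" using ok by (simp add: wf_dpa_def del: upt_Suc)
  then show ?thesis
    unfolding wf_dpa_rep_def by (auto simp: control_rep_def mk_dpa_def simp del: upt_Suc)
qed

lemma cell_length: "length (cell_rows c (Suc m) L) = 2 * Suc m" "length (cell_priorities (Suc m)) = 2 * Suc m"
  by (simp_all add: cell_rows_def cell_priorities_def nth_pairs(3) del: length_concat)

lemma cell_rows_nth:
  assumes "e < m"
  shows "cell_rows c (Suc m) L ! Suc (Suc (2 * e)) = map (cell_target c (Suc m) e False) L"
    and "cell_rows c (Suc m) L ! Suc (Suc (Suc (2 * e))) = map (cell_target c (Suc m) e True) L"
    and "cell_rows c (Suc m) L ! 0 = map (\<lambda>_. 0) L" "cell_rows c (Suc m) L ! Suc 0 = map (\<lambda>_. 0) L"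
  using assms by (simp_all add: cell_rows_def nth_pairs)

lemma cell_target_less: "cell_target c m e b act < 2 * m \<or> m = 0"
  by (auto simp: cell_target_def Let_def)

lemma state_cases:
  assumes "s < 2 * Suc m"
  obtains "s = 0" | "s = Suc 0" | e where "e < m" "s = Suc (Suc (2 * e))" | e where "e < m" "s = Suc (Suc (Suc (2 * e)))"
proof -
  have "s = 0 \<or> s = Suc 0 \<or> (\<exists>e<m. s = Suc (Suc (2 * e)) \<or> s = Suc (Suc (Suc (2 * e))))"
  proof (cases "s < 2")
    case False
    then obtain r where r: "s = Suc (Suc r)" by (metis add_2_eq_Suc le_Suc_ex not_less)
    have "r = 2 * (r div 2) \<or> r = Suc (2 * (r div 2))" by presburger
    moreover have "r div 2 < m" using assms r by simp
    ultimately show ?thesis using r by metis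
  next
    case True
    then have "s = 0 \<or> s = Suc 0" by linarith
    then show ?thesis by blast
  qed
  then show thesis using that by metis
qed

lemma cell_rep_simps:
  "rep_succ (cell_rep c m d b L) = cell_rows c m L" "rep_priority (cell_rep c m d b L) = cell_priorities m"
  "rep_initial (cell_rep c m d b L) = (if b then Suc (2 * d) else 2 * d)"
  by (simp_all add: cell_rep_def mk_dpa_def)

lemma cell_priority:
  assumes "s < 2 * Suc m"
  shows "priority (dpa_of (cell_rep c (Suc m) d b L)) s = (if s < 2 then 1 else 0)"
  using assms by (rule state_cases) (auto simp: dpa_of_def cell_rep_simps cell_priorities_def nth_pairs)

lemma wf_cell:
  assumes "d < Suc m" "length L = N"
  shows "wf_dpa_rep N (cell_rep c (Suc m) d b L)"
proof -
  have rows: "length row = N \<and> (\<forall>i<N. row ! i < 2 * Suc m)" if row: "row \<in> set (cell_rows c (Suc m) L)" for row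
  proof -
    obtain s where s: "s < 2 * Suc m" "row = cell_rows c (Suc m) L ! s"
      using row unfolding in_set_conv_nth cell_length by blast
    show ?thesis
      using s(1)
    proof (rule state_cases)
      show ?thesis if "s = 0" using assms(2) unfolding s(2) that by (simp add: cell_rows_def)
      show ?thesis if "s = Suc 0" using assms(2) unfolding s(2) that by (simp add: cell_rows_def)
      show ?thesis if "e < m" "s = Suc (Suc (2 * e))" for e
        using assms(2) cell_target_less[of c "Suc m" e False] unfolding s(2) that cell_rows_nth(1)[OF that(1)] by simp
      show ?thesis if "e < m" "s = Suc (Suc (Suc (2 * e)))" for e
        using assms(2) cell_target_less[of c "Suc m" e True] unfolding s(2) that cell_rows_nth(2)[OF that(1)] by simp
    qed
  qed
  have "cell_rows c (Suc m) L ! s ! i < 2 * Suc m" if "s < 2 * Suc m" "i < N" for s i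
    using rows[OF nth_mem, of s] that by (simp add: cell_length)
  then show ?thesis
    using rows assms(1) unfolding wf_dpa_rep_def wf_dpa_def
    by (auto simp: dpa_of_def cell_rep_simps cell_length)
qed

text \<open>The states \<open>0\<close> and \<open>1\<close> have odd priority and cannot be left,
  all others have priority \<open>0\<close>: a safety condition.\<close>

lemma cell_language:
  assumes d: "d < Suc m" and L: "length L = N" and w: "w \<in> omega_words {..<N}"
  shows "w \<in> dpa_language {..<N} (dpa_of (cell_rep c (Suc m) d b L)) \<longleftrightarrow>
    (\<forall>t. run (dpa_of (cell_rep c (Suc m) d b L)) w t \<ge> 2)" (is "_ \<longleftrightarrow> (\<forall>t. ?r t \<ge> 2)")
proof -
  have less: "?r t < 2 * Suc m" for t
    using run_less[OF wf_cell[OF d L] w] by (simp add: cell_rep_simps cell_length)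
  show ?thesis
  proof (cases "\<forall>t. ?r t \<ge> 2")
    case True
    then have "limit (priority (dpa_of (cell_rep c (Suc m) d b L)) \<circ> run (dpa_of (cell_rep c (Suc m) d b L)) w) = {0}"
      by (intro limit_eventually_const[of 0]) (simp add: cell_priority[OF less] not_less)
    then show ?thesis using True w by (simp add: dpa_language_def)
  next
    case False
    then obtain t where t: "?r t < 2" by (auto simp: not_le)
    have "?r (t + i) < 2" for i
    proof (induction i)
      case (Suc i)
      then have "?r (t + i) = 0 \<or> ?r (t + i) = Suc 0" by auto
      then have "cell_rows c (Suc m) L ! ?r (t + i) = map (\<lambda>_. 0) L" by (auto simp: cell_rows_def)
      then have "?r (Suc (t + i)) = 0"
        using omega_words_less[OF w, of "t + i"] L by (simp add: dpa_of_def cell_rep_simps)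
      then show ?case by simp
    qed (use t in simp)
    then have "?r u < 2" if "u \<ge> t" for u using that le_Suc_ex by blast
    then have "limit (priority (dpa_of (cell_rep c (Suc m) d b L)) \<circ> run (dpa_of (cell_rep c (Suc m) d b L)) w) = {1}"
      by (intro limit_eventually_const[of t]) (simp add: cell_priority[OF less])
    then show ?thesis using False by (simp add: dpa_language_def)
  qed
qed

lemma control_language:
  assumes w: "w \<in> omega_words {..<N}"
  shows "w \<in> dpa_language {..<N} (dpa_of control_rep) \<Longrightarrow> run (dpa_of control_rep) w t \<noteq> 0"
    and "w \<in> dpa_language {..<N} (dpa_of control_rep) \<Longrightarrow> \<exists>t. run (dpa_of control_rep) w t = Suc (accept_state M)"
    and "(\<And>u. u \<ge> t \<Longrightarrow> run (dpa_of control_rep) w u = Suc (accept_state M)) \<Longrightarrow> w \<in> dpa_language {..<N} (dpa_of control_rep)"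
proof -
  let ?r = "run (dpa_of control_rep) w"
  have less: "?r t \<le> Q" for t
    using run_less[OF wf_control w, of t] by (simp add: control_rep_def mk_dpa_def)
  have acc: "Suc (accept_state M) \<le> Q" using wf_states(2) by (simp add: Suc_le_eq)
  have never: "w \<notin> dpa_language {..<N} (dpa_of control_rep)"
    if "\<And>u. u \<ge> t \<Longrightarrow> ?r u \<noteq> Suc (accept_state M)" for t
  proof -
    have "limit (priority (dpa_of control_rep) \<circ> ?r) = {1}"
      by (intro limit_eventually_const[of t]) (simp add: control_priority[OF less] that)
    then show ?thesis by (simp add: dpa_language_def)
  qed
  show "?r t \<noteq> 0" if "w \<in> dpa_language {..<N} (dpa_of control_rep)"
  proof
    assume 0: "?r t = 0"
    have "?r (t + i) = 0" for i
    proof (induction i)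
      case (Suc i)
      then show ?case using control_succ[of 0 "w (t + i)"] omega_words_less[OF w] by simp
    qed (use 0 in simp)
    then have "?r u \<noteq> Suc (accept_state M)" if "u \<ge> t" for u using that le_Suc_ex[OF that] by auto
    from never[OF this] that show False by simp
  qed
  show "\<exists>t. ?r t = Suc (accept_state M)" if "w \<in> dpa_language {..<N} (dpa_of control_rep)"
    using never[of 0] that by auto
  show "w \<in> dpa_language {..<N} (dpa_of control_rep)" if "\<And>u. u \<ge> t \<Longrightarrow> ?r u = Suc (accept_state M)"
  proof -
    have "limit (priority (dpa_of control_rep) \<circ> ?r) = {0}"
      by (intro limit_eventually_const[of t]) (simp add: that control_priority[OF acc])
    then show ?thesis using w by (simp add: dpa_language_def)
  qed
qed

lemma config_step:
  assumes "j < k"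
  shows "fst (config_at M x (Suc t)) = fst (next_action (config_letter (config_at M x t)))"
    and "cell x j (Suc t) = (cell x j t)(head x j t := fst (snd (next_action (config_letter (config_at M x t))) ! j))"
    and "head x j (Suc t) = (case snd (snd (next_action (config_letter (config_at M x t))) ! j) of
      Go_Left \<Rightarrow> head x j t - 1 | Stay \<Rightarrow> head x j t | Go_Right \<Rightarrow> head x j t + 1)"
proof -
  obtain q acts where n: "next_action (config_letter (config_at M x t)) = (q, acts)" by fastforce
  obtain T z where T: "snd (config_at M x t) ! j = (T, z)" by fastforce
  obtain b d where a: "acts ! j = (b, d)" by fastforce
  have len: "length acts = k" "length (snd (config_at M x t)) = k"
    using next_action_wf[OF config_letter[OF config_ok_at] n] config_ok_at[of x t] by (auto simp: config_ok_def)
  have S: "config_at M x (Suc t) = (q, map2 tape_act acts (snd (config_at M x t)))"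
    using step_next_action[OF config_ok_at[of x t]] n by (simp add: config_at_def)
  show "fst (config_at M x (Suc t)) = fst (next_action (config_letter (config_at M x t)))" by (simp add: S n)
  show "cell x j (Suc t) = (cell x j t)(head x j t := fst (snd (next_action (config_letter (config_at M x t))) ! j))"
    "head x j (Suc t) = (case snd (snd (next_action (config_letter (config_at M x t))) ! j) of
      Go_Left \<Rightarrow> head x j t - 1 | Stay \<Rightarrow> head x j t | Go_Right \<Rightarrow> head x j t + 1)"
    using len assms by (auto simp: S n cell_def head_def T a split: direction.splits)
qed

lemma letter_nth: "j < k \<Longrightarrow> snd (config_letter (config_at M x t)) ! j = cell x j t (head x j t)"
  using config_ok_at[of x t]
  by (cases "snd (config_at M x t) ! j") (simp add: config_letter_def config_ok_def cell_def head_def)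

text \<open>The bounds on \<open>z\<close> and on the heads keep the distance inside the table. A
  letter makes a claim about the cell under the head only, and the automaton of that cell compares
  it with the stored bit.\<close>

lemma cell_step:
  fixes s :: nat
  assumes heads: "\<And>t. \<bar>head x j t\<bar> \<le> int S" and j: "j < k" and z: "\<bar>z\<bar> \<le> int S" and i: "i < N"
  defines "B \<equiv> dpa_of (the_cell_rep x S j s z)"
  shows "letters ! i = config_letter (config_at M x t) \<Longrightarrow> succ B (cell_state x S j s z t) i = cell_state x S j s z (Suc t)"
    and "z = head x j t \<Longrightarrow> (snd (letters ! i) ! j = s) \<noteq> (cell x j t z = s) \<Longrightarrow> succ B (cell_state x S j s z t) i = 0"
    and "cell_state x S j s z t \<ge> 2"
proof -
  define d where "d t = 2 * int S + 1 + z - head x j t" for t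
  have d: "1 \<le> d t" "d t \<le> 4 * int S + 1" for t using heads[of t] z by (auto simp: d_def)
  define e where "e = nat (d t - 1)"
  have e: "nat (d t) = Suc e" "e < 4 * S + 1" using d[of t] by (auto simp: e_def)
  have cs: "cell_state x S j s z t = (if cell x j t z = s then Suc (Suc (Suc (2 * e))) else Suc (Suc (2 * e)))"
    using e(1) by (simp add: cell_state_def d_def Let_def)
  show "cell_state x S j s z t \<ge> 2" by (simp add: cs)
  have len: "length (actions j s) = N" by (simp add: actions_def)
  have m: "4 * S + 2 = Suc (4 * S + 1)" by simp
  have su: "succ B (cell_state x S j s z t) i =
      cell_target (2 * S + 1) (4 * S + 2) e (cell x j t z = s) (actions j s ! i)"
    using cell_rows_nth[OF e(2), of "2 * S + 1" "actions j s"] i len unfolding B_def the_cell_rep_def m cs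
    by (simp add: dpa_of_def cell_rep_simps)
  have at: "Suc e = 2 * S + 1 \<longleftrightarrow> z = head x j t"
    using d[of t] unfolding e(1)[symmetric] by (auto simp: d_def)
  show "succ B (cell_state x S j s z t) i = 0"
    if "z = head x j t" "(snd (letters ! i) ! j = s) \<noteq> (cell x j t z = s)"
    using that at unfolding su by (simp add: cell_target_def actions_def i)
  show "succ B (cell_state x S j s z t) i = cell_state x S j s z (Suc t)"
    if l: "letters ! i = config_letter (config_at M x t)"
  proof -
    define act where "act = snd (next_action (config_letter (config_at M x t))) ! j"
    have A: "actions j s ! i = (cell x j t (head x j t) = s, fst act = s,
        case snd act of Go_Left \<Rightarrow> 0 | Stay \<Rightarrow> 1 | Go_Right \<Rightarrow> 2)"
      using i by (simp add: actions_def l act_def letter_nth[OF j])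
    have C: "cell x j (Suc t) z = (if z = head x j t then fst act else cell x j t z)"
      by (simp add: config_step(2)[OF j] act_def)
    have D: "nat (d (Suc t)) = (case snd act of Go_Left \<Rightarrow> Suc (Suc e) | Stay \<Rightarrow> Suc e | Go_Right \<Rightarrow> e)"
      using e(1) d[of t] by (auto simp: d_def config_step(3)[OF j] act_def split: direction.splits)
    have D': "nat (d (Suc t)) < 4 * S + 2" using d(2)[of "Suc t"] by linarith
    have r: "cell_state x S j s z (Suc t) = (if (if z = head x j t then fst act else cell x j t z) = s
        then Suc (2 * nat (d (Suc t))) else 2 * nat (d (Suc t)))"
      by (simp add: cell_state_def C d_def Let_def)
    show ?thesis
      unfolding su A r cell_target_def at fst_conv snd_conv Let_def
      using D D' by (auto split: direction.splits)
  qed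
qed

definition all_reps :: "bool list \<Rightarrow> nat \<Rightarrow> dpa_rep list" where
  "all_reps x S = control_rep # concat (map (\<lambda>(j, s). map (\<lambda>e. the_cell_rep x S j s (int e - int S)) [0..<2 * S + 1])
     (List.product [0..<k] [0..<G]))"

lemma set_all_reps:
  "set (all_reps x S) = insert control_rep {the_cell_rep x S j s z | j s z. j < k \<and> s < G \<and> \<bar>z\<bar> \<le> int S}"
proof -
  have "(\<lambda>e. int e - int S) ` {0..<Suc (2 * S)} = {z. \<bar>z\<bar> \<le> int S}"
  proof (intro equalityI subsetI)
    fix z assume "z \<in> {z. \<bar>z\<bar> \<le> int S}"
    then have "z = int (nat (z + int S)) - int S" "nat (z + int S) \<in> {0..<Suc (2 * S)}" by auto
    then show "z \<in> (\<lambda>e. int e - int S) ` {0..<Suc (2 * S)}" by blast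
  qed auto
  then have im: "(\<lambda>e. the_cell_rep x S j s (int e - int S)) ` {0..<Suc (2 * S)} = the_cell_rep x S j s ` {z. \<bar>z\<bar> \<le> int S}"
    for j s by (metis image_image)
  have "set (all_reps x S) = insert control_rep (\<Union>(j, s)\<in>{0..<k} \<times> {0..<G}. the_cell_rep x S j s ` {z. \<bar>z\<bar> \<le> int S})"
    unfolding all_reps_def im[symmetric] by (auto simp del: upt_Suc)
  then show ?thesis by force
qed

lemma wf_all_reps: "B \<in> set (all_reps x S) \<Longrightarrow> wf_dpa_rep N B"
  using wf_control wf_cell[of _ "4 * S + 1"] unfolding set_all_reps
  by (auto simp: the_cell_rep_def actions_def)

lemma cell_accepts:
  assumes "w \<in> omega_words {..<N}" "\<bar>z\<bar> \<le> int S"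
  shows "w \<in> dpa_language {..<N} (dpa_of (the_cell_rep x S j s z)) \<longleftrightarrow> (\<forall>t. run (dpa_of (the_cell_rep x S j s z)) w t \<ge> 2)"
  using cell_language[of "nat (2 * int S + 1 + z)" "4 * S + 1" "actions j s" w] assms
  by (simp add: the_cell_rep_def actions_def)

lemma cell_initial: "j < k \<Longrightarrow> initial (dpa_of (the_cell_rep x S j s z)) = cell_state x S j s z 0"
  by (cases j)
    (auto simp: the_cell_rep_def cell_state_def dpa_of_def cell_rep_simps Let_def head_def config_at_def start_config_def word_tape_def)

text \<open>A word accepted by all automata is forced letter by letter: the control automaton
  dictates the state, and on each tape the automaton of the scanned cell and its true symbol
  dictates the symbol. Conversely, the word of an accepting run satisfies all of them.\<close>

theorem simulation:
  assumes fin: "finite (visited_cells M x)" and card: "card (visited_cells M x) \<le> S"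
  shows "(\<exists>w\<in>omega_words {..<N}. w 0 = index_of letters (config_letter (start_config M x)) \<and>
      (\<forall>B\<in>set (all_reps x S). w \<in> dpa_language {..<N} (dpa_of B))) \<longleftrightarrow>
    (\<exists>t. fst (config_at M x t) = accept_state M)"
proof -
  have heads: "\<bar>head x j t\<bar> \<le> int S" if "j < k" for j t by (rule head_bound[OF fin card that])
  have idx: "index_of letters (config_letter (config_at M x t)) < N \<and>
      letters ! index_of letters (config_letter (config_at M x t)) = config_letter (config_at M x t)" for t
    by (rule index_of[OF config_letter[OF config_ok_at]])
  have Q: "fst (config_at M x t) < Q" for t using config_ok_at[of x t] by (simp add: config_ok_def)
  define P where "P w t \<longleftrightarrow> run (dpa_of control_rep) w t = Suc (fst (config_at M x t)) \<and>
      (\<forall>j s z. j < k \<longrightarrow> s < G \<longrightarrow> \<bar>z\<bar> \<le> int S \<longrightarrow> run (dpa_of (the_cell_rep x S j s z)) w t = cell_state x S j s z t)" for w t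
  have k0: "0 < k" by (rule wf_states)
  have P0: "P w 0" for w
    by (simp add: P_def cell_initial) (simp add: control_rep_def mk_dpa_def dpa_of_def config_at_def start_config_def)
  have PS: "P w (Suc t)" if "P w t" "w t < N" "letters ! w t = config_letter (config_at M x t)" for w t
  proof -
    have "succ (dpa_of control_rep) (Suc (fst (config_at M x t))) (w t) = Suc (fst (config_at M x (Suc t)))"
      using control_succ[of "Suc (fst (config_at M x t))" "w t"] Q[of t] that(2,3)
      unfolding config_step(1)[OF k0] by (simp add: config_letter_def)
    moreover have "succ (dpa_of (the_cell_rep x S j s z)) (cell_state x S j s z t) (w t) = cell_state x S j s z (Suc t)"
      if "j < k" "\<bar>z\<bar> \<le> int S" for j s z
      using cell_step(1)[OF heads[OF that(1)] that \<open>w t < N\<close>] \<open>letters ! w t = _\<close> by blast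
    ultimately show ?thesis using that(1) by (simp add: P_def)
  qed
  show ?thesis
  proof
    assume "\<exists>w\<in>omega_words {..<N}. w 0 = index_of letters (config_letter (start_config M x)) \<and>
      (\<forall>B\<in>set (all_reps x S). w \<in> dpa_language {..<N} (dpa_of B))"
    then obtain w where w: "w \<in> omega_words {..<N}"
      and ctl: "w \<in> dpa_language {..<N} (dpa_of control_rep)"
      and cells: "\<And>j s z. j < k \<Longrightarrow> s < G \<Longrightarrow> \<bar>z\<bar> \<le> int S \<Longrightarrow> w \<in> dpa_language {..<N} (dpa_of (the_cell_rep x S j s z))"
      unfolding set_all_reps by blast
    note wN = omega_words_less[OF w]
    have "P w t" for t
    proof (induction t)
      case (Suc t)
      obtain q as where l: "letters ! w t = (q, as)" by fastforce
      have as: "length as = k" "set as \<subseteq> {..<G}"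
        using set_letters[of q as] nth_mem[OF wN[of t]] by (auto simp: l)
      have "succ (dpa_of control_rep) (Suc (fst (config_at M x t))) (w t) \<noteq> 0"
        using control_language(1)[OF w ctl, of "Suc t"] Suc by (simp add: P_def)
      then have "q = fst (config_at M x t)"
        using control_succ[of "Suc (fst (config_at M x t))" "w t"] Q[of t] wN[of t] by (simp add: l split: if_splits)
      moreover have "as = map tape_read (snd (config_at M x t))"
      proof (rule nth_equalityI)
        show len: "length as = length (map tape_read (snd (config_at M x t)))"
          using as config_ok_at[of x t] by (simp add: config_ok_def)
        fix j assume "j < length as"
        then have j: "j < k" using as by simp
        \<comment> \<open>The automaton for the symbol that is actually scanned: it rejects every
          letter that claims another one.\<close>
        define s where "s = cell x j t (head x j t)"
        have s: "s < G" using config_ok_at[of x t] j by (simp add: s_def cell_def config_ok_def)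
        have "succ (dpa_of (the_cell_rep x S j s (head x j t))) (cell_state x S j s (head x j t) t) (w t) \<noteq> 0"
        proof -
          have "2 \<le> run (dpa_of (the_cell_rep x S j s (head x j t))) w (Suc t)"
            using cells[OF j s heads[OF j, of t]] cell_accepts[OF w heads[OF j, of t], of x j s] by blast
          moreover have "run (dpa_of (the_cell_rep x S j s (head x j t))) w t = cell_state x S j s (head x j t) t"
            using Suc j s heads[OF j, of t] by (simp add: P_def)
          ultimately show ?thesis by simp
        qed
        then have "as ! j = s"
          using cell_step(2)[OF heads[OF j] j heads[OF j] wN[of t], of t t s] by (auto simp: l s_def)
        then show "as ! j = map tape_read (snd (config_at M x t)) ! j"
          using letter_nth[OF j, of x t] by (simp add: s_def config_letter_def)
      qed
      ultimately have "letters ! w t = config_letter (config_at M x t)" by (simp add: l config_letter_def)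
      from PS[OF Suc wN this] show ?case .
    qed (rule P0)
    then show "\<exists>t. fst (config_at M x t) = accept_state M"
      using control_language(2)[OF w ctl] by (auto simp: P_def)
  next
    assume "\<exists>t. fst (config_at M x t) = accept_state M"
    then obtain t where t: "fst (config_at M x t) = accept_state M" by blast
    define w where "w t = index_of letters (config_letter (config_at M x t))" for t
    have w: "w \<in> omega_words {..<N}" using idx by (auto simp: omega_words_def w_def)
    have P: "P w u" for u by (induction u) (use P0 PS idx in \<open>auto simp: w_def\<close>)
    have "fst (config_at M x (t + i)) = accept_state M" for i
      by (induction i) (use t in \<open>auto simp: config_at_def tm_step_def halted_def\<close>)
    then have "fst (config_at M x u) = accept_state M" if "u \<ge> t" for u using that le_Suc_ex by blast
    then have "w \<in> dpa_language {..<N} (dpa_of control_rep)"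
      using P by (intro control_language(3)[OF w, of t]) (simp add: P_def)
    moreover have "w \<in> dpa_language {..<N} (dpa_of (the_cell_rep x S j s z))" if "j < k" "s < G" "\<bar>z\<bar> \<le> int S" for j s z
      unfolding cell_accepts[OF w that(3)]
      using P that cell_step(3)[OF heads[OF that(1)] that(1,3)] idx[of 0] by (auto simp: P_def)
    ultimately show "\<exists>w\<in>omega_words {..<N}. w 0 = index_of letters (config_letter (start_config M x)) \<and>
      (\<forall>B\<in>set (all_reps x S). w \<in> dpa_language {..<N} (dpa_of B))"
      using w unfolding set_all_reps by (intro bexI[of _ w]) (auto simp: w_def config_at_def)
  qed
qed

end

text \<open>Polynomial quantities are represented by lists of that length, because folds, maps and
  \<open>[0..<length xs]\<close> are feasible on lists.\<close>

primrec power_list :: "bool list \<Rightarrow> nat \<Rightarrow> bool list" where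
  "power_list xs 0 = [True]"
| "power_list xs (Suc i) = concat (map (\<lambda>_. power_list xs i) xs)"

lemma length_power_list: "length (power_list xs i) = length xs ^ i"
proof (induction i)
  case (Suc i)
  have "length (concat (map (\<lambda>_. zs) ys)) = length ys * length zs" for zs ys :: "bool list"
    by (induction ys) auto
  then show ?case by (simp add: Suc del: length_concat)
qed simp

lemma feas_power_list: "feas b D f \<Longrightarrow> feas b D (\<lambda>x. power_list (f x) i)"
proof (rule feas_comp[of b "\<lambda>xs. power_list xs i"])
  show "feas b UNIV (\<lambda>xs. power_list xs i)"
    by (induction i) (auto intro!: feas_intros intro: feas_comp)
qed

lemma poly_le_power:
  fixes q :: "nat poly"
  shows "\<exists>i. \<forall>n. poly q n \<le> (n + 2) ^ i"
proof (induction q)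
  case (pCons a q)
  then obtain i where i: "\<And>n. poly q n \<le> (n + 2) ^ i" by blast
  have "poly_bounded (\<lambda>n. a + n * (n + 2) ^ i)"
  proof -
    have "poly_bounded (\<lambda>n. (n + 2) ^ i)" by (rule poly_boundedI) (auto simp: mono_def intro!: power_mono)
    then show ?thesis by auto
  qed
  then obtain j where "\<And>n. a + n * (n + 2) ^ i \<le> (n + 2) ^ j" by (auto simp: poly_bounded_def)
  then have "poly (pCons a q) n \<le> (n + 2) ^ j" for n
    using i[of n] by (simp add: le_trans[OF add_left_mono[OF mult_left_mono]])
  then show ?case by blast
qed auto

context space_bounded
begin

definition cell_constants :: "(bool \<times> nat \<times> (bool \<times> bool \<times> nat) list) list" where
  "cell_constants = map (\<lambda>p. (fst p = 0, snd p, actions (fst p) (snd p))) (List.product [0..<k] [0..<G])"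

text \<open>For \<open>length U = S\<close> the cells from \<open>-S\<close> to \<open>S\<close> of
  the input tape: \<open>S\<close> blanks, then the input from cell \<open>0\<close> on, then blanks
  up to the \<open>S + 1\<close> cells that \<open>True # U\<close> counts.\<close>

definition initial_cells :: "bool list \<Rightarrow> bool list \<Rightarrow> nat list" where
  "initial_cells U xs = map (\<lambda>_. 0) U @ map (\<lambda>a. if a then 2 else 1) xs @ map (\<lambda>_. 0) (drop (length xs) (True # U))"

definition control_tuple :: dpa_tuple where
  "control_tuple = (rep_initial control_rep, rep_succ control_rep, rep_priority control_rep)"

text \<open>The list \<open>all_reps\<close> with lists instead of numbers, so that feasibility
  follows by composition: \<open>U\<close> stands for \<open>S\<close> and \<open>W\<close> for
  \<open>4 * S + 2\<close>. Entry \<open>e\<close> of the shortened interval is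
  \<open>S + 1 + e\<close>, the initial position of the cell \<open>e - S\<close>.\<close>

definition rep_tuples :: "bool list \<Rightarrow> bool list \<Rightarrow> bool list \<Rightarrow> dpa_tuple list" where
  "rep_tuples U W xs = control_tuple # concat (map (\<lambda>a. map (\<lambda>e.
     (if (if fst a then lookup (initial_cells U xs) e else 0) = fst (snd a)
        then Suc (2 * lookup (drop (Suc (length U)) [0..<length W]) e)
        else 2 * lookup (drop (Suc (length U)) [0..<length W]) e,
      cell_rows (Suc (length (U @ U))) (length W) (snd (snd a)), cell_priorities (length W)))
     [0..<length (True # U @ U)]) cell_constants)"

lemma rep_tuples:
  assumes U: "length U = S" "length W = 4 * S + 2" and x: "length x \<le> S"
  shows "map mk_dpa (rep_tuples U W x) = all_reps x S"
proof -
  have ctl: "mk_dpa control_tuple = control_rep" by (simp add: mk_dpa_def control_tuple_def)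
  have init: "lookup (initial_cells U x) e = cell x 0 0 (int e - int S)" if e: "e < 2 * S + 1" for e
  proof -
    have "length (initial_cells U x) = 2 * S + 1" using U x by (simp add: initial_cells_def)
    then have "lookup (initial_cells U x) e = initial_cells U x ! e" using e by simp
    also have "\<dots> = cell x 0 0 (int e - int S)"
      using U(1) e x unfolding cell_def config_at_def start_config_def word_tape_def initial_cells_def
      by (auto simp: nth_append letter_def nat_diff_distrib simp del: drop_Suc_Cons)
    finally show ?thesis .
  qed
  have other: "cell x j 0 z = 0" if "j < k" "j \<noteq> 0" for j z
    using that by (cases j) (auto simp: cell_def config_at_def start_config_def word_tape_def)
  have d: "lookup (drop (Suc S) [0..<4 * S + 2]) e = nat (2 * int S + 1 + (int e - int S))" if "e < 2 * S + 1" for e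
    using that by (simp del: upt_Suc)
  have "map mk_dpa (map (\<lambda>e.
     (if (if j = 0 then lookup (initial_cells U x) e else 0) = s
        then Suc (2 * lookup (drop (Suc (length U)) [0..<length W]) e)
        else 2 * lookup (drop (Suc (length U)) [0..<length W]) e,
      cell_rows (Suc (length (U @ U))) (length W) (actions j s), cell_priorities (length W)))
     [0..<length (True # U @ U)]) = map (\<lambda>e. the_cell_rep x S j s (int e - int S)) [0..<2 * S + 1]"
    if j: "j < k" for j s
  proof -
    have len: "length (True # U @ U) = 2 * S + 1" using U by simp
    show ?thesis
      unfolding len map_map
    proof (rule map_cong[OF refl])
      fix e assume "e \<in> set [0..<2 * S + 1]"
      then have e: "e < 2 * S + 1" by (simp del: upt_Suc)
      have c: "(if j = 0 then lookup (initial_cells U x) e else 0) = cell x j 0 (int e - int S)"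
        using init[OF e] other[OF j] by simp
      show "(mk_dpa \<circ> (\<lambda>e. (if (if j = 0 then lookup (initial_cells U x) e else 0) = s
          then Suc (2 * lookup (drop (Suc (length U)) [0..<length W]) e)
          else 2 * lookup (drop (Suc (length U)) [0..<length W]) e,
          cell_rows (Suc (length (U @ U))) (length W) (actions j s), cell_priorities (length W)))) e =
        the_cell_rep x S j s (int e - int S)"
        unfolding comp_apply c the_cell_rep_def cell_rep_def U d[OF e] length_append
        by (simp add: mult_2)
    qed
  qed
  then show ?thesis
    unfolding rep_tuples_def all_reps_def list.map ctl map_concat map_map cell_constants_def
    by (auto intro!: arg_cong[where f = concat] map_cong simp del: upt_Suc)
qed

definition start_vertex :: "bool list \<Rightarrow> nat" where
  "start_vertex xs = index_of letters (start_state M,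
     (case xs of [] \<Rightarrow> 0 | a # _ \<Rightarrow> letter a) # replicate (k - 1) 0)"

lemma start_vertex: "start_vertex x = index_of letters (config_letter (start_config M x))"
proof -
  have "tape_read (word_tape x) = (case x of [] \<Rightarrow> 0 | a # _ \<Rightarrow> letter a)"
    by (auto simp: word_tape_def split: list.splits)
  moreover have "tape_read (word_tape []) = 0" by (simp add: word_tape_def)
  ultimately show ?thesis by (simp add: start_vertex_def config_letter_def start_config_def)
qed

definition instance_tuple :: "dpa_tuple list \<Rightarrow> bool list \<Rightarrow> game_tuple \<times> nat \<times> nat list" where
  "instance_tuple Bs xs = ((replicate N 0, List.product [0..<N] [0..<N],
     map (\<lambda>B. ([B, (fst B, fst (snd B), map Suc (snd (snd B)))], [])) Bs), start_vertex xs, map (\<lambda>_. 0) Bs)"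

text \<open>The exponent is \<open>Suc i\<close>, not \<open>i\<close>, so that the length of
  \<open>U\<close> exceeds the length of the input as well as the space bound.\<close>

definition reduction :: "nat \<Rightarrow> bool list \<Rightarrow> bool list" where
  "reduction i xs = (let U = power_list (xs @ [True, True]) (Suc i);
     I = instance_tuple (rep_tuples U (U @ U @ U @ U @ [True, True]) xs) xs
     in encode_instance (mk_game (fst I), fst (snd I), snd (snd I)))"

lemma reduction_correct:
  assumes fin: "finite (visited_cells M x)" and card: "card (visited_cells M x) \<le> (length x + 2) ^ i"
  shows "reduction i x \<in> constrained_ne_problem 2 \<longleftrightarrow> (\<exists>t. fst (config_at M x t) = accept_state M)"
proof -
  define S where "S = (length x + 2) ^ Suc i"
  define U where "U = power_list (x @ [True, True]) (Suc i)"
  define Bs where "Bs = rep_tuples U (U @ U @ U @ U @ [True, True]) x"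
  define R where "R = mk_game (fst (instance_tuple Bs x))"
  have "(length x + 2) ^ i \<le> S" by (simp add: S_def)
  with card have card: "card (visited_cells M x) \<le> S" by linarith
  have "length x \<le> (length x + 2) * 1" by simp
  also have "\<dots> \<le> S" unfolding S_def power_Suc by (intro mult_left_mono) auto
  finally have xS: "length x \<le> S" .
  have U: "length U = S" by (simp add: U_def S_def length_power_list del: power_list.simps)
  have Bs: "map mk_dpa Bs = all_reps x S" unfolding Bs_def by (rule rep_tuples[OF U _ xS]) (simp add: U)
  then have len: "length (all_reps x S) = length Bs" by (metis length_map)
  have v: "start_vertex x < N"
    using index_of[OF config_letter[OF config_ok_at, of x 0]] by (simp add: start_vertex config_at_def)
  have co: "mk_dpa (fst B, fst (snd B), map Suc (snd (snd B))) = complement_rep (mk_dpa B)" for B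
    by (simp add: mk_dpa_def complement_rep_def)
  have R: "rep_owner R = replicate N 0" "set (rep_edges R) = {..<N} \<times> {..<N}"
    "rep_players R = map (\<lambda>B. \<lparr>rep_automata = [B, complement_rep B], rep_pref = []\<rparr>) (all_reps x S)"
    unfolding Bs[symmetric] by (auto simp: R_def mk_game_def instance_tuple_def mk_player_def co)
  have red: "reduction i x = encode_instance (R, start_vertex x, replicate (length (all_reps x S)) 0)"
    unfolding reduction_def Let_def U_def[symmetric] Bs_def[symmetric] R_def[symmetric] len
    by (simp add: instance_tuple_def map_replicate_const)
  have ne: "all_reps x S \<noteq> []" by (simp add: all_reps_def)
  show ?thesis
    unfolding red
    by (subst problem_intersection[OF v ne _ R])
      (auto simp: wf_all_reps simulation[OF fin card, folded start_vertex])
qed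

section \<open>Feasibility of the reduction\<close>

lemma feas_cell_target [feas_intros]:
  assumes "feas b D c" "feas b D m" "feas b D e" "feas b D a" "feas b D act"
  shows "feas b D (\<lambda>x. cell_target (c x) (m x) (e x) (a x) (act x))"
  unfolding cell_target_def Let_def by (intro feas_intros feas_iff assms)

lemma feas_cell_rows [feas_intros]:
  assumes "feas b D c" "feas b D W" "feas b D L"
  shows "feas b D (\<lambda>x. cell_rows (c x) (length (W x)) (L x))"
  by (rule feas_comp3[OF _ assms, where f = "\<lambda>c W L. cell_rows c (length W) L"])
    (unfold cell_rows_def length_tl[symmetric], intro feas_intros)

lemma feas_cell_priorities [feas_intros]:
  "feas b D W \<Longrightarrow> feas b D (\<lambda>x. cell_priorities (length (W x)))"
  unfolding cell_priorities_def length_tl[symmetric] by (intro feas_intros)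

lemma feas_initial_cells [feas_intros]:
  "feas b D U \<Longrightarrow> feas b D f \<Longrightarrow> feas b D (\<lambda>x. initial_cells (U x) (f x))"
  unfolding initial_cells_def by (intro feas_intros)

lemma feas_rep_tuples:
  assumes "feas b D U" "feas b D W" "feas b D f"
  shows "feas b D (\<lambda>x. rep_tuples (U x) (W x) (f x))"
  by (rule feas_comp3[OF _ assms]) (unfold rep_tuples_def, intro feas_intros)

text \<open>Only the first bit of the input is scanned at the start, so the value is one of three
  constants.\<close>

lemma feas_start_vertex: "feas b D f \<Longrightarrow> feas b D (\<lambda>x. start_vertex (f x))"
proof (rule feas_comp[of b start_vertex])
  have "start_vertex = (\<lambda>xs. case xs of [] \<Rightarrow> start_vertex [] | a # as \<Rightarrow> if a then start_vertex [True] else start_vertex [False])"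
    by (auto simp: start_vertex_def fun_eq_iff split: list.splits)
  moreover have "feas b UNIV \<dots>" by (intro feas_intros)
  ultimately show "feas b UNIV start_vertex" by metis
qed

lemma feas_reduction: "feas b D f \<Longrightarrow> feas b D (\<lambda>x. reduction i (f x))"
proof (rule feas_comp[of b "reduction i"])
  have I: "feas b UNIV (\<lambda>z. instance_tuple (fst z) (snd z))"
    unfolding instance_tuple_def map_replicate_const[symmetric]
    by (intro feas_intros feas_start_vertex)
  show "feas b UNIV (reduction i)"
    unfolding reduction_def[abs_def] Let_def
    by (intro feas_encode_instance feas_intros feas_comp2[OF I] feas_rep_tuples feas_power_list)
qed

end

theorem hardness: "PSPACE_hard (constrained_ne_problem 2)"
  unfolding PSPACE_hard_def
proof
  fix L assume "L \<in> PSPACE"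
  then obtain M and q :: "nat poly" where M: "wf_tm M" "decides M L"
    and space: "\<And>x. finite (visited_cells M x) \<and> card (visited_cells M x) \<le> poly q (length x)"
    unfolding PSPACE_def by blast
  interpret space_bounded M by unfold_locales (rule M)
  obtain i where i: "\<And>n. poly q n \<le> (n + 2) ^ i" using poly_le_power by blast
  have "x \<in> L \<longleftrightarrow> reduction i x \<in> constrained_ne_problem 2" for x
  proof -
    have "card (visited_cells M x) \<le> (length x + 2) ^ i" using space[of x] i[of "length x"] by linarith
    from reduction_correct[OF _ this] have red: "reduction i x \<in> constrained_ne_problem 2 \<longleftrightarrow> (\<exists>t. fst (config_at M x t) = accept_state M)"
      using space by blast
    obtain t where t: "halted M (config_at M x t)" "fst (config_at M x t) = accept_state M \<longleftrightarrow> x \<in> L"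
      using M(2) unfolding decides_def by blast
    have halt: "config_at M x (u + j) = config_at M x u" if "halted M (config_at M x u)" for u j
      using that by (induction j) (auto simp: config_at_def tm_step_def)
    \<comment> \<open>Halted configurations persist, hence acceptance at any time \<open>u\<close>
      agrees with the verdict at time \<open>t\<close>.\<close>
    have "fst (config_at M x t) = accept_state M" if "fst (config_at M x u) = accept_state M" for u
      using halt[OF t(1), of u] halt[of u t] that by (simp add: halted_def add.commute)
    then show ?thesis using red t(2) by blast
  qed
  moreover have "polytime_computable (reduction i)"
    using feas_polytime[OF feas_comp[OF feas_Raw feas_reduction[OF feas_unraw[OF feas_id]]], of i] by simp
  ultimately show "polytime_reducible L (constrained_ne_problem 2)"
    unfolding polytime_reducible_def by blast
qed


subsection \<open>Alternating computations of polynomial depth\<close>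

definition tuples :: "nat \<Rightarrow> nat \<Rightarrow> nat list set" where
  "tuples m n = {c. length c = m \<and> set c \<subseteq> {..<n}}"

text \<open>Numbers the choices in \<open>tuples m n\<close>, lowest digit first. The search passes
  from one choice to the next by \<open>increment\<close>, without storing a list of exponentially
  many choices.\<close>

primrec digits :: "nat \<Rightarrow> nat \<Rightarrow> nat \<Rightarrow> nat list" where
  "digits n 0 i = []"
| "digits n (Suc m) i = (i mod n) # digits n m (i div n)"

primrec increment :: "nat \<Rightarrow> nat list \<Rightarrow> nat list" where
  "increment n [] = []"
| "increment n (x # xs) = (if Suc x < n then Suc x # xs else 0 # increment n xs)"

lemma increment_digits: "n > 0 \<Longrightarrow> increment n (digits n m i) = digits n m (Suc i)"
proof (induction m arbitrary: i)
  case (Suc m)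
  show ?case
  proof (cases "Suc (i mod n) < n")
    case True
    then show ?thesis by (simp add: mod_Suc div_Suc)
  next
    case False
    then have "Suc (i mod n) = n" using mod_less_divisor[OF Suc.prems, of i] by linarith
    then show ?thesis using Suc by (simp add: mod_Suc div_Suc)
  qed
qed simp

lemma digits_last: "n > 0 \<Longrightarrow> i < n ^ m \<Longrightarrow> (\<forall>y\<in>set (digits n m i). Suc y = n) \<longleftrightarrow> Suc i = n ^ m"
proof (induction m arbitrary: i)
  case (Suc m)
  have d: "i div n < n ^ m" using Suc.prems by (simp add: less_mult_imp_div_less mult.commute)
  have i: "i = n * (i div n) + i mod n" by simp
  have less: "i mod n < n" using Suc.prems by simp
  have "Suc (i mod n) = n \<and> Suc (i div n) = n ^ m \<longleftrightarrow> Suc i = n * n ^ m"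
  proof
    assume a: "Suc (i mod n) = n \<and> Suc (i div n) = n ^ m"
    then have "Suc i = n * (i div n) + n" using i by linarith
    also have "\<dots> = n * Suc (i div n)" by simp
    finally show "Suc i = n * n ^ m" using a by simp
  next
    assume a: "Suc i = n * n ^ m"
    have "n * Suc (i div n) \<le> n * n ^ m" using d by (intro mult_left_mono) auto
    moreover have "Suc i \<le> n * Suc (i div n)" unfolding mult_Suc_right using i less by linarith
    ultimately have e: "n * Suc (i div n) = n * n ^ m" using a by linarith
    then have "Suc (i div n) = n ^ m" using Suc.prems(1) by (simp only: nat_mult_eq_cancel1)
    moreover have "Suc (i mod n) = n" using e a i unfolding mult_Suc_right by linarith
    ultimately show "Suc (i mod n) = n \<and> Suc (i div n) = n ^ m" by simp
  qed
  then show ?case using Suc.IH[OF Suc.prems(1) d] by simp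
qed auto

lemma tuples_digits: "n > 0 \<Longrightarrow> tuples m n = digits n m ` {..<n ^ m}"
proof (induction m)
  case 0
  then show ?case by (auto simp: tuples_def)
next
  case (Suc m)
  show ?case
  proof (intro equalityI subsetI)
    fix c assume "c \<in> tuples (Suc m) n"
    then obtain x xs where c: "c = x # xs" "x < n" "xs \<in> tuples m n" by (cases c) (auto simp: tuples_def)
    then obtain i where i: "i < n ^ m" "xs = digits n m i" using Suc by auto
    have "n * Suc i \<le> n * n ^ m" using i by (intro mult_left_mono) auto
    then have "n * i + x < n ^ Suc m" using c(2) by simp
    moreover have "c = digits n (Suc m) (n * i + x)" using c i by simp
    ultimately show "c \<in> digits n (Suc m) ` {..<n ^ Suc m}" by blast
  next
    fix c assume "c \<in> digits n (Suc m) ` {..<n ^ Suc m}"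
    then obtain i where i: "i < n ^ Suc m" "c = digits n (Suc m) i" by auto
    have "i div n < n ^ m" using i(1) by (simp add: less_mult_imp_div_less mult.commute)
    then have "digits n m (i div n) \<in> tuples m n" using Suc by auto
    then show "c \<in> tuples (Suc m) n" using i(2) Suc.prems by (auto simp: tuples_def)
  qed
qed

lemma digits_0: "digits n m 0 = replicate m 0"
  by (induction m) auto

lemma finite_tuples: "finite (tuples m n)" "card (tuples m n) \<le> n ^ m"
proof -
  have e: "tuples m n = {xs. set xs \<subseteq> {..<n} \<and> length xs = m}" by (auto simp: tuples_def)
  show "finite (tuples m n)" unfolding e by (rule finite_lists_length_eq) simp
  show "card (tuples m n) \<le> n ^ m" unfolding e by (simp add: card_lists_length_eq)
qed

lemma sz_tuple: "c \<in> tuples m n \<Longrightarrow> sz c \<le> m * (2 * n + 2)"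
  using sz_bound[of c n] by (fastforce simp: tuples_def intro!: order_trans[OF sz_nat])

section \<open>Depth-first evaluation of alternating computations\<close>

primrec alternate :: "('s \<Rightarrow> bool) \<Rightarrow> ('s \<Rightarrow> bool) \<Rightarrow> ('s \<Rightarrow> nat list \<Rightarrow> 's) \<Rightarrow> nat list set \<Rightarrow> nat \<Rightarrow> 's \<Rightarrow> bool" where
  "alternate ty leaf nx C 0 s = leaf s"
| "alternate ty leaf nx C (Suc k) s =
     (if ty s then \<exists>c\<in>C. alternate ty leaf nx C k (nx s c) else \<forall>c\<in>C. alternate ty leaf nx C k (nx s c))"

text \<open>Depth-first evaluation. The stack holds the states on the current branch with the current
  choices; the first component is the value of the subtree just left, if any.\<close>

type_synonym 's dfs = "(bool option \<times> 's) \<times> ('s \<times> nat list) list"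

text \<open>The test \<open>r = ty (fst f)\<close> cuts the search short: a true child settles an
  existential state and a false child settles a universal one. Otherwise the last choice is
  recognised by all digits being maximal.\<close>

definition dfs_step :: "('s \<Rightarrow> bool) \<Rightarrow> ('s \<Rightarrow> bool) \<Rightarrow> ('s \<Rightarrow> nat list \<Rightarrow> 's) \<Rightarrow> nat list \<Rightarrow> nat \<Rightarrow> nat \<Rightarrow> 's dfs \<Rightarrow> 's dfs" where
  "dfs_step ty leaf nx zero n d x = (case fst (fst x) of
     None \<Rightarrow> if length (snd x) = d then ((Some (leaf (snd (fst x))), snd (fst x)), snd x)
       else ((None, nx (snd (fst x)) zero), (snd (fst x), zero) # snd x)
   | Some r \<Rightarrow> (case snd x of [] \<Rightarrow> x
       | f # stk \<Rightarrow> if r = ty (fst f) \<or> (\<forall>y\<in>set (snd f). Suc y = n) then ((Some r, fst f), stk)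
           else ((None, nx (fst f) (increment n (snd f))), (fst f, increment n (snd f)) # stk)))"

text \<open>The property of the intermediate states serves twice: it bounds their sizes, and it
  shows that the loop does not stop before the target.\<close>

definition reaches :: "('a \<Rightarrow> 'a) \<Rightarrow> ('a \<Rightarrow> bool) \<Rightarrow> 'a \<Rightarrow> 'a \<Rightarrow> bool" where
  "reaches f P a b \<longleftrightarrow> (\<exists>n. (f ^^ n) a = b \<and> (\<forall>j<n. P ((f ^^ j) a)))"

lemma reaches_trans: "reaches f P a b \<Longrightarrow> reaches f P b c \<Longrightarrow> reaches f P a c"
proof -
  assume "reaches f P a b" "reaches f P b c"
  then obtain n n' where n: "(f ^^ n) a = b" "\<forall>j<n. P ((f ^^ j) a)" "(f ^^ n') b = c" "\<forall>j<n'. P ((f ^^ j) b)"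
    unfolding reaches_def by blast
  have s: "(f ^^ (n + i)) a = (f ^^ i) b" for i
    using n(1) by (simp add: add.commute[of n i] funpow_add)
  have "P ((f ^^ j) a)" if "j < n + n'" for j
  proof (cases "j < n")
    case False
    then have "j = n + (j - n)" "j - n < n'" using that by auto
    then show ?thesis using s[of "j - n"] n(4) by metis
  qed (use n in auto)
  then show ?thesis using s n unfolding reaches_def by metis
qed

lemma reaches_step: "P a \<Longrightarrow> f a = b \<Longrightarrow> reaches f P a b"
  unfolding reaches_def by (rule exI[of _ 1]) simp

context
  fixes ty leaf :: "'s::enc \<Rightarrow> bool" and nx :: "'s \<Rightarrow> nat list \<Rightarrow> 's" and m n d :: nat and s0 :: 's
  assumes n: "n > 0"
begin

definition level :: "nat \<Rightarrow> 's set" where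
  "level i = {foldl nx s0 cs |cs. length cs = i \<and> set cs \<subseteq> tuples m n}"

lemma level_Suc: "s \<in> level i \<Longrightarrow> c \<in> tuples m n \<Longrightarrow> nx s c \<in> level (Suc i)"
proof -
  assume "s \<in> level i" "c \<in> tuples m n"
  then obtain cs where "s = foldl nx s0 cs" "length cs = i" "set cs \<subseteq> tuples m n" by (auto simp: level_def)
  then show ?thesis using \<open>c \<in> tuples m n\<close> unfolding level_def by (auto intro!: exI[of _ "cs @ [c]"])
qed

definition stack_ok :: "('s \<times> nat list) list \<Rightarrow> bool" where
  "stack_ok stk \<longleftrightarrow> length stk \<le> d \<and> (\<forall>(s, c)\<in>set stk. (\<exists>i\<le>d. s \<in> level i) \<and> c \<in> tuples m n)"

definition dfs_ok :: "'s dfs \<Rightarrow> bool" where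
  "dfs_ok x \<longleftrightarrow> stack_ok (snd x) \<and> (\<exists>i\<le>d. snd (fst x) \<in> level i)"

definition running :: "'s dfs \<Rightarrow> bool" where
  "running x \<longleftrightarrow> dfs_ok x \<and> \<not> (fst (fst x) \<noteq> None \<and> snd x = [])"

abbreviation "step \<equiv> dfs_step ty leaf nx (replicate m 0) n d"

text \<open>Induction on the remaining depth. The inner claim \<open>loop\<close> describes a search
  that resumes at choice number \<open>i\<close>: its result is the quantifier restricted to the
  choices from \<open>i\<close> on.\<close>

lemma dfs_explores:
  assumes "stack_ok stk" "s \<in> level (length stk)" "length stk + k = d"
  shows "\<exists>s' i. i \<le> d \<and> s' \<in> level i \<and>
    reaches step running ((None, s), stk) ((Some (alternate ty leaf nx (tuples m n) k s), s'), stk)"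
  using assms
proof (induction k arbitrary: s stk)
  case 0
  have "reaches step running ((None, s), stk) ((Some (leaf s), s), stk)"
    by (rule reaches_step) (use 0 in \<open>auto simp: running_def dfs_ok_def dfs_step_def\<close>)
  then show ?case using 0 by auto
next
  case (Suc k)
  note IH = Suc.IH and prems = Suc.prems
  let ?ev = "alternate ty leaf nx (tuples m n) k"
  have pos: "n ^ m > 0" using n by simp
  have c: "digits n m i \<in> tuples m n" if "i < n ^ m" for i
    using tuples_digits[OF n] that by blast
  have sd: "length stk \<le> d" using Suc.prems by simp
  have loop: "\<exists>s' l. l \<le> d \<and> s' \<in> level l \<and> reaches step running ((None, nx s (digits n m i)), (s, digits n m i) # stk)
      ((Some (if ty s then \<exists>j\<in>{i..<n ^ m}. ?ev (nx s (digits n m j)) else \<forall>j\<in>{i..<n ^ m}. ?ev (nx s (digits n m j))), s'), stk)"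
    if "i < n ^ m" for i
    using that
  proof (induction "n ^ m - i" arbitrary: i)
    case (Suc x)
    have "\<exists>l\<le>d. s \<in> level l" using prems(2) sd by blast
    then have ok: "stack_ok ((s, digits n m i) # stk)"
      using prems(1) prems(3) c[OF Suc.prems] by (simp add: stack_ok_def)
    have "nx s (digits n m i) \<in> level (length ((s, digits n m i) # stk))"
      using level_Suc[OF prems(2) c[OF Suc.prems]] by simp
    from IH[OF ok this] obtain s' l where 1: "l \<le> d" "s' \<in> level l" "reaches step running ((None, nx s (digits n m i)), (s, digits n m i) # stk)
        ((Some (?ev (nx s (digits n m i))), s'), (s, digits n m i) # stk)"
      using prems(3) by auto
    let ?r = "?ev (nx s (digits n m i))"
    have run: "running ((Some ?r, s'), (s, digits n m i) # stk)"
      using ok 1 by (auto simp: running_def dfs_ok_def)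
    have ivl: "{i..<n ^ m} = insert i {Suc i..<n ^ m}" using Suc.prems by auto
    show ?case
    proof (cases "(?r \<longleftrightarrow> ty s) \<or> Suc i = n ^ m")
      case True
      have "step ((Some ?r, s'), (s, digits n m i) # stk) = ((Some ?r, s), stk)"
        using True digits_last[OF n Suc.prems] by (auto simp: dfs_step_def)
      from reaches_trans[OF 1(3) reaches_step[where P = running and f = step, OF run this]]
      have r: "reaches step running ((None, nx s (digits n m i)), (s, digits n m i) # stk) ((Some ?r, s), stk)" .
      have e: "(if ty s then \<exists>j\<in>{i..<n ^ m}. ?ev (nx s (digits n m j)) else \<forall>j\<in>{i..<n ^ m}. ?ev (nx s (digits n m j))) = ?r"
        using True unfolding ivl by auto
      show ?thesis using prems(2) sd r unfolding e by blast
    next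
      case False
      have "step ((Some ?r, s'), (s, digits n m i) # stk) = ((None, nx s (digits n m (Suc i))), (s, digits n m (Suc i)) # stk)"
        using False digits_last[OF n Suc.prems] increment_digits[OF n] by (auto simp: dfs_step_def)
      note 2 = reaches_trans[OF 1(3) reaches_step[where P = running and f = step, OF run this]]
      have "Suc i < n ^ m" "x = n ^ m - Suc i" using False Suc.prems Suc.hyps by auto
      from Suc.hyps(1)[OF this(2,1)] obtain s'' l' where 3: "l' \<le> d" "s'' \<in> level l'" and
        "reaches step running ((None, nx s (digits n m (Suc i))), (s, digits n m (Suc i)) # stk)
        ((Some (if ty s then \<exists>j\<in>{Suc i..<n ^ m}. ?ev (nx s (digits n m j)) else \<forall>j\<in>{Suc i..<n ^ m}. ?ev (nx s (digits n m j))), s''), stk)"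
        by blast
      note r = reaches_trans[OF 2 this(3)]
      have e: "(if ty s then \<exists>j\<in>{Suc i..<n ^ m}. ?ev (nx s (digits n m j)) else \<forall>j\<in>{Suc i..<n ^ m}. ?ev (nx s (digits n m j))) =
          (if ty s then \<exists>j\<in>{i..<n ^ m}. ?ev (nx s (digits n m j)) else \<forall>j\<in>{i..<n ^ m}. ?ev (nx s (digits n m j)))"
        using False unfolding ivl by auto
      show ?thesis using 3 r unfolding e by blast
    qed
  qed simp
  have "\<exists>l\<le>d. s \<in> level l" using prems(2) sd by blast
  then have "running ((None, s), stk)" using prems(1) by (simp add: running_def dfs_ok_def)
  moreover have "step ((None, s), stk) = ((None, nx s (digits n m 0)), (s, digits n m 0) # stk)"
    using Suc.prems by (simp add: dfs_step_def digits_0)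
  ultimately have 1: "reaches step running ((None, s), stk) ((None, nx s (digits n m 0)), (s, digits n m 0) # stk)"
    by (rule reaches_step)
  have e: "alternate ty leaf nx (tuples m n) (Suc k) s =
      (if ty s then \<exists>j\<in>{0..<n ^ m}. ?ev (nx s (digits n m j)) else \<forall>j\<in>{0..<n ^ m}. ?ev (nx s (digits n m j)))"
    unfolding alternate.simps tuples_digits[OF n] by (simp add: lessThan_atLeast0)
  obtain s' l where "l \<le> d" "s' \<in> level l" "reaches step running ((None, nx s (digits n m 0)), (s, digits n m 0) # stk)
      ((Some (alternate ty leaf nx (tuples m n) (Suc k) s), s'), stk)"
    using loop[OF pos] unfolding e by blast
  with reaches_trans[OF 1 this(3)] show ?case by blast
qed

lemma sz_dfs:
  assumes "dfs_ok x" and p: "\<And>i s. i \<le> d \<Longrightarrow> s \<in> level i \<Longrightarrow> sz s \<le> p"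
  shows "sz x \<le> 20 + 3 * p + d * (10 + 10 * p + 10 * (m * (2 * n + 2)))"
proof -
  obtain res s stk where x: "x = ((res, s), stk)" by (cases x) auto
  have s: "sz s \<le> p" using assms by (auto simp: dfs_ok_def x)
  have r: "sz res \<le> 2" using sz_bool by (cases res) (auto simp: enc_bool_def)
  have "sz stk \<le> length stk * (2 * (1 + 2 * p + m * (2 * n + 2)) + 2)"
  proof (rule sz_bound)
    fix f assume "f \<in> set stk"
    then obtain i where "i \<le> d" "fst f \<in> level i" "snd f \<in> tuples m n"
      using assms(1) by (auto simp: dfs_ok_def stack_ok_def x)
    then show "sz f \<le> 1 + 2 * p + m * (2 * n + 2)"
      using p[of i "fst f"] sz_tuple[of "snd f" m n] by (cases f) simp
  qed
  also have "\<dots> \<le> d * (2 * (1 + 2 * p + m * (2 * n + 2)) + 2)"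
    using assms(1) by (intro mult_right_mono) (auto simp: dfs_ok_def stack_ok_def x)
  also have "\<dots> \<le> d * (10 + 10 * p + 10 * (m * (2 * n + 2)))" by (intro mult_left_mono) auto
  finally show ?thesis using s r unfolding x by simp
qed

end

lemma feas_increment [feas_intros]:
  assumes "feas b D n" "feas b D c" shows "feas b D (\<lambda>x. increment (n x) (c x))"
proof -
  let ?h = "\<lambda>n s y. if fst s then if Suc y < n then (False, Suc y # snd s) else (True, 0 # snd s) else (False, y # snd s)"
  have F: "foldl (?h n) (False, acc) c = (False, rev c @ acc)" for n acc c
    by (induction c arbitrary: acc) auto
  have T: "rev (snd (foldl (?h n) (True, acc) c)) = rev acc @ increment n c" for n acc c
    by (induction c arbitrary: acc) (auto simp: F)
  have size: "sz (snd (foldl (?h n) s c)) \<le> sz (snd s) + 2 * sz c" for n c s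
  proof (induction c arbitrary: s)
    case (Cons y c)
    have "sz (snd (?h n s y)) \<le> sz (snd s) + 2 * (2 * sz y + 2)" using sz_Suc[of y] by auto
    then show ?case using Cons.IH[of "?h n s y"] by (simp del: split_paired_All)
  qed simp
  have "feas b UNIV (\<lambda>z :: nat \<times> nat list. foldl (?h (fst z)) (True, []) (snd z))"
  proof (rule feas_foldl)
    show "poly_bounded (\<lambda>k. 10 + 10 * k)" by auto
    fix z :: "nat \<times> nat list" and i
    have "sz (fst (foldl (?h (fst z)) (True, []) (take i (snd z)))) \<le> 1" by (rule sz_bool)
    then show "sz (foldl (?h (fst z)) (True, []) (take i (snd z))) \<le> 10 + 10 * sz z"
      using size[of "fst z" "(True, [])" "take i (snd z)"] sz_take[of i "snd z"]
      by (cases z; cases "foldl (?h (fst z)) (True, []) (take i (snd z))") simp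
  qed (intro feas_intros)+
  from feas_comp2[of b "\<lambda>n c. rev (snd (foldl (?h n) (True, []) c))", OF _ assms] feas_rev[OF feas_snd[OF this]]
  show ?thesis by (simp add: T)
qed

text \<open>The tree has exponentially many branches, but the stack holds a single branch of
  polynomial length. The number of rounds is not polynomial, so this is a statement about
  space.\<close>

lemma feas_alternate:
  assumes ty: "feas False UNIV (\<lambda>z. ty (fst z) (snd z))" and leaf: "feas False UNIV (\<lambda>z. leaf (fst z) (snd z))"
    and nx: "feas False UNIV (\<lambda>z. nx (fst z) (fst (snd z)) (snd (snd z)))"
    and M: "feas False UNIV M" and B: "feas False UNIV B" and d: "feas False UNIV d" and s: "feas False UNIV s"
    and B0: "\<And>x. B x \<noteq> []" and p: "poly_bounded p"
    and size: "\<And>x cs. length cs \<le> length (d x) \<Longrightarrow> set cs \<subseteq> tuples (length (M x)) (length (B x)) \<Longrightarrow>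
      sz (foldl (nx x) (s x) cs) \<le> p (sz x)"
  shows "feas False D (\<lambda>x. alternate (ty x) (leaf x) (nx x) (tuples (length (M x)) (length (B x))) (length (d x)) (s x))"
proof -
  let ?st = "\<lambda>x. dfs_step (ty x) (leaf x) (nx x) (replicate (length (M x)) 0) (length (B x)) (length (d x))"
  let ?run = "\<lambda>x. running (nx x) (length (M x)) (length (B x)) (length (d x)) (s x)"
  let ?ev = "\<lambda>x. alternate (ty x) (leaf x) (nx x) (tuples (length (M x)) (length (B x))) (length (d x)) (s x)"
  obtain pM where pM: "poly_bounded pM" "\<And>x. sz (M x) \<le> pM (sz x)" by (rule feas_size[OF M]) auto
  obtain pB where pB: "poly_bounded pB" "\<And>x. sz (B x) \<le> pB (sz x)" by (rule feas_size[OF B]) auto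
  obtain pd where pd: "poly_bounded pd" "\<And>x. sz (d x) \<le> pd (sz x)" by (rule feas_size[OF d]) auto
  let ?ok = "\<lambda>x. dfs_ok (nx x) (length (M x)) (length (B x)) (length (d x)) (s x)"
  define PR where "PR x n \<longleftrightarrow> (\<exists>s'. (?st x ^^ n) ((None, s x), []) = ((Some (?ev x), s'), [])) \<and>
      (\<forall>j<n. ?run x ((?st x ^^ j) ((None, s x), []))) \<and> ?ok x ((?st x ^^ n) ((None, s x), []))" for x n
  have ex: "\<exists>n. PR x n" for x
  proof -
    have B1: "0 < length (B x)" using B0 by simp
    have "s x \<in> level (nx x) (length (M x)) (length (B x)) (s x) (length [])"
      unfolding level_def[OF B1] by (intro CollectI exI[of _ "[]"]) simp
    moreover have "stack_ok (nx x) (length (M x)) (length (B x)) (length (d x)) (s x) []"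
      by (simp add: stack_ok_def[OF B1])
    ultimately obtain s' i where i: "i \<le> length (d x)" "s' \<in> level (nx x) (length (M x)) (length (B x)) (s x) i"
      and "reaches (?st x) (?run x) ((None, s x), []) ((Some (?ev x), s'), [])"
      using dfs_explores[OF B1, where d = "length (d x)" and nx = "nx x" and m = "length (M x)" and ?s0.0 = "s x"
          and stk = "[]" and s = "s x" and k = "length (d x)" and ty = "ty x" and leaf = "leaf x"] by auto
    from this(3) obtain n where n: "(?st x ^^ n) ((None, s x), []) = ((Some (?ev x), s'), [])"
      "\<forall>j<n. ?run x ((?st x ^^ j) ((None, s x), []))" unfolding reaches_def by blast
    have "?ok x ((Some (?ev x), s'), [])"
      unfolding dfs_ok_def[OF B1] stack_ok_def[OF B1] using i by auto
    then have "PR x n" unfolding PR_def n(1) using n(2) by blast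
    then show ?thesis ..
  qed
  have "\<forall>x. \<exists>n. PR x n" using ex by simp
  from choice[OF this] obtain n where PR: "\<And>x. PR x (n x)" by blast
  have n: "\<exists>s'. (?st x ^^ n x) ((None, s x), []) = ((Some (?ev x), s'), [])"
    "\<And>j. j < n x \<Longrightarrow> ?run x ((?st x ^^ j) ((None, s x), []))"
    "?ok x ((?st x ^^ n x) ((None, s x), []))" for x
    using PR[of x] unfolding PR_def by auto
  have n1: "fst (fst ((?st x ^^ n x) ((None, s x), []))) = Some (?ev x)" "snd ((?st x ^^ n x) ((None, s x), [])) = []" for x
    using n(1)[of x] by auto
  let ?p = "\<lambda>n. 20 + 3 * p n + pd n * (10 + 10 * p n + 10 * (pM n * (2 * pB n + 2)))"
  have "feas False UNIV (\<lambda>x. (?st x ^^ n x) ((None, s x), []))"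
  proof (rule feas_iterate[where c = "\<lambda>x y. \<not> (fst (fst y) \<noteq> None \<and> snd y = [])"])
    show "feas False UNIV (\<lambda>z. ?st (fst z) (snd z))"
      unfolding dfs_step_def map_replicate_const[symmetric]
      by (intro feas_intros feas_iff feas_comp2[OF ty] feas_comp2[OF leaf] feas_comp3[OF nx]
          feas_comp[OF M] feas_comp[OF B] feas_comp[OF d])
    show "feas False UNIV (\<lambda>z. \<not> (fst (fst (snd z)) \<noteq> None \<and> snd (snd z) = []))"
      by (intro feas_intros)
    show "feas False UNIV (\<lambda>x. ((None, s x), []))" by (intro feas_intros s)
    show "poly_bounded ?p" using p pM pB pd by auto
    fix x
    have B1: "0 < length (B x)" using B0 by simp
    show "(x, (?st x ^^ j) ((None, s x), [])) \<in> UNIV \<and> sz ((?st x ^^ j) ((None, s x), [])) \<le> ?p (sz x)" if "j \<le> n x" for j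
    proof -
      have ok: "dfs_ok (nx x) (length (M x)) (length (B x)) (length (d x)) (s x) ((?st x ^^ j) ((None, s x), []))"
        using that n(2)[of j x] n(3)[of x] by (cases "j = n x") (auto simp: running_def[OF B1])
      have "sz ((?st x ^^ j) ((None, s x), [])) \<le>
          20 + 3 * p (sz x) + length (d x) * (10 + 10 * p (sz x) + 10 * (length (M x) * (2 * length (B x) + 2)))"
        by (rule sz_dfs[OF B1 ok]) (auto simp: level_def[OF B1] intro!: size)
      also have "\<dots> \<le> ?p (sz x)"
        using le_trans[OF length_le_sz pM(2)[of x]] le_trans[OF length_le_sz pB(2)[of x]] le_trans[OF length_le_sz pd(2)[of x]]
        by (intro add_left_mono mult_mono add_mono) auto
      finally show ?thesis by simp
    qed
    show "\<not> (fst (fst ((?st x ^^ j) ((None, s x), []))) \<noteq> None \<and> snd ((?st x ^^ j) ((None, s x), [])) = [])" if "j < n x" for j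
      using n(2)[OF that] by (simp add: running_def[OF B1])
    show "\<not> \<not> (fst (fst ((?st x ^^ n x) ((None, s x), []))) \<noteq> None \<and> snd ((?st x ^^ n x) ((None, s x), [])) = [])"
      using n1[of x] by simp
  qed simp
  from feas_fst[OF feas_fst[OF this]] have "feas False UNIV (\<lambda>x. Some (?ev x))" by (simp only: n1)
  from feas_case_option[OF this feas_const feas_snd[OF feas_id], of False]
  have "feas False UNIV ?ev" by simp
  then show ?thesis by (rule feas_subset) simp
qed

text \<open>An alternation of depth one.\<close>

lemma feas_Bex_tuples:
  assumes P: "feas False UNIV (\<lambda>z. P (fst z) (snd z))" and M: "feas False UNIV M" and B: "feas False UNIV B"
    and B0: "\<And>x. B x \<noteq> []"
  shows "feas False D (\<lambda>x. \<exists>c\<in>tuples (length (M x)) (length (B x)). P x c)"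
proof -
  obtain pM where pM: "poly_bounded pM" "\<And>x. sz (M x) \<le> pM (sz x)" by (rule feas_size[OF M]) auto
  obtain pB where pB: "poly_bounded pB" "\<And>x. sz (B x) \<le> pB (sz x)" by (rule feas_size[OF B]) auto
  have "feas False D (\<lambda>x. alternate (\<lambda>_. True) (\<lambda>c. P x c) (\<lambda>_ c. c) (tuples (length (M x)) (length (B x))) (length [True]) [])"
  proof (rule feas_alternate[where p = "\<lambda>n. pM n * (2 * pB n + 2)", OF _ _ _ M B _ _ B0])
    show "poly_bounded (\<lambda>n. pM n * (2 * pB n + 2))" using pM pB by auto
    fix x and cs :: "nat list list"
    assume "length cs \<le> length [True]" and cs: "set cs \<subseteq> tuples (length (M x)) (length (B x))"
    then consider "cs = []" | c where "cs = [c]" by (cases cs) auto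
    then show "sz (foldl (\<lambda>_ c. c) [] cs) \<le> pM (sz x) * (2 * pB (sz x) + 2)"
    proof cases
      case 2
      have "sz c \<le> length (M x) * (2 * length (B x) + 2)" using cs 2 by (intro sz_tuple) auto
      also have "\<dots> \<le> pM (sz x) * (2 * pB (sz x) + 2)"
        using le_trans[OF length_le_sz pM(2)[of x]] le_trans[OF length_le_sz pB(2)[of x]] by (intro mult_mono) auto
      finally show ?thesis using 2 by simp
    qed simp
  qed (intro feas_intros P)+
  then show ?thesis by simp
qed

text \<open>Savitch's algorithm: the states alternate between choosing a midpoint and choosing one of the halves.\<close>

definition graph :: "nat \<Rightarrow> nat \<Rightarrow> (nat list \<Rightarrow> nat list \<Rightarrow> bool) \<Rightarrow> (nat list \<times> nat list) set" where
  "graph m n E = {(u, v). u \<in> tuples m n \<and> v \<in> tuples m n \<and> E u v}"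

definition midpoint_next :: "nat list \<Rightarrow> (nat list \<times> nat list) \<times> nat list option \<Rightarrow> nat list \<Rightarrow> (nat list \<times> nat list) \<times> nat list option" where
  "midpoint_next zero s c = (case snd s of None \<Rightarrow> (fst s, Some c)
     | Some w \<Rightarrow> if c = zero then ((fst (fst s), w), None) else ((w, snd (fst s)), None))"

lemma feas_midpoint_next:
  assumes "feas b D zero" "feas b D s" "feas b D c"
  shows "feas b D (\<lambda>x. midpoint_next (zero x) (s x) (c x))"
proof (rule feas_comp3[OF _ assms])
  show "feas b UNIV (\<lambda>z. midpoint_next (fst z) (fst (snd z)) (snd (snd z)))"
    unfolding midpoint_next_def by (intro feas_intros)
qed

lemma savitch:
  assumes m: "m > 0" and n: "n > 1" and uv: "u \<in> tuples m n" "v \<in> tuples m n"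
  shows "alternate (\<lambda>s. snd s = None) (\<lambda>s. fst (fst s) = snd (fst s) \<or> E (fst (fst s)) (snd (fst s)))
      (midpoint_next (replicate m 0)) (tuples m n) (2 * k) ((u, v), None) \<longleftrightarrow>
    (\<exists>i\<le>2 ^ k. (u, v) \<in> graph m n E ^^ i)"
  using uv
proof (induction k arbitrary: u v)
  case 0
  have "(\<exists>i\<le>1. (u, v) \<in> graph m n E ^^ i) \<longleftrightarrow> (u, v) \<in> graph m n E ^^ 0 \<or> (u, v) \<in> graph m n E ^^ 1"
    by (metis le_0_eq le_SucE One_nat_def le_refl zero_le_one)
  then show ?case using 0 by (auto simp: graph_def)
next
  case (Suc k)
  let ?A = "alternate (\<lambda>s. snd s = None) (\<lambda>s. fst (fst s) = snd (fst s) \<or> E (fst (fst s)) (snd (fst s)))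
      (midpoint_next (replicate m 0)) (tuples m n)"
  \<comment> \<open>The universal choice has to select one of two halves: the zero tuple selects the
    first and any other tuple the second. The assumptions on \<open>m\<close> and \<open>n\<close>
    provide another one.\<close>
  have zero: "replicate m 0 \<in> tuples m n" and one: "replicate m 1 \<in> tuples m n" "replicate m 1 \<noteq> replicate m (0::nat)"
    using m n by (auto simp: tuples_def)
  have "(\<forall>c\<in>tuples m n. ?A (2 * k) (midpoint_next (replicate m 0) ((u, v), Some w) c)) \<longleftrightarrow>
      ?A (2 * k) ((u, w), None) \<and> ?A (2 * k) ((w, v), None)" for w
    using zero one by (auto simp: midpoint_next_def)
  then have "?A (2 * Suc k) ((u, v), None) \<longleftrightarrow>
      (\<exists>w\<in>tuples m n. ?A (2 * k) ((u, w), None) \<and> ?A (2 * k) ((w, v), None))"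
    by (simp add: midpoint_next_def)
  also have "\<dots> \<longleftrightarrow> (\<exists>w\<in>tuples m n. (\<exists>i\<le>2 ^ k. (u, w) \<in> graph m n E ^^ i) \<and> (\<exists>i\<le>2 ^ k. (w, v) \<in> graph m n E ^^ i))"
    using Suc by auto
  also have "\<dots> \<longleftrightarrow> (\<exists>i\<le>2 ^ Suc k. (u, v) \<in> graph m n E ^^ i)"
  proof
    assume "\<exists>w\<in>tuples m n. (\<exists>i\<le>2 ^ k. (u, w) \<in> graph m n E ^^ i) \<and> (\<exists>i\<le>2 ^ k. (w, v) \<in> graph m n E ^^ i)"
    then obtain w i j where "i \<le> 2 ^ k" "j \<le> 2 ^ k" "(u, w) \<in> graph m n E ^^ i" "(w, v) \<in> graph m n E ^^ j" by blast
    then have "i + j \<le> 2 ^ Suc k" "(u, v) \<in> graph m n E ^^ (i + j)" by (auto simp: relpow_add)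
    then show "\<exists>i\<le>2 ^ Suc k. (u, v) \<in> graph m n E ^^ i" by blast
  next
    assume "\<exists>i\<le>2 ^ Suc k. (u, v) \<in> graph m n E ^^ i"
    then obtain i where i: "i \<le> 2 ^ Suc k" "(u, v) \<in> graph m n E ^^ i" by blast
    define a where "a = i div 2"
    have a: "a \<le> 2 ^ k" "i - a \<le> 2 ^ k" "i = a + (i - a)" using i(1) by (auto simp: a_def)
    have "(u, v) \<in> graph m n E ^^ a O graph m n E ^^ (i - a)"
      unfolding relpow_add[symmetric] using i(2) a(3) by simp
    then obtain w where w: "(u, w) \<in> graph m n E ^^ a" "(w, v) \<in> graph m n E ^^ (i - a)" by blast
    have "w \<in> tuples m n"
    proof (cases a)
      case 0
      then show ?thesis using w(1) Suc.prems by simp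
    next
      case (Suc l)
      then show ?thesis using w(1) by (auto simp: graph_def)
    qed
    then show "\<exists>w\<in>tuples m n. (\<exists>i\<le>2 ^ k. (u, w) \<in> graph m n E ^^ i) \<and> (\<exists>i\<le>2 ^ k. (w, v) \<in> graph m n E ^^ i)"
      using w a by blast
  qed
  finally show ?case .
qed

lemma feas_reachable:
  assumes E: "feas False UNIV (\<lambda>z. E (fst z) (fst (snd z)) (snd (snd z)))"
    and M: "feas False UNIV M" and B: "feas False UNIV B" and u: "feas False UNIV u" and v: "feas False UNIV v"
    and M0: "\<And>x. M x \<noteq> []" and B0: "\<And>x. length (B x) > 1"
    and uv: "\<And>x. x \<in> D \<Longrightarrow> u x \<in> tuples (length (M x)) (length (B x)) \<and> v x \<in> tuples (length (M x)) (length (B x))"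
  shows "feas False D (\<lambda>x. (u x, v x) \<in> (graph (length (M x)) (length (B x)) (E x))\<^sup>*)"
proof -
  obtain pM where pM: "poly_bounded pM" "\<And>x. sz (M x) \<le> pM (sz x)" by (rule feas_size[OF M]) auto
  obtain pB where pB: "poly_bounded pB" "\<And>x. sz (B x) \<le> pB (sz x)" by (rule feas_size[OF B]) auto
  obtain pu where pu: "poly_bounded pu" "\<And>x. sz (u x) \<le> pu (sz x)" by (rule feas_size[OF u]) auto
  obtain pv where pv: "poly_bounded pv" "\<And>x. sz (v x) \<le> pv (sz x)" by (rule feas_size[OF v]) auto
  \<comment> \<open>Its length is \<open>2 * k\<close> for
    \<open>k = 2 * (length (M x) * length (B x))\<close>. Paths need be no longer than the number of
    edges, and that number is at most \<open>2 ^ k\<close>.\<close>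
  let ?d = "\<lambda>x. concat (map (\<lambda>_. B x @ B x @ B x @ B x) (M x))"
  have d: "length (?d x) = 2 * (2 * (length (M x) * length (B x)))" for x
  proof -
    have "length (concat (map (\<lambda>_. zs) ys)) = length ys * length zs" for zs :: "'c list" and ys :: "'b list"
      by (induction ys) auto
    then show ?thesis by (simp del: length_concat)
  qed
  let ?q = "\<lambda>n. pu n + pv n + pM n * (2 * pB n + 2)"
  let ?ev = "\<lambda>x. alternate (\<lambda>s. snd s = None) (\<lambda>s. fst (fst s) = snd (fst s) \<or> E x (fst (fst s)) (snd (fst s)))
      (midpoint_next (replicate (length (M x)) 0)) (tuples (length (M x)) (length (B x))) (length (?d x)) ((u x, v x), None)"
  have "feas False D ?ev"
  proof (rule feas_alternate[OF _ _ _ M B])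
    show "poly_bounded (\<lambda>n. 10 + 10 * ?q n)" using pM pB pu pv by auto
    show "feas False UNIV (\<lambda>z. midpoint_next (replicate (length (M (fst z))) 0) (fst (snd z)) (snd (snd z)))"
      unfolding map_replicate_const[symmetric] by (intro feas_intros feas_midpoint_next feas_comp[OF M])
    show "B x \<noteq> []" for x using B0[of x] by auto
    fix x and cs :: "nat list list"
    let ?C = "tuples (length (M x)) (length (B x))"
    assume cs: "set cs \<subseteq> ?C"
    have mem: "fst (fst s) \<in> insert (u x) (insert (v x) ?C) \<and> snd (fst s) \<in> insert (u x) (insert (v x) ?C) \<and>
        (\<forall>w. snd s = Some w \<longrightarrow> w \<in> ?C)" if "s = foldl (midpoint_next (replicate (length (M x)) 0)) ((u x, v x), None) cs" for s
      using cs that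
    proof (induction cs arbitrary: s rule: rev_induct)
      case (snoc c cs)
      define s' where "s' = foldl (midpoint_next (replicate (length (M x)) 0)) ((u x, v x), None) cs"
      have "s = midpoint_next (replicate (length (M x)) 0) s' c" "c \<in> ?C" using snoc.prems by (auto simp: s'_def)
      then show ?case using snoc.IH[OF _ s'_def] snoc.prems(1) by (cases "snd s'") (auto simp: midpoint_next_def)
    qed simp
    have small: "sz w \<le> ?q (sz x)" if "w \<in> insert (u x) (insert (v x) ?C)" for w
    proof -
      have "length (M x) * (2 * length (B x) + 2) \<le> pM (sz x) * (2 * pB (sz x) + 2)"
        using le_trans[OF length_le_sz pM(2)[of x]] le_trans[OF length_le_sz pB(2)[of x]] by (intro mult_mono) auto
      then show ?thesis using that pu(2)[of x] pv(2)[of x] sz_tuple[of w "length (M x)" "length (B x)"] by auto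
    qed
    define t where "t = foldl (midpoint_next (replicate (length (M x)) 0)) ((u x, v x), None) cs"
    note t = mem[OF t_def]
    have "sz (fst (fst t)) \<le> ?q (sz x)" "sz (snd (fst t)) \<le> ?q (sz x)" using t small by blast+
    moreover have "sz (snd t) \<le> 1 + ?q (sz x)"
    proof (cases "snd t")
      case (Some w)
      then have "w \<in> ?C" using t by blast
      then show ?thesis using small[of w] Some by simp
    qed simp
    ultimately have "sz t \<le> 10 + 10 * ?q (sz x)" by (cases t; cases "fst t") simp
    then show "sz (foldl (midpoint_next (replicate (length (M x)) 0)) ((u x, v x), None) cs) \<le> 10 + 10 * ?q (sz x)"
      by (simp only: t_def)
  qed (intro feas_intros M B u v feas_comp[OF B] feas_comp3[OF E])+
  moreover have "?ev x \<longleftrightarrow> (u x, v x) \<in> (graph (length (M x)) (length (B x)) (E x))\<^sup>*" if x: "x \<in> D" for x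
  proof -
    let ?m = "length (M x)" and ?n = "length (B x)"
    let ?R = "graph ?m ?n (E x)"
    have sub: "?R \<subseteq> tuples ?m ?n \<times> tuples ?m ?n" by (auto simp: graph_def)
    have fin: "finite ?R" by (rule finite_subset[OF sub]) (simp add: finite_tuples)
    have "card ?R \<le> card (tuples ?m ?n) * card (tuples ?m ?n)"
      using card_mono[OF _ sub] by (simp add: finite_tuples card_cartesian_product)
    also have "\<dots> \<le> ?n ^ ?m * ?n ^ ?m" by (intro mult_mono finite_tuples) auto
    also have "\<dots> \<le> (2 ^ ?n) ^ ?m * (2 ^ ?n) ^ ?m" by (intro mult_mono power_mono) auto
    also have "\<dots> = 2 ^ (2 * (?m * ?n))" by (simp add: power_mult[symmetric] power_add[symmetric] mult_2 mult.commute)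
    finally have card: "card ?R \<le> 2 ^ (2 * (?m * ?n))" .
    have "?ev x \<longleftrightarrow> (\<exists>i\<le>2 ^ (2 * (?m * ?n)). (u x, v x) \<in> ?R ^^ i)"
      unfolding d by (rule savitch) (use M0 B0 uv[OF x] in auto)
    also have "\<dots> \<longleftrightarrow> (u x, v x) \<in> ?R\<^sup>*"
    proof
      assume "(u x, v x) \<in> ?R\<^sup>*"
      then obtain i where "i \<le> card ?R" "(u x, v x) \<in> ?R ^^ i" unfolding rtrancl_finite_eq_relpow[OF fin] by blast
      then show "\<exists>i\<le>2 ^ (2 * (?m * ?n)). (u x, v x) \<in> ?R ^^ i" using le_trans[OF _ card] by blast
    qed (use relpow_imp_rtrancl in metis)
    finally show ?thesis .
  qed
  ultimately show ?thesis by (rule feas_cong)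
qed


subsection \<open>Decoding instances\<close>

text \<open>The second conjunct makes the parser fail on everything that is not an encoding followed
  by a remainder; such inputs have to be rejected, too.\<close>

definition parses :: "(bool list \<Rightarrow> ('a \<times> bool list) option) \<Rightarrow> ('a \<Rightarrow> bool list) \<Rightarrow> bool" where
  "parses p e \<longleftrightarrow> (\<forall>x r. p (e x @ r) = Some (x, r)) \<and> (\<forall>s x r. p s = Some (x, r) \<longrightarrow> s = e x @ r)"

definition parse_bit :: "bool list \<Rightarrow> (bool \<times> bool list) option" where
  "parse_bit s = (case s of [] \<Rightarrow> None | b # r \<Rightarrow> Some (b, r))"

lemma parses_bit: "parses parse_bit (\<lambda>b. [b])"
  by (auto simp: parses_def parse_bit_def split: list.splits)

text \<open>The first component is a status: \<open>0\<close> while reading, \<open>1\<close> after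
  the end marker, \<open>2\<close> after an error.\<close>

definition parse_list_step :: "(bool list \<Rightarrow> ('a \<times> bool list) option) \<Rightarrow> nat \<times> 'a list \<times> bool list \<Rightarrow> nat \<times> 'a list \<times> bool list" where
  "parse_list_step p t = (if fst t \<noteq> 0 then t else case snd (snd t) of [] \<Rightarrow> (2, fst (snd t), [])
     | b # s \<Rightarrow> if b then (case p s of None \<Rightarrow> (2, fst (snd t), []) | Some v \<Rightarrow> (0, fst v # fst (snd t), snd v))
       else (1, fst (snd t), s))"

text \<open>A round consumes at least the bit in front of an entry, and one more round reads the end
  marker; so the input with an additional bit provides enough rounds.\<close>

definition parse_list :: "(bool list \<Rightarrow> ('a \<times> bool list) option) \<Rightarrow> bool list \<Rightarrow> ('a list \<times> bool list) option" where
  "parse_list p s = (let t = foldl (\<lambda>t _. parse_list_step p t) (0, [], s) (True # s) in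
     if fst t = 1 then Some (rev (fst (snd t)), snd (snd t)) else None)"

lemma foldl_funpow: "foldl (\<lambda>t _. f t) t xs = (f ^^ length xs) t"
  by (induction xs arbitrary: t) (simp_all del: funpow.simps(2) add: funpow_Suc_right)

lemma parses_list:
  assumes "parses p e"
  shows "parses (parse_list p) (encode_list e)"
proof -
  have const: "(parse_list_step p ^^ n) (Suc 0, y) = (Suc 0, y)" "(parse_list_step p ^^ n) (2, y) = (2, y)" for n y
    by (induction n) (auto simp: parse_list_step_def)
  have 1: "length xs < n \<Longrightarrow> (parse_list_step p ^^ n) (0, acc, encode_list e xs @ r) = (1, rev xs @ acc, r)" for n xs acc r
  proof (induction xs arbitrary: n acc)
    case Nil
    have "parse_list_step p (0, acc, encode_list e [] @ r) = (Suc 0, acc, r)"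
      by (simp add: parse_list_step_def encode_list_def)
    then show ?case using Nil by (cases n) (simp_all del: funpow.simps(2) add: funpow_Suc_right const)
  next
    case (Cons x xs)
    then obtain n' where n: "n = Suc n'" "length xs < n'" by (cases n) auto
    have "parse_list_step p (0, acc, encode_list e (x # xs) @ r) = (0, x # acc, encode_list e xs @ r)"
      using assms by (simp add: parse_list_step_def encode_list_def parses_def)
    then show ?case using Cons.IH[OF n(2), of "x # acc"] by (simp del: funpow.simps(2) add: n(1) funpow_Suc_right)
  qed
  have 2: "(parse_list_step p ^^ n) (0, acc, s) = (1, acc', r) \<Longrightarrow> \<exists>xs. s = encode_list e xs @ r \<and> acc' = rev xs @ acc" for n acc s acc' r
  proof (induction n arbitrary: acc s)
    case (Suc n)
    have s: "(parse_list_step p ^^ n) (parse_list_step p (0, acc, s)) = (1, acc', r)"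
      using Suc.prems by (simp del: funpow.simps(2) add: funpow_Suc_right)
    show ?case
    proof (cases s)
      case Nil
      then show ?thesis using s by (simp add: parse_list_step_def const)
    next
      case (Cons b t)
      show ?thesis
      proof (cases b)
        case True
        show ?thesis
        proof (cases "p t")
          case None
          then show ?thesis using s True Cons by (simp add: parse_list_step_def const)
        next
          case (Some v)
          then have "parse_list_step p (0, acc, s) = (0, fst v # acc, snd v)" using True Cons by (simp add: parse_list_step_def)
          then obtain xs where "snd v = encode_list e xs @ r" "acc' = rev xs @ fst v # acc"
            using Suc.IH s by metis
          moreover have "t = e (fst v) @ snd v" using assms Some unfolding parses_def by (metis prod.collapse)
          ultimately show ?thesis using True Cons by (intro exI[of _ "fst v # xs"]) (simp add: encode_list_def)
        qed
      next
        case False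
        then show ?thesis using s Cons by (intro exI[of _ "[]"]) (simp add: parse_list_step_def const encode_list_def)
      qed
    qed
  qed simp
  have len: "length xs < length (True # encode_list e xs @ r)" for xs r
    by (induction xs) (auto simp: encode_list_def)
  show ?thesis
    unfolding parses_def
  proof (intro conjI allI impI)
    show "parse_list p (encode_list e xs @ r) = Some (xs, r)" for xs r
      unfolding parse_list_def foldl_funpow 1[OF len] by simp
    fix s xs r assume "parse_list p s = Some (xs, r)"
    then have "(parse_list_step p ^^ length (True # s)) (0, [], s) = (1, rev xs, r)"
      unfolding parse_list_def foldl_funpow Let_def by (auto split: if_splits simp: prod_eq_iff)
    from 2[OF this] show "s = encode_list e xs @ r" by auto
  qed
qed

definition bits_value :: "bool list \<Rightarrow> nat" where
  "bits_value bs = foldl (\<lambda>n b. if b then Suc (2 * n) else 2 * n) 0 (rev bs)"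

lemma bits_value_simps: "bits_value [] = 0" "bits_value (b # bs) = (if b then Suc (2 * bits_value bs) else 2 * bits_value bs)"
  by (simp_all add: bits_value_def)

lemma bits_value_binary: "bits_value (binary n) = n"
proof (induction n rule: less_induct)
  case (less n)
  then show ?case using binary.simps[of n] by (cases "n = 0") (auto simp: bits_value_simps binary.simps[of 0])
qed

lemma binary_Nil: "binary n = [] \<longleftrightarrow> n = 0"
  using enc_nat_0(2)[of n] by (simp add: enc_nat_def)

text \<open>The most significant bit comes last and is \<open>True\<close>. Testing for it rejects
  numerals with leading zeros, which are not the encoding of any number.\<close>

lemma binary_last: "case rev (binary n) of [] \<Rightarrow> True | b # _ \<Rightarrow> b"
proof (induction n rule: less_induct)
  case (less n)
  show ?case
  proof (cases "n = 0")
    case False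
    then have "case rev (binary (n div 2)) of [] \<Rightarrow> True | b # _ \<Rightarrow> b" using less by simp
    moreover have "n div 2 = 0 \<Longrightarrow> odd n" using False by presburger
    ultimately show ?thesis using False by (subst binary.simps) (auto simp: binary_Nil binary_Nil[THEN iffD2] split: list.splits)
  qed (simp add: binary.simps)
qed

lemma binary_bits_value: "(case rev bs of [] \<Rightarrow> True | b # _ \<Rightarrow> b) \<Longrightarrow> binary (bits_value bs) = bs"
proof (induction bs)
  case (Cons b bs)
  then have IH: "binary (bits_value bs) = bs" by (cases "rev bs") auto
  have "bs \<noteq> [] \<or> b" using Cons.prems by (cases bs) auto
  then have "bits_value (b # bs) \<noteq> 0"
    using IH binary_Nil[of "bits_value bs"] by (auto simp: bits_value_simps)
  then show ?case using IH by (subst binary.simps) (auto simp: bits_value_simps)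
qed (simp add: bits_value_simps binary.simps)

definition parse_nat :: "bool list \<Rightarrow> (nat \<times> bool list) option" where
  "parse_nat s = (case parse_list parse_bit s of None \<Rightarrow> None
     | Some v \<Rightarrow> if (case rev (fst v) of [] \<Rightarrow> True | b # _ \<Rightarrow> b) then Some (bits_value (fst v), snd v) else None)"

lemma parses_nat: "parses parse_nat encode_nat"
proof -
  note b = parses_list[OF parses_bit, unfolded parses_def]
  show ?thesis
    unfolding parses_def
  proof (intro conjI allI impI)
    show "parse_nat (encode_nat n @ r) = Some (n, r)" for n r
      using b binary_last[of n] by (simp add: parse_nat_def encode_nat_def bits_value_binary)
    fix s n r assume "parse_nat s = Some (n, r)"
    then obtain bs where "parse_list parse_bit s = Some (bs, r)" "n = bits_value bs" "case rev bs of [] \<Rightarrow> True | b # _ \<Rightarrow> b"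
      unfolding parse_nat_def by (auto split: option.splits if_splits)
    then show "s = encode_nat n @ r" using b binary_bits_value[of bs] by (simp add: encode_nat_def)
  qed
qed

definition parse_both where
  "parse_both p q s = (case p s of None \<Rightarrow> None | Some v \<Rightarrow> (case q (snd v) of None \<Rightarrow> None
     | Some u \<Rightarrow> Some ((fst v, fst u), snd u)))"

lemma parses_both:
  assumes "parses p e" "parses q f" "\<And>z. g z = e (fst z) @ f (snd z)"
  shows "parses (parse_both p q) g"
  using assms unfolding parses_def parse_both_def by (auto split: option.splits)

section \<open>Feasibility of parsing\<close>

lemma parses_remainder: "parses p e \<Longrightarrow> p s = Some v \<Longrightarrow> sz (snd v) \<le> sz s"
proof -
  assume "parses p e" "p s = Some v"
  then have "s = e (fst v) @ snd v" by (cases v) (simp add: parses_def)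
  then show ?thesis using enc_append[of "e (fst v)" "snd v"] by simp
qed

lemma feas_parse_list:
  assumes p: "feas b UNIV p" and e: "parses p e"
  shows "feas b UNIV (parse_list p)"
proof -
  obtain pp where pp: "poly_bounded pp" "\<And>x. sz (p x) \<le> pp (sz x)" by (rule feas_size[OF p]) auto
  have inv: "fst ((parse_list_step p ^^ i) (0, [], s)) \<le> 2 \<and> length (fst (snd ((parse_list_step p ^^ i) (0, [], s)))) \<le> i \<and>
      (\<forall>x\<in>set (fst (snd ((parse_list_step p ^^ i) (0, [], s)))). sz x \<le> pp (sz s)) \<and>
      sz (snd (snd ((parse_list_step p ^^ i) (0, [], s)))) \<le> sz s" for i s
  proof (induction i)
    case (Suc i)
    define t where "t = (parse_list_step p ^^ i) (0, [], s)"
    note IH = Suc[folded t_def]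
    have "fst (parse_list_step p t) \<le> 2 \<and> length (fst (snd (parse_list_step p t))) \<le> Suc i \<and>
      (\<forall>x\<in>set (fst (snd (parse_list_step p t))). sz x \<le> pp (sz s)) \<and> sz (snd (snd (parse_list_step p t))) \<le> sz s"
    proof (cases "fst t = 0 \<and> snd (snd t) \<noteq> [] \<and> hd (snd (snd t)) \<and> p (tl (snd (snd t))) \<noteq> None")
      case True
      then obtain u v where u: "snd (snd t) = True # u" "p u = Some v" by (cases "snd (snd t)") auto
      have st: "parse_list_step p t = (0, fst v # fst (snd t), snd v)" using True u by (simp add: parse_list_step_def)
      have "sz u \<le> sz s" using IH u by simp
      then have "sz (p u) \<le> pp (sz s)" using pp(2)[of u] poly_bounded_mono[OF pp(1)] le_trans by blast
      then have "sz (fst v) \<le> pp (sz s)" using u by (cases v) simp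
      moreover have "sz (snd v) \<le> sz s" using parses_remainder[OF e u(2)] \<open>sz u \<le> sz s\<close> by simp
      ultimately show ?thesis using IH unfolding st by simp
    next
      case False
      then show ?thesis using IH by (auto simp: parse_list_step_def split: list.splits option.splits)
    qed
    then show ?case by (simp add: t_def)
  qed simp
  have "feas b UNIV (\<lambda>s. foldl (\<lambda>t _. parse_list_step p t) (0, [], s) (True # s))"
  proof (rule feas_foldl)
    show "feas b UNIV (\<lambda>z. parse_list_step p (fst (snd z)))"
      unfolding parse_list_step_def by (intro feas_intros feas_comp[OF p])
    show "poly_bounded (\<lambda>n. 10 + n + 10 * ((n + 1) * (2 * pp n + 2)))" using pp by auto
    fix s i assume i: "i \<le> length (True # s)"
    obtain k acc r where t: "(parse_list_step p ^^ i) (0, [], s) = (k, acc, r)"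
      by (cases "(parse_list_step p ^^ i) (0, [], s)") auto
    note v = inv[of i s, unfolded t fst_conv snd_conv]
    have "sz acc \<le> length acc * (2 * pp (sz s) + 2)" by (rule sz_bound) (use v in auto)
    also have "\<dots> \<le> (sz s + 1) * (2 * pp (sz s) + 2)"
      using v i length_le_sz[of s] by (intro mult_right_mono) auto
    finally have "sz acc \<le> (sz s + 1) * (2 * pp (sz s) + 2)" .
    moreover have "sz k \<le> 2" using v sz_nat[of k] by linarith
    moreover have "foldl (\<lambda>t _. parse_list_step p t) (0, [], s) (take i (True # s)) = (k, acc, r)"
      unfolding foldl_funpow t[symmetric] using i by (simp add: min_absorb2)
    ultimately show "sz (foldl (\<lambda>t _. parse_list_step p t) (0, [], s) (take i (True # s))) \<le>
        10 + sz s + 10 * ((sz s + 1) * (2 * pp (sz s) + 2))"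
      using v by (simp only: sz_prod) linarith
  qed (intro feas_intros)+
  then show ?thesis unfolding parse_list_def[abs_def] Let_def by (intro feas_intros)
qed

lemma feas_parse_both:
  assumes "feas b UNIV p" "feas b UNIV q" shows "feas b UNIV (parse_both p q)"
  unfolding parse_both_def[abs_def]
  by (intro feas_intros feas_comp[OF assms(1)] feas_comp[OF assms(2)])

lemma feas_parse_bit: "feas b UNIV parse_bit"
  unfolding parse_bit_def[abs_def] by (intro feas_intros)

lemma feas_parse_nat: "feas b UNIV parse_nat"
proof -
  have bv: "feas b UNIV bits_value"
    unfolding bits_value_def[abs_def]
  proof (rule feas_foldl)
    show "poly_bounded (\<lambda>n. n)" by simp
    fix bs :: "bool list" and i
    have "sz (foldl (\<lambda>n b. if b then Suc (2 * n) else 2 * n) n cs) \<le> sz n + length cs" for n and cs :: "bool list"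
    proof (induction cs arbitrary: n)
      case (Cons c cs)
      have "sz (if c then Suc (2 * n) else 2 * n) \<le> Suc (sz n)" using sz_nat[of 1] by (cases "n = 0") auto
      then show ?case using Cons.IH[of "if c then Suc (2 * n) else 2 * n"] by simp
    qed simp
    from this[of 0 "take i (rev bs)"] show "sz (foldl (\<lambda>n b. if b then Suc (2 * n) else 2 * n) 0 (take i (rev bs))) \<le> sz bs"
      using length_le_sz[of bs] by simp
  qed (intro feas_intros)+
  show ?thesis unfolding parse_nat_def[abs_def]
    by (intro feas_intros feas_comp[OF bv] feas_comp[OF feas_parse_list[OF feas_parse_bit parses_bit]])
qed

definition "parse_dpa = parse_both parse_nat (parse_both (parse_list (parse_list parse_nat)) (parse_list parse_nat))"
definition "parse_player = parse_both (parse_list parse_dpa) (parse_list (parse_both parse_nat parse_nat))"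
definition "parse_game = parse_both (parse_list parse_nat)
  (parse_both (parse_list (parse_both parse_nat parse_nat)) (parse_list parse_player))"
definition "parse_instance = parse_both parse_game (parse_both parse_nat (parse_list parse_nat))"

lemma parses_pair: "parses (parse_both parse_nat parse_nat) encode_pair"
  by (rule parses_both[OF parses_nat parses_nat]) (simp add: encode_pair_def)

lemma parses_dpa: "parses parse_dpa (\<lambda>A. encode_dpa (mk_dpa A))"
  unfolding parse_dpa_def
  by (rule parses_both[OF parses_nat parses_both[OF parses_list[OF parses_list[OF parses_nat]] parses_list[OF parses_nat] refl]])
    (simp add: encode_mk)

lemma parses_player: "parses parse_player (\<lambda>P. encode_player (mk_player P))"
  unfolding parse_player_def
  by (rule parses_both[OF parses_list[OF parses_dpa] parses_list[OF parses_pair]]) (simp add: encode_mk)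

lemma parses_game: "parses parse_game (\<lambda>R. encode_game (mk_game R))"
  unfolding parse_game_def
  by (rule parses_both[OF parses_list[OF parses_nat] parses_both[OF parses_list[OF parses_pair] parses_list[OF parses_player] refl]])
    (simp add: encode_mk)

lemma parses_instance: "parses parse_instance (\<lambda>I. encode_instance (mk_game (fst I), fst (snd I), snd (snd I)))"
  unfolding parse_instance_def
  by (rule parses_both[OF parses_game parses_both[OF parses_nat parses_list[OF parses_nat] refl]])
    (simp add: encode_instance_def split: prod.splits)

lemma feas_parse_instance: "feas b UNIV parse_instance"
  unfolding parse_instance_def parse_game_def parse_player_def[abs_def]
  by (intro feas_parse_both feas_parse_nat feas_parse_list[OF _ parses_nat] feas_parse_list[OF _ parses_pair]
      feas_parse_list[OF _ parses_player[unfolded parse_player_def]] feas_parse_list[OF _ parses_dpa])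
    (unfold parse_dpa_def, intro feas_parse_both feas_parse_nat feas_parse_list[OF _ parses_nat]
      feas_parse_list[OF _ parses_list[OF parses_nat]])

lemma game_rep_tuple: "\<exists>I. R = mk_game I"
proof -
  have dpa: "\<exists>A. B = mk_dpa A" for B :: dpa_rep
    by (rule exI[of _ "(rep_initial B, rep_succ B, rep_priority B)"]) (simp add: mk_dpa_def)
  have lists: "\<exists>ys. xs = map f ys" if f: "\<And>x. \<exists>y. x = f y" for f and xs :: "'z list"
  proof (induction xs)
    case (Cons x xs)
    then obtain y ys where "x = f y" "xs = map f ys" using f[of x] by blast
    then show ?case by (intro exI[of _ "y # ys"]) simp
  qed simp
  have player: "\<exists>Q. P = mk_player Q" for P :: player_rep
  proof -
    obtain As where "rep_automata P = map mk_dpa As" using lists[OF dpa] by blast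
    then show ?thesis by (intro exI[of _ "(As, rep_pref P)"]) (simp add: mk_player_def)
  qed
  obtain Ps where "rep_players R = map mk_player Ps" using lists[OF player] by blast
  then show ?thesis by (intro exI[of _ "(rep_owner R, rep_edges R, Ps)"]) (simp add: mk_game_def)
qed


subsection \<open>First-cycle games\<close>

text \<open>The stack is a simple path with the latest state first. A return to a state
  \<open>t\<close> on it cuts off the states visited since, and \<open>t\<close> itself stays. The
  cycle that is closed also contains \<open>t\<close>, as its last element.\<close>

definition push_cycle :: "'s list \<Rightarrow> 's \<Rightarrow> 's list" where
  "push_cycle S t = (if t \<in> set S then dropWhile (\<lambda>s. s \<noteq> t) S else t # S)"

definition closed_cycle :: "'s list \<Rightarrow> 's \<Rightarrow> 's list" where
  "closed_cycle S t = takeWhile (\<lambda>s. s \<noteq> t) S @ [t]"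

text \<open>The value \<open>z\<close> at exhausted depth is a parameter so that it can be negated
  together with the goal when the roles are exchanged.\<close>

primrec first_cycle :: "('s \<Rightarrow> 's set) \<Rightarrow> ('s \<Rightarrow> bool) \<Rightarrow> ('s list \<Rightarrow> bool) \<Rightarrow> bool \<Rightarrow> nat \<Rightarrow> 's list \<Rightarrow> bool" where
  "first_cycle sc mine good z 0 S = z"
| "first_cycle sc mine good z (Suc k) S =
     (if mine (hd S) then \<exists>t\<in>sc (hd S). if t \<in> set S then good (closed_cycle S t) else first_cycle sc mine good z k (t # S)
      else \<forall>t\<in>sc (hd S). if t \<in> set S then good (closed_cycle S t) else first_cycle sc mine good z k (t # S))"

text \<open>Determinacy of a finite game is just de Morgan's law; losing for the coalition is
  winning for the player.\<close>

lemma first_cycle_dual: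
  "\<not> first_cycle sc mine good z k S \<longleftrightarrow> first_cycle sc (\<lambda>s. \<not> mine s) (\<lambda>c. \<not> good c) (\<not> z) k S"
  by (induction k arbitrary: S) auto

text \<open>Closing a cycle returns to a suffix of the stack. The winner therefore has to keep the
  first-cycle game won from every suffix, each with the depth that was left when the path had that
  length.\<close>

definition cycle_invariant :: "('s \<Rightarrow> 's set) \<Rightarrow> ('s \<Rightarrow> bool) \<Rightarrow> ('s list \<Rightarrow> bool) \<Rightarrow> bool \<Rightarrow> 's set \<Rightarrow> nat \<Rightarrow> 's list \<Rightarrow> bool" where
  "cycle_invariant sc mine good z P F S \<longleftrightarrow> S \<noteq> [] \<and> distinct S \<and> set S \<subseteq> P \<and>
     (\<forall>i<length S. first_cycle sc mine good z (F - length (drop i S)) (drop i S))"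

definition good_push :: "('s \<Rightarrow> 's set) \<Rightarrow> ('s \<Rightarrow> bool) \<Rightarrow> ('s list \<Rightarrow> bool) \<Rightarrow> bool \<Rightarrow> 's set \<Rightarrow> nat \<Rightarrow> 's list \<Rightarrow> 's \<Rightarrow> bool" where
  "good_push sc mine good z P F S t \<longleftrightarrow>
     (t \<in> set S \<longrightarrow> good (closed_cycle S t)) \<and> cycle_invariant sc mine good z P F (push_cycle S t)"

lemma dropWhile_drop: "\<exists>i\<le>length xs. dropWhile P xs = drop i xs"
  using dropWhile_eq_drop[of P xs] length_takeWhile_le[of P xs] by auto

lemma cycle_invariant_step:
  assumes P: "finite P" "card P < F" and S: "cycle_invariant sc mine good z P F S" and sc: "sc (hd S) \<subseteq> P"
  shows "if mine (hd S) then \<exists>t\<in>sc (hd S). good_push sc mine good z P F S t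
    else \<forall>t\<in>sc (hd S). good_push sc mine good z P F S t"
proof -
  have ne: "S \<noteq> []" and d: "distinct S" and sub: "set S \<subseteq> P"
    and fc: "\<And>i. i < length S \<Longrightarrow> first_cycle sc mine good z (F - length (drop i S)) (drop i S)"
    using S by (auto simp: cycle_invariant_def)
  \<comment> \<open>The stack is a repetition-free list in \<open>P\<close>, hence shorter than
    \<open>F\<close>: the depth is not exhausted and a further move of the first-cycle game
    exists.\<close>
  have "length S \<le> card P" using card_mono[OF P(1) sub] distinct_card[OF d] by simp
  then obtain k where k: "F - length S = Suc k" using P(2) by (metis Suc_diff_Suc le_less_trans)
  have push: "good_push sc mine good z P F S t"
    if t: "t \<in> sc (hd S)" and g: "if t \<in> set S then good (closed_cycle S t) else first_cycle sc mine good z k (t # S)" for t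
  proof (cases "t \<in> set S")
    case True
    obtain i where i: "i \<le> length S" "dropWhile (\<lambda>s. s \<noteq> t) S = drop i S" using dropWhile_drop by blast
    have ne': "dropWhile (\<lambda>s. s \<noteq> t) S \<noteq> []" using True by (auto simp: dropWhile_eq_Nil_conv)
    have "first_cycle sc mine good z (F - length (drop j (drop i S))) (drop j (drop i S))" if "j < length (drop i S)" for j
      using fc[of "j + i"] that by (simp add: add.commute)
    then show ?thesis
      using True g ne' d sub unfolding good_push_def cycle_invariant_def push_cycle_def i(2)
      by (auto dest: in_set_dropD)
  next
    case False
    have "first_cycle sc mine good z (F - length (drop i (t # S))) (drop i (t # S))" if "i < length (t # S)" for i
    proof (cases i)
      case 0
      have "F - length (t # S) = k" using k by simp
      then show ?thesis using g False 0 by simp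
    next
      case (Suc j)
      then show ?thesis using fc[of j] that by simp
    qed
    then show ?thesis using False d sub t sc by (auto simp: good_push_def cycle_invariant_def push_cycle_def)
  qed
  have "first_cycle sc mine good z (Suc k) S" using fc[of 0] ne k by simp
  then show ?thesis using push by (cases "mine (hd S)") (simp, blast, simp)
qed

text \<open>The elements of the stack whose value exceeds the limit maximum eventually stay on the stack.
  From then on, an element with the limit maximum never lies on a closed cycle, so these elements
  accumulate on the stack unless the maximum is odd.\<close>

lemma stack_parity:
  fixes x :: "nat \<Rightarrow> 's" and pr :: "'s \<Rightarrow> nat"
  assumes fin: "finite (range x)" and S0: "S 0 = [x 0]" and SS: "\<And>k. S (Suc k) = push_cycle (S k) (x (Suc k))"
    and odd: "\<And>k. x (Suc k) \<in> set (S k) \<Longrightarrow> odd (Max (pr ` set (closed_cycle (S k) (x (Suc k)))))"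
  shows "odd (Max (limit (pr \<circ> x)))"
proof (rule ccontr)
  define M where "M = Max (limit (pr \<circ> x))"
  assume "\<not> odd (Max (limit (pr \<circ> x)))"
  then have even: "even M" by (simp add: M_def)
  have finp: "finite (range (pr \<circ> x))" using fin by (metis finite_imageI image_comp)
  note lim = limit_finite_range[OF finp]
  have "M \<in> limit (pr \<circ> x)" unfolding M_def by (rule Max_in[OF lim])
  then have often: "\<exists>k>m. pr (x k) = M" for m by (auto simp: limit_def INFM_nat)
  have "\<exists>T. \<forall>k\<ge>T. pr (x k) \<le> M"
  proof -
    have "\<exists>T. \<forall>k\<ge>T. pr (x k) \<noteq> a" if "a \<in> range (pr \<circ> x)" "a > M" for a
    proof -
      have "a \<notin> limit (pr \<circ> x)" using Max_ge[OF lim(1), of a] that(2) by (auto simp: M_def)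
      then obtain m where "\<forall>k>m. pr (x k) \<noteq> a" by (auto simp: limit_def INFM_nat)
      then show ?thesis by (intro exI[of _ "Suc m"]) auto
    qed
    then obtain T where T: "\<And>a k. a \<in> range (pr \<circ> x) \<Longrightarrow> a > M \<Longrightarrow> k \<ge> T a \<Longrightarrow> pr (x k) \<noteq> a" by metis
    have "pr (x k) \<le> M" if "k \<ge> Max (T ` range (pr \<circ> x))" for k
    proof (rule ccontr)
      assume "\<not> pr (x k) \<le> M"
      moreover have "T (pr (x k)) \<le> Max (T ` range (pr \<circ> x))" using finp by (intro Max_ge) auto
      ultimately show False using T[of "pr (x k)" k] that by auto
    qed
    then show ?thesis by blast
  qed
  then obtain T where T: "\<And>k. k \<ge> T \<Longrightarrow> pr (x k) \<le> M" by blast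
  have dist: "distinct (S k) \<and> set (S k) \<subseteq> range x" for k
    by (induction k) (auto simp: S0 SS push_cycle_def dest: set_dropWhileD)
  have len: "length (S k) \<le> card (range x)" for k
    using dist[of k] card_mono[OF fin, of "set (S k)"] by (simp add: distinct_card)
  define hi where "hi k = length (filter (\<lambda>s. pr s > M) (S k))" for k
  have split: "length (filter P (S k)) =
      length (filter P (takeWhile (\<lambda>s. s \<noteq> t) (S k))) + length (filter P (dropWhile (\<lambda>s. s \<noteq> t) (S k)))" for P t k
    by (metis filter_append length_append takeWhile_dropWhile_id)
  \<comment> \<open>From \<open>T\<close> on no element above \<open>M\<close> is pushed any more,
    so the number of those on the stack can only fall and finally stabilises.\<close>
  have hi_step: "hi (Suc k) \<le> hi k" if "k \<ge> T" for k
  proof (cases "x (Suc k) \<in> set (S k)")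
    case True
    then show ?thesis using split[of _ k "x (Suc k)"] by (simp add: hi_def SS push_cycle_def)
  next
    case False
    then show ?thesis using T[of "Suc k"] that by (simp add: hi_def SS push_cycle_def)
  qed
  have "\<exists>T1\<ge>T. \<forall>k\<ge>T1. hi k = hi T1"
  proof -
    obtain T1 where T1: "T1 \<ge> T" "\<And>k. k \<ge> T \<Longrightarrow> hi T1 \<le> hi k"
      using ex_has_least_nat[of "\<lambda>k. k \<ge> T" T hi] by auto
    have "hi (T1 + i) \<le> hi T1" for i
    proof (induction i)
      case (Suc i)
      then show ?case using hi_step[of "T1 + i"] T1(1) by simp
    qed simp
    note le = this
    have "hi k = hi T1" if "k \<ge> T1" for k
      using that T1(1) T1(2)[of k] le[of "k - T1"] by simp
    then show ?thesis using T1(1) by blast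
  qed
  then obtain T1 where T1: "T1 \<ge> T" "\<And>k. k \<ge> T1 \<Longrightarrow> hi k = hi T1" by blast
  have cyc: "pr s < M" if k: "k \<ge> T1" and t: "x (Suc k) \<in> set (S k)" and s: "s \<in> set (closed_cycle (S k) (x (Suc k)))" for k s
  proof -
    have le: "pr s \<le> M" if "s \<in> set (closed_cycle (S k) (x (Suc k)))" for s
    proof (rule ccontr)
      assume gt: "\<not> pr s \<le> M"
      then have "s \<noteq> x (Suc k)" using T[of "Suc k"] k T1(1) by auto
      then have "s \<in> set (filter (\<lambda>s. pr s > M) (takeWhile (\<lambda>s. s \<noteq> x (Suc k)) (S k)))"
        using that gt by (auto simp: closed_cycle_def)
      then have "0 < length (filter (\<lambda>s. pr s > M) (takeWhile (\<lambda>s. s \<noteq> x (Suc k)) (S k)))"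
        by (rule length_pos_if_in_set)
      moreover have "hi k = length (filter (\<lambda>s. pr s > M) (takeWhile (\<lambda>s. s \<noteq> x (Suc k)) (S k))) + hi (Suc k)"
        using t split[of _ k "x (Suc k)"] by (simp add: hi_def SS push_cycle_def)
      ultimately show False using T1(2)[of k] T1(2)[of "Suc k"] k by simp
    qed
    \<comment> \<open>The maximum on a closed cycle is odd while \<open>M\<close> is even, so being
      at most \<open>M\<close> it is smaller.\<close>
    have "Max (pr ` set (closed_cycle (S k) (x (Suc k)))) \<noteq> M" using odd[OF t] even by auto
    moreover have "Max (pr ` set (closed_cycle (S k) (x (Suc k)))) \<le> M"
      using le by (subst Max_le_iff) (auto simp: closed_cycle_def)
    moreover have "pr s \<le> Max (pr ` set (closed_cycle (S k) (x (Suc k))))" using s by (intro Max_ge) auto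
    ultimately show ?thesis by linarith
  qed
  define cnt where "cnt k = length (filter (\<lambda>s. pr s = M) (S k))" for k
  have cnt_step: "cnt (Suc k) = (if pr (x (Suc k)) = M then Suc (cnt k) else cnt k)" if k: "k \<ge> T1" for k
  proof (cases "x (Suc k) \<in> set (S k)")
    case True
    have "filter (\<lambda>s. pr s = M) (takeWhile (\<lambda>s. s \<noteq> x (Suc k)) (S k)) = []"
      using cyc[OF k True] by (fastforce simp: filter_empty_conv closed_cycle_def)
    then have "cnt (Suc k) = cnt k"
      using True split[of _ k "x (Suc k)"] by (simp add: cnt_def SS push_cycle_def)
    moreover have "pr (x (Suc k)) \<noteq> M" using cyc[OF k True, of "x (Suc k)"] by (simp add: closed_cycle_def)
    ultimately show ?thesis by simp
  next
    case False
    then show ?thesis by (simp add: cnt_def SS push_cycle_def)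
  qed
  have mono: "cnt k \<le> cnt (k + i)" if "k \<ge> T1" for k i
    by (induction i) (use that cnt_step in \<open>auto intro: le_trans\<close>)
  have "\<exists>k\<ge>T1. cnt k \<ge> c" for c
  proof (induction c)
    case (Suc c)
    then obtain k where k: "k \<ge> T1" "cnt k \<ge> c" by blast
    obtain k' where k': "k' > k" "pr (x k') = M" using often by blast
    then obtain j where j: "k' = Suc (k + j)" using less_imp_Suc_add by blast
    have "cnt k' = Suc (cnt (k + j))" using cnt_step[of "k + j"] k k' j by simp
    then have "cnt k' \<ge> Suc c" using mono[OF k(1), of j] k(2) by simp
    then show ?case using k k' by (intro exI[of _ k']) simp
  qed auto
  then obtain k where "cnt k \<ge> Suc (card (range x))" by blast
  moreover have "cnt k \<le> length (S k)" by (simp add: cnt_def)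
  ultimately show False using len[of k] by simp
qed


subsection \<open>Products of automata\<close>

definition wf_dpa_tuple :: "nat \<Rightarrow> dpa_tuple \<Rightarrow> bool" where
  "wf_dpa_tuple n A \<longleftrightarrow> length (snd (snd A)) = length (fst (snd A)) \<and> fst A < length (fst (snd A)) \<and>
     (\<forall>row\<in>set (fst (snd A)). length row = n \<and> (\<forall>q\<in>set row. q < length (fst (snd A))))"

lemma wf_dpa_tuple: "wf_dpa_rep n (mk_dpa A) \<longleftrightarrow> wf_dpa_tuple n A"
proof -
  have "(\<forall>q<length ss. \<forall>a<n. ss ! q ! a < k) \<longleftrightarrow> (\<forall>row\<in>set ss. \<forall>q\<in>set row. q < k)"
    if "\<forall>row\<in>set ss. length row = n" for ss and k :: nat
    using that by (auto simp: all_set_conv_all_nth)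
  from this[of "fst (snd A)" "length (fst (snd A))"] show ?thesis
    unfolding wf_dpa_rep_def wf_dpa_tuple_def mk_dpa_def dpa_of_def wf_dpa_def by (auto simp: lessThan_def)
qed

definition dpa_next :: "dpa_tuple \<Rightarrow> nat \<Rightarrow> nat \<Rightarrow> nat" where
  "dpa_next A q a = lookup (lookup (fst (snd A)) q) a"

definition dpa_priority :: "dpa_tuple \<Rightarrow> nat \<Rightarrow> nat" where
  "dpa_priority A q = lookup (snd (snd A)) q"

text \<open>A node consists of a letter and of the states that the automata have reached before reading it.\<close>

definition node_next :: "dpa_tuple list \<Rightarrow> nat list \<Rightarrow> nat \<Rightarrow> nat list" where
  "node_next As u a = a # map (\<lambda>j. dpa_next (lookup As j) (lookup u (Suc j)) (lookup u 0)) [0..<length As]"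

definition node_priority :: "dpa_tuple list \<Rightarrow> nat \<Rightarrow> nat list \<Rightarrow> nat" where
  "node_priority As j u = dpa_priority (lookup As j) (lookup u (Suc j))"

definition nodes :: "dpa_tuple list \<Rightarrow> nat word \<Rightarrow> nat \<Rightarrow> nat list" where
  "nodes As w k = w k # map (\<lambda>A. run (dpa_of (mk_dpa A)) w k) As"

abbreviation lang :: "nat \<Rightarrow> dpa_tuple \<Rightarrow> nat word set" where
  "lang n A \<equiv> dpa_language {..<n} (dpa_of (mk_dpa A))"

lemma length_nodes [simp]: "length (nodes As w k) = Suc (length As)"
  by (simp add: nodes_def)

lemma nodes_0: "nodes As w 0 = w 0 # map fst As"
  by (simp add: nodes_def mk_dpa_def dpa_of_def)

lemma nodes_cong: "(\<And>i. i \<le> k \<Longrightarrow> w i = w' i) \<Longrightarrow> nodes As w k = nodes As w' k"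
proof -
  assume a: "\<And>i. i \<le> k \<Longrightarrow> w i = w' i"
  have "i \<le> k \<Longrightarrow> run B w i = run B w' i" for i and B :: "(nat, nat) dpa"
    by (induction i) (use a in auto)
  then show ?thesis using a by (simp add: nodes_def)
qed

lemma nodes_lookup_0 [simp]: "lookup (nodes As w k) 0 = w k" "hd (nodes As w k) = w k"
  by (simp_all add: nodes_def lookup_def)

locale automata =
  fixes As :: "dpa_tuple list" and n :: nat
  assumes wf: "\<And>A. A \<in> set As \<Longrightarrow> wf_dpa_tuple n A"
begin

lemma state_less: "A \<in> set As \<Longrightarrow> w \<in> omega_words {..<n} \<Longrightarrow> run (dpa_of (mk_dpa A)) w k < length (fst (snd A))"
  using run_less[of n "mk_dpa A" w k] wf_dpa_tuple[of n A] wf[of A] by (simp add: mk_dpa_def[of A])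

lemma nodes_Suc:
  assumes w: "w \<in> omega_words {..<n}"
  shows "nodes As w (Suc k) = node_next As (nodes As w k) (w (Suc k))"
proof -
  have "succ (dpa_of (mk_dpa A)) (run (dpa_of (mk_dpa A)) w k) (w k) = dpa_next A (run (dpa_of (mk_dpa A)) w k) (w k)"
    if A: "A \<in> set As" for A
  proof -
    have "length (fst (snd A) ! run (dpa_of (mk_dpa A)) w k) = n"
      using wf[OF A] nth_mem[OF state_less[OF A w, of k]] by (simp add: wf_dpa_tuple_def)
    then show ?thesis
      using state_less[OF A w, of k] omega_words_less[OF w, of k] by (simp add: dpa_next_def dpa_of_def mk_dpa_def)
  qed
  then show ?thesis
    by (intro nth_equalityI) (simp_all add: nodes_def node_next_def nth_Cons lookup_def split: nat.split)
qed

lemma node_priority: "j < length As \<Longrightarrow> w \<in> omega_words {..<n} \<Longrightarrow>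
    node_priority As j (nodes As w k) = priority (dpa_of (mk_dpa (As ! j))) (run (dpa_of (mk_dpa (As ! j))) w k)"
  using state_less[of "As ! j" w k] wf[of "As ! j"]
  by (simp add: node_priority_def nodes_def dpa_priority_def dpa_of_def mk_dpa_def wf_dpa_tuple_def lookup_def)

lemma lang_iff:
  assumes "j < length As" "w \<in> omega_words {..<n}"
  shows "w \<in> lang n (As ! j) \<longleftrightarrow> even (Max (limit (node_priority As j \<circ> nodes As w)))"
proof -
  have "node_priority As j \<circ> nodes As w = priority (dpa_of (mk_dpa (As ! j))) \<circ> run (dpa_of (mk_dpa (As ! j))) w"
    by (rule ext) (simp add: node_priority[OF assms])
  then show ?thesis using assms by (simp add: dpa_language_def)
qed

lemma nodes_tuples:
  assumes w: "w \<in> omega_words {..<n}" and B: "n \<le> B" "\<And>A. A \<in> set As \<Longrightarrow> length (fst (snd A)) \<le> B"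
  shows "nodes As w k \<in> tuples (Suc (length As)) B"
proof -
  have "run (dpa_of (mk_dpa A)) w k < B" if "A \<in> set As" for A
    using state_less[OF that w, of k] B(2)[OF that] by simp
  moreover have "w k < B" using omega_words_less[OF w, of k] B(1) by simp
  ultimately show ?thesis by (auto simp: tuples_def nodes_def)
qed

lemma finite_nodes:
  assumes w: "w \<in> omega_words {..<n}" shows "finite (range (nodes As w))"
proof (rule finite_subset)
  let ?B = "n + sum_list (map (\<lambda>A. length (fst (snd A))) As)"
  have "length (fst (snd A)) \<le> ?B" if "A \<in> set As" for A
    using member_le_sum_list[of "length (fst (snd A))" "map (\<lambda>A. length (fst (snd A))) As"] that by auto
  then show "range (nodes As w) \<subseteq> tuples (Suc (length As)) ?B" using nodes_tuples[OF w, of ?B] by auto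
qed (rule finite_tuples)

text \<open>A closed walk through the product that is entered from a word can be repeated forever.
  It yields the ultimately periodic outcomes and also the words that repeat a cycle of the
  stack.\<close>

lemma lasso_word:
  assumes w: "w \<in> omega_words {..<n}" and c: "c \<noteq> []" "c ! 0 = nodes As w T"
    and step: "\<And>i. i < length c \<Longrightarrow> hd (c ! i) < n \<and>
      c ! (Suc i mod length c) = node_next As (c ! i) (hd (c ! (Suc i mod length c)))"
  obtains w' where "w' \<in> omega_words {..<n}" "\<And>k. k \<le> T \<Longrightarrow> w' k = w k"
    "\<And>i. nodes As w' (T + i) = c ! (i mod length c)"
proof -
  define w' where "w' k = (if k < T then w k else hd (c ! ((k - T) mod length c)))" for k
  have lc: "length c > 0" using c by simp
  have w': "w' \<in> omega_words {..<n}"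
    using w step lc by (auto simp: omega_words_def w'_def)
  have eq: "w' k = w k" if "k \<le> T" for k
    using that c by (cases "k = T") (auto simp: w'_def nodes_def)
  have "nodes As w' (T + i) = c ! (i mod length c)" for i
  proof (induction i)
    case 0
    then show ?case using c nodes_cong[of T w' w] eq by simp
  next
    case (Suc i)
    have m: "Suc (i mod length c) mod length c = Suc i mod length c" by (simp add: mod_Suc_eq)
    have "nodes As w' (T + Suc i) = node_next As (nodes As w' (T + i)) (w' (T + Suc i))"
      using nodes_Suc[OF w', of "T + i"] by simp
    also have "\<dots> = node_next As (c ! (i mod length c)) (hd (c ! (Suc i mod length c)))"
      unfolding Suc by (simp add: w'_def)
    also have "\<dots> = c ! (Suc i mod length c)"
      using step[of "i mod length c"] lc unfolding m by simp
    finally show ?case .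
  qed
  with w' eq show thesis by (rule that)
qed

lemma limit_lasso:
  assumes "c \<noteq> []" "\<And>i. x (T + i) = c ! (i mod length c)"
  shows "limit (f \<circ> x) = f ` set c"
proof (intro equalityI subsetI)
  fix a assume "a \<in> limit (f \<circ> x)"
  then obtain k where k: "k > T" "f (x k) = a" by (auto simp: limit_def INFM_nat)
  then obtain i where "k = T + i" using le_Suc_ex less_imp_le by blast
  then show "a \<in> f ` set c" using k assms by auto
next
  fix a assume "a \<in> f ` set c"
  then obtain j where j: "j < length c" "a = f (c ! j)" by (auto simp: in_set_conv_nth)
  have "\<exists>k>m. f (x k) = a" for m
  proof (intro exI conjI)
    let ?i = "j + length c * Suc m"
    have "m < Suc m * length c" using j(1) by (cases "length c") auto
    then show "m < T + ?i" by (simp add: mult.commute)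
    have "?i mod length c = j" using j(1) by (simp only: mod_mult_self2 mod_less)
    then show "f (x (T + ?i)) = a" using j by (simp only: assms(2))
  qed
  then show "a \<in> limit (f \<circ> x)" by (auto simp: limit_def INFM_nat)
qed

end

lemma limit_comp:
  assumes "finite (range w)" shows "limit (f \<circ> w) = f ` limit w"
proof (intro equalityI subsetI)
  obtain k where k: "limit w = range (suffix k w)" using limit_is_suffix[OF assms] by blast
  fix a assume "a \<in> limit (f \<circ> w)"
  then have "a \<in> range (suffix k (f \<circ> w))" by (rule limit_in_range_suffixD)
  then show "a \<in> f ` limit w" unfolding k by auto
qed auto

section \<open>Lassos in the product graph\<close>

definition letter_step :: "dpa_tuple list \<Rightarrow> nat \<Rightarrow> (nat list \<Rightarrow> nat \<Rightarrow> bool) \<Rightarrow> nat list \<Rightarrow> nat list \<Rightarrow> bool" where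
  "letter_step As n E u v \<longleftrightarrow> lookup v 0 < n \<and> E u (lookup v 0) \<and> v = node_next As u (lookup v 0)"

definition flags :: "nat list \<Rightarrow> nat list \<Rightarrow> nat list \<Rightarrow> nat list" where
  "flags r v f = map (\<lambda>j. if lookup v (Suc j) = lookup r j then 1 else lookup f j) [0..<length r]"

text \<open>On the cycle of a lasso, the priorities are bounded by those of the states \<open>r\<close>, and flags
  record which of these states have been visited.\<close>

definition cycle_step :: "dpa_tuple list \<Rightarrow> nat \<Rightarrow> (nat list \<Rightarrow> nat \<Rightarrow> bool) \<Rightarrow> nat list \<Rightarrow> nat list \<Rightarrow> nat list \<Rightarrow> bool" where
  "cycle_step As n E r x y \<longleftrightarrow>
     letter_step As n E (take (Suc (length As)) x) (take (Suc (length As)) y) \<and>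
     (\<forall>j\<in>set [0..<length As]. node_priority As j (take (Suc (length As)) y) \<le> dpa_priority (lookup As j) (lookup r j)) \<and>
     drop (Suc (length As)) y = flags r (take (Suc (length As)) y) (drop (Suc (length As)) x)"

context automata
begin

lemma run_word:
  assumes p: "p 0 = a # map fst As" "a < n" and step: "\<And>k. k < T \<Longrightarrow> letter_step As n E (p k) (p (Suc k))"
  obtains w where "w \<in> omega_words {..<n}" "w 0 = a" "\<And>k. k \<le> T \<Longrightarrow> nodes As w k = p k"
proof -
  define w where "w k = lookup (p (min k T)) 0" for k
  have less: "lookup (p k) 0 < n" if "k \<le> T" for k
    using that p step by (cases k) (auto simp: letter_step_def)
  then have w: "w \<in> omega_words {..<n}" by (auto simp: omega_words_def w_def)
  moreover have "nodes As w k = p k" if "k \<le> T" for k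
    using that
  proof (induction k)
    case 0
    then show ?case by (simp add: nodes_0 p w_def)
  next
    case (Suc k)
    have "w (Suc k) = lookup (p (Suc k)) 0" using Suc.prems by (simp add: w_def)
    then show ?case using Suc step[of k] by (simp add: nodes_Suc[OF w] letter_step_def)
  qed
  moreover have "w 0 = a" by (simp add: w_def p)
  ultimately show thesis using that by blast
qed

lemma limit_priority:
  assumes "w \<in> omega_words {..<n}"
  shows "limit (node_priority As j \<circ> nodes As w) = node_priority As j ` limit (nodes As w)"
  by (rule limit_comp[OF finite_nodes[OF assms]])

text \<open>A word is replaced by an ultimately periodic one with the same limit maximum for every
  automaton, so every condition on the accepting automata is preserved. The guesses
  \<open>a\<close>, \<open>s\<close> and \<open>r\<close> are small, and what remains are two
  reachability questions: the stem, and a cycle with flags.\<close>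

theorem lasso_iff:
  assumes ne: "As \<noteq> []" and B: "n \<le> B" "\<And>A. A \<in> set As \<Longrightarrow> length (fst (snd A)) \<le> B" "1 < B"
    and cong: "\<And>P Q. (\<And>j. j < length As \<Longrightarrow> P j = Q j) \<Longrightarrow> cond P = cond Q"
  shows "(\<exists>w\<in>omega_words {..<n}. I (w 0) \<and> (\<forall>k. E (nodes As w k) (w (Suc k))) \<and> cond (\<lambda>j. w \<in> lang n (lookup As j))) \<longleftrightarrow>
    (\<exists>a\<in>set [0..<n]. I a \<and> (\<exists>s\<in>tuples (Suc (length As)) B.
      (a # map fst As, s) \<in> (graph (Suc (length As)) B (letter_step As n E))\<^sup>* \<and>
      (\<exists>r\<in>tuples (length As) B.
        (s @ map (\<lambda>_. 0) As, s @ map (\<lambda>_. 1) As) \<in> (graph (Suc (length As) + length As) B (cycle_step As n E r))\<^sup>* \<and>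
        cond (\<lambda>j. even (dpa_priority (lookup As j) (lookup r j))))))"
    (is "?L \<longleftrightarrow> ?R")
proof
  let ?m = "length As"
  assume ?L
  then obtain w where w: "w \<in> omega_words {..<n}" and I: "I (w 0)" and E: "\<And>k. E (nodes As w k) (w (Suc k))"
    and c: "cond (\<lambda>j. w \<in> lang n (lookup As j))" by blast
  let ?x = "nodes As w"
  have tup: "?x k \<in> tuples (Suc ?m) B" for k by (rule nodes_tuples[OF w B(1,2)])
  have step: "letter_step As n E (?x k) (?x (Suc k))" for k
    using E[of k] omega_words_less[OF w] by (simp add: letter_step_def nodes_Suc[OF w, symmetric])
  \<comment> \<open>From \<open>k0\<close> on only recurring nodes occur, so all priorities are
    bounded by the limit maxima.\<close>
  obtain k0 where k0: "limit ?x = range (suffix k0 ?x)" using limit_is_suffix[OF finite_nodes[OF w]] by blast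
  define s where "s = ?x k0"
  have s: "s \<in> limit ?x" using k0 by (metis rangeI s_def suffix_nth add_0_right)
  define pr where "pr j = Max (node_priority As j ` limit ?x)" for j
  have lim: "finite (limit ?x)" "limit ?x \<noteq> {}" using limit_finite_range[OF finite_nodes[OF w]] by auto
  have "\<exists>u\<in>limit ?x. node_priority As j u = pr j" for j
  proof -
    have "pr j \<in> node_priority As j ` limit ?x" unfolding pr_def by (rule Max_in) (use lim in auto)
    then show ?thesis by auto
  qed
  then obtain u where u: "\<And>j. u j \<in> limit ?x" "\<And>j. node_priority As j (u j) = pr j" by metis
  have "\<exists>t>k0. ?x t = u j" for j using u(1)[of j] by (simp add: limit_def INFM_nat)
  then obtain t where t: "\<And>j. t j > k0" "\<And>j. ?x (t j) = u j" by metis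
  have "\<exists>k>Max (t ` {..<?m}). ?x k = s" using s by (simp add: limit_def INFM_nat)
  \<comment> \<open>A return to \<open>s\<close> after each automaton has attained its limit
    maximum; the cycle runs from \<open>k0\<close> to \<open>k2\<close>.\<close>
  then obtain k2 where k2: "k2 > Max (t ` {..<?m})" "?x k2 = s" by blast
  have tk: "t j < k2" if "j < ?m" for j
  proof -
    have "t j \<le> Max (t ` {..<?m})" using that by (intro Max_ge) auto
    then show ?thesis using k2(1) by linarith
  qed
  define r where "r = map (\<lambda>j. lookup (u j) (Suc j)) [0..<?m]"
  have uB: "lookup (u j) (Suc j) < B" if "j < ?m" for j
    using tup[of "t j"] t(2)[of j] that by (auto simp: tuples_def subset_iff)
  then have r: "r \<in> tuples ?m B" by (auto simp: tuples_def r_def)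
  have lr: "lookup r j = lookup (u j) (Suc j)" if "j < ?m" for j using that by (simp add: r_def)
  have prr: "dpa_priority (lookup As j) (lookup r j) = pr j" if "j < ?m" for j
    using u(2)[of j] lr[OF that] by (simp add: node_priority_def)
  have reach1: "(w 0 # map fst As, ?x k) \<in> (graph (Suc ?m) B (letter_step As n E))\<^sup>*" for k
  proof (induction k)
    case (Suc k)
    have "(?x k, ?x (Suc k)) \<in> graph (Suc ?m) B (letter_step As n E)" using tup step by (simp add: graph_def)
    with Suc show ?case by (rule rtrancl_into_rtrancl)
  qed (simp add: nodes_0)
  define fl where "fl i = map (\<lambda>j. if \<exists>k. k0 < k \<and> k \<le> k0 + i \<and> lookup (?x k) (Suc j) = lookup r j then 1 else (0::nat)) [0..<?m]" for i
  have flB: "fl i \<in> tuples ?m B" for i using B(3) by (auto simp: fl_def tuples_def)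
  have fl0: "fl 0 = map (\<lambda>_. 0) As" by (rule nth_equalityI) (simp_all add: fl_def)
  have flS: "fl (Suc i) = flags r (?x (Suc (k0 + i))) (fl i)" for i
  proof (rule nth_equalityI)
    fix j assume "j < length (fl (Suc i))"
    then have j: "j < ?m" by (simp add: fl_def)
    have "(\<exists>k. k0 < k \<and> k \<le> k0 + Suc i \<and> lookup (?x k) (Suc j) = lookup r j) \<longleftrightarrow>
        (lookup (?x (Suc (k0 + i))) (Suc j) = lookup r j) \<or> (\<exists>k. k0 < k \<and> k \<le> k0 + i \<and> lookup (?x k) (Suc j) = lookup r j)"
      by (metis add_Suc_right le_Suc_eq le_add1 le_imp_less_Suc le_refl)
    then show "fl (Suc i) ! j = flags r (?x (Suc (k0 + i))) (fl i) ! j"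
      using j by (simp add: fl_def flags_def r_def)
  qed (simp add: fl_def flags_def r_def)
  have reach2: "(s @ map (\<lambda>_. 0) As, ?x (k0 + i) @ fl i) \<in> (graph (Suc ?m + ?m) B (cycle_step As n E r))\<^sup>*" for i
  proof (induction i)
    case (Suc i)
    have le: "node_priority As j (?x (Suc (k0 + i))) \<le> dpa_priority (lookup As j) (lookup r j)" if "j < ?m" for j
    proof -
      have "?x (Suc (k0 + i)) = suffix k0 ?x (Suc i)" by simp
      then have "?x (Suc (k0 + i)) \<in> limit ?x" unfolding k0 by blast
      then have "node_priority As j (?x (Suc (k0 + i))) \<le> pr j" using lim unfolding pr_def by (intro Max_ge) auto
      then show ?thesis using prr[OF that] by simp
    qed
    have "cycle_step As n E r (?x (k0 + i) @ fl i) (?x (Suc (k0 + i)) @ fl (Suc i))"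
      unfolding cycle_step_def using step[of "k0 + i"] le flS by simp
    moreover have "x \<in> tuples (Suc ?m) B \<Longrightarrow> f \<in> tuples ?m B \<Longrightarrow> x @ f \<in> tuples (Suc ?m + ?m) B" for x f
      by (auto simp: tuples_def)
    ultimately have "(?x (k0 + i) @ fl i, ?x (k0 + Suc i) @ fl (Suc i)) \<in> graph (Suc ?m + ?m) B (cycle_step As n E r)"
      using tup flB by (simp add: graph_def)
    with Suc show ?case by (rule rtrancl_into_rtrancl)
  qed (simp add: s_def fl0)
  have k02: "k0 < k2" using tk[of 0] t(1)[of 0] ne by auto
  have "fl (k2 - k0) = map (\<lambda>_. 1) As"
  proof (rule nth_equalityI)
    fix j assume "j < length (fl (k2 - k0))"
    then have j: "j < ?m" by (simp add: fl_def)
    then have "\<exists>k. k0 < k \<and> k \<le> k2 \<and> lookup (?x k) (Suc j) = lookup r j"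
      using t[of j] tk[of j] lr[of j] by (intro exI[of _ "t j"]) auto
    then show "fl (k2 - k0) ! j = map (\<lambda>_. 1) As ! j" using j k02 by (simp add: fl_def)
  qed (simp add: fl_def)
  then have "(s @ map (\<lambda>_. 0) As, s @ map (\<lambda>_. 1) As) \<in> (graph (Suc ?m + ?m) B (cycle_step As n E r))\<^sup>*"
    using reach2[of "k2 - k0"] k2(2) k02 by simp
  moreover have "cond (\<lambda>j. even (dpa_priority (lookup As j) (lookup r j)))"
  proof -
    have "(w \<in> lang n (lookup As j)) = even (dpa_priority (lookup As j) (lookup r j))" if "j < ?m" for j
      using lang_iff[OF that w] that prr[OF that] by (simp add: limit_priority[OF w] pr_def)
    from cong[OF this] show ?thesis using c by simp
  qed
  ultimately show ?R
    using omega_words_less[OF w, of 0] I r tup[of k0] reach1[of k0] unfolding s_def by (intro bexI conjI) auto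
next
  let ?m = "length As"
  assume ?R
  then obtain a s r where a: "a < n" "I a" and s: "s \<in> tuples (Suc ?m) B" and r: "r \<in> tuples ?m B"
    and 1: "(a # map fst As, s) \<in> (graph (Suc ?m) B (letter_step As n E))\<^sup>*"
    and 2: "(s @ map (\<lambda>_. 0) As, s @ map (\<lambda>_. 1) As) \<in> (graph (Suc ?m + ?m) B (cycle_step As n E r))\<^sup>*"
    and c: "cond (\<lambda>j. even (dpa_priority (lookup As j) (lookup r j)))" by auto
  from rtrancl_imp_relpow[OF 1] obtain T where "(a # map fst As, s) \<in> graph (Suc ?m) B (letter_step As n E) ^^ T" by blast
  then obtain p where p: "p 0 = a # map fst As" "p T = s" "\<And>k. k < T \<Longrightarrow> letter_step As n E (p k) (p (Suc k))"
    unfolding relpow_fun_conv by (auto simp: graph_def)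
  from rtrancl_imp_relpow[OF 2] obtain L where
    "(s @ map (\<lambda>_. 0) As, s @ map (\<lambda>_. 1) As) \<in> graph (Suc ?m + ?m) B (cycle_step As n E r) ^^ L" by blast
  then obtain q where q: "q 0 = s @ map (\<lambda>_. 0) As" "q L = s @ map (\<lambda>_. 1) As"
    and qs: "\<And>k. k < L \<Longrightarrow> cycle_step As n E r (q k) (q (Suc k))"
    unfolding relpow_fun_conv by (auto simp: graph_def)
  \<comment> \<open>There is at least one flag, and it changes from \<open>0\<close> to
    \<open>1\<close> along the cycle.\<close>
  have L: "L > 0" using q ne by (cases L; cases As) auto
  obtain w where w: "w \<in> omega_words {..<n}" "w 0 = a" "\<And>k. k \<le> T \<Longrightarrow> nodes As w k = p k"
    by (rule run_word[OF p(1) a(1) p(3)]) blast+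
  define y where "y k = take (Suc ?m) (q k)" for k
  have ls: "length s = Suc ?m" using s by (simp add: tuples_def)
  have y0: "y 0 = s" "y L = s" using q ls by (simp_all add: y_def)
  have ys: "letter_step As n E (y k) (y (Suc k))" if "k < L" for k using qs[OF that] by (simp add: cycle_step_def y_def)
  define cyc where "cyc = map y [0..<L]"
  have cyc: "length cyc = L" "\<And>i. i < L \<Longrightarrow> cyc ! i = y i" "\<And>i. i < L \<Longrightarrow> cyc ! (Suc i mod L) = y (Suc i)"
  proof -
    show "cyc ! (Suc i mod L) = y (Suc i)" if "i < L" for i
      using that L y0 by (cases "Suc i = L") (auto simp: cyc_def)
  qed (simp_all add: cyc_def)
  have hd: "hd (y k) = lookup (y k) 0" "lookup (y k) 0 < n" if "k \<le> L" for k
  proof -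
    show "lookup (y k) 0 < n"
    proof (cases k)
      case 0
      have "lookup s 0 = w T" using w(3)[of T] p(2) nodes_lookup_0(1)[of As w T] by simp
      then show ?thesis using 0 y0 omega_words_less[OF w(1)] by simp
    next
      case (Suc k')
      then show ?thesis using ys[of k'] that by (simp add: letter_step_def)
    qed
    have "y k \<noteq> []"
    proof (cases k)
      case (Suc k')
      then show ?thesis using ys[of k'] that by (auto simp: letter_step_def node_next_def)
    qed (use y0 ls in auto)
    then show "hd (y k) = lookup (y k) 0" by (simp add: hd_conv_nth)
  qed
  have sT: "cyc ! 0 = nodes As w T" using cyc(2)[of 0] y0 L w(3)[of T] p(2) by simp
  have cs: "hd (cyc ! i) < n \<and> cyc ! (Suc i mod length cyc) = node_next As (cyc ! i) (hd (cyc ! (Suc i mod length cyc)))"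
    if i: "i < length cyc" for i
  proof -
    have "i < L" using i cyc(1) by simp
    then show ?thesis using cyc(2,3)[of i] hd[of i] hd[of "Suc i"] ys[of i] unfolding cyc(1) by (simp add: letter_step_def)
  qed
  have cne: "cyc \<noteq> []" using cyc(1) L by auto
  obtain w' where w': "w' \<in> omega_words {..<n}" "\<And>k. k \<le> T \<Longrightarrow> w' k = w k" "\<And>i. nodes As w' (T + i) = cyc ! (i mod length cyc)"
    by (rule lasso_word[OF w(1) cne sT cs]) blast+
  have E: "E (nodes As w' k) (w' (Suc k))" for k
  proof (cases "k < T")
    case True
    have "nodes As w' i = p i" if "i \<le> T" for i
      using nodes_cong[of i w' w] w'(2) w(3)[OF that] that by simp
    then show ?thesis using p(3)[OF True] True nodes_lookup_0(1)[of As w' "Suc k"] by (simp add: letter_step_def)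
  next
    case False
    define i where "i = (k - T) mod L"
    have i: "i < L" using L by (simp add: i_def)
    have k: "nodes As w' k = y i" using False w'(3)[of "k - T"] cyc(2)[OF i] by (simp add: i_def cyc(1))
    have "Suc (k - T) mod L = Suc i mod L" by (simp add: i_def mod_Suc_eq)
    then have "nodes As w' (Suc k) = y (Suc i)" using False w'(3)[of "Suc (k - T)"] cyc(3)[OF i] by (simp add: cyc(1) Suc_diff_le)
    then show ?thesis using ys[OF i] k nodes_lookup_0(1)[of As w' "Suc k"] by (simp add: letter_step_def)
  qed
  have even: "w' \<in> lang n (lookup As j) \<longleftrightarrow> even (dpa_priority (lookup As j) (lookup r j))" if j: "j < ?m" for j
  proof -
    have lim: "limit (node_priority As j \<circ> nodes As w') = node_priority As j ` set cyc"
      by (rule limit_lasso[OF cne w'(3)])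
    have le: "node_priority As j (y (Suc k)) \<le> dpa_priority (lookup As j) (lookup r j)" if "k < L" for k
      using qs[OF that] j by (simp add: cycle_step_def y_def)
    have mem: "y k \<in> set cyc" if "k \<le> L" for k
      using that y0 L cyc(1,2) by (cases "k = L") (metis nth_mem, metis nth_mem le_neq_implies_less)
    \<comment> \<open>Flag \<open>j\<close> starts at \<open>0\<close>, ends at \<open>1\<close> and
      is set only by a visit to the guessed state, so the bound on the priorities is
      attained.\<close>
    have "\<exists>k<L. lookup (y (Suc k)) (Suc j) = lookup r j"
    proof (rule ccontr)
      assume none: "\<not> ?thesis"
      have "k \<le> L \<Longrightarrow> lookup (drop (Suc ?m) (q k)) j = 0" for k
      proof (induction k)
        case 0
        then show ?case using q(1) ls j by simp
      next
        case (Suc k)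
        have "drop (Suc ?m) (q (Suc k)) = flags r (y (Suc k)) (drop (Suc ?m) (q k))"
          using qs[of k] Suc.prems by (simp add: cycle_step_def y_def)
        then show ?case using Suc none j r by (simp add: flags_def tuples_def)
      qed
      from this[of L] show False using q(2) ls j by simp
    qed
    then obtain k where k: "k < L" "lookup (y (Suc k)) (Suc j) = lookup r j" by blast
    have "Max (node_priority As j ` set cyc) = dpa_priority (lookup As j) (lookup r j)"
    proof (rule Max_eqI)
      fix z assume "z \<in> node_priority As j ` set cyc"
      then obtain i where i: "i < L" "z = node_priority As j (y i)" using cyc(1,2) by (auto simp: in_set_conv_nth)
      show "z \<le> dpa_priority (lookup As j) (lookup r j)"
      proof (cases i)
        case 0
        then show ?thesis using i le[of "L - 1"] L y0 by simp
      next
        case (Suc i')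
        then show ?thesis using i le[of i'] by simp
      qed
    next
      show "dpa_priority (lookup As j) (lookup r j) \<in> node_priority As j ` set cyc"
        using mem[of "Suc k"] k by (auto simp: node_priority_def image_iff intro!: bexI[of _ "y (Suc k)"])
    qed simp
    then show ?thesis using lang_iff[OF j w'(1)] j by (simp add: lim)
  qed
  have "cond (\<lambda>j. w' \<in> lang n (lookup As j))" using cong[OF even] c by simp
  then show ?L using w'(1) w'(2)[of 0] w(2) a(2) E by (intro bexI[of _ w'] conjI) auto
qed

end


subsection \<open>Nash equilibria\<close>

definition successors :: "dpa_tuple list \<Rightarrow> (nat \<times> nat) list \<Rightarrow> nat list \<Rightarrow> nat list set" where
  "successors As es u = {node_next As u a | a. (lookup u 0, a) \<in> set es}"

definition node_set :: "dpa_tuple list \<Rightarrow> nat \<Rightarrow> nat list set" where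
  "node_set As n = {u. length u = Suc (length As) \<and> lookup u 0 < n \<and>
     (\<forall>j<length As. lookup u (Suc j) < length (fst (snd (As ! j))))}"

primrec cycle_stack :: "dpa_tuple list \<Rightarrow> nat word \<Rightarrow> nat \<Rightarrow> nat \<Rightarrow> nat list list" where
  "cycle_stack As w k 0 = [nodes As w k]"
| "cycle_stack As w k (Suc j) = push_cycle (cycle_stack As w k j) (nodes As w (Suc (k + j)))"

lemma push_cycle_Cons: "\<exists>S'. push_cycle S t = t # S'"
proof (cases "t \<in> set S")
  case True
  then have "dropWhile (\<lambda>s. s \<noteq> t) S \<noteq> []" by (auto simp: dropWhile_eq_Nil_conv)
  then show ?thesis using True hd_dropWhile[of "\<lambda>s. s \<noteq> t" S]
    by (cases "dropWhile (\<lambda>s. s \<noteq> t) S") (auto simp: push_cycle_def)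
qed (simp add: push_cycle_def)

lemma hd_cycle_stack: "\<exists>S'. cycle_stack As w k j = nodes As w (k + j) # S'"
  using push_cycle_Cons by (cases j) auto

lemma set_push_cycle: "set (push_cycle S t) \<subseteq> insert t (set S)"
  by (auto simp: push_cycle_def dest: set_dropWhileD)

lemma set_cycle_stack: "set (cycle_stack As w k j) \<subseteq> range (nodes As w)"
proof (induction j)
  case (Suc j)
  then show ?case using set_push_cycle[of "cycle_stack As w k j" "nodes As w (Suc (k + j))"] by auto
qed simp

context automata
begin

lemma finite_node_set: "finite (node_set As n)"
  and node_set_tuples: "n \<le> B \<Longrightarrow> (\<And>A. A \<in> set As \<Longrightarrow> length (fst (snd A)) \<le> B) \<Longrightarrow>
    node_set As n \<subseteq> tuples (Suc (length As)) B"
proof -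
  have sub: "node_set As n \<subseteq> tuples (Suc (length As)) B"
    if B: "n \<le> B" "\<And>A. A \<in> set As \<Longrightarrow> length (fst (snd A)) \<le> B" for B
  proof
    fix u assume u: "u \<in> node_set As n"
    have "u ! i < B" if "i < length u" for i
    proof (cases i)
      case 0
      then show ?thesis using u B(1) that by (auto simp: node_set_def)
    next
      case (Suc j)
      then have "u ! i < length (fst (snd (As ! j)))" "As ! j \<in> set As" using u that by (auto simp: node_set_def)
      then show ?thesis using B(2)[of "As ! j"] by simp
    qed
    then show "u \<in> tuples (Suc (length As)) B" using u by (auto simp: tuples_def node_set_def in_set_conv_nth)
  qed
  show "n \<le> B \<Longrightarrow> (\<And>A. A \<in> set As \<Longrightarrow> length (fst (snd A)) \<le> B) \<Longrightarrow> node_set As n \<subseteq> tuples (Suc (length As)) B"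
    by (rule sub)
  let ?B = "n + sum_list (map (\<lambda>A. length (fst (snd A))) As)"
  have "length (fst (snd A)) \<le> ?B" if "A \<in> set As" for A
    using member_le_sum_list[of "length (fst (snd A))" "map (\<lambda>A. length (fst (snd A))) As"] that by auto
  then show "finite (node_set As n)"
    using finite_subset[OF sub[of ?B] finite_tuples(1)] by simp
qed

lemma nodes_node_set:
  assumes "w \<in> omega_words {..<n}" shows "nodes As w k \<in> node_set As n"
  using state_less[OF nth_mem assms, of _ k] omega_words_less[OF assms, of k]
  by (simp add: node_set_def) (simp add: nodes_def)

lemma node_next_node_set:
  assumes u: "u \<in> node_set As n" and a: "a < n"
  shows "node_next As u a \<in> node_set As n"
proof -
  have "dpa_next (As ! j) (lookup u (Suc j)) (lookup u 0) < length (fst (snd (As ! j)))" if j: "j < length As" for j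
  proof -
    have A: "wf_dpa_tuple n (As ! j)" using wf j by simp
    have "lookup u (Suc j) < length (fst (snd (As ! j)))" "lookup u 0 < n" using u j by (auto simp: node_set_def)
    moreover from this have row: "fst (snd (As ! j)) ! lookup u (Suc j) \<in> set (fst (snd (As ! j)))" by simp
    then have l: "length (fst (snd (As ! j)) ! lookup u (Suc j)) = n" using A by (simp add: wf_dpa_tuple_def)
    ultimately have "fst (snd (As ! j)) ! lookup u (Suc j) ! lookup u 0 \<in> set (fst (snd (As ! j)) ! lookup u (Suc j))" by simp
    with row have "fst (snd (As ! j)) ! lookup u (Suc j) ! lookup u 0 < length (fst (snd (As ! j)))"
      using A unfolding wf_dpa_tuple_def by blast
    then show ?thesis using l \<open>lookup u (Suc j) < _\<close> \<open>lookup u 0 < n\<close> by (simp add: dpa_next_def)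
  qed
  then show ?thesis using a by (simp add: node_set_def node_next_def)
qed

text \<open>In the infinite play the owner of the moves marked by \<open>mine\<close> maintains
  \<open>cycle_invariant\<close>, because \<open>cycle_invariant_step\<close> always offers a good
  push. With \<open>mine\<close> and the goal negated, the same statement serves the deviating
  player.\<close>

lemma cycle_stack_good:
  assumes w: "w \<in> omega_words {..<n}" and e: "\<And>j. (w j, w (Suc j)) \<in> set es"
    and es: "\<And>a a'. (a, a') \<in> set es \<Longrightarrow> a' < n" and d: "card (node_set As n) \<le> d"
    and start: "first_cycle (successors As es) mine good z d [nodes As w k]"
    and choose: "\<And>j. mine (nodes As w (k + j)) \<Longrightarrow> \<exists>a. (w (k + j), a) \<in> set es \<and>
      good_push (successors As es) mine good z (node_set As n) (Suc d) (cycle_stack As w k j) (node_next As (nodes As w (k + j)) a) \<Longrightarrow>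
      good_push (successors As es) mine good z (node_set As n) (Suc d) (cycle_stack As w k j) (nodes As w (Suc (k + j)))"
  shows "nodes As w (Suc (k + j)) \<in> set (cycle_stack As w k j) \<Longrightarrow>
    good (closed_cycle (cycle_stack As w k j) (nodes As w (Suc (k + j))))"
proof -
  let ?inv = "cycle_invariant (successors As es) mine good z (node_set As n) (Suc d)"
  let ?gp = "good_push (successors As es) mine good z (node_set As n) (Suc d)"
  have step: "?gp (cycle_stack As w k j) (nodes As w (Suc (k + j)))" if inv: "?inv (cycle_stack As w k j)" for j
  proof -
    obtain S' where S: "cycle_stack As w k j = nodes As w (k + j) # S'" using hd_cycle_stack by blast
    have sub: "successors As es (hd (cycle_stack As w k j)) \<subseteq> node_set As n"
      using node_next_node_set[OF nodes_node_set[OF w]] es unfolding S by (auto simp: successors_def)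
    have suc: "nodes As w (Suc (k + j)) \<in> successors As es (hd (cycle_stack As w k j))"
      using e[of "k + j"] unfolding S successors_def by (auto simp: nodes_Suc[OF w])
    note c = cycle_invariant_step[OF finite_node_set _ inv sub]
    show ?thesis
    proof (cases "mine (nodes As w (k + j))")
      case True
      then obtain t where "t \<in> successors As es (nodes As w (k + j))" "?gp (cycle_stack As w k j) t"
        using c d unfolding S by auto
      then show ?thesis using choose[OF True] by (auto simp: successors_def)
    next
      case False
      then show ?thesis using c d suc unfolding S by auto
    qed
  qed
  have "?inv (cycle_stack As w k j)" for j
  proof (induction j)
    case 0
    then show ?case using start nodes_node_set[OF w] by (simp add: cycle_invariant_def)
  next
    case (Suc j)
    then show ?case using step[OF Suc] by (simp add: good_push_def)
  qed
  then have "?gp (cycle_stack As w k j) (nodes As w (Suc (k + j)))" by (rule step)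
  then show "nodes As w (Suc (k + j)) \<in> set (cycle_stack As w k j) \<Longrightarrow>
      good (closed_cycle (cycle_stack As w k j) (nodes As w (Suc (k + j))))"
    by (simp add: good_push_def)
qed

text \<open>Acceptance is a property of the limit, so \<open>stack_parity\<close> may be applied to
  the play from any position \<open>k\<close> on.\<close>

lemma odd_cycles:
  assumes w: "w \<in> omega_words {..<n}" and p: "p < length As"
    and odd: "\<And>j. nodes As w (Suc (k + j)) \<in> set (cycle_stack As w k j) \<Longrightarrow>
      odd (Max (node_priority As p ` set (closed_cycle (cycle_stack As w k j) (nodes As w (Suc (k + j))))))"
  shows "w \<notin> lang n (As ! p)"
proof -
  have "odd (Max (limit (node_priority As p \<circ> suffix k (nodes As w))))"
  proof (rule stack_parity[where S = "cycle_stack As w k"])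
    show "finite (range (suffix k (nodes As w)))"
      by (rule finite_subset[OF _ finite_nodes[OF w]]) auto
  qed (use odd in auto)
  moreover have "limit (node_priority As p \<circ> suffix k (nodes As w)) = limit (node_priority As p \<circ> nodes As w)"
    using limit_suffix[of k "node_priority As p \<circ> nodes As w"] by (simp add: suffix_def comp_def)
  ultimately show ?thesis using lang_iff[OF p w] by simp
qed

text \<open>A cycle that is cut out by the stack can be repeated forever.\<close>

lemma closed_cycle_word:
  assumes w: "w \<in> omega_words {..<n}" and t: "nodes As w (Suc (k + j)) \<in> set (cycle_stack As w k j)"
  obtains w' where "w' \<in> omega_words {..<n}"
    "\<And>p. p < length As \<Longrightarrow> w' \<in> lang n (As ! p) \<longleftrightarrow>
      even (Max (node_priority As p ` set (closed_cycle (cycle_stack As w k j) (nodes As w (Suc (k + j))))))"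
proof -
  let ?R = "\<lambda>t s. hd t < n \<and> t = node_next As s (hd t)"
  have step: "?R (nodes As w (Suc i)) (nodes As w i)" for i
    using omega_words_less[OF w] by (simp add: nodes_Suc[OF w, of i, symmetric])
  have path: "successively ?R (cycle_stack As w k j)" for j
  proof (induction j)
    case (Suc j)
    obtain S' where S: "cycle_stack As w k j = nodes As w (k + j) # S'" using hd_cycle_stack by blast
    let ?P = "\<lambda>s. s \<noteq> nodes As w (Suc (k + j))"
    have "successively ?R (takeWhile ?P (cycle_stack As w k j) @ dropWhile ?P (cycle_stack As w k j))"
      using Suc by (simp only: takeWhile_dropWhile_id)
    then have "successively ?R (dropWhile ?P (cycle_stack As w k j))"
      unfolding successively_append_iff by blast
    moreover have "successively ?R (nodes As w (Suc (k + j)) # cycle_stack As w k j)"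
      using Suc step[of "k + j"] unfolding S by (simp only: successively.simps simp_thms)
    ultimately show ?case unfolding cycle_stack.simps push_cycle_def by (simp only: if_split) blast
  qed simp
  let ?S = "cycle_stack As w k j" and ?t = "nodes As w (Suc (k + j))"
  obtain S' where S: "?S = nodes As w (k + j) # S'" using hd_cycle_stack by blast
  define q where "q = closed_cycle ?S ?t"
  obtain zs where zs: "?S = q @ zs"
  proof -
    have "?S = takeWhile (\<lambda>s. s \<noteq> ?t) ?S @ dropWhile (\<lambda>s. s \<noteq> ?t) ?S" by simp
    moreover obtain zs where "dropWhile (\<lambda>s. s \<noteq> ?t) ?S = ?t # zs"
      using push_cycle_Cons[of ?S ?t] t by (auto simp: push_cycle_def)
    ultimately have "?S = q @ zs" by (simp add: q_def closed_cycle_def)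
    then show thesis by (rule that)
  qed
  have q: "q \<noteq> []" "last q = ?t" by (simp_all add: q_def closed_cycle_def)
  have q0: "q ! 0 = nodes As w (k + j)" using zs S q(1) by (cases q) auto
  have qs: "successively ?R q" using path[of j] unfolding zs successively_append_iff by blast
  have qset: "x \<in> range (nodes As w)" if "x \<in> set q" for x
    using that set_cycle_stack[of As w k j] zs by auto
  \<comment> \<open>The stack lists the latest node first, so the closed walk is \<open>q\<close>
    reversed: it starts at \<open>?t\<close> and ends at node \<open>k + j\<close>, whose successor
    is \<open>?t\<close> again.\<close>
  define c where "c = rev q"
  have c: "c \<noteq> []" "c ! 0 = ?t" using q by (simp_all add: c_def rev_nth last_conv_nth)
  have cs: "hd (c ! i) < n \<and> c ! (Suc i mod length c) = node_next As (c ! i) (hd (c ! (Suc i mod length c)))"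
    if i: "i < length c" for i
  proof
    have "c ! i \<in> set q" using i by (metis c_def nth_mem set_rev)
    then obtain l where "c ! i = nodes As w l" using qset by blast
    then show "hd (c ! i) < n" using omega_words_less[OF w] by simp
    show "c ! (Suc i mod length c) = node_next As (c ! i) (hd (c ! (Suc i mod length c)))"
    proof (cases "Suc i = length c")
      case True
      then have "c ! i = nodes As w (k + j)" unfolding q0[symmetric] by (simp add: c_def rev_nth)
      moreover have "c ! (Suc i mod length c) = ?t" using True c(2) by simp
      ultimately show ?thesis using step[of "k + j"] by (simp only:)
    next
      case False
      then have l: "Suc i < length q" using i by (simp add: c_def)
      define l where "l = length q - Suc (Suc i)"
      have "c ! Suc i = q ! l" "c ! i = q ! Suc l" "Suc l < length q"
        using l by (simp_all add: c_def rev_nth l_def Suc_diff_Suc)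
      then show ?thesis using qs l by (simp add: successively_conv_nth c_def)
    qed
  qed
  obtain w' where w': "w' \<in> omega_words {..<n}" "\<And>l. nodes As w' (Suc (k + j) + l) = c ! (l mod length c)"
    by (rule lasso_word[OF w c cs]) blast+
  have "limit (node_priority As p \<circ> nodes As w') = node_priority As p ` set q" for p
    using limit_lasso[OF c(1) w'(2), of "node_priority As p"] by (simp add: c_def)
  then show thesis using w'(1) lang_iff by (intro that[of w']) (auto simp: q_def)
qed

end

text \<open>The goal of the coalition: repeating the cycle forever yields no payoff that the player
  prefers to \<open>p\<close>.\<close>

definition good_cycle :: "player_tuple \<Rightarrow> nat \<Rightarrow> nat list list \<Rightarrow> bool" where
  "good_cycle P p c \<longleftrightarrow>
     (\<forall>j\<in>set [0..<length (fst P)]. (p, j) \<in> set (snd P) \<longrightarrow> odd (Max (node_priority (fst P) j ` set c)))"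

definition coalition_wins :: "nat list \<Rightarrow> (nat \<times> nat) list \<Rightarrow> player_tuple \<Rightarrow> nat \<Rightarrow> nat \<Rightarrow> nat \<Rightarrow> nat list \<Rightarrow> bool" where
  "coalition_wins own es P i p d u =
     first_cycle (successors (fst P) es) (\<lambda>u. lookup own (lookup u 0) \<noteq> i) (good_cycle P p) True d [u]"

text \<open>The stack since position \<open>k\<close> is recomputed from the history, which turns a
  winning first-cycle game into a strategy. If no push is good, some edge is taken, so that the move
  is legal after every history.\<close>

definition stack_move where
  "stack_move As es mine good z d n k h =
     (let S = cycle_stack As (\<lambda>j. lookup h j) k (length h - Suc k);
        gp = (\<lambda>a. good_push (successors As es) mine good z (node_set As n) (Suc d) S (node_next As (hd S) a))
      in SOME a. (last h, a) \<in> set es \<and> ((\<exists>b. (last h, b) \<in> set es \<and> gp b) \<longrightarrow> gp a))"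

lemma stack_move_edge: "\<exists>a. (last h, a) \<in> set es \<Longrightarrow> (last h, stack_move As es mine good z d n k h) \<in> set es"
  unfolding stack_move_def Let_def by (rule someI2_ex) blast+

lemma cycle_stack_local: "(\<And>i. i \<le> k + j \<Longrightarrow> w i = w' i) \<Longrightarrow> cycle_stack As w k j = cycle_stack As w' k j"
proof (induction j)
  case 0
  then show ?case using nodes_cong[of k w w'] by simp
next
  case (Suc j)
  then show ?case using nodes_cong[of "Suc (k + j)" w w'] by simp
qed

lemma stack_move_good:
  assumes "(w (k + j), b) \<in> set es"
    "good_push (successors As es) mine good z (node_set As n) (Suc d) (cycle_stack As w k j) (node_next As (nodes As w (k + j)) b)"
  shows "good_push (successors As es) mine good z (node_set As n) (Suc d) (cycle_stack As w k j)
    (node_next As (nodes As w (k + j)) (stack_move As es mine good z d n k (prefix (Suc (k + j)) w)))"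
proof -
  have S: "cycle_stack As (lookup (prefix (Suc (k + j)) w)) k (length (prefix (Suc (k + j)) w) - Suc k) = cycle_stack As w k j"
  proof -
    have "length (prefix (Suc (k + j)) w) - Suc k = j" by (simp add: subsequence_def)
    then show ?thesis by (simp only:) (rule cycle_stack_local, simp add: lookup_def subsequence_def del: upt_Suc)
  qed
  have l: "last (prefix (Suc (k + j)) w) = w (k + j)" by (simp add: subsequence_def)
  obtain S' where h: "cycle_stack As w k j = nodes As w (k + j) # S'" using hd_cycle_stack by blast
  have hd: "hd (cycle_stack As w k j) = nodes As w (k + j)" by (simp add: h)
  let ?g = "\<lambda>a. good_push (successors As es) mine good z (node_set As n) (Suc d) (cycle_stack As w k j) (node_next As (nodes As w (k + j)) a)"
  have e: "stack_move As es mine good z d n k (prefix (Suc (k + j)) w) =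
      (SOME a. (w (k + j), a) \<in> set es \<and> ((\<exists>b. (w (k + j), b) \<in> set es \<and> ?g b) \<longrightarrow> ?g a))"
    unfolding stack_move_def Let_def S l hd ..
  have "\<exists>a. (w (k + j), a) \<in> set es \<and> ((\<exists>b. (w (k + j), b) \<in> set es \<and> ?g b) \<longrightarrow> ?g a)" using assms by blast
  from someI_ex[OF this] show ?thesis unfolding e using assms by blast
qed

section \<open>Equilibria of a represented game\<close>

locale represented =
  fixes own :: "nat list" and es :: "(nat \<times> nat) list" and pls :: "player_tuple list" and G :: "(nat, nat, nat) game"
  assumes rep: "represents (mk_game (own, es, pls)) G"
begin

abbreviation "n \<equiv> length own"

lemma arena: "verts G = {..<n}" "edges G = set es" "players G = {..<length pls}" "wf_arena G"
proof -
  have "verts G = {..<length (rep_owner (mk_game (own, es, pls)))}" "edges G = set (rep_edges (mk_game (own, es, pls)))"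
    "players G = {..<length (rep_players (mk_game (own, es, pls)))}" and "rp_game G"
    using rep unfolding represents_def by blast+
  then show "verts G = {..<n}" "edges G = set es" "players G = {..<length pls}" "wf_arena G"
    by (simp_all add: mk_game_def rp_game_def wf_game_def)
qed

lemma player:
  assumes "i < length pls"
  shows "owned G i = {v. v < n \<and> own ! v = i}" "payoffs G i = {..<length (fst (pls ! i))}" "pref G i = set (snd (pls ! i))"
proof -
  have i: "i \<in> players G" using assms arena by simp
  then have "owned G i = {v \<in> verts G. rep_owner (mk_game (own, es, pls)) ! v = i}"
    "payoffs G i = {..<length (rep_automata (rep_players (mk_game (own, es, pls)) ! i))}"
    "pref G i = set (rep_pref (rep_players (mk_game (own, es, pls)) ! i))"
    using rep unfolding represents_def by blast+
  then show "owned G i = {v. v < n \<and> own ! v = i}" "payoffs G i = {..<length (fst (pls ! i))}" "pref G i = set (snd (pls ! i))"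
    using assms by (simp_all add: mk_game_def mk_player_def arena)
qed

lemma automaton:
  assumes "i < length pls" "p < length (fst (pls ! i))"
  shows "wf_dpa_tuple n (fst (pls ! i) ! p)" "lang n (fst (pls ! i) ! p) = pay_preimage G i p"
proof -
  let ?R = "mk_game (own, es, pls)"
  have "i \<in> players G" "p \<in> payoffs G i" using assms arena player by auto
  moreover have "\<forall>i\<in>players G. \<forall>p\<in>payoffs G i. wf_dpa_rep (length (rep_owner ?R)) (rep_automata (rep_players ?R ! i) ! p) \<and>
      dpa_language (verts G) (dpa_of (rep_automata (rep_players ?R ! i) ! p)) = pay_preimage G i p"
    using rep unfolding represents_def Let_def by blast
  ultimately have "wf_dpa_rep (length (rep_owner ?R)) (rep_automata (rep_players ?R ! i) ! p)"
    "dpa_language (verts G) (dpa_of (rep_automata (rep_players ?R ! i) ! p)) = pay_preimage G i p" by blast+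
  then show "wf_dpa_tuple n (fst (pls ! i) ! p)" "lang n (fst (pls ! i) ! p) = pay_preimage G i p"
    using assms arena(1) wf_dpa_tuple by (simp_all add: mk_game_def mk_player_def)
qed

lemma automata: "i < length pls \<Longrightarrow> automata (fst (pls ! i)) n"
  by unfold_locales (metis in_set_conv_nth automaton(1))

lemma pay:
  assumes "i < length pls" "w \<in> omega_words {..<n}"
  shows "pay G i w < length (fst (pls ! i))"
    and "p < length (fst (pls ! i)) \<Longrightarrow> w \<in> lang n (fst (pls ! i) ! p) \<longleftrightarrow> pay G i w = p"
proof -
  have "\<forall>i\<in>players G. \<forall>w\<in>omega_words (verts G). pay G i w \<in> payoffs G i"
    using rep unfolding represents_def rp_game_def wf_game_def by blast
  then have "pay G i w \<in> payoffs G i" using assms unfolding arena by blast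
  then show "pay G i w < length (fst (pls ! i))" using player(2)[OF assms(1)] by simp
  show "p < length (fst (pls ! i)) \<Longrightarrow> w \<in> lang n (fst (pls ! i) ! p) \<longleftrightarrow> pay G i w = p"
    using assms(2) arena(1) by (simp add: automaton(2)[OF assms(1)] pay_preimage_def)
qed

lemma edges:
  "(a, b) \<in> set es \<Longrightarrow> a < n" "(a, b) \<in> set es \<Longrightarrow> b < n" "a < n \<Longrightarrow> \<exists>b. (a, b) \<in> set es"
  "a < n \<Longrightarrow> own ! a < length pls"
proof -
  have "edges G \<subseteq> verts G \<times> verts G" "\<forall>v\<in>verts G. \<exists>u. (v, u) \<in> edges G" "(\<Union>i\<in>players G. owned G i) = verts G"
    using arena(4) by (auto simp: wf_arena_def)
  then have *: "set es \<subseteq> {..<n} \<times> {..<n}" "\<forall>a<n. \<exists>b. (a, b) \<in> set es" "\<forall>a<n. \<exists>i<length pls. a \<in> owned G i"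
    unfolding arena by auto
  then show "(a, b) \<in> set es \<Longrightarrow> a < n" "(a, b) \<in> set es \<Longrightarrow> b < n" "a < n \<Longrightarrow> \<exists>b. (a, b) \<in> set es"
    by auto
  assume "a < n"
  then obtain i where "i < length pls" "a \<in> owned G i" using * by blast
  then show "own ! a < length pls" using player(1) by auto
qed

lemma play_iff: "play G w \<longleftrightarrow> w \<in> omega_words {..<n} \<and> (\<forall>k. (w k, w (Suc k)) \<in> set es)"
  by (auto simp: play_def omega_words_def arena)

lemma history_last: "history G h \<Longrightarrow> last h < n"
  using last_in_set[of h] by (auto simp: history_def arena subset_iff)

lemma step_cases:
  assumes "profile G \<sigma>" "v < n"
  shows "outcome G \<sigma> v (Suc k) = \<sigma> (own ! outcome G \<sigma> v k) (prefix (Suc k) (outcome G \<sigma> v))"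
proof -
  let ?w = "outcome G \<sigma> v"
  note out = outcome_props[OF arena(4) assms(1), of v] assms(2) arena(1,3)
  have k: "?w k < n" using out by (auto simp: play_def image_subset_iff)
  then have i: "own ! ?w k < length pls" by (rule edges)
  then have "consistent G (own ! ?w k) (\<sigma> (own ! ?w k)) ?w" using out by auto
  then show ?thesis using player(1)[OF i] k by (auto simp: consistent_def)
qed

lemma play_outcome: "profile G \<sigma> \<Longrightarrow> v < n \<Longrightarrow> play G (outcome G \<sigma> v) \<and> outcome G \<sigma> v 0 = v"
  using outcome_props[OF arena(4), of \<sigma> v] arena(1) by auto

text \<open>The cycle repeated forever is a word and has exactly one payoff, so exactly one
  automaton accepts it. This carries the partition of words over to the cycles of the stack.\<close>

lemma cycle_partition:
  assumes i: "i < length pls" and w: "w \<in> omega_words {..<n}"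
    and t: "nodes (fst (pls ! i)) w (Suc (k + j)) \<in> set (cycle_stack (fst (pls ! i)) w k j)"
  shows "\<exists>q<length (fst (pls ! i)). \<forall>p<length (fst (pls ! i)).
    even (Max (node_priority (fst (pls ! i)) p ` set (closed_cycle (cycle_stack (fst (pls ! i)) w k j) (nodes (fst (pls ! i)) w (Suc (k + j))))))
    \<longleftrightarrow> p = q"
proof -
  interpret automata "fst (pls ! i)" n by (rule automata[OF i])
  obtain w' where "w' \<in> omega_words {..<n}" "\<And>p. p < length (fst (pls ! i)) \<Longrightarrow> w' \<in> lang n (fst (pls ! i) ! p) \<longleftrightarrow>
      even (Max (node_priority (fst (pls ! i)) p ` set (closed_cycle (cycle_stack (fst (pls ! i)) w k j) (nodes (fst (pls ! i)) w (Suc (k + j))))))"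
    by (rule closed_cycle_word[OF w t]) blast+
  then show ?thesis using pay[OF i, of w'] by (intro exI[of _ "pay G i w'"]) auto
qed

text \<open>If the coalition lost at a node of the outcome, the player would win the dual game there
  and could make each later closed cycle even for some preferred payoff. By
  \<open>cycle_partition\<close> these cycles are odd for every payoff that is not preferred, so
  \<open>odd_cycles\<close> excludes all of those, and the deviation is profitable.\<close>

theorem nash_equilibrium_outcome:
  assumes \<sigma>: "nash_equilibrium G v \<sigma>" and v: "v < n" and i: "i < length pls"
    and d: "card (node_set (fst (pls ! i)) n) \<le> d"
  shows "(pay G i (outcome G \<sigma> v), pay G i (outcome G \<sigma> v)) \<notin> set (snd (pls ! i))"
    and "coalition_wins own es (pls ! i) i (pay G i (outcome G \<sigma> v)) d (nodes (fst (pls ! i)) (outcome G \<sigma> v) k)"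
proof -
  let ?w = "outcome G \<sigma> v" and ?As = "fst (pls ! i)"
  let ?p = "pay G i ?w"
  interpret A: automata ?As n by (rule automata[OF i])
  have prof: "profile G \<sigma>" using \<sigma> by (simp add: nash_equilibrium_def)
  have dev: "(?p, pay G i (outcome G (\<sigma>(i := \<tau>)) v)) \<notin> set (snd (pls ! i))" if "strategy G i \<tau>" for \<tau>
    using \<sigma> that i unfolding nash_equilibrium_def arena(3) player(3)[OF i, symmetric] by simp
  have si: "strategy G i (\<sigma> i)" using prof i by (simp add: profile_def arena)
  \<comment> \<open>Keeping one's own strategy counts as a deviation, which matters because
    preference relations may be reflexive.\<close>
  show "(?p, ?p) \<notin> set (snd (pls ! i))" using dev[OF si] by simp
  show "coalition_wins own es (pls ! i) i ?p d (nodes ?As ?w k)"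
  proof (rule ccontr)
    assume lose: "\<not> coalition_wins own es (pls ! i) i ?p d (nodes ?As ?w k)"
    let ?mine = "\<lambda>u. \<not> lookup own (lookup u 0) \<noteq> i" and ?good = "\<lambda>c. \<not> good_cycle (pls ! i) ?p c"
    define mv where "mv = stack_move ?As es ?mine ?good False d n k"
    \<comment> \<open>A history of length at most \<open>k\<close> ends before position
      \<open>k\<close>; so the outcome is followed up to position \<open>k\<close>, and the attack
      starts with the move from there.\<close>
    define \<tau> where "\<tau> h = (if length h \<le> k then \<sigma> i h else mv h)" for h
    have \<tau>: "strategy G i \<tau>"
      unfolding strategy_def
    proof (intro allI impI)
      fix h assume h: "history G h \<and> last h \<in> owned G i"
      then have "(last h, mv h) \<in> set es"
        unfolding mv_def using edges(3)[OF history_last[of h]] by (intro stack_move_edge) simp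
      then show "(last h, \<tau> h) \<in> edges G" using h si by (simp add: \<tau>_def arena strategy_def)
    qed
    then have prof': "profile G (\<sigma>(i := \<tau>))" using prof by (simp add: profile_def)
    define x where "x = outcome G (\<sigma>(i := \<tau>)) v"
    have x: "x \<in> omega_words {..<n}" "\<And>j. (x j, x (Suc j)) \<in> set es" "x 0 = v"
      using play_outcome[OF prof' v] unfolding x_def[symmetric] by (auto simp: play_iff)
    have w: "?w \<in> omega_words {..<n}" "?w 0 = v"
      using play_outcome[OF prof v] by (auto simp: play_iff)
    have agree: "j \<le> k \<Longrightarrow> \<forall>l\<le>j. x l = ?w l" for j
    proof (induction j)
      case (Suc j)
      have IH: "\<forall>l\<le>j. x l = ?w l" by (rule Suc.IH[OF Suc_leD[OF Suc.prems]])
      then have "prefix (Suc j) x = prefix (Suc j) ?w" unfolding subsequence_def by (intro map_cong) auto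
      moreover have "x j = ?w j" using IH by simp
      ultimately have "x (Suc j) = ?w (Suc j)"
        using step_cases[OF prof v, of j] step_cases[OF prof' v, of j, folded x_def] Suc.prems by (auto simp: \<tau>_def)
      then show ?case using IH by (auto simp: le_Suc_eq)
    qed (use x w in simp)
    then have node: "nodes ?As x k = nodes ?As ?w k" by (intro nodes_cong) auto
    have start: "first_cycle (successors ?As es) ?mine ?good False d [nodes ?As x k]"
      using lose unfolding coalition_wins_def first_cycle_dual node by simp
    have bad: "\<not> good_cycle (pls ! i) ?p (closed_cycle (cycle_stack ?As x k j) (nodes ?As x (Suc (k + j))))"
      if "nodes ?As x (Suc (k + j)) \<in> set (cycle_stack ?As x k j)" for j
    proof (rule A.cycle_stack_good[OF x(1,2) edges(2) d start _ that])
      fix j assume m: "?mine (nodes ?As x (k + j))" and ex: "\<exists>a. (x (k + j), a) \<in> set es \<and>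
        good_push (successors ?As es) ?mine ?good False (node_set ?As n) (Suc d) (cycle_stack ?As x k j) (node_next ?As (nodes ?As x (k + j)) a)"
      have "own ! x (k + j) = i" using m omega_words_less[OF x(1)] by simp
      then have xe: "x (Suc (k + j)) = mv (prefix (Suc (k + j)) x)"
        using step_cases[OF prof' v, of "k + j", folded x_def] by (simp add: \<tau>_def)
      obtain b where b: "(x (k + j), b) \<in> set es"
        "good_push (successors ?As es) ?mine ?good False (node_set ?As n) (Suc d) (cycle_stack ?As x k j) (node_next ?As (nodes ?As x (k + j)) b)"
        using ex by blast
      show "good_push (successors ?As es) ?mine ?good False (node_set ?As n) (Suc d) (cycle_stack ?As x k j) (nodes ?As x (Suc (k + j)))"
        unfolding A.nodes_Suc[OF x(1), of "k + j"] xe mv_def by (rule stack_move_good[OF b])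
    qed
    have "x \<notin> lang n (?As ! q)" if q: "q < length ?As" "(?p, q) \<notin> set (snd (pls ! i))" for q
    proof (rule A.odd_cycles[OF x(1) q(1), of k])
      fix j assume t: "nodes ?As x (Suc (k + j)) \<in> set (cycle_stack ?As x k j)"
      let ?c = "closed_cycle (cycle_stack ?As x k j) (nodes ?As x (Suc (k + j)))"
      obtain q' where q': "q' < length ?As" "\<And>p. p < length ?As \<Longrightarrow> even (Max (node_priority ?As p ` set ?c)) \<longleftrightarrow> p = q'"
        using cycle_partition[OF i x(1) t] by blast
      obtain j' where "j' < length ?As" "(?p, j') \<in> set (snd (pls ! i))" "even (Max (node_priority ?As j' ` set ?c))"
        using bad[OF t] unfolding good_cycle_def by auto
      then have "j' \<noteq> q" "j' = q'" using q(2) q' by auto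
      then show "odd (Max (node_priority ?As q ` set ?c))" using q(1) q' by simp
    qed
    then show False using dev[OF \<tau>, folded x_def] pay(1)[OF i x(1)] pay(2)[OF i x(1) pay(1)[OF i x(1)]] by blast
  qed
qed

text \<open>Everybody follows \<open>w\<close>, and the first player to leave it is punished by the
  others, who win the first-cycle game from the last common node. A deviation that does not leave
  \<open>w\<close> is unprofitable by \<open>irrefl\<close>.\<close>

theorem nash_equilibrium_construct:
  assumes w: "play G w" and v: "v < n" "w 0 = v" and d: "\<And>i. i < length pls \<Longrightarrow> card (node_set (fst (pls ! i)) n) \<le> d i"
    and irrefl: "\<And>i. i < length pls \<Longrightarrow> (pay G i w, pay G i w) \<notin> set (snd (pls ! i))"
    and win: "\<And>i k. i < length pls \<Longrightarrow> coalition_wins own es (pls ! i) i (pay G i w) (d i) (nodes (fst (pls ! i)) w k)"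
  obtains \<sigma> where "nash_equilibrium G v \<sigma>" "outcome G \<sigma> v = w"
proof -
  let ?mine = "\<lambda>i u. lookup own (lookup u 0) \<noteq> i" and ?good = "\<lambda>i. good_cycle (pls ! i) (pay G i w)"
  define mv where "mv i k = stack_move (fst (pls ! i)) es (?mine i) (?good i) True (d i) n k" for i k
  \<comment> \<open>The first position off \<open>w\<close>. The owner of the vertex before it is
    the deviator, and that vertex is on \<open>w\<close>, where the coalition is assumed to win;
    hence \<open>dv h - 1\<close> in both places below.\<close>
  define dv where "dv h = (LEAST j. lookup h j \<noteq> w j)" for h
  define \<sigma> where "\<sigma> (o' :: nat) h = (if \<forall>j<length h. h ! j = w j then w (length h)
    else mv (own ! w (dv h - 1)) (dv h - 1) h)" for o' h
  have wp: "w \<in> omega_words {..<n}" "\<And>k. (w k, w (Suc k)) \<in> set es" using w by (auto simp: play_iff)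
  have "strategy G i (\<sigma> i)" for i
    unfolding strategy_def
  proof (intro allI impI)
    fix h assume h: "history G h \<and> last h \<in> owned G i"
    have "(last h, \<sigma> i h) \<in> set es"
    proof (cases "\<forall>j<length h. h ! j = w j")
      case True
      have "h \<noteq> []" using h by (simp add: history_def)
      then have "last h = w (length h - 1)" "Suc (length h - 1) = length h" using True by (simp_all add: last_conv_nth)
      then show ?thesis using True wp(2)[of "length h - 1"] by (simp add: \<sigma>_def)
    next
      case False
      then have "\<sigma> i h = mv (own ! w (dv h - 1)) (dv h - 1) h" unfolding \<sigma>_def by (simp only: if_False)
      then show ?thesis using edges(3)[OF history_last[of h]] h by (simp add: mv_def stack_move_edge)
    qed
    then show "(last h, \<sigma> i h) \<in> edges G" by (simp add: arena)
  qed
  then have prof: "profile G \<sigma>" by (simp add: profile_def)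
  have out: "outcome G \<sigma> v = w"
    unfolding v(2)[symmetric]
    by (rule outcome_eqI[OF arena(4) prof w]) (auto simp: consistent_def \<sigma>_def subsequence_def simp del: upt_Suc)
  have "(pay G i w, pay G i (outcome G (\<sigma>(i := \<tau>)) v)) \<notin> set (snd (pls ! i))"
    if i: "i < length pls" and \<tau>: "strategy G i \<tau>" for i \<tau>
  proof -
    let ?As = "fst (pls ! i)"
    interpret A: automata ?As n by (rule automata[OF i])
    define x where "x = outcome G (\<sigma>(i := \<tau>)) v"
    have prof': "profile G (\<sigma>(i := \<tau>))" using prof \<tau> by (simp add: profile_def)
    have x: "x \<in> omega_words {..<n}" "\<And>j. (x j, x (Suc j)) \<in> set es" "x 0 = v"
      using play_outcome[OF prof' v(1)] unfolding x_def[symmetric] by (auto simp: play_iff)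
    note xs = step_cases[OF prof' v(1), folded x_def]
    show ?thesis
      unfolding x_def[symmetric]
    proof (cases "x = w")
      case True
      then show "(pay G i w, pay G i x) \<notin> set (snd (pls ! i))" using irrefl[OF i] by simp
    next
      case False
      then obtain j where "x j \<noteq> w j" by blast
      define l where "l = (LEAST j. x j \<noteq> w j)"
      have l: "x l \<noteq> w l" unfolding l_def by (rule LeastI) fact
      have before: "x j = w j" if "j < l" for j using not_less_Least[of j "\<lambda>j. x j \<noteq> w j"] that by (auto simp: l_def)
      have "l \<noteq> 0" using l x(3) v(2) by (intro notI) simp
      then obtain k where k: "l = Suc k" using not0_implies_Suc by blast
      have follow: "\<forall>j<length (prefix (Suc k) x). prefix (Suc k) x ! j = w j"
        using before k by (simp add: subsequence_def del: upt_Suc)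
      have own: "own ! w k = i"
      proof (rule ccontr)
        assume "own ! w k \<noteq> i"
        then have "x (Suc k) = \<sigma> (own ! w k) (prefix (Suc k) x)" using xs[of k] before[of k] k by simp
        also have "\<dots> = w (Suc k)" using follow by (simp add: \<sigma>_def subsequence_def)
        finally show False using l k by simp
      qed
      have deviation: "dv (prefix (Suc (k + j)) x) = Suc k" "\<not> (\<forall>m<length (prefix (Suc (k + j)) x). prefix (Suc (k + j)) x ! m = w m)"
        if "j > 0" for j
      proof -
        have lk: "lookup (prefix (Suc (k + j)) x) m = x m" if "m \<le> k + j" for m
          using that by (simp add: lookup_def subsequence_def del: upt_Suc)
        show "dv (prefix (Suc (k + j)) x) = Suc k"
          unfolding dv_def
        proof (rule Least_equality)
          show "lookup (prefix (Suc (k + j)) x) (Suc k) \<noteq> w (Suc k)" using lk[of "Suc k"] that l k by simp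
          show "Suc k \<le> y" if "lookup (prefix (Suc (k + j)) x) y \<noteq> w y" for y
          proof (rule ccontr)
            assume "\<not> Suc k \<le> y"
            then show False using that lk[of y] before[of y] k by simp
          qed
        qed
        have "prefix (Suc (k + j)) x ! Suc k \<noteq> w (Suc k)" "Suc k < length (prefix (Suc (k + j)) x)"
          using lk[of "Suc k"] that l k by (simp_all add: subsequence_def del: upt_Suc)
        then show "\<not> (\<forall>m<length (prefix (Suc (k + j)) x). prefix (Suc (k + j)) x ! m = w m)" by blast
      qed
      have node: "nodes ?As x k = nodes ?As w k" using before k by (intro nodes_cong) auto
      have start: "first_cycle (successors ?As es) (?mine i) (?good i) True (d i) [nodes ?As x k]"
        using win[OF i, of k] unfolding coalition_wins_def node by simp
      have good: "?good i (closed_cycle (cycle_stack ?As x k j) (nodes ?As x (Suc (k + j))))"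
        if "nodes ?As x (Suc (k + j)) \<in> set (cycle_stack ?As x k j)" for j
      proof (rule A.cycle_stack_good[OF x(1,2) edges(2) d[OF i] start _ that])
        fix j assume m: "?mine i (nodes ?As x (k + j))" and ex: "\<exists>a. (x (k + j), a) \<in> set es \<and>
          good_push (successors ?As es) (?mine i) (?good i) True (node_set ?As n) (Suc (d i)) (cycle_stack ?As x k j) (node_next ?As (nodes ?As x (k + j)) a)"
        have m': "own ! x (k + j) \<noteq> i" using m omega_words_less[OF x(1)] by simp
        then have j: "j > 0" using own before[of k] k by (cases j) auto
        have "x (Suc (k + j)) = \<sigma> (own ! x (k + j)) (prefix (Suc (k + j)) x)" using xs[of "k + j"] m' by simp
        also have "\<dots> = mv (own ! w (dv (prefix (Suc (k + j)) x) - 1)) (dv (prefix (Suc (k + j)) x) - 1) (prefix (Suc (k + j)) x)"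
          unfolding \<sigma>_def if_not_P[OF deviation(2)[OF j]] ..
        also have "\<dots> = mv i k (prefix (Suc (k + j)) x)" unfolding deviation(1)[OF j] diff_Suc_1 own ..
        finally have xe: "x (Suc (k + j)) = mv i k (prefix (Suc (k + j)) x)" .
        obtain b where b: "(x (k + j), b) \<in> set es" "good_push (successors ?As es) (?mine i) (?good i) True (node_set ?As n)
            (Suc (d i)) (cycle_stack ?As x k j) (node_next ?As (nodes ?As x (k + j)) b)"
          using ex by blast
        show "good_push (successors ?As es) (?mine i) (?good i) True (node_set ?As n) (Suc (d i)) (cycle_stack ?As x k j) (nodes ?As x (Suc (k + j)))"
          unfolding A.nodes_Suc[OF x(1), of "k + j"] xe mv_def by (rule stack_move_good[OF b])
      qed
      show "(pay G i w, pay G i x) \<notin> set (snd (pls ! i))"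
      proof
        assume pref: "(pay G i w, pay G i x) \<in> set (snd (pls ! i))"
        have px: "pay G i x < length ?As" by (rule pay(1)[OF i x(1)])
        have "x \<notin> lang n (?As ! pay G i x)"
          by (rule A.odd_cycles[OF x(1) px, of k], drule good) (use pref px in \<open>auto simp: good_cycle_def\<close>)
        then show False using pay(2)[OF i x(1) px] by simp
      qed
    qed
  qed
  then have "nash_equilibrium G v \<sigma>"
    using prof unfolding nash_equilibrium_def out arena(3) by (simp add: player(3))
  then show thesis using out by (rule that)
qed

end


subsection \<open>The decision procedure\<close>

text \<open>Savitch's algorithm is justified only for end points that are tuples; testing this first
  makes the predicate feasible on all arguments.\<close>

definition reachable :: "nat \<Rightarrow> nat \<Rightarrow> (nat list \<Rightarrow> nat list \<Rightarrow> bool) \<Rightarrow> nat list \<Rightarrow> nat list \<Rightarrow> bool" where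
  "reachable m B E u v \<longleftrightarrow> u \<in> tuples m B \<and> v \<in> tuples m B \<and> (u, v) \<in> (graph m B E)\<^sup>*"

text \<open>Only the length of this list is relevant.\<close>

definition bound :: "nat list \<Rightarrow> dpa_tuple list \<Rightarrow> bool list" where
  "bound own As = [True, True] @ map (\<lambda>_. True) own @ concat (map (\<lambda>A. map (\<lambda>_. True) (fst (snd A))) As)"

text \<open>The right-hand side of \<open>lasso_iff\<close>, with the acceptance vector as a list
  instead of a predicate, so that it is a value with a code.\<close>

definition lasso where
  "lasso own As I E cond \<longleftrightarrow> (\<exists>a\<in>set [0..<length own]. I a \<and> (\<exists>s\<in>tuples (Suc (length As)) (length (bound own As)).
     reachable (Suc (length As)) (length (bound own As)) (letter_step As (length own) E) (a # map fst As) s \<and>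
     (\<exists>r\<in>tuples (length As) (length (bound own As)).
       reachable (Suc (length As) + length As) (length (bound own As)) (cycle_step As (length own) E r)
         (s @ map (\<lambda>_. 0) As) (s @ map (\<lambda>_. 1) As) \<and>
       cond (map (\<lambda>j. even (dpa_priority (lookup As j) (lookup r j))) [0..<length As]))))"

lemma bound: "length own \<le> length (bound own As)" "A \<in> set As \<Longrightarrow> length (fst (snd A)) \<le> length (bound own As)"
  "1 < length (bound own As)"
proof -
  show "length (fst (snd A)) \<le> length (bound own As)" if "A \<in> set As"
    using that by (induction As) (auto simp: bound_def)
  show "length own \<le> length (bound own As)" "1 < length (bound own As)" unfolding bound_def by simp_all
qed

lemma lasso_correct:
  assumes "automata As (length own)" and ne: "As \<noteq> []"
  shows "lasso own As I E cond \<longleftrightarrow> (\<exists>w\<in>omega_words {..<length own}. I (w 0) \<and> (\<forall>k. E (nodes As w k) (w (Suc k))) \<and>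
    cond (map (\<lambda>j. w \<in> lang (length own) (lookup As j)) [0..<length As]))"
proof -
  interpret automata As "length own" by fact
  have B: "length own \<le> length (bound own As)" "\<And>A. A \<in> set As \<Longrightarrow> length (fst (snd A)) \<le> length (bound own As)"
    "1 < length (bound own As)" by (rule bound | assumption)+
  have init: "a # map fst As \<in> tuples (Suc (length As)) (length (bound own As))" if "a \<in> set [0..<length own]" for a
  proof -
    have "fst A < length (bound own As)" if "A \<in> set As" for A
      using wf[OF that] B(2)[OF that] by (simp add: wf_dpa_tuple_def)
    then show ?thesis using that B(1) by (auto simp: tuples_def)
  qed
  have ends: "s @ map (\<lambda>_. 0) As \<in> tuples (Suc (length As) + length As) (length (bound own As))"
    "s @ map (\<lambda>_. 1) As \<in> tuples (Suc (length As) + length As) (length (bound own As))"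
    if "s \<in> tuples (Suc (length As)) (length (bound own As))" for s
    using that B(3) by (auto simp: tuples_def)
  have cong: "cond (map P [0..<length As]) = cond (map Q [0..<length As])" if "\<And>j. j < length As \<Longrightarrow> P j = Q j" for P Q
    using that by (intro arg_cong[of _ _ cond]) auto
  show ?thesis
    unfolding lasso_def reachable_def
    by (subst lasso_iff[OF ne B(1) _ B(3), where cond = "\<lambda>P. cond (map P [0..<length As])"])
      ((rule B(2), assumption) | (rule cong, blast) | (intro bex_cong conj_cong refl; use init ends in auto))+
qed

section \<open>Validity of a representation\<close>

definition exactly_one :: "bool list \<Rightarrow> bool" where
  "exactly_one bs \<longleftrightarrow> (\<exists>i\<in>set [0..<length bs]. \<forall>j\<in>set [0..<length bs]. lookup bs j \<longleftrightarrow> j = i)"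

text \<open>An instance may represent no game at all. Payoff functions for given automata exist if
  the automata of each player partition the words, and a violation shows up on an ultimately
  periodic word, which \<open>lasso\<close> finds. The equivalence with the existence of a game is
  used for games that have a vertex.\<close>

definition valid :: "game_tuple \<Rightarrow> bool" where
  "valid R \<longleftrightarrow>
     (\<forall>e\<in>set (fst (snd R)). fst e < length (fst R) \<and> snd e < length (fst R)) \<and>
     (\<forall>a\<in>set [0..<length (fst R)]. \<exists>e\<in>set (fst (snd R)). fst e = a) \<and>
     (\<forall>i\<in>set (fst R). i < length (snd (snd R))) \<and>
     (\<forall>P\<in>set (snd (snd R)). fst P \<noteq> [] \<and> (\<forall>A\<in>set (fst P). wf_dpa_tuple (length (fst R)) A) \<and>
        (\<forall>e\<in>set (snd P). fst e < length (fst P) \<and> snd e < length (fst P)) \<and>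
        \<not> lasso (fst R) (fst P) (\<lambda>_. True) (\<lambda>_ _. True) (\<lambda>bs. \<not> exactly_one bs))"

lemma exactly_one_iff:
  "exactly_one (map P [0..<m]) \<longleftrightarrow> (\<exists>i<m. \<forall>j<m. P j \<longleftrightarrow> j = i)"
  by (auto simp: exactly_one_def)

lemma valid_partition:
  assumes "automata As n" "As \<noteq> []" "n = length own"
  shows "\<not> lasso own As (\<lambda>_. True) (\<lambda>_ _. True) (\<lambda>bs. \<not> exactly_one bs) \<longleftrightarrow>
    (\<forall>w\<in>omega_words {..<n}. \<exists>i<length As. \<forall>j<length As. w \<in> lang n (As ! j) \<longleftrightarrow> j = i)"
  using lasso_correct[of As own] assms by (auto simp: exactly_one_iff)

lemma (in represented) valid:
  assumes v: "v < n" shows "valid (own, es, pls)"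
proof -
  have pref: "set (snd (pls ! i)) \<subseteq> {..<length (fst (pls ! i))} \<times> {..<length (fst (pls ! i))}" if i: "i < length pls" for i
  proof -
    have "\<forall>i\<in>players G. pref G i \<subseteq> payoffs G i \<times> payoffs G i"
      using rep unfolding represents_def rp_game_def wf_game_def by blast
    then show "set (snd (pls ! i)) \<subseteq> {..<length (fst (pls ! i))} \<times> {..<length (fst (pls ! i))}"
      unfolding player(2,3)[OF i, symmetric] using i arena(3) by simp
  qed
  have "fst P \<noteq> [] \<and> (\<forall>A\<in>set (fst P). wf_dpa_tuple n A) \<and> (\<forall>e\<in>set (snd P). fst e < length (fst P) \<and> snd e < length (fst P)) \<and>
      \<not> lasso own (fst P) (\<lambda>_. True) (\<lambda>_ _. True) (\<lambda>bs. \<not> exactly_one bs)" if "P \<in> set pls" for P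
  proof -
    from that obtain i where i: "i < length pls" "P = pls ! i" by (elim in_set_conv_nth[THEN iffD1, THEN exE] conjE) simp
    have "(\<lambda>_. v) \<in> omega_words {..<n}" using v by (auto simp: omega_words_def)
    from pay(1)[OF i(1) this] have ne: "fst P \<noteq> []" unfolding i(2) by auto
    have "\<exists>i<length (fst P). \<forall>j<length (fst P). w \<in> lang n (fst P ! j) \<longleftrightarrow> j = i" if "w \<in> omega_words {..<n}" for w
      using pay[OF i(1) that] i(2) by (intro exI[of _ "pay G i w"]) auto
    moreover have "automata (fst P) n" using automata[OF i(1)] i(2) by simp
    ultimately have "\<not> lasso own (fst P) (\<lambda>_. True) (\<lambda>_ _. True) (\<lambda>bs. \<not> exactly_one bs)"
      using valid_partition[OF _ ne refl] by simp
    moreover have "\<forall>A\<in>set (fst P). wf_dpa_tuple n A"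
      using \<open>automata (fst P) n\<close> unfolding automata_def by blast
    moreover have "\<forall>e\<in>set (snd P). fst e < length (fst P) \<and> snd e < length (fst P)" using pref[OF i(1)] unfolding i(2) by auto
    ultimately show ?thesis using ne by blast
  qed
  moreover have "i < length pls" if "i \<in> set own" for i using that edges(4) by (auto simp: in_set_conv_nth)
  moreover have "\<exists>e\<in>set es. fst e = a" if "a < n" for a using edges(3)[OF that] by force
  moreover have "fst e < n \<and> snd e < n" if "e \<in> set es" for e using edges(1,2)[of "fst e" "snd e"] that by simp
  ultimately show ?thesis unfolding valid_def by simp
qed

lemma valid_represents:
  assumes "valid (own, es, pls)"
  shows "\<exists>G. represents (mk_game (own, es, pls)) G"
proof -
  let ?n = "length own"
  have e: "\<And>e. e \<in> set es \<Longrightarrow> fst e < ?n \<and> snd e < ?n" "\<And>a. a < ?n \<Longrightarrow> \<exists>e\<in>set es. fst e = a"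
    and own: "\<And>i. i \<in> set own \<Longrightarrow> i < length pls"
    and pls: "\<And>P. P \<in> set pls \<Longrightarrow> fst P \<noteq> [] \<and> (\<forall>A\<in>set (fst P). wf_dpa_tuple ?n A) \<and>
        (\<forall>e\<in>set (snd P). fst e < length (fst P) \<and> snd e < length (fst P)) \<and>
        \<not> lasso own (fst P) (\<lambda>_. True) (\<lambda>_ _. True) (\<lambda>bs. \<not> exactly_one bs)"
    using assms unfolding valid_def fst_conv snd_conv by simp_all
  have part: "\<exists>p<length (fst (pls ! i)). \<forall>j<length (fst (pls ! i)). w \<in> lang ?n (fst (pls ! i) ! j) \<longleftrightarrow> j = p"
    if i: "i < length pls" and w: "w \<in> omega_words {..<?n}" for i w
  proof -
    note P = pls[OF nth_mem[OF i]]
    have "automata (fst (pls ! i)) ?n" using P by unfold_locales auto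
    then show ?thesis using valid_partition[of "fst (pls ! i)" ?n own] P w by blast
  qed
  define py where "py i w = (SOME p. p < length (fst (pls ! i)) \<and> (\<forall>j<length (fst (pls ! i)). w \<in> lang ?n (fst (pls ! i) ! j) \<longleftrightarrow> j = p))" for i w
  have py': "py i w < length (fst (pls ! i)) \<and> (\<forall>j<length (fst (pls ! i)). w \<in> lang ?n (fst (pls ! i) ! j) \<longleftrightarrow> j = py i w)"
    if "i < length pls" "w \<in> omega_words {..<?n}" for i w
    unfolding py_def by (rule someI_ex) (use part[OF that] in blast)
  have py: "py i w < length (fst (pls ! i))" "\<And>j. j < length (fst (pls ! i)) \<Longrightarrow> w \<in> lang ?n (fst (pls ! i) ! j) \<longleftrightarrow> j = py i w"
    if "i < length pls" "w \<in> omega_words {..<?n}" for i w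
    using py'[OF that] by simp_all
  define G :: "(nat, nat, nat) game" where "G = \<lparr>verts = {..<?n}, edges = set es, players = {..<length pls},
    owned = (\<lambda>i. {v. v < ?n \<and> own ! v = i}), payoffs = (\<lambda>i. {..<length (fst (pls ! i))}),
    pref = (\<lambda>i. set (snd (pls ! i))), pay = py\<rparr>"
  have Gs: "verts G = {..<?n}" "edges G = set es" "players G = {..<length pls}" "owned G i = {v. v < ?n \<and> own ! v = i}"
    "payoffs G i = {..<length (fst (pls ! i))}" "pref G i = set (snd (pls ! i))" "pay G = py" for i
    by (simp_all add: G_def)
  have "set es \<subseteq> {..<?n} \<times> {..<?n}" using e(1) by auto
  moreover have "\<forall>v\<in>{..<?n}. \<exists>u. (v, u) \<in> set es" using e(2) by force
  moreover have "disjoint_family_on (owned G) {..<length pls}" by (auto simp: disjoint_family_on_def Gs)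
  moreover have "(\<Union>i\<in>{..<length pls}. owned G i) = {..<?n}" using own by (auto simp: Gs)
  ultimately have arena: "wf_arena G" by (simp add: wf_arena_def Gs(1-3))
  have wfd: "wf_dpa_rep ?n (mk_dpa (fst (pls ! i) ! p))" and pre: "lang ?n (fst (pls ! i) ! p) = pay_preimage G i p"
    if "i < length pls" "p < length (fst (pls ! i))" for i p
  proof -
    show "wf_dpa_rep ?n (mk_dpa (fst (pls ! i) ! p))" using pls[OF nth_mem[OF that(1)]] that(2) wf_dpa_tuple by simp
    have "w \<in> lang ?n (fst (pls ! i) ! p) \<longleftrightarrow> w \<in> omega_words {..<?n} \<and> py i w = p" for w
      using py(2)[OF that(1) _ that(2), of w] by (auto simp: dpa_language_def)
    then show "lang ?n (fst (pls ! i) ! p) = pay_preimage G i p" by (auto simp: pay_preimage_def Gs)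
  qed
  have "wf_game G"
    unfolding wf_game_def Gs
  proof (intro conjI ballI arena)
    fix i assume i: "i \<in> {..<length pls}"
    show "set (snd (pls ! i)) \<subseteq> {..<length (fst (pls ! i))} \<times> {..<length (fst (pls ! i))}"
      using pls[OF nth_mem, of i] i by force
    show "py i w \<in> {..<length (fst (pls ! i))}" if "w \<in> omega_words {..<?n}" for w using py(1)[of i w] i that by simp
  qed
  then have "rp_game G"
    unfolding rp_game_def Gs
  proof (intro conjI ballI)
    fix i p assume "i \<in> {..<length pls}" "p \<in> {..<length (fst (pls ! i))}"
    then have "wf_dpa {..<?n} (dpa_of (mk_dpa (fst (pls ! i) ! p)))" "lang ?n (fst (pls ! i) ! p) = pay_preimage G i p"
      using wfd pre by (auto simp: wf_dpa_rep_def)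
    then show "omega_regular {..<?n} (pay_preimage G i p)" unfolding omega_regular_def by blast
  qed auto
  then have "represents (mk_game (own, es, pls)) G"
    using wfd pre unfolding represents_def Let_def by (auto simp: Gs mk_game_def mk_player_def)
  then show ?thesis by blast
qed

text \<open>The lasso is searched in the product of all automata, but the coalition's game against
  \<open>i\<close> is played in the product of the automata of \<open>i\<close> alone. This keeps
  its depth polynomial.\<close>

definition segment :: "player_tuple list \<Rightarrow> nat \<Rightarrow> nat list \<Rightarrow> nat list" where
  "segment pls i u = lookup u 0 # take (length (fst (lookup pls i))) (drop (length (concat (map fst (take i pls)))) (tl u))"

definition chosen :: "player_tuple list \<Rightarrow> nat list \<Rightarrow> bool list \<Rightarrow> bool" where
  "chosen pls q bs \<longleftrightarrow> (\<forall>i\<in>set [0..<length pls]. lookup (drop (length (concat (map fst (take i pls)))) bs) (lookup q i))"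

definition payoffs_ok :: "player_tuple list \<Rightarrow> nat list \<Rightarrow> nat list \<Rightarrow> bool" where
  "payoffs_ok pls ps q \<longleftrightarrow> (\<forall>i\<in>set [0..<length pls]. lookup q i < length (fst (lookup pls i)) \<and>
     (lookup ps i = lookup q i \<or> (lookup ps i, lookup q i) \<in> set (snd (lookup pls i))) \<and>
     (lookup q i, lookup q i) \<notin> set (snd (lookup pls i)))"

text \<open>The coalitions are tested at the source of each step, so along an infinite word every
  node gets tested. The depth is a power whose exponent is fixed by \<open>l\<close>.\<close>

definition safe_step :: "nat \<Rightarrow> game_tuple \<Rightarrow> nat list \<Rightarrow> nat list \<Rightarrow> nat \<Rightarrow> bool" where
  "safe_step l R q u a \<longleftrightarrow> (lookup u 0, a) \<in> set (fst (snd R)) \<and>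
     (\<forall>i\<in>set [0..<length (snd (snd R))]. coalition_wins (fst R) (fst (snd R)) (lookup (snd (snd R)) i) i (lookup q i)
        (length (power_list (bound (fst R) (fst (lookup (snd (snd R)) i))) (Suc l))) (segment (snd (snd R)) i u))"

text \<open>The payoffs \<open>q\<close> are guessed before the word, because the tests in
  \<open>safe_step\<close> refer to them. The number of all automata bounds the payoffs, and the
  additional \<open>0\<close> keeps the list nonempty for \<open>feas_Bex_tuples\<close>.\<close>

definition solvable :: "nat \<Rightarrow> (game_tuple \<times> nat \<times> nat list) \<Rightarrow> bool" where
  "solvable l I \<longleftrightarrow> (\<exists>q\<in>tuples (length (snd (snd (fst I)))) (length (0 # map (\<lambda>_. 0::nat) (concat (map fst (snd (snd (fst I))))))).
     payoffs_ok (snd (snd (fst I))) (snd (snd I)) q \<and>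
     lasso (fst (fst I)) (concat (map fst (snd (snd (fst I))))) (\<lambda>a. a = fst (snd I)) (safe_step l (fst I) q)
       (chosen (snd (snd (fst I))) q))"

definition accepted :: "nat \<Rightarrow> (game_tuple \<times> nat \<times> nat list) \<Rightarrow> bool" where
  "accepted l I \<longleftrightarrow> valid (fst I) \<and> (\<forall>P\<in>set (snd (snd (fst I))). length (fst P) \<le> l) \<and>
     fst (snd I) < length (fst (fst I)) \<and> length (snd (snd I)) = length (snd (snd (fst I))) \<and>
     (\<forall>i\<in>set [0..<length (snd (snd (fst I)))]. lookup (snd (snd I)) i < length (fst (lookup (snd (snd (fst I))) i))) \<and>
     solvable l I"

section \<open>Correctness of the decision procedure\<close>

lemma concat_split:
  assumes "i < length pls"
  shows "concat (map fst pls) = concat (map fst (take i pls)) @ fst (pls ! i) @ concat (map fst (drop (Suc i) pls))"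
proof -
  have "pls = take i pls @ pls ! i # drop (Suc i) pls" using assms by (simp add: id_take_nth_drop)
  then show ?thesis by (metis concat.simps(2) concat_append list.simps(9) map_append)
qed

lemma segment_nodes:
  assumes "i < length pls"
  shows "segment pls i (nodes (concat (map fst pls)) w k) = nodes (fst (pls ! i)) w k"
  using assms by (simp add: segment_def nodes_def concat_split[OF assms] del: map_map)

lemma chosen_iff:
  assumes "\<And>i. i < length pls \<Longrightarrow> lookup q i < length (fst (pls ! i))"
  shows "chosen pls q (map (\<lambda>j. P (lookup (concat (map fst pls)) j)) [0..<length (concat (map fst pls))]) \<longleftrightarrow>
    (\<forall>i<length pls. P (fst (pls ! i) ! lookup q i))"
proof -
  have e: "map (\<lambda>j. P (lookup (concat (map fst pls)) j)) [0..<length (concat (map fst pls))] = map P (concat (map fst pls))"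
    by (rule nth_equalityI) simp_all
  have "lookup (drop (length (concat (map fst (take i pls)))) (map P (concat (map fst pls)))) (lookup q i) = P (fst (pls ! i) ! lookup q i)"
    if "i < length pls" for i
    unfolding concat_split[OF that] using assms[OF that] by (simp add: nth_append lookup_def)
  then show ?thesis unfolding chosen_def e by auto
qed

context represented
begin

lemma flat_automata:
  assumes "v < n" shows "automata (concat (map fst pls)) n" "concat (map fst pls) \<noteq> []"
proof -
  have P: "fst P \<noteq> [] \<and> (\<forall>A\<in>set (fst P). wf_dpa_tuple n A)" if "P \<in> set pls" for P
    using valid[OF assms] that unfolding valid_def by simp
  then show "automata (concat (map fst pls)) n" by unfold_locales auto
  have i: "own ! v < length pls" by (rule edges(4)[OF assms])
  then have "fst (pls ! (own ! v)) \<noteq> []" using P[of "pls ! (own ! v)"] by simp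
  then show "concat (map fst pls) \<noteq> []" unfolding concat_split[OF i] by simp
qed

text \<open>A node is a letter with at most \<open>l\<close> states, all below the bound; hence the
  exponent \<open>Suc l\<close>. This is where the fixed number of payoffs keeps the first-cycle
  games short.\<close>

lemma depth:
  assumes "i < length pls" "length (fst (pls ! i)) \<le> l"
  shows "card (node_set (fst (pls ! i)) n) \<le> length (power_list (bound own (fst (pls ! i))) (Suc l))"
proof -
  interpret automata "fst (pls ! i)" n by (rule automata[OF assms(1)])
  let ?B = "length (bound own (fst (pls ! i)))"
  have "node_set (fst (pls ! i)) n \<subseteq> tuples (Suc (length (fst (pls ! i)))) ?B"
    by (rule node_set_tuples) (rule bound | assumption)+
  then have "card (node_set (fst (pls ! i)) n) \<le> card (tuples (Suc (length (fst (pls ! i)))) ?B)"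
    by (rule card_mono[OF finite_tuples(1)])
  also have "\<dots> \<le> ?B ^ Suc (length (fst (pls ! i)))" by (rule finite_tuples(2))
  also have "\<dots> \<le> ?B ^ Suc l" using bound(3)[of own "fst (pls ! i)"] assms(2) by (intro power_increasing) auto
  finally show ?thesis by (simp only: length_power_list)
qed

lemma solvable_iff:
  assumes v: "v < n" and l: "\<And>i. i < length pls \<Longrightarrow> length (fst (pls ! i)) \<le> l" and ps: "length ps = length pls"
  shows "constrained_ne_exists G v (\<lambda>i. ps ! i) \<longleftrightarrow> solvable l ((own, es, pls), v, ps)"
proof -
  let ?As = "concat (map fst pls)" and ?d = "\<lambda>i. length (power_list (bound own (fst (pls ! i))) (Suc l))"
  have safe: "safe_step l (own, es, pls) q (nodes ?As w k) a \<longleftrightarrow> (w k, a) \<in> set es \<and>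
      (\<forall>i<length pls. coalition_wins own es (pls ! i) i (lookup q i) (?d i) (nodes (fst (pls ! i)) w k))" for q w k a
    unfolding safe_step_def fst_conv snd_conv nodes_lookup_0 by (auto simp: segment_nodes)
  have las: "lasso own ?As (\<lambda>a. a = v) (safe_step l (own, es, pls) q) (chosen pls q) \<longleftrightarrow>
      (\<exists>w. play G w \<and> w 0 = v \<and> (\<forall>i<length pls. pay G i w = lookup q i \<and>
        (\<forall>k. coalition_wins own es (pls ! i) i (lookup q i) (?d i) (nodes (fst (pls ! i)) w k))))"
    if q: "\<And>i. i < length pls \<Longrightarrow> lookup q i < length (fst (pls ! i))" for q
  proof -
    have ch: "chosen pls q (map (\<lambda>j. w \<in> lang n (lookup ?As j)) [0..<length ?As]) \<longleftrightarrow>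
        (\<forall>i<length pls. w \<in> lang n (fst (pls ! i) ! lookup q i))" for w
      by (rule chosen_iff) (rule q)
    have "(\<forall>i<length pls. w \<in> lang n (fst (pls ! i) ! lookup q i)) \<longleftrightarrow> (\<forall>i<length pls. pay G i w = lookup q i)"
      if "w \<in> omega_words {..<n}" for w
      using pay(2)[OF _ that q] by simp
    then show ?thesis
      unfolding lasso_correct[OF flat_automata[OF v]] safe ch play_iff by (intro iffI; elim exE bexE conjE) (simp_all, blast+)
  qed
  show ?thesis
  proof
    assume "constrained_ne_exists G v (\<lambda>i. ps ! i)"
    then obtain \<sigma> where \<sigma>: "nash_equilibrium G v \<sigma>"
      and c: "\<And>i. i < length pls \<Longrightarrow> ps ! i = pay G i (outcome G \<sigma> v) \<or> (ps ! i, pay G i (outcome G \<sigma> v)) \<in> set (snd (pls ! i))"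
      unfolding constrained_ne_exists_def arena(3) by (auto simp: player(3))
    define w where "w = outcome G \<sigma> v"
    define q where "q = map (\<lambda>i. pay G i w) [0..<length pls]"
    have w: "play G w" "w 0 = v" using play_outcome[of \<sigma> v] \<sigma> v by (auto simp: nash_equilibrium_def w_def)
    then have ww: "w \<in> omega_words {..<n}" by (simp add: play_iff)
    have lq: "lookup q i = pay G i w" if "i < length pls" for i using that by (simp add: q_def)
    note ne = nash_equilibrium_outcome[OF \<sigma> v _ depth[OF _ l], folded w_def]
    have "payoffs_ok pls ps q"
      using lq pay(1)[OF _ ww] c ne(1) ps unfolding payoffs_ok_def w_def[symmetric] by auto
    moreover have "lasso own ?As (\<lambda>a. a = v) (safe_step l (own, es, pls) q) (chosen pls q)"
    proof (subst las)
      show "lookup q i < length (fst (pls ! i))" if "i < length pls" for i using lq[OF that] pay(1)[OF that ww] by simp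
      show "\<exists>w. play G w \<and> w 0 = v \<and> (\<forall>i<length pls. pay G i w = lookup q i \<and>
        (\<forall>k. coalition_wins own es (pls ! i) i (lookup q i) (?d i) (nodes (fst (pls ! i)) w k)))"
        using w ne(2) by (intro exI[of _ w]) (auto simp: lq)
    qed
    moreover have "q \<in> tuples (length pls) (length (0 # map (\<lambda>_. 0::nat) ?As))"
    proof -
      have "pay G i w < length (0 # map (\<lambda>_. 0::nat) ?As)" if i: "i < length pls" for i
        using pay(1)[OF i ww] arg_cong[OF concat_split[OF i], of length] by simp
      then show ?thesis by (auto simp: tuples_def q_def)
    qed
    ultimately show "solvable l ((own, es, pls), v, ps)" unfolding solvable_def by auto
  next
    assume "solvable l ((own, es, pls), v, ps)"
    then obtain q where ok: "payoffs_ok pls ps q" and lasso: "lasso own ?As (\<lambda>a. a = v) (safe_step l (own, es, pls) q) (chosen pls q)"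
      unfolding solvable_def by auto
    have q: "lookup q i < length (fst (pls ! i))" "ps ! i = lookup q i \<or> (ps ! i, lookup q i) \<in> set (snd (pls ! i))"
      "(lookup q i, lookup q i) \<notin> set (snd (pls ! i))" if "i < length pls" for i
      using ok that ps unfolding payoffs_ok_def by auto
    obtain w where w: "play G w" "w 0 = v" "\<And>i. i < length pls \<Longrightarrow> pay G i w = lookup q i"
      "\<And>i k. i < length pls \<Longrightarrow> coalition_wins own es (pls ! i) i (lookup q i) (?d i) (nodes (fst (pls ! i)) w k)"
      using lasso las[OF q(1)] by blast
    obtain \<sigma> where \<sigma>: "nash_equilibrium G v \<sigma>" "outcome G \<sigma> v = w"
      by (rule nash_equilibrium_construct[OF w(1) v w(2), of ?d]) (use w(3,4) q(3) depth[OF _ l] in auto)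
    then show "constrained_ne_exists G v (\<lambda>i. ps ! i)"
      using w(3) q(2) unfolding constrained_ne_exists_def arena(3) by (intro exI[of _ \<sigma>]) (auto simp: player(3))
  qed
qed

end

theorem constrained_ne_problem_iff:
  "encode_instance (mk_game R, v, ps) \<in> constrained_ne_problem l \<longleftrightarrow> accepted l (R, v, ps)"
proof -
  obtain own es pls where R: "R = (own, es, pls)" by (cases R)
  \<comment> \<open>These conditions have the same truth value for every represented game, so
    afterwards it suffices that there is one.\<close>
  have sem: "(\<forall>i\<in>players G. card (payoffs G i) \<le> l) \<and> v \<in> verts G \<and> length ps = length (rep_players (mk_game R)) \<and>
      (\<forall>i\<in>players G. ps ! i \<in> payoffs G i) \<and> constrained_ne_exists G v (\<lambda>i. ps ! i) \<longleftrightarrow> accepted l (R, v, ps)"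
    if rep: "represents (mk_game R) G" for G
  proof -
    interpret represented own es pls G using rep R by unfold_locales simp
    have len: "(\<forall>P\<in>set pls. length (fst P) \<le> l) \<longleftrightarrow> (\<forall>i<length pls. length (fst (pls ! i)) \<le> l)"
      by (simp add: all_set_conv_all_nth)
    have "accepted l (R, v, ps) \<longleftrightarrow> valid R \<and> (\<forall>i<length pls. length (fst (pls ! i)) \<le> l) \<and> v < n \<and> length ps = length pls \<and>
        (\<forall>i<length pls. ps ! i < length (fst (pls ! i))) \<and> solvable l (R, v, ps)"
      unfolding accepted_def R fst_conv snd_conv len by auto
    moreover have "(\<forall>i\<in>players G. card (payoffs G i) \<le> l) \<longleftrightarrow> (\<forall>i<length pls. length (fst (pls ! i)) \<le> l)"
      "(\<forall>i\<in>players G. ps ! i \<in> payoffs G i) \<longleftrightarrow> (\<forall>i<length pls. ps ! i < length (fst (pls ! i)))"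
      by (auto simp: arena player(2))
    moreover have "length (rep_players (mk_game R)) = length pls" by (simp add: R mk_game_def)
    moreover have "constrained_ne_exists G v (\<lambda>i. ps ! i) \<longleftrightarrow> solvable l (R, v, ps)"
      if "v < n" "\<forall>i<length pls. length (fst (pls ! i)) \<le> l" "length ps = length pls"
      using solvable_iff[of v l ps] that by (simp add: R)
    moreover have "valid R" if "v < n" using valid[OF that] by (simp add: R)
    ultimately show ?thesis using arena(1) by simp blast
  qed
  have "\<exists>G. represents (mk_game R) G" if "accepted l (R, v, ps)"
    using that valid_represents[of own es pls] unfolding R accepted_def by simp
  then show ?thesis unfolding problem_iff using sem by blast
qed


subsection \<open>Membership in PSPACE\<close>

lemma feas_dpa_next [feas_intros]:
  assumes "feas b D A" "feas b D q" "feas b D a" shows "feas b D (\<lambda>x. dpa_next (A x) (q x) (a x))"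
  unfolding dpa_next_def by (intro feas_intros assms)

lemma feas_dpa_priority [feas_intros]:
  assumes "feas b D A" "feas b D q" shows "feas b D (\<lambda>x. dpa_priority (A x) (q x))"
  unfolding dpa_priority_def by (intro feas_intros assms)

lemma feas_node_next [feas_intros]:
  assumes "feas b D As" "feas b D u" "feas b D a" shows "feas b D (\<lambda>x. node_next (As x) (u x) (a x))"
  by (rule feas_comp3[OF _ assms]) (unfold node_next_def, intro feas_intros)

lemma feas_node_priority [feas_intros]:
  assumes "feas b D As" "feas b D j" "feas b D u" shows "feas b D (\<lambda>x. node_priority (As x) (j x) (u x))"
  unfolding node_priority_def by (intro feas_intros assms)

lemma feas_flags [feas_intros]:
  assumes "feas b D r" "feas b D v" "feas b D f" shows "feas b D (\<lambda>x. flags (r x) (v x) (f x))"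
  by (rule feas_comp3[OF _ assms]) (unfold flags_def, intro feas_intros)

lemma feas_letter_step:
  assumes E: "feas b UNIV (\<lambda>z. E (fst z) (fst (snd z)) (snd (snd z)))"
    and x: "feas b D As" "feas b D own" "feas b D f" "feas b D u" "feas b D v"
  shows "feas b D (\<lambda>x. letter_step (As x) (length (own x :: nat list)) (E (f x)) (u x) (v x))"
  unfolding letter_step_def by (intro feas_intros feas_comp3[OF E] x)

lemma feas_cycle_step:
  fixes E :: "'c::enc \<Rightarrow> nat list \<Rightarrow> nat \<Rightarrow> bool" and f :: "'a::enc \<Rightarrow> 'c"
  assumes E: "feas b UNIV (\<lambda>z. E (fst z) (fst (snd z)) (snd (snd z)))"
    and x: "feas b D As" "feas b D own" "feas b D f" "feas b D r" "feas b D u" "feas b D v"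
  shows "feas b D (\<lambda>x. cycle_step (As x) (length (own x :: nat list)) (E (f x)) (r x) (u x) (v x))"
proof -
  have "feas b UNIV (\<lambda>z. \<forall>j\<in>set [0..<length (fst z)]. node_priority (fst z) j (snd (snd z)) \<le>
      dpa_priority (lookup (fst z) j) (lookup (fst (snd z)) j))"
    by (intro feas_intros)
  from feas_comp3[of b "\<lambda>As r v. \<forall>j\<in>set [0..<length As]. node_priority As j v \<le> dpa_priority (lookup As j) (lookup r j)",
      OF this x(1,4)] feas_take[OF feas_Suc[OF feas_length[OF x(1)]] x(6)]
  have "feas b D (\<lambda>x. \<forall>j\<in>set [0..<length (As x)]. node_priority (As x) j (take (Suc (length (As x))) (v x)) \<le>
      dpa_priority (lookup (As x) j) (lookup (r x) j))" by blast
  then show ?thesis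
    unfolding cycle_step_def
    by (intro feas_conj feas_letter_step[OF E] feas_eq feas_flags feas_take feas_drop feas_Suc feas_length x)
qed

lemma feas_tuples:
  assumes "feas b D c" "feas b D M" "feas b D B"
  shows "feas b D (\<lambda>x. c x \<in> tuples (length (M x)) (length (B x)))"
proof -
  have "feas b UNIV (\<lambda>z. length (fst z) = length (fst (snd z)) \<and> (\<forall>y\<in>set (fst z). y < length (snd (snd z))))"
    by (intro feas_intros)
  from feas_comp3[of b "\<lambda>c M B. length c = length M \<and> (\<forall>y\<in>set c. y < length B)", OF this assms]
  show ?thesis by (rule feas_cong) (auto simp: tuples_def)
qed

lemma feas_reachable_tuples:
  assumes E: "feas False UNIV (\<lambda>z. E (fst z) (fst (snd z)) (snd (snd z)))"
    and x: "feas False UNIV M" "feas False UNIV B" "feas False UNIV u" "feas False UNIV v"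
    and "\<And>x. M x \<noteq> []" "\<And>x. length (B x) > 1"
  shows "feas False UNIV (\<lambda>x. reachable (length (M x)) (length (B x)) (E x) (u x) (v x))"
proof -
  let ?D = "{x. u x \<in> tuples (length (M x)) (length (B x)) \<and> v x \<in> tuples (length (M x)) (length (B x))}"
  have "feas False UNIV (\<lambda>x. if u x \<in> tuples (length (M x)) (length (B x)) \<and> v x \<in> tuples (length (M x)) (length (B x))
      then (u x, v x) \<in> (graph (length (M x)) (length (B x)) (E x))\<^sup>* else False)"
    by (intro feas_if_on feas_conj feas_tuples feas_const x feas_reachable[OF E x(1,2,3,4) assms(6,7)]) simp
  then show ?thesis by (rule feas_cong) (auto simp: reachable_def)
qed

lemma feas_bound [feas_intros]:
  assumes "feas b D own" "feas b D As" shows "feas b D (\<lambda>x. bound (own x) (As x))"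
  by (rule feas_comp2[OF _ assms]) (unfold bound_def, intro feas_intros)

lemma feas_lasso:
  assumes own: "feas False UNIV own" and As: "feas False UNIV As"
    and I: "feas False UNIV (\<lambda>z. I (fst z) (snd z))"
    and E: "feas False UNIV (\<lambda>z. E (fst z) (fst (snd z)) (snd (snd z)))"
    and cond: "feas False UNIV (\<lambda>z. cond (fst z) (snd z))"
  shows "feas False UNIV (\<lambda>x. lasso (own x) (As x) (I x) (E x) (cond x))"
proof -
  let ?M = "\<lambda>As. True # map (\<lambda>_. True) As"
  have "feas False UNIV (\<lambda>x. \<exists>a\<in>set [0..<length (own x)]. I x a \<and>
     (\<exists>s\<in>tuples (length (?M (As x))) (length (bound (own x) (As x))).
     reachable (length (?M (As x))) (length (bound (own x) (As x))) (letter_step (As x) (length (own x)) (E x)) (a # map fst (As x)) s \<and>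
     (\<exists>r\<in>tuples (length (map (\<lambda>_. True) (As x))) (length (bound (own x) (As x))).
       reachable (length (?M (As x) @ map (\<lambda>_. True) (As x))) (length (bound (own x) (As x))) (cycle_step (As x) (length (own x)) (E x) r)
         (s @ map (\<lambda>_. 0) (As x)) (s @ map (\<lambda>_. 1) (As x)) \<and>
       cond x (map (\<lambda>j. even (dpa_priority (lookup (As x) j) (lookup r j))) [0..<length (As x)]))))"
    by (intro feas_Bex feas_conj feas_Bex_tuples feas_reachable_tuples feas_letter_step[OF E] feas_cycle_step[OF E]
        feas_comp2[OF I] feas_comp2[OF cond] feas_intros feas_comp[OF own] feas_comp[OF As] own As)
      (use bound(3) in \<open>auto simp: bound_def\<close>)
  then show ?thesis by (rule feas_cong) (simp add: lasso_def)
qed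

lemma feas_exactly_one: "feas b UNIV exactly_one"
  unfolding exactly_one_def[abs_def] by (intro feas_intros)

lemma feas_wf_dpa_tuple: "feas b UNIV (\<lambda>z. wf_dpa_tuple (length (fst z :: nat list)) (snd z))"
  unfolding wf_dpa_tuple_def by (intro feas_intros)

lemma feas_valid: "feas False UNIV valid"
proof -
  have "feas False UNIV (\<lambda>z :: nat list \<times> dpa_tuple list. lasso (fst z) (snd z) (\<lambda>_. True) (\<lambda>_ _. True) (\<lambda>bs. \<not> exactly_one bs))"
    by (intro feas_lasso feas_intros feas_comp[OF feas_exactly_one])
  note las = feas_comp2[of False "\<lambda>own As. lasso own As (\<lambda>_. True) (\<lambda>_ _. True) (\<lambda>bs. \<not> exactly_one bs)", OF this]
    and wfd = feas_comp2[of False "\<lambda>own A. wf_dpa_tuple (length own) A", OF feas_wf_dpa_tuple]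
  show ?thesis
    unfolding valid_def[abs_def] by (intro feas_intros las wfd)
qed

lemma feas_segment [feas_intros]:
  assumes "feas b D pls" "feas b D i" "feas b D u" shows "feas b D (\<lambda>x. segment (pls x) (i x) (u x))"
  unfolding segment_def by (intro feas_intros assms)

lemma feas_chosen:
  assumes "feas b D pls" "feas b D q" "feas b D bs" shows "feas b D (\<lambda>x. chosen (pls x) (q x) (bs x))"
  by (rule feas_comp3[OF _ assms]) (unfold chosen_def, intro feas_intros)

lemma feas_payoffs_ok:
  assumes "feas b D pls" "feas b D ps" "feas b D q" shows "feas b D (\<lambda>x. payoffs_ok (pls x) (ps x) (q x))"
  by (rule feas_comp3[OF _ assms]) (unfold payoffs_ok_def, intro feas_intros)

section \<open>Feasibility of first-cycle games\<close>

lemma feas_closed_cycle [feas_intros]: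
  fixes S :: "'a::enc \<Rightarrow> 'b::enc list"
  assumes "feas b D S" "feas b D t" shows "feas b D (\<lambda>x. closed_cycle (S x) (t x))"
proof -
  let ?h = "\<lambda>t s y. if fst s \<or> y = t then (True, snd s) else (False, y # snd s)"
  have T: "foldl (?h t) (True, acc) ys = (True, acc)" for t acc and ys :: "'b list"
    by (induction ys) auto
  have e: "rev (snd (foldl (?h t) (False, acc) ys)) = rev acc @ takeWhile (\<lambda>s. s \<noteq> t) ys" for t acc and ys :: "'b list"
    by (induction ys arbitrary: acc) (auto simp: T)
  have "feas b UNIV (\<lambda>z :: 'b list \<times> 'b. foldl (?h (snd z)) (False, []) (fst z))"
  proof (rule feas_foldl)
    show "poly_bounded (\<lambda>n. 10 + n)" by auto
    fix z :: "'b list \<times> 'b" and i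
    have "sz (takeWhile (\<lambda>s. s \<noteq> snd z) (take i (fst z))) \<le> sz (take i (fst z))"
      using sz_take[of "length (takeWhile (\<lambda>s. s \<noteq> snd z) (take i (fst z)))" "take i (fst z)"]
      unfolding takeWhile_eq_take[symmetric] .
    moreover have "sz (snd (foldl (?h (snd z)) (False, []) (take i (fst z)))) = sz (takeWhile (\<lambda>s. s \<noteq> snd z) (take i (fst z)))"
      using arg_cong[OF e[of "snd z" "[]" "take i (fst z)"], of "\<lambda>ys. sz ys"] unfolding sz_rev rev.simps append_Nil .
    ultimately have "sz (snd (foldl (?h (snd z)) (False, []) (take i (fst z)))) \<le> sz (fst z)"
      using sz_take[of i "fst z"] by linarith
    then show "sz (foldl (?h (snd z)) (False, []) (take i (fst z))) \<le> 10 + sz z"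
      using sz_bool[of "fst (foldl (?h (snd z)) (False, []) (take i (fst z)))"]
      by (cases z; cases "foldl (?h (snd z)) (False, []) (take i (fst z))") auto
  qed (intro feas_intros)+
  from feas_comp[OF feas_rev[OF feas_snd[OF this]] feas_pair[OF assms]]
  have "feas b D (\<lambda>x. takeWhile (\<lambda>s. s \<noteq> t x) (S x))" by (simp add: e)
  then show ?thesis unfolding closed_cycle_def by (intro feas_intros assms)
qed

text \<open>Trades the maximum for bounded quantifiers over the list, which are feasible.\<close>

lemma Max_parity:
  fixes f :: "'a \<Rightarrow> nat"
  assumes "c \<noteq> []" shows "odd (Max (f ` set c)) \<longleftrightarrow> (\<exists>s\<in>set c. odd (f s) \<and> (\<forall>t\<in>set c. f t \<le> f s))"
proof
  have "Max (f ` set c) \<in> f ` set c" by (rule Max_in) (use assms in auto)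
  then obtain s where "s \<in> set c" "Max (f ` set c) = f s" by auto
  moreover have "f t \<le> Max (f ` set c)" if "t \<in> set c" for t using that by simp
  ultimately show "odd (Max (f ` set c)) \<Longrightarrow> \<exists>s\<in>set c. odd (f s) \<and> (\<forall>t\<in>set c. f t \<le> f s)"
    by (intro bexI[of _ s]) auto
next
  assume "\<exists>s\<in>set c. odd (f s) \<and> (\<forall>t\<in>set c. f t \<le> f s)"
  then obtain s where s: "s \<in> set c" "odd (f s)" "\<forall>t\<in>set c. f t \<le> f s" by blast
  then have "Max (f ` set c) = f s" by (intro Max_eqI) auto
  then show "odd (Max (f ` set c))" using s by simp
qed

lemma feas_good_cycle [feas_intros]:
  assumes "feas b D P" "feas b D p" "feas b D c" shows "feas b D (\<lambda>x. good_cycle (P x) (p x) (c x))"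
proof (rule feas_comp3[OF _ assms])
  \<comment> \<open>For the empty list the truth value is unspecified but does not depend on
    \<open>f\<close>, so it can be built into the program as a constant.\<close>
  have "odd (Max (f ` set c)) \<longleftrightarrow> (if c = [] then odd (Max ({} :: nat set)) else
      \<exists>s\<in>set c. odd (f s) \<and> (\<forall>t\<in>set c. f t \<le> f s))" for f :: "nat list \<Rightarrow> nat" and c
    by (simp add: Max_parity)
  note parity = this
  show "feas b UNIV (\<lambda>z. good_cycle (fst z) (fst (snd z)) (snd (snd z)))"
    unfolding good_cycle_def parity by (intro feas_intros)
qed

text \<open>The choices are indices of edges; an index of an edge with another source counts as a mistake
  of the player who makes the choice.\<close>

definition cycle_next :: "(nat \<times> nat) list \<Rightarrow> dpa_tuple list \<Rightarrow> (nat list \<Rightarrow> bool) \<Rightarrow> (nat list list \<Rightarrow> bool) \<Rightarrow>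
    bool option \<times> nat list list \<Rightarrow> nat list \<Rightarrow> bool option \<times> nat list list" where
  "cycle_next es As mine good s c = (case fst s of Some r \<Rightarrow> s | None \<Rightarrow>
     if lookup c 0 < length es \<and> fst (lookup es (lookup c 0)) = lookup (lookup (snd s) 0) 0
     then if node_next As (lookup (snd s) 0) (snd (lookup es (lookup c 0))) \<in> set (snd s)
       then (Some (good (closed_cycle (snd s) (node_next As (lookup (snd s) 0) (snd (lookup es (lookup c 0)))))), snd s)
       else (None, node_next As (lookup (snd s) 0) (snd (lookup es (lookup c 0))) # snd s)
     else (Some (\<not> mine (lookup (snd s) 0)), snd s))"

text \<open>A decided play idles until the depth is reached, so all branches have equal length. A
  wrong index loses for the player who chooses it and thus affects neither quantifier. With
  \<open>length es < n\<close> all edge indices are available and there is some choice even without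
  edges.\<close>

lemma first_cycle_alternate:
  assumes n: "length es < n" and S: "S \<noteq> []"
  shows "alternate (\<lambda>s. case fst s of None \<Rightarrow> mine (lookup (snd s) 0) | Some r \<Rightarrow> True)
      (\<lambda>s. case fst s of None \<Rightarrow> z | Some r \<Rightarrow> r) (cycle_next es As mine good) (tuples (length [0::nat]) n) k (None, S) \<longleftrightarrow>
    first_cycle (successors As es) mine good z k S"
  using S
proof (induction k arbitrary: S)
  case (Suc k)
  define ch where "ch = tuples (length [0::nat]) n"
  have C: "ch = (\<lambda>e. [e]) ` {..<n}"
    by (auto simp: tuples_def length_Suc_conv ch_def)
  let ?A = "alternate (\<lambda>s. case fst s of None \<Rightarrow> mine (lookup (snd s) 0) | Some r \<Rightarrow> True)
      (\<lambda>s. case fst s of None \<Rightarrow> z | Some r \<Rightarrow> r) (cycle_next es As mine good) ch"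
  note IH = Suc.IH[folded ch_def]
  have quant: "(\<exists>c\<in>ch. Q c) \<longleftrightarrow> (\<exists>e<n. Q [e])" "(\<forall>c\<in>ch. Q c) \<longleftrightarrow> (\<forall>e<n. Q [e])" for Q
    unfolding C by auto
  have ne: "ch \<noteq> {}" using n unfolding C by auto
  have "cycle_next es As mine good (Some r, T) c = (Some r, T)" for r T c by (simp add: cycle_next_def)
  then have dec: "?A k (Some r, T) = r" for r T k
    by (induction k) (use ne in auto)
  have hd: "lookup S 0 = hd S" using Suc.prems by (simp add: hd_conv_nth)
  let ?g = "\<lambda>t. if t \<in> set S then good (closed_cycle S t) else first_cycle (successors As es) mine good z k (t # S)"
  have step: "?A k (cycle_next es As mine good (None, S) [e]) \<longleftrightarrow>
      (if e < length es \<and> fst (es ! e) = lookup (hd S) 0 then ?g (node_next As (hd S) (snd (es ! e))) else \<not> mine (hd S))" for e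
    by (auto simp: cycle_next_def hd dec IH)
  have suc: "successors As es (hd S) = (\<lambda>e. node_next As (hd S) (snd (es ! e))) ` {e. e < length es \<and> fst (es ! e) = lookup (hd S) 0}"
    unfolding successors_def in_set_conv_nth by (auto simp: image_iff) (metis fst_conv snd_conv, metis prod.collapse)
  have ex: "(\<exists>e<n. e < length es \<and> fst (es ! e) = lookup (hd S) 0 \<and> Q e) \<longleftrightarrow> (\<exists>e\<in>{e. e < length es \<and> fst (es ! e) = lookup (hd S) 0}. Q e)"
    and all: "(\<forall>e<n. e < length es \<and> fst (es ! e) = lookup (hd S) 0 \<longrightarrow> Q e) \<longleftrightarrow> (\<forall>e\<in>{e. e < length es \<and> fst (es ! e) = lookup (hd S) 0}. Q e)" for Q
    using less_trans[OF _ n] by blast+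
  have "?A (Suc k) (None, S) \<longleftrightarrow> first_cycle (successors As es) mine good z (Suc k) S"
  proof (cases "mine (hd S)")
    case True
    then have "?A (Suc k) (None, S) \<longleftrightarrow> (\<exists>e<n. e < length es \<and> fst (es ! e) = lookup (hd S) 0 \<and> ?g (node_next As (hd S) (snd (es ! e))))"
      unfolding alternate.simps quant step using hd by auto
    also have "\<dots> \<longleftrightarrow> (\<exists>t\<in>successors As es (hd S). ?g t)" unfolding suc bex_simps ex by simp
    finally show ?thesis using True by (simp del: alternate.simps)
  next
    case False
    then have "?A (Suc k) (None, S) \<longleftrightarrow> (\<forall>e<n. e < length es \<and> fst (es ! e) = lookup (hd S) 0 \<longrightarrow> ?g (node_next As (hd S) (snd (es ! e))))"
      unfolding alternate.simps quant step using hd by auto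
    also have "\<dots> \<longleftrightarrow> (\<forall>t\<in>successors As es (hd S). ?g t)" unfolding suc ball_simps all by simp
    finally show ?thesis using False by (simp del: alternate.simps)
  qed
  then show ?case unfolding ch_def .
qed simp

lemma sz_lookup: "sz (lookup xs i) \<le> sz xs + sz (undefined :: 'a)" for xs :: "'a::enc list"
  using sz_mem[of "lookup xs i" xs] by (cases "i < length xs") (auto simp: lookup_def intro: order_trans[OF sz_mem])

text \<open>The bound does not mention \<open>u\<close>: apart from the letter, the entries are read
  from the tables of the automata, so nodes do not grow along a play.\<close>

lemma sz_node_next:
  defines "c \<equiv> sz (undefined :: dpa_tuple) + sz (undefined :: nat list) + sz (undefined :: nat)"
  shows "sz (node_next As u a) \<le> Suc (sz As) * (2 * (sz a + sz As + c) + 2)"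
proof -
  have "sz (dpa_next (lookup As j) q b) \<le> sz As + c" for j q b
  proof -
    have "sz (dpa_next (lookup As j) q b) \<le> sz (fst (snd (lookup As j))) + sz (undefined :: nat list) + sz (undefined :: nat)"
      unfolding dpa_next_def using sz_lookup order_trans add_right_mono by meson
    also have "sz (fst (snd (lookup As j))) \<le> sz (lookup As j)" by (cases "lookup As j") auto
    also have "sz (lookup As j) \<le> sz As + sz (undefined :: dpa_tuple)" by (rule sz_lookup)
    finally show ?thesis by (simp add: c_def)
  qed
  note le = this
  have "sz y \<le> sz a + sz As + c" if "y \<in> set (node_next As u a)" for y
  proof -
    from that have "y = a \<or> (\<exists>j. y = dpa_next (lookup As j) (lookup u (Suc j)) (lookup u 0))"
      unfolding node_next_def by (auto simp del: lookup_nth)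
    then show ?thesis
    proof (elim disjE exE)
      fix j assume "y = dpa_next (lookup As j) (lookup u (Suc j)) (lookup u 0)"
      then show ?thesis using le[of j "lookup u (Suc j)" "lookup u 0"] by simp
    qed simp
  qed
  then have "sz (node_next As u a) \<le> length (node_next As u a) * (2 * (sz a + sz As + c) + 2)" by (rule sz_bound)
  also have "\<dots> \<le> Suc (sz As) * (2 * (sz a + sz As + c) + 2)"
    using length_le_sz[of As] by (intro mult_right_mono) (auto simp: node_next_def)
  finally show ?thesis .
qed

lemma feas_coalition_wins:
  fixes own :: "'a::enc \<Rightarrow> nat list"
  assumes own: "feas False UNIV own" and es: "feas False UNIV es" and P: "feas False UNIV P" and i: "feas False UNIV i"
    and p: "feas False UNIV p" and d: "feas False UNIV d" and u: "feas False UNIV u"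
  shows "feas False UNIV (\<lambda>x. coalition_wins (own x) (es x) (P x) (i x) (p x) (length (d x)) (u x))"
proof -
  obtain pe where pe: "poly_bounded pe" "\<And>x. sz (es x) \<le> pe (sz x)" by (rule feas_size[OF es]) auto
  obtain pA where pA: "poly_bounded pA" "\<And>x. sz (fst (P x)) \<le> pA (sz x)" by (rule feas_size[OF feas_fst[OF P]]) auto
  obtain pu where pu: "poly_bounded pu" "\<And>x. sz (u x) \<le> pu (sz x)" by (rule feas_size[OF u]) auto
  obtain pd where pd: "poly_bounded pd" "\<And>x. sz (d x) \<le> pd (sz x)" by (rule feas_size[OF d]) auto
  define c where "c = sz (undefined :: dpa_tuple) + sz (undefined :: nat list) + sz (undefined :: nat)"
  let ?mine = "\<lambda>x u. lookup (own x) (lookup u 0) \<noteq> i x"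
  let ?nx = "\<lambda>x. cycle_next (es x) (fst (P x)) (?mine x) (good_cycle (P x) (p x))"
  define K where "K n = pu n + Suc (pA n) * (2 * (pe n + pA n + c) + 2)" for n
  have "poly_bounded (\<lambda>n. pu n + Suc (pA n) * (2 * (pe n + pA n + c) + 2))" using pe pA pu by auto
  then have K: "poly_bounded K" by (simp only: K_def[abs_def])
  have node: "sz (node_next (fst (P x)) v (snd (lookup (es x) e))) \<le> K (sz x)" if "e < length (es x)" for x v e
  proof -
    have "sz (snd (es x ! e)) \<le> sz (es x ! e)" by (cases "es x ! e") simp
    also have "\<dots> \<le> pe (sz x)" using that by (intro order_trans[OF sz_mem pe(2)]) simp
    finally have "sz (snd (lookup (es x) e)) \<le> pe (sz x)" using that by simp
    then have "Suc (sz (fst (P x))) * (2 * (sz (snd (lookup (es x) e)) + sz (fst (P x)) + c) + 2) \<le>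
        Suc (pA (sz x)) * (2 * (pe (sz x) + pA (sz x) + c) + 2)"
      using pA(2)[of x] by (intro mult_mono) auto
    then show ?thesis
      using sz_node_next[of "fst (P x)" v "snd (lookup (es x) e)"] unfolding K_def c_def by linarith
  qed
  have inv: "length (snd (foldl (?nx x) (None, [u x]) cs)) \<le> Suc (length cs) \<and>
      (\<forall>t\<in>set (snd (foldl (?nx x) (None, [u x]) cs)). sz t \<le> K (sz x))" for x cs
  proof (induction cs rule: rev_induct)
    case Nil
    then show ?case using pu(2)[of x] by (simp add: K_def trans_le_add1)
  next
    case (snoc c cs)
    then show ?case using node[of "lookup c 0" x] by (auto simp: cycle_next_def split: option.splits)
  qed
  have "feas False UNIV (\<lambda>x. alternate (\<lambda>s. case fst s of None \<Rightarrow> ?mine x (lookup (snd s) 0) | Some r \<Rightarrow> True)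
      (\<lambda>s. case fst s of None \<Rightarrow> True | Some r \<Rightarrow> r) (?nx x) (tuples (length [0::nat]) (length (0 # map (\<lambda>_. 0::nat) (es x))))
      (length (d x)) (None, [u x]))"
  proof (rule feas_alternate)
    show "poly_bounded (\<lambda>n. 10 + (Suc (pd n)) * (2 * K n + 2))" using pd K by auto
    show "feas False UNIV (\<lambda>z. ?nx (fst z) (fst (snd z)) (snd (snd z)))"
      unfolding cycle_next_def
      by (intro feas_intros feas_comp[OF own] feas_comp[OF es] feas_comp[OF P] feas_comp[OF i] feas_comp[OF p])
    fix x and cs :: "nat list list"
    assume cs: "length cs \<le> length (d x)"
    obtain r S where s: "foldl (?nx x) (None, [u x]) cs = (r, S)" by (cases "foldl (?nx x) (None, [u x]) cs") 
    have "sz S \<le> length S * (2 * K (sz x) + 2)" by (rule sz_bound) (use inv[of x cs] s in auto)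
    also have "\<dots> \<le> Suc (pd (sz x)) * (2 * K (sz x) + 2)"
      using inv[of x cs] s cs length_le_sz[of "d x"] pd(2)[of x] by (intro mult_right_mono) auto
    finally have "sz S \<le> Suc (pd (sz x)) * (2 * K (sz x) + 2)" .
    moreover have "sz r \<le> 2" using sz_bool by (cases r) (auto simp: enc_bool_def)
    ultimately show "sz (foldl (?nx x) (None, [u x]) cs) \<le> 10 + Suc (pd (sz x)) * (2 * K (sz x) + 2)" unfolding s by simp
  qed (intro feas_intros feas_comp[OF own] feas_comp[OF i] es d u | simp)+
  then show ?thesis
    by (rule feas_cong) (subst first_cycle_alternate, auto simp: coalition_wins_def)
qed

lemma feas_safe_step:
  assumes "feas False D R" "feas False D q" "feas False D u" "feas False D a"
  shows "feas False D (\<lambda>x. safe_step l (R x) (q x) (u x) (a x))"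
proof -
  have "feas False UNIV (\<lambda>y. coalition_wins (fst (fst (fst y))) (fst (snd (fst (fst y)))) (lookup (snd (snd (fst (fst y)))) (snd y))
     (snd y) (lookup (fst (snd (fst y))) (snd y))
     (length (power_list (bound (fst (fst (fst y))) (fst (lookup (snd (snd (fst (fst y)))) (snd y)))) (Suc l)))
     (segment (snd (snd (fst (fst y)))) (snd y) (snd (snd (fst y)))))"
    by (intro feas_coalition_wins feas_power_list feas_intros)
  then have "feas False UNIV (\<lambda>z. \<forall>i\<in>set [0..<length (snd (snd (fst z)))].
     coalition_wins (fst (fst z)) (fst (snd (fst z))) (lookup (snd (snd (fst z))) i)
     i (lookup (fst (snd z)) i) (length (power_list (bound (fst (fst z)) (fst (lookup (snd (snd (fst z))) i))) (Suc l)))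
     (segment (snd (snd (fst z))) i (snd (snd z))))"
    by (intro feas_Ball feas_intros)
  note ball = feas_comp3[of False "\<lambda>R q u. \<forall>i\<in>set [0..<length (snd (snd R))]. coalition_wins (fst R) (fst (snd R)) (lookup (snd (snd R)) i)
     i (lookup q i) (length (power_list (bound (fst R) (fst (lookup (snd (snd R)) i))) (Suc l))) (segment (snd (snd R)) i u)", OF this]
  show ?thesis
    unfolding safe_step_def by (intro feas_conj ball assms; intro feas_intros assms)
qed

lemma feas_accepted: "feas False UNIV (accepted l)"
proof -
  have "feas False UNIV (\<lambda>y. lasso (fst (fst (fst y))) (concat (map fst (snd (snd (fst (fst y)))))) (\<lambda>a. a = fst (snd (fst y)))
      (safe_step l (fst (fst y)) (snd y)) (chosen (snd (snd (fst (fst y)))) (snd y)))"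
    by (intro feas_lasso feas_chosen feas_safe_step feas_intros)
  then have "feas False UNIV (solvable l)"
    unfolding solvable_def[abs_def] by (intro feas_Bex_tuples feas_conj feas_payoffs_ok feas_intros) auto
  then show ?thesis
    unfolding accepted_def[abs_def] by (intro feas_intros feas_comp[OF feas_valid])
qed

theorem membership: "constrained_ne_problem l \<in> PSPACE"
proof -
  \<comment> \<open>The remainder has to be empty, since a string that continues after a complete
    instance is not an encoding.\<close>
  let ?P = "\<lambda>y. case parse_instance (unraw y) of None \<Rightarrow> False | Some z \<Rightarrow> snd z = [] \<and> accepted l (fst z)"
  have "feas False UNIV ?P"
    by (intro feas_intros feas_comp[OF feas_parse_instance] feas_unraw feas_comp[OF feas_accepted])
  from feas_PSPACE[OF this] have "{x. ?P (Raw x)} \<in> PSPACE" .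
  moreover have "x \<in> constrained_ne_problem l \<longleftrightarrow> ?P (Raw x)" for x
  proof
    assume x: "x \<in> constrained_ne_problem l"
    then obtain R v ps where "x = encode_instance (R, v, ps)" unfolding constrained_ne_problem_def by blast
    moreover obtain I where "R = mk_game I" using game_rep_tuple by blast
    ultimately have e: "x = encode_instance (mk_game I, v, ps)" by simp
    then have "parse_instance x = Some ((I, v, ps), [])"
      using parses_instance unfolding parses_def by (metis append_Nil2 fst_conv snd_conv)
    then show "?P (Raw x)" using x constrained_ne_problem_iff unfolding e by simp
  next
    assume "?P (Raw x)"
    then obtain I v ps where I: "parse_instance x = Some ((I, v, ps), [])" "accepted l (I, v, ps)"
      by (auto split: option.splits)
    then have "x = encode_instance (mk_game I, v, ps)"
      using parses_instance unfolding parses_def by (metis append_Nil2 fst_conv snd_conv)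
    then show "x \<in> constrained_ne_problem l" using I(2) constrained_ne_problem_iff by simp
  qed
  then have "{x. ?P (Raw x)} = constrained_ne_problem l" by blast
  ultimately show ?thesis by simp
qed

theorem theorem17:
  shows "(\<forall>l. constrained_ne_problem l \<in> PSPACE) \<and> (\<exists>l. PSPACE_hard (constrained_ne_problem l))"
  using membership hardness by blast

end
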